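(* Let $\Omega\subset\mathbb{R}^n$ ($n\ge2$) be a bounded $C^{2,\gamma}$ domain, $\alpha\in\mathbb{R}$, $G\in C^2(\mathbb{R})$, $g=G'$. Assume $\Delta u+g(u)=0$ in $\Omega$ and $\partial_\nu u+\alpha u=0$ on $\partial\Omega$. Let $(\Omega_t)_t$ be an admissible perturbation of $\Omega$ with fields $v,w$, let $\mathcal{E}(t)$ be the Robin energy of $\Omega_t$, and let $u'$ be the shape derivative, which satisfies $$\Delta u'+g'(u)u'=0\ \text{ in }\Omega,\qquad \partial_\nu u'+\alpha u'=-\partial_\nu(v\cdot\nabla u)+\nabla^\tau u\cdot D_v\nu+\nu\cdot D_v\nabla u-\alpha\,v\cdot\nabla u\ \text{ on }\partial\Omega.$$ Then $$\begin{aligned}\ddot{\mathcal{E}}(0)=&\oint_{\partial\Omega}\big[(v\cdot\nu)\operatorname{div}v-v\cdot D_v\nu+w\cdot\nu\big]\big(|\nabla u|^2-2G(u)\big)\,dS\\ &+4\oint_{\partial\Omega}\big(\partial_\nu u\;v\cdot D_v\nabla u-(v\cdot\nu)\,\nabla u\cdot D_v\nabla u\big)\,dS\\ &+2\oint_{\partial\Omega}\big(\partial_\nu u\;v\cdot(D^2u\,v)-(v\cdot\nu)\,v\cdot(D^2u\nabla u)\big)\,dS\\ &+2\oint_{\partial\Omega}g(u)(v\cdot\nu)\,v\cdot\nabla u\,dS-4\oint_{\partial\Omega}v\cdot\nabla u\,(\partial_\nu u'+\alpha u')\,dS\\ &-2\alpha\oint_{\partial\Omega}(v\cdot\nabla u)^2\,dS-2\oint_{\partial\Omega}w\cdot\nabla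 u\;\partial_\nu u\,dS\\ &+\alpha\oint_{\partial\Omega}u^2\,\ddot m(0)\,dS-2Q_g(u'),\end{aligned}$$ where $$Q_g(u')=\int_\Omega|\nabla u'|^2dx-\int_\Omega g'(u)u'^2dx+\alpha\oint_{\partial\Omega}u'^2\,dS.$$
   Context: $\nu$ is the outer unit normal, $\nabla^\tau u=\nabla u-(\partial_\nu u)\nu$ the tangential gradient, $D^2u$ the Hessian. For vectors $a,b$ the notation $a\cdot D_v b$ means $\sum_{i,j}a_i\,(\partial_iv_j)\,b_j$. Admissible perturbation: $\Omega_t=y_t(\Omega)$ for $|t|<t_0$ small, where $y_t(x)=x+tv(x)+\frac{t^2}{2}w(x)+o(t^2)$ are diffeomorphisms, $v,w\in C^{2,\gamma}(\overline\Omega;\mathbb{R}^n)$, and $t\mapsto y_t$ is twice continuously differentiable into $C^2(\overline\Omega;\mathbb{R}^n)$. No volume constraint is imposed. $m(t)$ denotes the density of the surface element of $\partial\Omega_t$ pulled back to $\partial\Omega$: $dS_t=m(t)\,dS$ (the tangential Jacobian of $y_t|_{\partial\Omega}$), and $\ddot m(0)$ is its second $t$-derivative at $0$. Robin energy: $\mathcal{E}(t)=\int_{\Omega_t}|\nabla\tilde u|^2dy-2\int_{\Omega_t}G(\tilde u)\,dy+\alpha\oint_{\partial\Omega_t}\tilde u^2\,dS_t$, where $\tilde u=\tilde u(\cdot,t)$ solves $\Delta\tilde u+g(\tilde u)=0$ in $\Omega_t$, $\partial_{\nu_t}\tilde u+\alpha\tilde u=0$ on $\partial\Omega_t$, with $\tilde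 u(\cdot,0)=u$. Standing assumptions: this problem is uniquely solvable for small $|t|$, and $t\mapsto\tilde u(t):=\tilde u(y_t(\cdot),t)$ is twice continuously differentiable into $C^2(\overline\Omega)$. The shape derivative is $u'=\dot{\tilde u}(0)-v\cdot\nabla u$, where $\dot{\tilde u}(0)=\frac{d}{dt}\tilde u(t)|_{t=0}$ (so $u'\in C^1(\overline\Omega)$ and its equation in $\Omega$ is understood in the weak sense). A dot denotes $d/dt$. *)

theory Defs
  imports "HOL-Analysis.Analysis"
begin
text \<open>
  \<open>partial \<Omega> i f\<close> is the partial derivative of \<open>f\<close> in the open set \<open>\<Omega>\<close>, extended by its limit
  (from inside \<open>\<Omega>\<close>) to boundary points.  Thus \<open>C1_closure \<Omega> f\<close> is the usual space of functions
  that are \<open>C\<^sup>1\<close> in \<open>\<Omega>\<close> and, together with their first derivatives, extend continuously to the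
  closure: if \<open>partial \<Omega> i f\<close> is continuous on the closure, the limits at boundary points exist,
  so that \<open>Lim\<close> is never applied outside its domain.
\<close>

definition partial ::
  "(real^'n) set \<Rightarrow> 'n \<Rightarrow> (real^'n \<Rightarrow> 'b::real_normed_vector) \<Rightarrow> real^'n \<Rightarrow> 'b" where
  "partial \<Omega> i f x =
     (if x \<in> \<Omega> then frechet_derivative f (at x) (axis i 1)
      else Lim (at x within \<Omega>) (\<lambda>z. frechet_derivative f (at z) (axis i 1)))"

definition C1_closure :: "(real^'n) set \<Rightarrow> (real^'n \<Rightarrow> 'b::real_normed_vector) \<Rightarrow> bool" where
  "C1_closure \<Omega> f \<longleftrightarrow>
     (\<forall>x\<in>\<Omega>. f differentiable (at x)) \<and> continuous_on (closure \<Omega>) f \<and>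
     (\<forall>i. continuous_on (closure \<Omega>) (partial \<Omega> i f))"

definition C2_closure :: "(real^'n) set \<Rightarrow> (real^'n \<Rightarrow> 'b::real_normed_vector) \<Rightarrow> bool" where
  "C2_closure \<Omega> f \<longleftrightarrow> C1_closure \<Omega> f \<and> (\<forall>i. C1_closure \<Omega> (partial \<Omega> i f))"

definition C2_holder_closure ::
  "real \<Rightarrow> (real^'n) set \<Rightarrow> (real^'n \<Rightarrow> 'b::real_normed_vector) \<Rightarrow> bool" where
  "C2_holder_closure \<gamma> \<Omega> f \<longleftrightarrow> C2_closure \<Omega> f \<and>
     (\<forall>i j. \<exists>C. \<forall>x\<in>\<Omega>. \<forall>z\<in>\<Omega>.
        dist (partial \<Omega> i (partial \<Omega> j f) x) (partial \<Omega> i (partial \<Omega> j f) z)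
          \<le> C * dist x z powr \<gamma>)"

text \<open>Convergence in the norm of \<open>C\<^sup>2\<close> of the closure.\<close>

definition C2_limit ::
  "(real^'n) set \<Rightarrow> ('a \<Rightarrow> real^'n \<Rightarrow> 'b::real_normed_vector) \<Rightarrow> (real^'n \<Rightarrow> 'b) \<Rightarrow> 'a filter \<Rightarrow> bool"
where
  "C2_limit \<Omega> f l F \<longleftrightarrow>
     uniform_limit (closure \<Omega>) f l F \<and>
     (\<forall>i. uniform_limit (closure \<Omega>) (\<lambda>s. partial \<Omega> i (f s)) (partial \<Omega> i l) F) \<and>
     (\<forall>i j. uniform_limit (closure \<Omega>)
        (\<lambda>s. partial \<Omega> i (partial \<Omega> j (f s))) (partial \<Omega> i (partial \<Omega> j l)) F)"

text \<open>
  \<open>t \<mapsto> f t\<close> is twice continuously differentiable on \<open>{-t0<..<t0}\<close> as a map into the Banach space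
  \<open>C\<^sup>2\<close> of the closure; \<open>f1\<close>, \<open>f2\<close> are its first and second derivatives.
\<close>

definition C2_curve ::
  "(real^'n) set \<Rightarrow> real \<Rightarrow> (real \<Rightarrow> real^'n \<Rightarrow> 'b::real_normed_vector) \<Rightarrow> bool" where
  "C2_curve \<Omega> t0 f \<longleftrightarrow>
     (\<exists>f1 f2. \<forall>t. \<bar>t\<bar> < t0 \<longrightarrow>
        C2_closure \<Omega> (f t) \<and> C2_closure \<Omega> (f1 t) \<and> C2_closure \<Omega> (f2 t) \<and>
        C2_limit \<Omega> (\<lambda>s x. (f s x - f t x) /\<^sub>R (s - t)) (f1 t) (at t) \<and>
        C2_limit \<Omega> (\<lambda>s x. (f1 s x - f1 t x) /\<^sub>R (s - t)) (f2 t) (at t) \<and>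
        C2_limit \<Omega> f2 (f2 t) (at t))"

definition grad :: "(real^'n) set \<Rightarrow> (real^'n \<Rightarrow> real) \<Rightarrow> real^'n \<Rightarrow> real^'n" where
  "grad \<Omega> f x = (\<chi> i. partial \<Omega> i f x)"

definition hess :: "(real^'n) set \<Rightarrow> (real^'n \<Rightarrow> real) \<Rightarrow> real^'n \<Rightarrow> real^'n^'n" where
  "hess \<Omega> f x = (\<chi> i j. partial \<Omega> i (partial \<Omega> j f) x)"

definition laplace :: "(real^'n) set \<Rightarrow> (real^'n \<Rightarrow> real) \<Rightarrow> real^'n \<Rightarrow> real" where
  "laplace \<Omega> f x = (\<Sum>i\<in>UNIV. partial \<Omega> i (partial \<Omega> i f) x)"

definition divergence :: "(real^'n) set \<Rightarrow> (real^'n \<Rightarrow> real^'n) \<Rightarrow> real^'n \<Rightarrow> real" where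
  "divergence \<Omega> v x = (\<Sum>i\<in>UNIV. partial \<Omega> i v x $ i)"

definition jacobian_matrix :: "(real^'n) set \<Rightarrow> (real^'n \<Rightarrow> real^'n) \<Rightarrow> real^'n \<Rightarrow> real^'n^'n" where
  "jacobian_matrix \<Omega> v x = (\<chi> i j. partial \<Omega> j v x $ i)"

text \<open>\<open>dform \<Omega> v x a b\<close> is \<open>a \<cdot> D\<^sub>v b\<close> at \<open>x\<close>; note that \<open>a\<close> is contracted with the derivative.\<close>

definition dform ::
  "(real^'n) set \<Rightarrow> (real^'n \<Rightarrow> real^'n) \<Rightarrow> real^'n \<Rightarrow> real^'n \<Rightarrow> real^'n \<Rightarrow> real" where
  "dform \<Omega> v x a b = (\<Sum>i\<in>UNIV. \<Sum>j\<in>UNIV. a $ i * (partial \<Omega> i v x $ j) * b $ j)"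

text \<open>
  Inside \<open>U\<close> the set \<open>\<Omega>\<close> lies on one side of the graph of \<open>h\<close> over the hyperplane \<open>x\<^sub>k = 0\<close>.
  The sign \<open>s\<close> says on which side.  The function \<open>h\<close> of the \<open>n - 1\<close> remaining coordinates is
  represented by a function on \<open>\<real>\<^sup>n\<close> that does not depend on \<open>x\<^sub>k\<close>.
\<close>

definition local_graph ::
  "(real^'n) set \<Rightarrow> (real^'n) set \<Rightarrow> 'n \<Rightarrow> real \<Rightarrow> (real^'n \<Rightarrow> real) \<Rightarrow> bool" where
  "local_graph \<Omega> U k s h \<longleftrightarrow>
     open U \<and> s \<in> {-1, 1} \<and> (\<forall>x c. h (x + c *\<^sub>R axis k 1) = h x) \<and>
     U \<inter> \<Omega> = {x\<in>U. s * x $ k < h x} \<and> U \<inter> frontier \<Omega> = {x\<in>U. s * x $ k = h x}"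

definition C2_holder_domain :: "real \<Rightarrow> (real^'n) set \<Rightarrow> bool" where
  "C2_holder_domain \<gamma> \<Omega> \<longleftrightarrow>
     open \<Omega> \<and> connected \<Omega> \<and> \<Omega> \<noteq> {} \<and> bounded \<Omega> \<and>
     (\<forall>x\<in>frontier \<Omega>. \<exists>U k s h. x \<in> U \<and> local_graph \<Omega> U k s h \<and> C2_holder_closure \<gamma> UNIV h)"

text \<open>
  The outer unit normal of a \<open>C\<^sup>1\<close> domain: directions in the open half space opposite to it enter
  the domain, directions in the open half space around it leave it.
\<close>

definition outer_normal :: "(real^'n) set \<Rightarrow> real^'n \<Rightarrow> real^'n" where
  "outer_normal \<Omega> x = (THE n. norm n = 1 \<and>
     (\<forall>d. d \<bullet> n < 0 \<longrightarrow> (\<forall>\<^sub>F s in at_right 0. x + s *\<^sub>R d \<in> \<Omega>)) \<and>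
     (\<forall>d. d \<bullet> n > 0 \<longrightarrow> (\<forall>\<^sub>F s in at_right 0. x + s *\<^sub>R d \<notin> closure \<Omega>)))"

definition normal_deriv :: "(real^'n) set \<Rightarrow> (real^'n \<Rightarrow> real) \<Rightarrow> real^'n \<Rightarrow> real" where
  "normal_deriv \<Omega> f x = outer_normal \<Omega> x \<bullet> grad \<Omega> f x"

definition tangential_grad :: "(real^'n) set \<Rightarrow> (real^'n \<Rightarrow> real) \<Rightarrow> real^'n \<Rightarrow> real^'n" where
  "tangential_grad \<Omega> f x = grad \<Omega> f x - normal_deriv \<Omega> f x *\<^sub>R outer_normal \<Omega> x"

text \<open>The \<open>(n-1)\<close>-dimensional Lebesgue measure on the hyperplane \<open>x\<^sub>k = 0\<close>.\<close>

definition hyperplane_lborel :: "'n \<Rightarrow> (real^'n) measure" where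
  "hyperplane_lborel k =
     distr (PiM (UNIV - {k}) (\<lambda>_. lborel)) borel (\<lambda>z. \<chi> i. if i = k then 0 else z i)"

definition graph_point :: "'n \<Rightarrow> real \<Rightarrow> (real^'n \<Rightarrow> real) \<Rightarrow> real^'n \<Rightarrow> real^'n" where
  "graph_point k s h z = (\<chi> i. if i = k then s * h z else z $ i)"

definition graph_integral ::
  "'n \<Rightarrow> real \<Rightarrow> (real^'n \<Rightarrow> real) \<Rightarrow> (real^'n \<Rightarrow> real) \<Rightarrow> real" where
  "graph_integral k s h f =
     (LINT z|hyperplane_lborel k. f (graph_point k s h z) * sqrt (1 + (norm (grad UNIV h z))\<^sup>2))"

text \<open>
  The surface integral is the classical one: a finite atlas of \<open>C\<^sup>1\<close> graphs \<open>(U, k, s, h)\<close> with a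
  subordinate partition of unity \<open>\<zeta>\<close>, and in each patch the surface element
  \<open>sqrt (1 + |\<nabla>h|\<^sup>2) dz\<close>.  The value does not depend on the atlas, so an arbitrary one is chosen.
\<close>

type_synonym 'n patch =
  "(real^'n) set \<times> 'n \<times> real \<times> (real^'n \<Rightarrow> real) \<times> (real^'n \<Rightarrow> real)"

definition boundary_atlas :: "(real^'n) set \<Rightarrow> 'n patch list \<Rightarrow> bool" where
  "boundary_atlas \<Omega> ps \<longleftrightarrow>
     (\<forall>(U, k, s, h, \<zeta>) \<in> set ps.
        local_graph \<Omega> U k s h \<and> C1_closure UNIV h \<and>
        C1_closure UNIV \<zeta> \<and> (\<forall>x. 0 \<le> \<zeta> x) \<and>
        (\<exists>K. compact K \<and> K \<subseteq> U \<and> (\<forall>x. x \<notin> K \<longrightarrow> \<zeta> x = 0))) \<and>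
     (\<exists>V. open V \<and> frontier \<Omega> \<subseteq> V \<and> (\<forall>x\<in>V. (\<Sum>(U, k, s, h, \<zeta>)\<leftarrow>ps. \<zeta> x) = 1))"

definition surface_integral :: "(real^'n) set \<Rightarrow> (real^'n \<Rightarrow> real) \<Rightarrow> real" where
  "surface_integral \<Omega> f =
     (\<Sum>(U, k, s, h, \<zeta>)\<leftarrow>(SOME ps. boundary_atlas \<Omega> ps). graph_integral k s h (\<lambda>x. \<zeta> x * f x))"

text \<open>
  Tangential Jacobian of \<open>y\<close> at \<open>x \<in> frontier \<Omega>\<close>: with \<open>A = Dy(x)\<close> and \<open>P\<close> the orthogonal
  projection onto the tangent space, the matrix \<open>P A\<^sup>T A P + \<nu> \<nu>\<^sup>T\<close> is the Gram operator of
  \<open>A\<close> restricted to the tangent space, completed by the identity in the normal direction.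
\<close>

definition tangential_jacobian :: "(real^'n) set \<Rightarrow> (real^'n \<Rightarrow> real^'n) \<Rightarrow> real^'n \<Rightarrow> real" where
  "tangential_jacobian \<Omega> y x =
     (let A = jacobian_matrix \<Omega> y x; n = outer_normal \<Omega> x;
          N = (\<chi> i j. n $ i * n $ j); P = mat 1 - N
      in sqrt (det (P ** transpose A ** A ** P + N)))"

definition C2_diffeo_closure :: "(real^'n) set \<Rightarrow> (real^'n \<Rightarrow> real^'n) \<Rightarrow> bool" where
  "C2_diffeo_closure \<Omega> y \<longleftrightarrow>
     C2_closure \<Omega> y \<and> inj_on y (closure \<Omega>) \<and> C2_closure (y ` \<Omega>) (inv_into (closure \<Omega>) y)"

text \<open>
  The remainder \<open>o(t\<^sup>2)\<close> is only required pointwise; since \<open>t \<mapsto> y t\<close> is a \<open>C\<^sup>2\<close> curve in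
  \<open>C\<^sup>2\<close> of the closure, this already identifies \<open>v\<close> and \<open>w\<close> as its first two derivatives at \<open>0\<close>.
\<close>

definition admissible_perturbation ::
  "real \<Rightarrow> (real^'n) set \<Rightarrow> real \<Rightarrow> (real \<Rightarrow> real^'n \<Rightarrow> real^'n) \<Rightarrow>
   (real^'n \<Rightarrow> real^'n) \<Rightarrow> (real^'n \<Rightarrow> real^'n) \<Rightarrow> bool" where
  "admissible_perturbation \<gamma> \<Omega> t0 y v w \<longleftrightarrow>
     0 < t0 \<and> C2_holder_closure \<gamma> \<Omega> v \<and> C2_holder_closure \<gamma> \<Omega> w \<and>
     C2_curve \<Omega> t0 y \<and> (\<forall>t. \<bar>t\<bar> < t0 \<longrightarrow> C2_diffeo_closure \<Omega> (y t)) \<and>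
     (\<forall>x\<in>closure \<Omega>. y 0 x = x \<and>
        ((\<lambda>t. (y t x - (x + t *\<^sub>R v x + (t\<^sup>2 / 2) *\<^sub>R w x)) /\<^sub>R t\<^sup>2) \<longlongrightarrow> 0) (at 0))"

definition robin_solution ::
  "(real^'n) set \<Rightarrow> real \<Rightarrow> (real \<Rightarrow> real) \<Rightarrow> (real^'n \<Rightarrow> real) \<Rightarrow> bool" where
  "robin_solution \<Omega> \<alpha> g u \<longleftrightarrow> C2_closure \<Omega> u \<and>
     (\<forall>x\<in>\<Omega>. laplace \<Omega> u x + g (u x) = 0) \<and>
     (\<forall>x\<in>frontier \<Omega>. normal_deriv \<Omega> u x + \<alpha> * u x = 0)"

definition robin_energy ::
  "(real^'n) set \<Rightarrow> real \<Rightarrow> (real \<Rightarrow> real) \<Rightarrow> (real^'n \<Rightarrow> real) \<Rightarrow> real" where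
  "robin_energy \<Omega> \<alpha> G u =
     (LINT x:\<Omega>|lborel. (norm (grad \<Omega> u x))\<^sup>2) - 2 * (LINT x:\<Omega>|lborel. G (u x))
       + \<alpha> * surface_integral \<Omega> (\<lambda>x. (u x)\<^sup>2)"

text \<open>
  \<open>U t\<close> is the solution on the perturbed domain \<open>y t ` \<Omega>\<close>, in Eulerian coordinates.
\<close>

definition shape_derivative ::
  "(real^'n) set \<Rightarrow> (real \<Rightarrow> real^'n \<Rightarrow> real^'n) \<Rightarrow> (real^'n \<Rightarrow> real^'n) \<Rightarrow>
   (real \<Rightarrow> real^'n \<Rightarrow> real) \<Rightarrow> (real^'n \<Rightarrow> real) \<Rightarrow> real^'n \<Rightarrow> real" where
  "shape_derivative \<Omega> y v U u x = deriv (\<lambda>t. U t (y t x)) 0 - v x \<bullet> grad \<Omega> u x"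

text \<open>
  Weak form of \<open>\<Delta>z + c z = 0\<close> in \<open>\<Omega>\<close> for \<open>z\<close> of class \<open>C\<^sup>1\<close>, tested with compactly supported
  \<open>C\<^sup>1\<close> functions (for continuous \<open>c\<close>, equivalent to smooth test functions by density).
\<close>

definition weak_solution :: "(real^'n) set \<Rightarrow> (real^'n \<Rightarrow> real) \<Rightarrow> (real^'n \<Rightarrow> real) \<Rightarrow> bool" where
  "weak_solution \<Omega> c z \<longleftrightarrow>
     (\<forall>\<phi>. C1_closure UNIV \<phi> \<and> (\<exists>K. compact K \<and> K \<subseteq> \<Omega> \<and> (\<forall>x. x \<notin> K \<longrightarrow> \<phi> x = 0)) \<longrightarrow>
        (LINT x:\<Omega>|lborel. grad \<Omega> z x \<bullet> grad UNIV \<phi> x - c x * z x * \<phi> x) = 0)"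

definition Q_form ::
  "(real^'n) set \<Rightarrow> real \<Rightarrow> (real^'n \<Rightarrow> real) \<Rightarrow> (real^'n \<Rightarrow> real) \<Rightarrow> real" where
  "Q_form \<Omega> \<alpha> c z =
     (LINT x:\<Omega>|lborel. (norm (grad \<Omega> z x))\<^sup>2) - (LINT x:\<Omega>|lborel. c x * (z x)\<^sup>2)
       + \<alpha> * surface_integral \<Omega> (\<lambda>x. (z x)\<^sup>2)"

definition has_second_derivative :: "(real \<Rightarrow> real) \<Rightarrow> real \<Rightarrow> real \<Rightarrow> bool" where
  "has_second_derivative f D t \<longleftrightarrow>
     (\<exists>f'. (\<forall>\<^sub>F s in nhds t. (f has_real_derivative f' s) (at s)) \<and>
           (f' has_real_derivative D) (at t))"

end

theory Submission
  imports Defs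
begin

text \<open>
  After pulling the energy back to \<open>\<Omega>\<close>, put \<open>A = Dy\<^sub>t\<close>, \<open>J = det A\<close>, and let \<open>p\<close> and \<open>n\<close> solve \<open>A\<^sup>T p = \<nabla>u~\<close> and
  \<open>A\<^sup>T n = J \<nu>\<close>; then \<open>p\<close> is the gradient on \<open>\<Omega>\<^sub>t\<close> and \<open>m = |n|\<close>.  The first variation is the surface integral of
  \<open>(|p|\<^sup>2 - 2 G(u~)) (V \<bullet> n) - 2 (V \<bullet> p) (p \<bullet> n) + \<alpha> u~\<^sup>2 m'\<close> with \<open>V = dy\<^sub>t/dt\<close>, because the \<open>t\<close>-derivative of
  the volume integrand is \<open>J\<close> times the divergence of a vector field on \<open>\<Omega>\<^sub>t\<close>.  Differentiating once more at \<open>t = 0\<close> gives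
  the claimed formula up to the surface integral of \<open>\<Sum> \<nu>\<^sub>i \<partial>\<^sub>j ((v\<^sub>i \<partial>\<^sub>j u - v\<^sub>j \<partial>\<^sub>i u) (2 u' + 4 v \<bullet> \<nabla>u))\<close>,
  which vanishes since the vector fields \<open>\<partial>\<^sub>j f e\<^sub>i - \<partial>\<^sub>i f e\<^sub>j\<close> are divergence free.  All fields involved are only
  \<open>C\<^sup>1\<close>, so divergences are understood in the sense of distributions.
\<close>

section \<open>Functions with partial derivatives up to the boundary\<close>

text \<open>The value of \<open>surface_integral\<close> is bound to an atlas picked by
  \<open>SOME\<close>, chosen separately for \<Omega> and for each deformed domain, so surface
  integrals over two domains cannot be compared chart by chart. They are compared through the
  divergence theorem, which holds for every atlas: the integrand is written as the flux of a field,
  the field is transported to the other domain, and both fluxes equal volume integrals related by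
  change of variables. This requires an atlas on the deformed domain, hence an inverse function
  theorem up to the boundary; it is obtained by straightening the boundary and extending the map
  across it by reflection. The Robin condition removes the time derivative of the solution from the
  first variation. One more differentiation therefore involves only first time derivatives of the
  solution, which at t = 0 are expressed by \<open>u'\<close>. The equation for \<open>u'\<close>
  enters through the Green identity for the quadratic form, and its boundary condition produces the
  remaining terms with \<open>u'\<close>.\<close>

lemma sum_axis_scaleR:
  fixes f :: "'n::finite \<Rightarrow> 'b::real_vector"
  shows "(\<Sum>j\<in>UNIV. axis i c $ j *\<^sub>R f j) = c *\<^sub>R f i"
  by (simp add: axis_def if_distrib[of "\<lambda>a. a *\<^sub>R _"] cong: if_cong)

text \<open>The derivatives are carried as an explicit family \<open>D\<close>, so that the rules
  below compute them. On the boundary \<open>D i\<close> is merely a continuous extension; no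
  differentiability at boundary points is claimed. For open \<open>S\<close> the existence of such a
  family is \<open>C1_closure\<close>.\<close>

definition has_partials ::
  "(real^'n) set \<Rightarrow> (real^'n \<Rightarrow> 'b::real_normed_vector) \<Rightarrow> ('n \<Rightarrow> real^'n \<Rightarrow> 'b) \<Rightarrow> bool" where
  "has_partials S f D \<longleftrightarrow>
     (\<forall>x\<in>S. (f has_derivative (\<lambda>h. \<Sum>i\<in>UNIV. h $ i *\<^sub>R D i x)) (at x)) \<and>
     continuous_on (closure S) f \<and> (\<forall>i. continuous_on (closure S) (D i))"

lemma has_partialsD:
  assumes "has_partials S f D"
  shows "x \<in> S \<Longrightarrow> (f has_derivative (\<lambda>h. \<Sum>i\<in>UNIV. h $ i *\<^sub>R D i x)) (at x)"
    and "continuous_on (closure S) f" and "continuous_on (closure S) (D i)"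
  using assms by (auto simp: has_partials_def)

lemma has_partialsI:
  assumes "\<And>x. x \<in> S \<Longrightarrow> (f has_derivative (\<lambda>h. \<Sum>i\<in>UNIV. h $ i *\<^sub>R D i x)) (at x)"
    and "continuous_on (closure S) f" and "\<And>i. continuous_on (closure S) (D i)"
  shows "has_partials S f D"
  using assms by (auto simp: has_partials_def)

lemma frechet_derivative_eq_partial:
  assumes "has_partials S f D" "x \<in> S"
  shows "frechet_derivative f (at x) (axis i 1) = D i x"
proof -
  have "frechet_derivative f (at x) = (\<lambda>h. \<Sum>i\<in>UNIV. h $ i *\<^sub>R D i x)"
    using frechet_derivative_at[OF has_partialsD(1)[OF assms]] by simp
  then show ?thesis by (simp add: sum_axis_scaleR)
qed

text \<open>On the boundary the \<open>Lim\<close> in \<open>partial\<close> is taken at a limit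
  point of \<open>S\<close>, where limits are unique, and it returns the value of the continuous
  function \<open>D i\<close>. In particular two families for the same function agree on the
  closure.\<close>

lemma partial_eq:
  assumes f: "has_partials S f D" and "open S" and x: "x \<in> closure S"
  shows "partial S i f x = D i x"
proof (cases "x \<in> S")
  case True
  then show ?thesis using frechet_derivative_eq_partial[OF f] by (simp add: partial_def)
next
  case False
  then have lim: "x islimpt S" using x by (simp add: closure_def)
  have "((D i) \<longlongrightarrow> D i x) (at x within closure S)"
    using has_partialsD(3)[OF f] x by (auto simp: continuous_on_def)
  then have "((D i) \<longlongrightarrow> D i x) (at x within S)"
    by (rule tendsto_within_subset[OF _ closure_subset])
  moreover have "\<forall>\<^sub>F z in at x within S. D i z = frechet_derivative f (at z) (axis i 1)"
    using frechet_derivative_eq_partial[OF f] by (auto simp: eventually_at_filter)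
  ultimately have "((\<lambda>z. frechet_derivative f (at z) (axis i 1)) \<longlongrightarrow> D i x) (at x within S)"
    by (rule Lim_transform_eventually)
  then show ?thesis using False lim
    by (simp add: partial_def tendsto_Lim trivial_limit_within)
qed

lemma has_partials_partial:
  assumes "C1_closure S f"
  shows "has_partials S f (\<lambda>i. partial S i f)"
proof (rule has_partialsI)
  fix x assume x: "x \<in> S"
  then have d: "(f has_derivative frechet_derivative f (at x)) (at x)"
    using assms by (auto simp: C1_closure_def frechet_derivative_works)
  then interpret bounded_linear "frechet_derivative f (at x)"
    by (rule has_derivative_bounded_linear)
  have "frechet_derivative f (at x) h = (\<Sum>i\<in>UNIV. h $ i *\<^sub>R partial S i f x)" for h
  proof -
    have "frechet_derivative f (at x) h = frechet_derivative f (at x) (\<Sum>i\<in>UNIV. (h $ i) *\<^sub>R axis i 1)"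
      using arg_cong[OF basis_expansion[of h, unfolded scalar_mult_eq_scaleR], of "frechet_derivative f (at x)"]
      by (rule sym)
    then show ?thesis using x by (simp add: sum scaleR partial_def)
  qed
  with d show "(f has_derivative (\<lambda>h. \<Sum>i\<in>UNIV. h $ i *\<^sub>R partial S i f x)) (at x)"
    by (rule has_derivative_eq_rhs[OF _ ext])
qed (use assms in \<open>auto simp: C1_closure_def\<close>)

lemma has_partials_C1_closure:
  assumes f: "has_partials S f D" and "open S"
  shows "C1_closure S f"
  unfolding C1_closure_def
proof (intro conjI allI ballI)
  show "f differentiable at x" if "x \<in> S" for x
    using has_partialsD(1)[OF f that] by (auto simp: differentiable_def)
  show "continuous_on (closure S) f" by (rule has_partialsD[OF f])
  show "continuous_on (closure S) (partial S i f)" for i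
    using continuous_on_cong[THEN iffD2, OF refl partial_eq[OF f \<open>open S\<close>] has_partialsD(3)[OF f]] .
qed

lemma has_partials_cong:
  assumes "has_partials S f D" and "open S"
    and fg: "\<And>x. x \<in> closure S \<Longrightarrow> f x = g x" and DE: "\<And>i x. x \<in> closure S \<Longrightarrow> D i x = E i x"
  shows "has_partials S g E"
proof (rule has_partialsI)
  fix x assume x: "x \<in> S"
  have "(f has_derivative (\<lambda>h. \<Sum>i\<in>UNIV. h $ i *\<^sub>R E i x)) (at x)"
    using has_partialsD(1)[OF assms(1) x] DE[OF subsetD[OF closure_subset x]] by simp
  then show "(g has_derivative (\<lambda>h. \<Sum>i\<in>UNIV. h $ i *\<^sub>R E i x)) (at x)"
    by (rule has_derivative_transform_within_open[OF _ \<open>open S\<close> x]) (use fg closure_subset in blast)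
next
  show "continuous_on (closure S) g"
    using continuous_on_cong[THEN iffD1, OF refl fg has_partialsD(2)[OF assms(1)]] .
  show "continuous_on (closure S) (E i)" for i
    using continuous_on_cong[THEN iffD1, OF refl DE has_partialsD(3)[OF assms(1)]] .
qed

text \<open>Only values inside the open set enter either branch of \<open>partial\<close>, so the
  equality holds at every point \<open>x\<close>. This is how \<open>U 0\<close> is exchanged for
  \<open>u\<close>, and the time derivative of \<open>y\<close> at 0 for \<open>v\<close>, although
  they are known to agree on the closure only.\<close>

lemma partial_cong:
  assumes "open S" and fg: "\<And>x. x \<in> S \<Longrightarrow> f x = g x"
  shows "partial S i f x = partial S i g x"
proof -
  have *: "frechet_derivative f (at z) = frechet_derivative g (at z)" if "z \<in> S" for z
  proof -
    have "(f has_derivative d) (at z) \<longleftrightarrow> (g has_derivative d) (at z)" for d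
      using has_derivative_transform_within_open[OF _ \<open>open S\<close> that] fg by metis
    then show ?thesis by (simp add: frechet_derivative_def)
  qed
  \<comment> \<open>\<open>Lim\<close> is a definite description over all limits; both functions
    have the same limits, so the two values coincide even where no limit exists.\<close>
  have "Lim (at x within S) (\<lambda>z. frechet_derivative f (at z) (axis i 1)) =
        Lim (at x within S) (\<lambda>z. frechet_derivative g (at z) (axis i 1))"
    unfolding Topological_Spaces.Lim_def
    by (rule arg_cong[where f=The], rule ext, rule tendsto_cong)
       (use * in \<open>auto simp: eventually_at_filter\<close>)
  then show ?thesis using * by (simp add: partial_def)
qed

lemma has_partials_subset:
  assumes "has_partials S f D" "T \<subseteq> S"
  shows "has_partials T f D"
  using assms closure_mono[of T S] unfolding has_partials_def
  by (meson continuous_on_subset subsetD)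

lemma has_partials_along:
  assumes f: "has_partials S f D" and "x + s *\<^sub>R d \<in> S"
  shows "((\<lambda>s. f (x + s *\<^sub>R d)) has_vector_derivative (\<Sum>i\<in>UNIV. d $ i *\<^sub>R D i (x + s *\<^sub>R d))) (at s)"
proof -
  have "((\<lambda>s. x + s *\<^sub>R d) has_derivative (\<lambda>t. t *\<^sub>R d)) (at s)"
    by (auto intro!: derivative_eq_intros)
  from has_derivative_compose[OF this has_partialsD(1)[OF assms]]
  show ?thesis
    by (simp add: has_vector_derivative_def scaleR_sum_right)
qed

lemma has_partials_along_axis:
  assumes "has_partials S f D" and "x + s *\<^sub>R axis i 1 \<in> S"
  shows "((\<lambda>s. f (x + s *\<^sub>R axis i 1)) has_vector_derivative D i (x + s *\<^sub>R axis i 1)) (at s)"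
  using has_partials_along[OF assms] by (simp add: sum_axis_scaleR)

lemma has_partials_const: "has_partials S (\<lambda>x. c) (\<lambda>i x. 0)"
  by (rule has_partialsI) auto

lemma has_partials_bounded_linear:
  assumes L: "bounded_linear L" and f: "has_partials S f D"
  shows "has_partials S (\<lambda>x. L (f x)) (\<lambda>i x. L (D i x))"
proof (rule has_partialsI)
  interpret L: bounded_linear L by fact
  show "((\<lambda>x. L (f x)) has_derivative (\<lambda>h. \<Sum>i\<in>UNIV. h $ i *\<^sub>R L (D i x))) (at x)" if "x \<in> S" for x
    using L.has_derivative[OF has_partialsD(1)[OF f that]] by (simp add: L.sum L.scaleR)
qed (auto intro!: bounded_linear.continuous_on[OF L] has_partialsD[OF f])

lemma has_partials_bilinear:
  assumes B: "bounded_bilinear B" and f: "has_partials S f D" and g: "has_partials S g E"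
  shows "has_partials S (\<lambda>x. B (f x) (g x)) (\<lambda>i x. B (f x) (E i x) + B (D i x) (g x))"
proof (rule has_partialsI)
  interpret B: bounded_bilinear B by fact
  show "((\<lambda>x. B (f x) (g x)) has_derivative
      (\<lambda>h. \<Sum>i\<in>UNIV. h $ i *\<^sub>R (B (f x) (E i x) + B (D i x) (g x)))) (at x)" if "x \<in> S" for x
    using B.FDERIV[OF has_partialsD(1)[OF f that] has_partialsD(1)[OF g that]]
    by (simp add: B.sum_left B.sum_right B.scaleR_left B.scaleR_right scaleR_add_right sum.distrib)
qed (auto intro!: bounded_bilinear.continuous_on[OF B] continuous_on_add has_partialsD[OF f] has_partialsD[OF g])

lemmas has_partials_mult = has_partials_bilinear[OF bounded_bilinear_mult]
lemmas has_partials_scaleR = has_partials_bilinear[OF bounded_bilinear_scaleR]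
lemmas has_partials_inner = has_partials_bilinear[OF bounded_bilinear_inner]
lemmas has_partials_component = has_partials_bounded_linear[OF bounded_linear_vec_nth]

lemma has_partials_add:
  assumes "has_partials S f D" and "has_partials S g E"
  shows "has_partials S (\<lambda>x. f x + g x) (\<lambda>i x. D i x + E i x)"
  using assms unfolding has_partials_def
  by (auto intro!: continuous_intros has_derivative_add
      simp: scaleR_add_right sum.distrib)

lemma has_partials_diff:
  assumes "has_partials S f D" and "has_partials S g E"
  shows "has_partials S (\<lambda>x. f x - g x) (\<lambda>i x. D i x - E i x)"
  using assms unfolding has_partials_def
  by (auto intro!: continuous_intros has_derivative_diff
      simp: scaleR_diff_right sum_subtractf)

lemma has_partials_sum:
  assumes "\<And>a. a \<in> A \<Longrightarrow> has_partials S (f a) (D a)"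
  shows "has_partials S (\<lambda>x. \<Sum>a\<in>A. f a x) (\<lambda>i x. \<Sum>a\<in>A. D a i x)"
  using assms
  by (induction A rule: infinite_finite_induct) (auto intro: has_partials_const has_partials_add)

lemma has_partials_sum_list:
  assumes "\<And>a. a \<in> set as \<Longrightarrow> has_partials S (f a) (D a)"
  shows "has_partials S (\<lambda>x. \<Sum>a\<leftarrow>as. f a x) (\<lambda>i x. \<Sum>a\<leftarrow>as. D a i x)"
  using assms by (induction as) (auto intro: has_partials_const has_partials_add)

lemma has_partials_prod:
  fixes f :: "'a \<Rightarrow> real^'n \<Rightarrow> real"
  assumes "finite A" "\<And>a. a \<in> A \<Longrightarrow> has_partials S (f a) (D a)"
  shows "\<exists>E. has_partials S (\<lambda>x. \<Prod>a\<in>A. f a x) E"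
  using assms
proof (induction A)
  case (insert a A)
  then show ?case using has_partials_mult by fastforce
qed (auto intro: has_partials_const)

lemma has_partials_vec:
  fixes f :: "'k::finite \<Rightarrow> real^'n \<Rightarrow> real"
  assumes "\<And>k. has_partials S (f k) (D k)"
  shows "has_partials S (\<lambda>x. \<chi> k. f k x) (\<lambda>i x. \<chi> k. D k i x)"
proof (rule has_partialsI)
  fix x assume x: "x \<in> S"
  have "((\<lambda>x. f k x) has_derivative (\<lambda>h. (\<Sum>i\<in>UNIV. h $ i *\<^sub>R (\<chi> k. D k i x)) $ k)) (at x)" for k
    using has_partialsD(1)[OF assms x] by simp
  then show "((\<lambda>x. \<chi> k. f k x) has_derivative (\<lambda>h. \<Sum>i\<in>UNIV. h $ i *\<^sub>R (\<chi> k. D k i x))) (at x)"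
    by (subst has_derivative_componentwise_within) (auto simp: Basis_vec_def inner_axis)
qed (use has_partialsD[OF assms] in \<open>auto intro!: continuous_on_vec_lambda\<close>)

lemma has_partials_id: "has_partials (S :: (real^'n) set) (\<lambda>x. x) (\<lambda>i x. axis i 1)"
proof (rule has_partialsI)
  have "(\<lambda>h::real^'n. \<Sum>i\<in>UNIV. h $ i *\<^sub>R axis i 1) = (\<lambda>h. h)"
    by (rule ext, rule basis_expansion[where 'a = real, unfolded scalar_mult_eq_scaleR])
  then show "((\<lambda>x. x) has_derivative (\<lambda>h. \<Sum>i\<in>UNIV. h $ i *\<^sub>R axis i 1)) (at x)" for x :: "real^'n"
    by simp
qed auto

lemma has_partials_comp_real:
  fixes f :: "real^'n \<Rightarrow> real" and \<phi> :: "real \<Rightarrow> 'b::real_normed_vector"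
  assumes f: "has_partials S f D"
    and \<phi>: "\<And>x. x \<in> closure S \<Longrightarrow> (\<phi> has_vector_derivative \<phi>' (f x)) (at (f x))"
    and c: "continuous_on (f ` closure S) \<phi>'"
  shows "has_partials S (\<lambda>x. \<phi> (f x)) (\<lambda>i x. D i x *\<^sub>R \<phi>' (f x))"
proof (rule has_partialsI)
  show "((\<lambda>x. \<phi> (f x)) has_derivative (\<lambda>h. \<Sum>i\<in>UNIV. h $ i *\<^sub>R (D i x *\<^sub>R \<phi>' (f x)))) (at x)" if "x \<in> S" for x
    using has_derivative_compose[OF has_partialsD(1)[OF f that], of \<phi> "\<lambda>t. t *\<^sub>R \<phi>' (f x)"]
      \<phi>[of x] that closure_subset[of S]
    by (auto simp: has_vector_derivative_def scaleR_sum_left)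
  have "continuous_on (f ` closure S) \<phi>"
    using \<phi> by (auto intro!: continuous_at_imp_continuous_on
        dest!: has_vector_derivative_continuous)
  from continuous_on_compose2[OF this has_partialsD(2)[OF f]]
  show "continuous_on (closure S) (\<lambda>x. \<phi> (f x))" by auto
  show "continuous_on (closure S) (\<lambda>x. D i x *\<^sub>R \<phi>' (f x))" for i
    by (intro continuous_on_scaleR has_partialsD(3)[OF f] continuous_on_compose2[OF c has_partialsD(2)[OF f]]) auto
qed

lemma has_partials_comp:
  assumes f: "has_partials T f D" and y: "has_partials S y E" and sub: "y ` S \<subseteq> T"
  shows "has_partials S (\<lambda>x. f (y x)) (\<lambda>i x. \<Sum>j\<in>UNIV. E i x $ j *\<^sub>R D j (y x))"
proof (rule has_partialsI)
  show "((\<lambda>x. f (y x)) has_derivative (\<lambda>h. \<Sum>i\<in>UNIV. h $ i *\<^sub>R (\<Sum>j\<in>UNIV. E i x $ j *\<^sub>R D j (y x)))) (at x)"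
    if "x \<in> S" for x
  proof -
    have "(\<Sum>j\<in>UNIV. (\<Sum>i\<in>UNIV. h $ i *\<^sub>R E i x) $ j *\<^sub>R D j (y x)) =
        (\<Sum>i\<in>UNIV. h $ i *\<^sub>R (\<Sum>j\<in>UNIV. E i x $ j *\<^sub>R D j (y x)))" for h
      by (simp add: scaleR_sum_left scaleR_sum_right) (rule sum.swap)
    with has_derivative_compose[OF has_partialsD(1)[OF y that] has_partialsD(1)[OF f, of "y x"]]
    show ?thesis using that sub by auto
  qed
  have cl: "y ` closure S \<subseteq> closure T"
    using image_closure_subset[OF has_partialsD(2)[OF y], of "closure T"] sub closure_subset by blast
  show "continuous_on (closure S) (\<lambda>x. f (y x))"
    by (rule continuous_on_compose2[OF has_partialsD(2)[OF f] has_partialsD(2)[OF y] cl])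
  show "continuous_on (closure S) (\<lambda>x. \<Sum>j\<in>UNIV. E i x $ j *\<^sub>R D j (y x))" for i
    by (intro continuous_intros continuous_on_compose2[OF has_partialsD(3)[OF f] has_partialsD(2)[OF y] cl]
       has_partialsD(3)[OF y])
qed

section \<open>Symmetry of second partial derivatives up to the boundary\<close>

lemma closure_eqI:
  fixes f g :: "'a::topological_space \<Rightarrow> 'b::t2_space"
  assumes "continuous_on (closure T) f" "continuous_on (closure T) g"
    and "\<And>x. x \<in> T \<Longrightarrow> f x = g x" and "x \<in> closure T"
  shows "f x = g x"
proof (cases "x \<in> T")
  case False
  then have nt: "at x within T \<noteq> bot"
    using assms(4) by (simp add: closure_def trivial_limit_within)
  have f: "(f \<longlongrightarrow> f x) (at x within T)" and g: "(g \<longlongrightarrow> g x) (at x within T)"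
    using assms(1,2,4) unfolding continuous_on_def by (auto intro: tendsto_within_subset[OF _ closure_subset])
  have "(g \<longlongrightarrow> f x) (at x within T)"
    by (rule Lim_transform_eventually[OF f]) (use assms(3) in \<open>auto simp: eventually_at_filter\<close>)
  with g nt show ?thesis using tendsto_unique by blast
qed (use assms in auto)

text \<open>The mean value theorem is applied twice: in direction \<open>i\<close> to the increment
  of \<open>f\<close> in direction \<open>j\<close>, then in direction \<open>j\<close> to
  \<open>D i\<close>. The intermediate point is displaced by at most \<open>h\<close> along each of
  the two axes, hence lies within \<open>2 * h\<close>.\<close>

lemma second_difference:
  fixes f :: "real^'n \<Rightarrow> real"
  assumes f: "has_partials S f D" and D: "has_partials S (D i) E"
    and r: "ball x r \<subseteq> S" and h: "0 < h" "2 * h < r"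
  shows "\<exists>\<xi>. dist x \<xi> \<le> 2 * h \<and>
    f (x + h *\<^sub>R axis i 1 + h *\<^sub>R axis j 1) - f (x + h *\<^sub>R axis i 1) - f (x + h *\<^sub>R axis j 1) + f x
      = h\<^sup>2 * E j \<xi>"
proof -
  have near: "dist x (x + s *\<^sub>R axis i 1 + t *\<^sub>R axis j 1) \<le> 2 * h" if "0 \<le> s" "s \<le> h" "0 \<le> t" "t \<le> h" for s t
  proof -
    have "dist x (x + a) = norm a" for a by (simp add: dist_norm)
    moreover have "norm (s *\<^sub>R axis i (1::real) + t *\<^sub>R axis j 1) \<le> s + t"
      using norm_triangle_ineq[of "s *\<^sub>R axis i (1::real)" "t *\<^sub>R axis j 1"] that by simp
    ultimately show ?thesis using that by (simp add: add.assoc)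
  qed
  have inS: "x + s *\<^sub>R axis i 1 + t *\<^sub>R axis j 1 \<in> S" if "0 \<le> s" "s \<le> h" "0 \<le> t" "t \<le> h" for s t
    using near[OF that] h r by auto
  define g where "g s = f (x + h *\<^sub>R axis j 1 + s *\<^sub>R axis i 1) - f (x + s *\<^sub>R axis i 1)" for s
  have "\<exists>z>0. z < h \<and> g h - g 0 = (h - 0) *
      (D i (x + h *\<^sub>R axis j 1 + z *\<^sub>R axis i 1) - D i (x + z *\<^sub>R axis i 1))"
  proof (rule MVT2[OF h(1)])
    fix s assume s: "0 \<le> s" "s \<le> h"
    have "x + h *\<^sub>R axis j 1 + s *\<^sub>R axis i 1 \<in> S" "x + s *\<^sub>R axis i 1 \<in> S"
      using inS[OF s, of h] inS[OF s, of 0] h by (simp_all add: add_ac)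
    from has_partials_along_axis[OF f this(1)] has_partials_along_axis[OF f this(2)]
    show "(g has_real_derivative
         D i (x + h *\<^sub>R axis j 1 + s *\<^sub>R axis i 1) - D i (x + s *\<^sub>R axis i 1)) (at s)"
      unfolding g_def has_real_derivative_iff_has_vector_derivative by (rule has_vector_derivative_diff)
  qed
  then obtain z where z: "0 < z" "z < h" "g h - g 0 = h *
      (D i (x + h *\<^sub>R axis j 1 + z *\<^sub>R axis i 1) - D i (x + z *\<^sub>R axis i 1))" by auto
  have "\<exists>w>0. w < h \<and> D i (x + z *\<^sub>R axis i 1 + h *\<^sub>R axis j 1) - D i (x + z *\<^sub>R axis i 1 + 0 *\<^sub>R axis j 1) =
     (h - 0) * E j (x + z *\<^sub>R axis i 1 + w *\<^sub>R axis j 1)"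
  proof (rule MVT2[OF h(1)])
    fix s assume s: "0 \<le> s" "s \<le> h"
    have "x + z *\<^sub>R axis i 1 + s *\<^sub>R axis j 1 \<in> S" using inS s z by auto
    from has_partials_along_axis[OF D this]
    show "((\<lambda>s. D i (x + z *\<^sub>R axis i 1 + s *\<^sub>R axis j 1)) has_real_derivative
        E j (x + z *\<^sub>R axis i 1 + s *\<^sub>R axis j 1)) (at s)"
      by (simp add: has_real_derivative_iff_has_vector_derivative)
  qed
  then obtain w where w: "0 < w" "w < h" "D i (x + z *\<^sub>R axis i 1 + h *\<^sub>R axis j 1) - D i (x + z *\<^sub>R axis i 1) =
     h * E j (x + z *\<^sub>R axis i 1 + w *\<^sub>R axis j 1)" by auto
  show ?thesis
  proof (intro exI conjI)
    show "dist x (x + z *\<^sub>R axis i 1 + w *\<^sub>R axis j 1) \<le> 2 * h" using near z w by simp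
    have "h *\<^sub>R axis j 1 + (x + z *\<^sub>R axis i 1) = x + h *\<^sub>R axis j 1 + z *\<^sub>R axis i 1" by simp
    then show "f (x + h *\<^sub>R axis i 1 + h *\<^sub>R axis j 1) - f (x + h *\<^sub>R axis i 1) - f (x + h *\<^sub>R axis j 1) + f x
      = h\<^sup>2 * E j (x + z *\<^sub>R axis i 1 + w *\<^sub>R axis j 1)"
      using z(3) w(3) unfolding g_def by (simp add: power2_eq_square algebra_simps)
  qed
qed

text \<open>Schwarz's theorem: one and the same mixed difference equals the squared step times
  either mixed partial derivative at a nearby point. The step tends to 0 inside \<open>S\<close>,
  and continuity extends the equality to the closure.\<close>

lemma mixed_partials_eq:
  fixes f :: "real^'n \<Rightarrow> real"
  assumes f: "has_partials S f D" and D: "\<And>i. has_partials S (D i) (E i)"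
    and "open S" and "x \<in> closure S"
  shows "E i j x = E j i x"
proof (rule closure_eqI[OF has_partialsD(3)[OF D] has_partialsD(3)[OF D] _ \<open>x \<in> closure S\<close>])
  fix x assume x: "x \<in> S"
  then obtain r where r: "0 < r" "ball x r \<subseteq> S" using \<open>open S\<close> openE by blast
  \<comment> \<open>The factor 3 leaves room for displacements of length up to
    \<open>2 * h n\<close> inside the ball of radius \<open>r\<close>.\<close>
  define h where "h n = r / (3 * real (Suc n))" for n
  have h: "0 < h n" "2 * h n < r" for n
  proof -
    have "0 < r + r * (real n * 3)" using r(1) by (intro add_pos_nonneg) auto
    then show "0 < h n" "2 * h n < r" using r(1) by (auto simp: h_def field_simps)
  qed
  have h0: "h \<longlonglongrightarrow> 0" unfolding h_def
    using tendsto_mult_right_zero[OF LIMSEQ_inverse_real_of_nat, of "r/3"] by (simp add: field_simps)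
  have E: "\<exists>\<xi>. (\<forall>n. dist x (\<xi> n) \<le> 2 * h n \<and>
    f (x + h n *\<^sub>R axis i 1 + h n *\<^sub>R axis j 1) - f (x + h n *\<^sub>R axis i 1) - f (x + h n *\<^sub>R axis j 1) + f x
      = (h n)\<^sup>2 * E i j (\<xi> n))" for i j
    by (rule choice, rule allI, rule second_difference[OF f D r(2) h])
  have lim: "(\<lambda>n. E i j (\<xi> n)) \<longlonglongrightarrow> E i j x" if "\<forall>n. dist x (\<xi> n) \<le> 2 * h n" for \<xi> i j
  proof -
    have "\<forall>n. norm (dist (\<xi> n) x) \<le> 2 * h n" using that by (simp add: dist_commute)
    then have "(\<lambda>n. dist (\<xi> n) x) \<longlonglongrightarrow> 0"
      by (rule Lim_null_comparison[OF always_eventually tendsto_mult_right_zero[OF h0]])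
    then have "\<xi> \<longlonglongrightarrow> x" by (rule iffD2[OF tendsto_dist_iff])
    moreover have "isCont (E i j) x"
      using continuous_on_subset[OF has_partialsD(3)[OF D] closure_subset] \<open>open S\<close> x
      by (auto simp: continuous_on_eq_continuous_at)
    ultimately show ?thesis by (rule isCont_tendsto_compose[rotated])
  qed
  obtain \<xi> where \<xi>: "\<forall>n. dist x (\<xi> n) \<le> 2 * h n \<and>
    f (x + h n *\<^sub>R axis i 1 + h n *\<^sub>R axis j 1) - f (x + h n *\<^sub>R axis i 1) - f (x + h n *\<^sub>R axis j 1) + f x
      = (h n)\<^sup>2 * E i j (\<xi> n)" using E by blast
  obtain \<eta> where \<eta>: "\<forall>n. dist x (\<eta> n) \<le> 2 * h n \<and>
    f (x + h n *\<^sub>R axis j 1 + h n *\<^sub>R axis i 1) - f (x + h n *\<^sub>R axis j 1) - f (x + h n *\<^sub>R axis i 1) + f x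
      = (h n)\<^sup>2 * E j i (\<eta> n)" using E by blast
  have "E i j (\<xi> n) = E j i (\<eta> n)" for n
  proof -
    have "(h n)\<^sup>2 * E i j (\<xi> n) = (h n)\<^sup>2 * E j i (\<eta> n)"
      using \<xi> \<eta> by (smt (verit) add.assoc add.commute)
    then show ?thesis using h(1)[of n] by simp
  qed
  moreover have "(\<lambda>n. E i j (\<xi> n)) \<longlonglongrightarrow> E i j x" "(\<lambda>n. E j i (\<eta> n)) \<longlonglongrightarrow> E j i x"
    using \<xi> \<eta> by (auto intro!: lim)
  ultimately show "E i j x = E j i x"
    using LIMSEQ_unique by simp
qed

section \<open>Boundary atlases\<close>

text \<open>The square of the positive part is the C^1 building block of all cutoffs below. It is
  half of \<open>s * \<bar>s\<bar> + s * s\<close>, so that only \<open>s * \<bar>s\<bar>\<close> at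
  0 needs care.\<close>

lemma DERIV_square_pos_part:
  "((\<lambda>s. (max 0 s)\<^sup>2) has_real_derivative 2 * max 0 s) (at (s::real))"
proof -
  have "((\<lambda>s. s * \<bar>s\<bar>) has_real_derivative 2 * \<bar>s\<bar>) (at s)"
  proof -
    consider "s = 0" | "0 < s" | "s < 0" by linarith
    then show ?thesis
    proof cases
      case 1
      have "((\<lambda>h::real. \<bar>h\<bar>) \<longlongrightarrow> 0) (at 0)" by (rule tendsto_rabs_zero) (rule tendsto_ident_at)
      then have "((\<lambda>h::real. h * \<bar>h\<bar> / h) \<longlongrightarrow> 0) (at 0)"
        by (rule Lim_transform_eventually) (auto simp: eventually_at_filter)
      then show ?thesis using 1 by (simp add: DERIV_def del: nonzero_mult_div_cancel_left)
    next
      case 2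
      have "((\<lambda>s. s * s) has_real_derivative 2 * \<bar>s\<bar>) (at s)"
        using 2 by (auto intro!: derivative_eq_intros)
      then show ?thesis
        by (rule has_field_derivative_transform_within_open[where S = "{0<..}"]) (use 2 in auto)
    next
      case 3
      have "((\<lambda>s. - (s * s)) has_real_derivative 2 * \<bar>s\<bar>) (at s)"
        using 3 by (auto intro!: derivative_eq_intros)
      then show ?thesis
        by (rule has_field_derivative_transform_within_open[where S = "{..<0}"]) (use 3 in auto)
    qed
  qed
  from DERIV_cdivide[OF DERIV_add[OF this DERIV_mult[OF DERIV_ident DERIV_ident]], of 2]
  have "((\<lambda>s. (s * \<bar>s\<bar> + s * s) / 2) has_real_derivative (2 * \<bar>s\<bar> + (s + s)) / 2) (at s)"
    by simp
  moreover have "(\<lambda>s::real. (s * \<bar>s\<bar> + s * s) / 2) = (\<lambda>s. (max 0 s)\<^sup>2)"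
    by (rule ext) (simp add: max_def power2_eq_square)
  moreover have "(2 * \<bar>s\<bar> + (s + s)) / 2 = 2 * max 0 s" by (simp add: max_def)
  ultimately show ?thesis by metis
qed

text \<open>Squaring the positive part removes the corner on the sphere of radius \<open>r\<close>.
  Class C^1 is enough, because partitions of unity and test functions are only asked to be
  C^1.\<close>

definition bump :: "real^'n \<Rightarrow> real \<Rightarrow> real^'n \<Rightarrow> real" where
  "bump a r x = (max 0 (1 - (norm (x - a))\<^sup>2 / r\<^sup>2))\<^sup>2"

lemma bump_nonneg: "0 \<le> bump a r x"
  by (simp add: bump_def)

lemma bump_pos: "0 < bump a r x" if "0 < r" "dist x a < r"
proof -
  have "(norm (x - a))\<^sup>2 < r\<^sup>2"
    using that by (auto simp: dist_norm intro!: power_strict_mono)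
  then have "(norm (x - a))\<^sup>2 / r\<^sup>2 < 1" using that by simp
  then show ?thesis unfolding bump_def by (intro zero_less_power) simp
qed

lemma bump_outside: "bump a r x = 0" if "0 < r" "r \<le> dist x a"
proof -
  have "r\<^sup>2 \<le> (norm (x - a))\<^sup>2"
    using that by (auto simp: dist_norm intro!: power_mono)
  then show ?thesis using that by (simp add: bump_def max_def)
qed

lemma has_partials_bump: "\<exists>D. has_partials \<Omega> (bump a r) D"
proof -
  have 1: "has_partials \<Omega> (\<lambda>x. 1 - ((x - a) \<bullet> (x - a)) / r\<^sup>2)
     (\<lambda>i x. 0 - ((x - a) \<bullet> (axis i 1 - 0) + (axis i 1 - 0) \<bullet> (x - a)) / r\<^sup>2)"
    by (intro has_partials_diff has_partials_const has_partials_inner has_partials_id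
        has_partials_bounded_linear[OF bounded_linear_divide])
  have "has_partials \<Omega> (\<lambda>x. (max 0 (1 - ((x - a) \<bullet> (x - a)) / r\<^sup>2))\<^sup>2)
     (\<lambda>i x. (0 - ((x - a) \<bullet> (axis i 1 - 0) + (axis i 1 - 0) \<bullet> (x - a)) / r\<^sup>2) *\<^sub>R
        (2 * max 0 (1 - ((x - a) \<bullet> (x - a)) / r\<^sup>2)))"
    by (rule has_partials_comp_real[OF 1])
       (auto intro!: continuous_intros DERIV_square_pos_part
         simp: has_real_derivative_iff_has_vector_derivative[symmetric])
  then show ?thesis
    unfolding bump_def power2_norm_eq_inner by blast
qed

text \<open>The denominator is positive whenever \<open>s \<ge> 0\<close>, and it equals \<open>s\<close> for \<open>s \<ge> c\<close>.\<close>

lemma has_partials_regularised_quotient: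
  fixes f S :: "real^'n \<Rightarrow> real"
  assumes f: "has_partials \<Omega> f D" and S: "has_partials \<Omega> S E"
    and c: "0 < c" and nonneg: "\<And>x. x \<in> closure \<Omega> \<Longrightarrow> 0 \<le> S x"
  shows "\<exists>F. has_partials \<Omega> (\<lambda>x. f x / (S x + (max 0 (c - S x))\<^sup>2)) F"
proof -
  have pos: "0 < s + (max 0 (c - s))\<^sup>2" if "0 \<le> s" for s
    using that c by (cases "s = 0") (auto simp: add_pos_nonneg)
  define \<phi> where "\<phi> s = inverse (s + (max 0 (c - s))\<^sup>2)" for s
  define \<phi>' where "\<phi>' s = - (inverse (s + (max 0 (c - s))\<^sup>2) * (1 + 2 * max 0 (c - s) * (0 - 1)) * inverse (s + (max 0 (c - s))\<^sup>2))" for s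
  have d: "(\<phi> has_vector_derivative \<phi>' s) (at s)" if "0 \<le> s" for s
  proof -
    have "((\<lambda>s. (max 0 (c - s))\<^sup>2) has_real_derivative (2 * max 0 (c - s)) * (0 - 1)) (at s)"
      by (rule DERIV_chain2[where f = "\<lambda>s. (max 0 s)\<^sup>2" and g = "\<lambda>s. c - s", OF DERIV_square_pos_part])
         (auto intro!: derivative_eq_intros)
    then have "(\<phi> has_real_derivative \<phi>' s) (at s)"
      unfolding \<phi>_def \<phi>'_def using pos[OF that] by (intro DERIV_inverse' DERIV_add DERIV_ident) auto
    then show ?thesis by (simp add: has_real_derivative_iff_has_vector_derivative)
  qed
  have "continuous_on {0..} \<phi>'"
    unfolding \<phi>'_def using pos by (auto intro!: continuous_intros simp: less_le)
  then have "has_partials \<Omega> (\<lambda>x. \<phi> (S x)) (\<lambda>i x. E i x *\<^sub>R \<phi>' (S x))"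
    using nonneg by (intro has_partials_comp_real[OF S]) (auto intro: d continuous_on_subset)
  from has_partials_mult[OF f this] show ?thesis
    by (auto simp: \<phi>_def divide_inverse)
qed

text \<open>The compact frontier is covered by finitely many balls inside chart domains, and the
  bumps of these balls are normalised by their sum. The predicate \<open>P\<close> hands an
  additional property of the graph functions on to the atlas: second order regularity for \<Omega>
  itself, and \<open>True\<close> for deformed domains.\<close>

theorem boundary_atlas_exists:
  assumes "bounded \<Omega>"
    and graph: "\<And>x. x \<in> frontier \<Omega> \<Longrightarrow> \<exists>U k s h. x \<in> U \<and> local_graph \<Omega> U k s h \<and> C1_closure UNIV h \<and> P h"
  shows "\<exists>ps. boundary_atlas \<Omega> ps \<and> (\<forall>(U, k, s, h, \<zeta>)\<in>set ps. P h)"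
proof -
  from graph obtain U k s h where g: "\<And>x. x \<in> frontier \<Omega> \<Longrightarrow>
      x \<in> U x \<and> local_graph \<Omega> (U x) (k x) (s x) (h x) \<and> C1_closure UNIV (h x) \<and> P (h x)"
    by metis
  have "\<exists>r>0. cball x r \<subseteq> U x" if "x \<in> frontier \<Omega>" for x
    using g[OF that] open_contains_cball by (metis local_graph_def)
  then obtain r where r: "\<And>x. x \<in> frontier \<Omega> \<Longrightarrow> 0 < r x \<and> cball x (r x) \<subseteq> U x" by metis
  have comp: "compact (frontier \<Omega>)" using \<open>bounded \<Omega>\<close> by (rule compact_frontier_bounded)
  obtain A where A: "A \<subseteq> frontier \<Omega>" "finite A" "frontier \<Omega> \<subseteq> (\<Union>a\<in>A. ball a (r a))"
    by (rule compactE_image[OF comp, of "frontier \<Omega>" "\<lambda>a. ball a (r a)"]) (use r in auto)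
  then obtain as where as: "set as = A" using finite_list by blast
  define S where "S x = (\<Sum>a\<leftarrow>as. bump a (r a) x)" for x
  have "\<forall>a. \<exists>D. has_partials UNIV (bump a (r a)) D" by (blast intro: has_partials_bump)
  then obtain D where D: "\<And>a. has_partials UNIV (bump a (r a)) (D a)" by metis
  have Sp: "has_partials UNIV S (\<lambda>i x. \<Sum>a\<leftarrow>as. D a i x)"
    unfolding S_def by (rule has_partials_sum_list) (rule D)
  have S0: "0 \<le> S x" for x unfolding S_def by (intro sum_list_nonneg) (auto simp: bump_nonneg)
  have Spos: "0 < S x" if x: "x \<in> frontier \<Omega>" for x
  proof -
    obtain a where a: "a \<in> A" "dist x a < r a" using x A(3) by (auto simp: dist_commute)
    then have "0 < bump a (r a) x" using r A(1) by (intro bump_pos) auto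
    moreover have "bump a (r a) x \<le> S x"
      unfolding S_def using a as by (intro member_le_sum_list) (auto simp: bump_nonneg)
    ultimately show ?thesis by linarith
  qed
  have contS: "continuous_on X S" for X
    using has_partialsD(2)[OF Sp] continuous_on_subset by auto
  \<comment> \<open>Half the minimum of \<open>S\<close> on the frontier makes
    \<open>c < S x\<close> strict there, so that the set where \<open>c < S x\<close> is an open
    neighbourhood of the frontier.\<close>
  obtain c where c: "0 < c" "\<And>x. x \<in> frontier \<Omega> \<Longrightarrow> c < S x"
  proof (cases "frontier \<Omega> = {}")
    case False
    then obtain x where "x \<in> frontier \<Omega>" "\<forall>y\<in>frontier \<Omega>. S x \<le> S y"
      using continuous_attains_inf[OF comp _ contS] by blast
    then show thesis using Spos[of x] by (intro that[of "S x / 2"]) fastforce+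
  qed (use that[of 1] in auto)
  \<comment> \<open>Dividing by \<open>S\<close> alone would fail where \<open>S\<close> vanishes.
    The correction is zero where \<open>c < S x\<close>, so near the frontier this is the plain
    quotient and the functions sum to 1.\<close>
  define \<zeta> where "\<zeta> a x = bump a (r a) x / (S x + (max 0 (c - S x))\<^sup>2)" for a x
  have \<zeta>1: "C1_closure UNIV (\<zeta> a)" for a
    using has_partials_regularised_quotient[OF D Sp c(1) S0] has_partials_C1_closure
    unfolding \<zeta>_def by blast
  have \<zeta>0: "0 \<le> \<zeta> a x" for a x
    unfolding \<zeta>_def by (intro divide_nonneg_nonneg add_nonneg_nonneg S0 bump_nonneg zero_le_power2)
  define ps where "ps = map (\<lambda>a. (U a, k a, s a, h a, \<zeta> a)) as"
  have patch: "\<exists>K. compact K \<and> K \<subseteq> U a \<and> (\<forall>x. x \<notin> K \<longrightarrow> \<zeta> a x = 0)" if "a \<in> A" for a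
  proof (intro exI conjI allI impI)
    have a: "a \<in> frontier \<Omega>" using that A by auto
    show "compact (cball a (r a))" "cball a (r a) \<subseteq> U a" using r[OF a] by auto
    show "\<zeta> a x = 0" if "x \<notin> cball a (r a)" for x
      using bump_outside[of "r a" x a] r[OF a] that by (auto simp: \<zeta>_def dist_commute)
  qed
  have one: "(\<Sum>a\<leftarrow>as. \<zeta> a x) = 1" if "c < S x" for x
  proof -
    have "(\<Sum>a\<leftarrow>as. \<zeta> a x) = (\<Sum>a\<leftarrow>as. bump a (r a) x / S x)"
      using that unfolding \<zeta>_def by (simp add: max_def)
    also have "\<dots> = S x / S x"
      unfolding divide_inverse sum_list_mult_const by (simp add: S_def)
    finally show ?thesis using that c by simp
  qed
  have "boundary_atlas \<Omega> ps"
    unfolding boundary_atlas_def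
  proof (intro conjI)
    show "\<forall>(U, k, s, h, \<zeta>)\<in>set ps.
        local_graph \<Omega> U k s h \<and> C1_closure UNIV h \<and> C1_closure UNIV \<zeta> \<and> (\<forall>x. 0 \<le> \<zeta> x) \<and>
        (\<exists>K. compact K \<and> K \<subseteq> U \<and> (\<forall>x. x \<notin> K \<longrightarrow> \<zeta> x = 0))"
      using g A(1) as \<zeta>0 \<zeta>1 patch by (auto simp: ps_def)
    have "open {x. c < S x}" by (intro open_Collect_less continuous_on_const contS)
    moreover have "(\<Sum>(U, k, s, h, \<zeta>)\<leftarrow>ps. \<zeta> x) = 1" if "c < S x" for x
      using one[OF that] by (simp add: ps_def comp_def)
    ultimately show "\<exists>V. open V \<and> frontier \<Omega> \<subseteq> V \<and> (\<forall>x\<in>V. (\<Sum>(U, k, s, h, \<zeta>)\<leftarrow>ps. \<zeta> x) = 1)"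
      using c(2) by (intro exI[of _ "{x. c < S x}"]) auto
  qed
  moreover have "\<forall>(U, k, s, h, \<zeta>)\<in>set ps. P h"
    using g A(1) as by (auto simp: ps_def)
  ultimately show ?thesis by blast
qed

section \<open>Divergence in the sense of distributions\<close>

lemma measurable_vec_lambda:
  assumes "\<And>i. (\<lambda>x. f x i) \<in> borel_measurable M"
  shows "(\<lambda>x. (\<chi> i. f x i) :: real^'n) \<in> borel_measurable M"
  unfolding borel_measurable_euclidean_space[of "\<lambda>x. (\<chi> i. f x i) :: real^'n"]
  using assms by (auto simp: Basis_vec_def inner_axis)

lemma prod_Basis_vec: "(\<Prod>b\<in>(Basis :: (real^'n) set). f b) = (\<Prod>i\<in>UNIV. f (axis i 1))"
proof -
  have B: "(Basis :: (real^'n) set) = range (\<lambda>i. axis i 1)"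
    by (auto simp: Basis_vec_def)
  have "inj (\<lambda>i::'n. axis i (1::real))" by (auto simp: inj_on_def axis_eq_axis)
  then show ?thesis unfolding B by (subst prod.reindex) auto
qed

text \<open>Both measures agree on boxes, and this determines Lebesgue measure. The product form
  over the index type is what allows one coordinate to be split off.\<close>

lemma lborel_eq_distr_PiM:
  "(lborel :: (real^'n) measure) = distr (PiM UNIV (\<lambda>_. lborel)) borel (\<lambda>z. \<chi> i. z i)"
proof (rule lborel_eqI)
  interpret product_sigma_finite "\<lambda>_::'n. lborel :: real measure" by standard
  have m: "(\<lambda>z. (\<chi> i. z i) :: real^'n) \<in> borel_measurable (PiM UNIV (\<lambda>_. lborel))"
    by (rule measurable_vec_lambda) simp
  fix l u :: "real^'n" assume "\<And>b. b \<in> Basis \<Longrightarrow> l \<bullet> b \<le> u \<bullet> b"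
  then have le: "l $ i \<le> u $ i" for i
    using inner_axis[of l i 1] inner_axis[of u i 1] by (metis axis_in_Basis_iff Basis_real_def inner_real_def mult.right_neutral singletonI)
  have "(\<lambda>z. (\<chi> i. z i) :: real^'n) -` box l u \<inter> space (PiM UNIV (\<lambda>_. lborel)) =
      PiE UNIV (\<lambda>i. {l $ i<..<u $ i})"
    by (auto simp: box_def Basis_vec_def inner_axis space_PiM PiE_iff)
  then have "emeasure (distr (PiM UNIV (\<lambda>_. lborel)) borel (\<lambda>z. \<chi> i. z i)) (box l u) =
      emeasure (PiM UNIV (\<lambda>_. lborel)) (PiE UNIV (\<lambda>i. {l $ i<..<u $ i}))"
    by (simp add: emeasure_distr[OF m])
  also have "\<dots> = (\<Prod>i\<in>UNIV. emeasure lborel {l $ i<..<u $ i})"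
    by (rule emeasure_PiM) auto
  also have "\<dots> = (\<Prod>i\<in>UNIV. ennreal (u $ i - l $ i))"
    using le by (intro prod.cong refl emeasure_lborel_Ioo) auto
  also have "\<dots> = ennreal (\<Prod>i\<in>UNIV. u $ i - l $ i)"
    using le by (intro prod_ennreal) auto
  also have "\<dots> = (\<Prod>b\<in>Basis. (u - l) \<bullet> b)"
    by (simp add: prod_Basis_vec inner_axis)
  finally show "emeasure (distr (PiM UNIV (\<lambda>_. lborel)) borel (\<lambda>z. \<chi> i. z i)) (box l u) =
      (\<Prod>b\<in>Basis. (u - l) \<bullet> b)" .
qed simp

lemma measurable_hyperplane_point:
  "(\<lambda>z. (\<chi> i. if i = k then 0 else z i) :: real^'n) \<in> borel_measurable (PiM (UNIV - {k}) (\<lambda>_. lborel))"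
proof (rule measurable_vec_lambda)
  show "(\<lambda>z. if i = k then 0 else z i) \<in> borel_measurable (PiM (UNIV - {k}) (\<lambda>_. lborel :: real measure))" for i
    by (cases "i = k") auto
qed

lemma sets_hyperplane_lborel [simp, measurable_cong]: "sets (hyperplane_lborel k) = sets borel"
  and space_hyperplane_lborel [simp]: "space (hyperplane_lborel k) = UNIV"
  by (simp_all add: hyperplane_lborel_def)

lemma AE_hyperplane: "AE z in hyperplane_lborel k. z $ k = 0"
  unfolding hyperplane_lborel_def
  by (subst AE_distr_iff[OF measurable_hyperplane_point]) auto

lemma emeasure_hyperplane_cball: "emeasure (hyperplane_lborel (k::'n::finite)) (cball 0 r) < \<infinity>"
proof -
  interpret product_sigma_finite "\<lambda>_::'n. lborel :: real measure" by standard
  let ?p = "\<lambda>z. (\<chi> i. if i = k then 0 else z i) :: real^'n"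
  have "?p -` cball 0 r \<inter> space (PiM (UNIV - {k}) (\<lambda>_. lborel)) \<subseteq> PiE (UNIV - {k}) (\<lambda>i. {-r..r})"
  proof
    fix z assume z: "z \<in> ?p -` cball 0 r \<inter> space (PiM (UNIV - {k}) (\<lambda>_. lborel))"
    then have "\<bar>z i\<bar> \<le> r" if "i \<noteq> k" for i
      using component_le_norm_cart[of "?p z" i] that by auto
    then show "z \<in> PiE (UNIV - {k}) (\<lambda>i. {-r..r})"
      using z by (auto simp: space_PiM PiE_iff abs_le_iff minus_le_iff)
  qed
  moreover have "PiE (UNIV - {k}) (\<lambda>i. {-r..r}) \<in> sets (PiM (UNIV - {k}) (\<lambda>_. lborel :: real measure))"
    by (rule sets_PiM_I_finite) auto
  ultimately have "emeasure (hyperplane_lborel k) (cball 0 r) \<le>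
      emeasure (PiM (UNIV - {k}) (\<lambda>_. lborel)) (PiE (UNIV - {k}) (\<lambda>i. {-r..r}))"
    unfolding hyperplane_lborel_def
    by (subst emeasure_distr[OF measurable_hyperplane_point]) (auto intro!: emeasure_mono)
  also have "\<dots> = (\<Prod>i\<in>UNIV - {k}. emeasure lborel {-r..r})"
    by (rule emeasure_PiM) auto
  also have "\<dots> = (\<Prod>i\<in>UNIV - {k}. ennreal (max 0 (2 * r)))"
    by (intro prod.cong refl) (auto simp: emeasure_lborel_Icc_eq max_def)
  also have "\<dots> < \<infinity>"
    by (simp add: ennreal_power)
  finally show ?thesis .
qed

text \<open>Bounds are asked for on the hyperplane itself, which carries the whole measure; the part
  of it inside a ball has finite measure.\<close>

lemma integrable_hyperplane:
  fixes g :: "real^'n \<Rightarrow> real"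
  assumes m: "g \<in> borel_measurable borel" and b: "\<And>z. z $ k = 0 \<Longrightarrow> \<bar>g z\<bar> \<le> B"
    and s: "\<And>z. z $ k = 0 \<Longrightarrow> r < norm z \<Longrightarrow> g z = 0"
  shows "integrable (hyperplane_lborel k) g"
proof (rule integrableI_bounded_set[of "cball 0 r" _ _ B])
  show "g \<in> borel_measurable (hyperplane_lborel k)"
    using m by (simp add: measurable_def)
  show "AE x in hyperplane_lborel k. x \<in> cball 0 r \<longrightarrow> norm (g x) \<le> B"
    using AE_hyperplane by eventually_elim (use b in auto)
  show "AE x in hyperplane_lborel k. x \<notin> cball 0 r \<longrightarrow> g x = 0"
    using AE_hyperplane by eventually_elim (use s in auto)
qed (use emeasure_hyperplane_cball in auto)

text \<open>Fubini's theorem with coordinate \<open>k\<close> integrated first: inserting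
  \<open>k\<close> into the product over \<open>UNIV - {k}\<close> gives the iterated integral, and
  the outer integral is moved to the hyperplane by the map that defines
  \<open>hyperplane_lborel\<close>.\<close>

lemma lborel_integral_axis:
  fixes f :: "real^'n \<Rightarrow> real"
  assumes f: "integrable lborel f"
  shows "(LINT x|lborel. f x) = (LINT z|hyperplane_lborel k. LINT c|lborel. f (z + c *\<^sub>R axis k 1))"
proof -
  interpret product_sigma_finite "\<lambda>_::'n. lborel :: real measure" by standard
  have m: "(\<lambda>z. (\<chi> i. z i) :: real^'n) \<in> borel_measurable (PiM UNIV (\<lambda>_. lborel))"
    by (rule measurable_vec_lambda) simp
  have fm: "f \<in> borel_measurable borel" using f by auto
  have ins: "insert k (UNIV - {k}) = (UNIV :: 'n set)" by auto
  have "(LINT x|lborel. f x) = (LINT z|PiM UNIV (\<lambda>_. lborel). f (\<chi> i. z i))"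
    by (subst lborel_eq_distr_PiM) (rule integral_distr[OF m fm])
  also have "\<dots> = (LINT z|PiM (UNIV - {k}) (\<lambda>_. lborel). LINT c|lborel. f (\<chi> i. (z(k := c)) i))"
  proof -
    have "integrable (PiM UNIV (\<lambda>_. lborel)) (\<lambda>z. f (\<chi> i. z i))"
      using f unfolding lborel_eq_distr_PiM by (subst (asm) integrable_distr_eq[OF m fm])
    then show ?thesis
      using product_integral_insert[of "UNIV - {k}" k "\<lambda>z. f (\<chi> i. z i)"] by (simp add: ins)
  qed
  also have "\<dots> = (LINT z|PiM (UNIV - {k}) (\<lambda>_. lborel).
      LINT c|lborel. f ((\<chi> i. if i = k then 0 else z i) + c *\<^sub>R axis k 1))"
  proof (intro Bochner_Integration.integral_cong refl)
    fix z :: "'n \<Rightarrow> real" and c :: real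
    have "(\<chi> i. (z(k := c)) i) = (\<chi> i. if i = k then 0 else z i) + c *\<^sub>R axis k 1"
      by (simp add: vec_eq_iff axis_def)
    then show "f (\<chi> i. (z(k := c)) i) = f ((\<chi> i. if i = k then 0 else z i) + c *\<^sub>R axis k 1)" by simp
  qed
  also have "\<dots> = (LINT z|hyperplane_lborel k. LINT c|lborel. f (z + c *\<^sub>R axis k 1))"
  proof -
    have "(\<lambda>z. LINT c|lborel. f (z + c *\<^sub>R axis k 1)) \<in> borel_measurable borel"
    proof -
      have "(\<lambda>p. f (fst p + snd p *\<^sub>R axis k 1)) \<in> borel_measurable (borel \<Otimes>\<^sub>M borel)"
        unfolding borel_prod
        by (rule measurable_compose[OF borel_measurable_continuous_onI fm]) (intro continuous_intros)
      then have "(\<lambda>p. f (fst p + snd p *\<^sub>R axis k 1)) \<in> borel_measurable (borel \<Otimes>\<^sub>M lborel)"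
        by (simp add: measurable_cong_sets[OF sets_pair_measure_cong[OF refl sets_lborel] refl])
      then show ?thesis
        by (intro lborel.borel_measurable_lebesgue_integral) (simp add: case_prod_beta')
    qed
    then show ?thesis
      unfolding hyperplane_lborel_def by (subst integral_distr[OF measurable_hyperplane_point]) auto
  qed
  finally show ?thesis .
qed

section \<open>Test functions and weak divergence\<close>

lemma set_integrable_continuous:
  fixes f :: "real^'n \<Rightarrow> real"
  assumes "bounded S" "open S" "continuous_on (closure S) f"
  shows "set_integrable lborel S f"
proof -
  have "set_integrable lborel (closure S) f"
    unfolding set_integrable_def
    using borel_integrable_compact[of "closure S" f] assms by (simp add: compact_closure)
  then show ?thesis
    by (rule set_integrable_subset) (use assms closure_subset in auto)
qed

text \<open>The class is the one used in \<open>weak_solution\<close>, so that the weak equation for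
  \<open>u'\<close> becomes literally a statement about the weak divergence of its gradient.\<close>

definition test_function :: "(real^'n) set \<Rightarrow> (real^'n \<Rightarrow> real) \<Rightarrow> bool" where
  "test_function S \<phi> \<longleftrightarrow>
     C1_closure UNIV \<phi> \<and> (\<exists>K. compact K \<and> K \<subseteq> S \<and> (\<forall>x. x \<notin> K \<longrightarrow> \<phi> x = 0))"

text \<open>
  \<open>f\<close> is the divergence of \<open>F\<close> in \<open>S\<close> in the sense of distributions, tested with \<open>C\<^sup>1\<close> functions.
  In this weak form the divergence is transported by \<open>C\<^sup>1\<close> diffeomorphisms without
  any second derivatives (Piola's identity comes for free).
\<close>

definition has_weak_div ::
  "(real^'n) set \<Rightarrow> (real^'n \<Rightarrow> real^'n) \<Rightarrow> (real^'n \<Rightarrow> real) \<Rightarrow> bool" where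
  "has_weak_div S F f \<longleftrightarrow>
     (\<forall>\<phi>. test_function S \<phi> \<longrightarrow> (LINT x:S|lborel. F x \<bullet> grad UNIV \<phi> x + f x * \<phi> x) = 0)"

lemma has_partials_zero_outside:
  assumes f: "has_partials UNIV f D" and "closed K" and "\<And>x. x \<notin> K \<Longrightarrow> f x = 0" and "x \<notin> K"
  shows "D i x = 0"
proof -
  have "(f has_derivative (\<lambda>h. 0)) (at x)"
    by (rule has_derivative_transform_within_open[of "\<lambda>x. 0" _ _ _ "- K"]) (use assms in auto)
  with has_partialsD(1)[OF f UNIV_I] have "(\<lambda>h. \<Sum>i\<in>UNIV. h $ i *\<^sub>R D i x) = (\<lambda>h. 0)"
    by (rule has_derivative_unique)
  from fun_cong[OF this, of "axis i 1"] show ?thesis by (simp add: sum_axis_scaleR)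
qed

text \<open>\<open>W\<close> and the complement of the closed set \<open>K\<close> cover the space,
  and on these open sets the extension is \<open>f\<close> or 0. Products of fields defined in
  \<Omega> with cutoffs become test functions in this way.\<close>

lemma has_partials_extend_zero:
  assumes "open W" "closed K" "K \<subseteq> W"
    and d: "\<And>x. x \<in> W \<Longrightarrow> (f has_derivative (\<lambda>h. \<Sum>i\<in>UNIV. h $ i *\<^sub>R D i x)) (at x)"
    and c: "\<And>i. continuous_on W (D i)" and z: "\<And>x. x \<in> W \<Longrightarrow> x \<notin> K \<Longrightarrow> f x = 0"
  shows "has_partials UNIV (\<lambda>x. if x \<in> W then f x else 0) (\<lambda>i x. if x \<in> W then D i x else 0)"
proof -
  let ?g = "\<lambda>x. if x \<in> W then f x else 0" and ?E = "\<lambda>i x. if x \<in> W then D i x else 0"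
  have D0: "D i x = 0" if "x \<in> W" "x \<notin> K" for x i
  proof -
    have "(f has_derivative (\<lambda>h. 0)) (at x)"
      by (rule has_derivative_transform_within_open[of "\<lambda>x. 0" _ _ _ "W - K"])
         (use assms that in \<open>auto simp: open_Diff\<close>)
    with d[OF that(1)] have "(\<lambda>h. \<Sum>i\<in>UNIV. h $ i *\<^sub>R D i x) = (\<lambda>h. 0)"
      by (rule has_derivative_unique)
    from fun_cong[OF this, of "axis i 1"] show ?thesis by (simp add: sum_axis_scaleR)
  qed
  have der: "(?g has_derivative (\<lambda>h. \<Sum>i\<in>UNIV. h $ i *\<^sub>R ?E i x)) (at x)" for x
  proof (cases "x \<in> W")
    case True
    show ?thesis
      by (rule has_derivative_transform_within_open[of f _ _ _ W]) (use True d assms in auto)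
  next
    case False
    show ?thesis
      by (rule has_derivative_transform_within_open[of "\<lambda>x. 0" _ _ _ "- K"]) (use False assms in auto)
  qed
  show ?thesis
  proof (rule has_partialsI)
    show "continuous_on (closure UNIV) ?g"
      by (intro continuous_at_imp_continuous_on ballI has_derivative_continuous[OF der])
    have "continuous_on (W \<union> - K) (?E i)" for i
    proof (rule continuous_on_open_Un)
      show "continuous_on W (?E i)" using c by (simp cong: continuous_on_cong)
      show "continuous_on (- K) (?E i)"
        by (rule continuous_on_cong[THEN iffD1, OF refl _ continuous_on_const[of _ 0]]) (use D0 in auto)
    qed (use assms in auto)
    moreover have "W \<union> - K = UNIV" using assms by auto
    ultimately show "continuous_on (closure UNIV) (?E i)" for i by simp
  qed (rule der)
qed

text \<open>A piecewise quadratic C^1 step from 0 at 1 to 1 at 2; its derivative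
  \<open>layer'\<close> is the tent on [1, 2] of height 2 and mass 1. The rise starts at 1 rather
  than 0 so that \<open>layer (\<rho> / e)\<close> vanishes near the zero set of
  \<open>\<rho>\<close>, which gives a cutoff with compact support inside the domain.\<close>

definition layer :: "real \<Rightarrow> real" where
  "layer \<tau> = 2 * ((max 0 (\<tau> - 1))\<^sup>2 - 2 * (max 0 (\<tau> - 3/2))\<^sup>2 + (max 0 (\<tau> - 2))\<^sup>2)"

definition layer' :: "real \<Rightarrow> real" where
  "layer' \<tau> = 4 * (max 0 (\<tau> - 1) - 2 * max 0 (\<tau> - 3/2) + max 0 (\<tau> - 2))"

lemma DERIV_layer: "(layer has_real_derivative layer' \<tau>) (at \<tau>)"
proof -
  have "((\<lambda>\<tau>. (max 0 (\<tau> - c))\<^sup>2) has_real_derivative 2 * max 0 (\<tau> - c)) (at \<tau>)" for c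
  proof -
    have "((\<lambda>\<tau>. (max 0 (\<tau> - c))\<^sup>2) has_real_derivative 2 * max 0 (\<tau> - c) * 1) (at \<tau>)"
      by (rule DERIV_chain2[where f = "\<lambda>s. (max 0 s)\<^sup>2" and g = "\<lambda>\<tau>. \<tau> - c", OF DERIV_square_pos_part])
         (auto intro!: derivative_eq_intros)
    then show ?thesis by simp
  qed
  from DERIV_cmult[OF DERIV_add[OF DERIV_diff[OF this DERIV_cmult[OF this]] this], of 2 1 2 "3/2" 2]
  show ?thesis unfolding layer_def layer'_def by (simp add: algebra_simps)
qed

lemma layer_simps:
  shows layer_lower: "\<tau> \<le> 1 \<Longrightarrow> layer \<tau> = 0" and layer_upper: "2 \<le> \<tau> \<Longrightarrow> layer \<tau> = 1"
    and layer'_outside: "\<tau> \<le> 1 \<or> 2 \<le> \<tau> \<Longrightarrow> layer' \<tau> = 0" and layer'_nonneg: "0 \<le> layer' \<tau>"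
  by (auto simp: layer_def layer'_def max_def power2_eq_square algebra_simps)

lemma continuous_layer': "continuous_on A layer'"
  unfolding layer'_def by (intro continuous_intros)

lemma layer_bounds: "0 \<le> layer \<tau>" "layer \<tau> \<le> 1"
proof -
  have mono: "layer a \<le> layer b" if "a \<le> b" for a b
    by (rule DERIV_nonneg_imp_nondecreasing[OF that]) (use DERIV_layer layer'_nonneg in blast)
  show "0 \<le> layer \<tau>" using mono[of "min 1 \<tau>" \<tau>] layer_lower[of "min 1 \<tau>"] by simp
  show "layer \<tau> \<le> 1" using mono[of \<tau> "max 2 \<tau>"] layer_upper[of "max 2 \<tau>"] by simp
qed

lemma layer'_has_integral: "integrable lborel layer'" "(LINT \<tau>|lborel. layer' \<tau>) = 1"
proof -
  have eq: "layer' = (\<lambda>\<tau>. indicator {1..2} \<tau> *\<^sub>R layer' \<tau>)"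
  proof (rule ext)
    show "layer' \<tau> = indicator {1..2} \<tau> *\<^sub>R layer' \<tau>" for \<tau>
      using layer'_outside[of \<tau>] by (cases "1 \<le> \<tau> \<and> \<tau> \<le> 2") auto
  qed
  show "integrable lborel layer'"
    by (subst eq) (rule borel_integrable_compact, auto simp: continuous_layer')
  have "(LINT \<tau>|lborel. indicator {1..2} \<tau> *\<^sub>R layer' \<tau>) = layer 2 - layer 1"
    by (rule integral_FTC_Icc)
       (auto simp: continuous_layer' has_real_derivative_iff_has_vector_derivative[symmetric]
         intro: has_field_derivative_at_within DERIV_layer)
  then show "(LINT \<tau>|lborel. layer' \<tau>) = 1"
    using eq by (simp add: layer_lower layer_upper)
qed

text \<open>The non-normalised outward normal: minus the gradient of \<open>h x - s * x $ k\<close>,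
  the defining function that is positive inside. Its length is the surface element of the graph, so
  the two cancel in every flux.\<close>

definition patch_normal :: "'n \<Rightarrow> real \<Rightarrow> (real^'n \<Rightarrow> real) \<Rightarrow> real^'n \<Rightarrow> real^'n" where
  "patch_normal k s h z = s *\<^sub>R axis k 1 - grad UNIV h z"

lemma inner_grad_eq: "d \<bullet> grad S f x = (\<Sum>i\<in>UNIV. d $ i * partial S i f x)"
  by (simp add: grad_def inner_vec_def)

lemma continuous_on_grad:
  assumes "C1_closure S f"
  shows "continuous_on (closure S) (grad S f)"
  unfolding grad_def
  by (intro continuous_on_vec_lambda has_partialsD(3)[OF has_partials_partial[OF assms]])

lemma grad_eq:
  assumes "has_partials S f D" "open S" "x \<in> closure S"
  shows "grad S f x = (\<chi> i. D i x)"
  by (simp add: grad_def partial_eq[OF assms])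

section \<open>Graph charts\<close>

lemma local_graphD:
  assumes "local_graph S U k s h"
  shows "open U" and "s * s = 1" and "h (x + c *\<^sub>R axis k 1) = h x"
    and "x \<in> U \<Longrightarrow> x \<in> S \<longleftrightarrow> s * x $ k < h x" and "x \<in> U \<Longrightarrow> x \<in> frontier S \<longleftrightarrow> s * x $ k = h x"
  using assms by (auto simp: local_graph_def set_eq_iff)

lemma graph_point_eq: "graph_point k s h z = z + (s * h z - z $ k) *\<^sub>R axis k 1"
  by (simp add: graph_point_def vec_eq_iff axis_def)

lemma graph_height:
  assumes "local_graph S U k s h"
  shows "h (graph_point k s h z) = h z" and "graph_point k s h z $ k = s * h z"
    and "s * graph_point k s h z $ k = h z"
proof -
  show 1: "graph_point k s h z $ k = s * h z" by (simp add: graph_point_def)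
  show "h (graph_point k s h z) = h z"
    unfolding graph_point_eq by (rule local_graphD(3)[OF assms])
  have "s * (s * h z) = h z"
    using local_graphD(2)[OF assms] by (metis mult.assoc mult_1)
  then show "s * graph_point k s h z $ k = h z" by (simp add: 1)
qed

lemma graph_point_frontier:
  assumes g: "local_graph S U k s h" and "graph_point k s h z \<in> U"
  shows "graph_point k s h z \<in> frontier S" and "graph_point k s h z \<in> closure S"
proof -
  show "graph_point k s h z \<in> frontier S"
    using local_graphD(5)[OF assms] graph_height[OF g, of z] by simp
  then show "graph_point k s h z \<in> closure S" by (simp add: frontier_def)
qed

lemma continuous_on_graph_point:
  "continuous_on A h \<Longrightarrow> continuous_on A (graph_point k s h)"
  unfolding graph_point_eq by (intro continuous_intros)

lemma partial_shift_invariant: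
  assumes h: "C1_closure UNIV h" and inv: "\<And>x. h (x + d) = h x"
  shows "partial UNIV i h (x + d) = partial UNIV i h x"
proof -
  have "((\<lambda>x. h (x + d)) has_derivative (\<lambda>v. \<Sum>j\<in>UNIV. v $ j *\<^sub>R partial UNIV j h (x + d))) (at x)"
  proof -
    have sh: "((\<lambda>x. x + d) has_derivative (\<lambda>v. v)) (at x)" by (auto intro!: derivative_eq_intros)
    show ?thesis
      using has_derivative_compose[OF sh has_partialsD(1)[OF has_partials_partial[OF h] UNIV_I]] .
  qed
  then have "(h has_derivative (\<lambda>v. \<Sum>j\<in>UNIV. v $ j *\<^sub>R partial UNIV j h (x + d))) (at x)"
    by (simp add: inv)
  then have "(\<lambda>v. \<Sum>j\<in>UNIV. v $ j *\<^sub>R partial UNIV j h (x + d)) = (\<lambda>v. \<Sum>j\<in>UNIV. v $ j *\<^sub>R partial UNIV j h x)"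
    by (rule has_derivative_unique) (rule has_partialsD(1)[OF has_partials_partial[OF h] UNIV_I])
  from fun_cong[OF this, of "axis i 1"] show ?thesis by (simp add: sum_axis_scaleR)
qed

lemma partial_graph_axis:
  assumes g: "local_graph S U k s h" and h: "C1_closure UNIV h"
  shows "partial UNIV k h x = 0"
proof -
  have "((\<lambda>s. h (x + s *\<^sub>R axis k 1)) has_vector_derivative partial UNIV k h (x + 0 *\<^sub>R axis k 1)) (at 0)"
    by (rule has_partials_along_axis[OF has_partials_partial[OF h]]) simp
  moreover have "((\<lambda>s. h (x + s *\<^sub>R axis k 1)) has_vector_derivative 0) (at 0)"
    by (simp add: local_graphD(3)[OF g])
  ultimately show ?thesis using vector_derivative_unique_at by fastforce
qed

lemma patch_normal_graph_point:
  assumes "local_graph S U k s h" "C1_closure UNIV h"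
  shows "patch_normal k s h (graph_point k s h z) = patch_normal k s h z"
  unfolding patch_normal_def grad_def graph_point_eq
  using partial_shift_invariant[OF assms(2) local_graphD(3)[OF assms(1)]] by simp

lemma continuous_on_patch_normal: "C1_closure UNIV h \<Longrightarrow> continuous_on A (patch_normal k s h)"
  unfolding patch_normal_def
  by (intro continuous_intros continuous_on_subset[OF continuous_on_grad]) auto

text \<open>\<open>f\<close> is continuous on the frontier only, and graph points outside
  \<open>U\<close> may leave the frontier; there the cutoff vanishes. The preimages of
  \<open>U\<close> and of the complement of \<open>K\<close> form an open cover on whose members
  continuity is clear.\<close>

lemma continuous_graph_integrand:
  fixes f :: "real^'n \<Rightarrow> real"
  assumes g: "local_graph S U k s h" and h: "continuous_on UNIV h" and \<zeta>: "continuous_on UNIV \<zeta>"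
    and K: "compact K" "K \<subseteq> U" "\<And>x. x \<notin> K \<Longrightarrow> \<zeta> x = (0::real)"
    and f: "continuous_on (frontier S) f"
  shows "continuous_on UNIV (\<lambda>z. \<zeta> (graph_point k s h z) * f (graph_point k s h z))"
proof -
  let ?g = "graph_point k s h"
  have cg: "continuous_on A ?g" for A
    using continuous_on_graph_point continuous_on_subset[OF h] by blast
  have "continuous_on (?g -` U \<union> ?g -` (- K)) (\<lambda>z. \<zeta> (?g z) * f (?g z))"
  proof (rule continuous_on_open_Un)
    show "open (?g -` U)" "open (?g -` (- K))"
      using local_graphD(1)[OF g] K(1) cg by (auto intro!: open_vimage compact_imp_closed)
    show "continuous_on (?g -` U) (\<lambda>z. \<zeta> (?g z) * f (?g z))"
      by (intro continuous_intros continuous_on_compose2[OF \<zeta> cg] continuous_on_compose2[OF f cg])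
         (use graph_point_frontier(1)[OF g] in auto)
    show "continuous_on (?g -` (- K)) (\<lambda>z. \<zeta> (?g z) * f (?g z))"
      by (rule continuous_on_cong[THEN iffD1, OF refl _ continuous_on_const[of _ 0]]) (use K(3) in auto)
  qed
  moreover have "?g -` U \<union> ?g -` (- K) = UNIV" using K by auto
  ultimately show ?thesis by simp
qed

lemma norm_graph_point:
  fixes z :: "real^'n"
  assumes "z $ k = 0"
  shows "norm z \<le> norm (z + c *\<^sub>R axis k 1)"
proof -
  have "z \<bullet> axis k 1 = 0" using assms by (simp add: inner_axis)
  then have "(z + c *\<^sub>R axis k 1) \<bullet> (z + c *\<^sub>R axis k 1) = z \<bullet> z + c\<^sup>2"
    by (simp add: inner_add_left inner_add_right inner_commute power2_eq_square inner_axis_axis)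
  then have "(norm (z + c *\<^sub>R axis k 1))\<^sup>2 = (norm z)\<^sup>2 + c\<^sup>2"
    unfolding power2_norm_eq_inner .
  then have "(norm z)\<^sup>2 \<le> (norm (z + c *\<^sub>R axis k 1))\<^sup>2" by simp
  then show ?thesis by (rule power2_le_imp_le) simp
qed

lemma has_partials_graph_distance:
  assumes "C1_closure UNIV h"
  shows "has_partials UNIV (\<lambda>x. h x - s * x $ k) (\<lambda>i x. - patch_normal k s h x $ i)"
proof (rule has_partials_cong)
  show "has_partials UNIV (\<lambda>x. h x - s * x $ k) (\<lambda>i x. partial UNIV i h x - s * axis i 1 $ k)"
    by (intro has_partials_diff has_partials_partial assms
        has_partials_bounded_linear[OF bounded_linear_mult_right] has_partials_component has_partials_id)
  show "partial UNIV i h x - s * axis i 1 $ k = - patch_normal k s h x $ i" for i x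
    by (auto simp: patch_normal_def grad_def axis_def)
qed auto

section \<open>The divergence theorem for fields with a weak divergence\<close>

lemma continuous_bounded_on_closure:
  fixes f :: "real^'n \<Rightarrow> 'b::real_normed_vector"
  assumes "bounded S" "continuous_on (closure S) f"
  obtains M where "0 \<le> M" "\<And>x. x \<in> closure S \<Longrightarrow> norm (f x) \<le> M"
proof -
  have "bounded (f ` closure S)"
    using assms compact_continuous_image compact_imp_bounded by (metis compact_closure)
  then show thesis using that unfolding bounded_iff
    by (metis (no_types, lifting) imageI norm_ge_zero order_trans linorder_le_cases)
qed

text \<open>The cutoff \<open>\<zeta>\<close> need not vanish on the frontier, hence it is not a
  test function in general. Multiplied by a boundary layer of width \<open>e n\<close> it becomes
  one, and the derivative of the layer contributes an integral of \<open>F x \<bullet> ?N x\<close>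
  against an approximate Dirac mass on the graph. As the width tends to 0, the layer itself
  disappears from the one term, and Fubini along axis \<open>k\<close> turns the other into the
  flux.\<close>

lemma patch_flux:
  fixes F :: "real^'n \<Rightarrow> real^'n"
  assumes S: "bounded S" "open S"
    and F: "continuous_on (closure S) F" and f: "continuous_on (closure S) f"
    and weak: "has_weak_div S F f"
    and g: "local_graph S U k s h" and h: "C1_closure UNIV h" and \<zeta>: "C1_closure UNIV \<zeta>"
    and K: "compact K" "K \<subseteq> U" "\<And>x. x \<notin> K \<Longrightarrow> \<zeta> x = 0"
  shows "(LINT x:S|lborel. F x \<bullet> grad UNIV \<zeta> x + f x * \<zeta> x) =
    (LINT z|hyperplane_lborel k. \<zeta> (graph_point k s h z) *
       (F (graph_point k s h z) \<bullet> patch_normal k s h (graph_point k s h z)))"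
proof -
  let ?g = "graph_point k s h" and ?N = "patch_normal k s h"
  define \<rho> where "\<rho> x = h x - s * x $ k" for x
  define e where "e n = inverse (real (Suc n))" for n
  define a where "a x = F x \<bullet> grad UNIV \<zeta> x + f x * \<zeta> x" for x
  define b where "b x = \<zeta> x * (F x \<bullet> ?N x)" for x
  note \<rho>p = has_partials_graph_distance[OF h, of s k, folded \<rho>_def]
  note \<zeta>p = has_partials_partial[OF \<zeta>]
  have e: "0 < e n" for n by (simp add: e_def)
  have e0: "e \<longlonglongrightarrow> 0" unfolding e_def by (rule LIMSEQ_inverse_real_of_nat)
  have c\<zeta>: "continuous_on A \<zeta>" for A using has_partialsD(2)[OF \<zeta>p] continuous_on_subset by auto
  have ch: "continuous_on A h" for A
    using has_partialsD(2)[OF has_partials_partial[OF h]] continuous_on_subset by auto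
  have cN: "continuous_on A ?N" for A by (rule continuous_on_patch_normal[OF h])
  have ca: "continuous_on (closure S) a" unfolding a_def
    by (intro continuous_intros F f c\<zeta> continuous_on_subset[OF continuous_on_grad[OF \<zeta>]]) auto
  have cb: "continuous_on (closure S) b" unfolding b_def
    by (intro continuous_intros F c\<zeta> cN)
  have grad\<zeta>: "grad UNIV \<zeta> x = 0" if "x \<notin> K" for x
    using has_partials_zero_outside[OF \<zeta>p compact_imp_closed[OF K(1)] K(3) that]
    by (simp add: grad_def vec_eq_iff)
  have inS: "x \<in> S \<longleftrightarrow> 0 < \<rho> x" if "x \<in> U" for x
    using local_graphD(4)[OF g that] by (simp add: \<rho>_def)

  text \<open>Testing with the cutoff \<open>\<zeta>\<close> multiplied by a layer of width \<open>e n\<close> along the graph.\<close>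
  have test: "(LINT x:S|lborel. a x * layer (\<rho> x / e n)) =
      (LINT x:S|lborel. b x * (layer' (\<rho> x / e n) / e n))" for n
  proof -
    let ?l = "\<lambda>x. layer (\<rho> x / e n)" and ?l' = "\<lambda>x. layer' (\<rho> x / e n) / e n"
    have l: "has_partials UNIV ?l (\<lambda>i x. (- ?N x $ i / e n) *\<^sub>R layer' (\<rho> x / e n))"
      by (rule has_partials_comp_real[OF has_partials_bounded_linear[OF bounded_linear_divide \<rho>p]])
         (auto simp: has_real_derivative_iff_has_vector_derivative[symmetric] DERIV_layer continuous_layer')
    note p = has_partials_mult[OF \<zeta>p l]
    let ?D = "\<lambda>i x. \<zeta> x * ((- ?N x $ i / e n) *\<^sub>R layer' (\<rho> x / e n)) + partial UNIV i \<zeta> x * ?l x"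
    define \<phi> where "\<phi> x = (if x \<in> S \<inter> U then \<zeta> x * ?l x else 0)" for x
    \<comment> \<open>The layer vanishes for \<open>\<rho> x \<le> e n\<close>, so off this compact
      subset of \<open>S \<inter> U\<close> the test function is zero.\<close>
    let ?K = "K \<inter> {x. e n \<le> \<rho> x}"
    have clK: "compact ?K"
      by (intro compact_Int_closed K(1) closed_Collect_le continuous_on_const has_partialsD(2)[OF \<rho>p, simplified])
    have KU: "?K \<subseteq> S \<inter> U" using K(2) e[of n] inS by (auto dest: less_le_trans)
    have zero: "\<zeta> x * ?l x = 0" if "x \<notin> ?K" for x
    proof (cases "x \<in> K")
      case True
      then have "\<rho> x / e n \<le> 1" using that e[of n] by (simp add: divide_le_eq)
      then show ?thesis by (simp add: layer_lower)
    qed (simp add: K)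
    have ext: "has_partials UNIV \<phi> (\<lambda>i x. if x \<in> S \<inter> U then ?D i x else 0)"
      unfolding \<phi>_def
      by (rule has_partials_extend_zero[OF _ compact_imp_closed[OF clK] KU])
         (use S local_graphD(1)[OF g] has_partialsD[OF p] zero in
           \<open>auto intro: continuous_on_subset\<close>)
    have "test_function S \<phi>"
      unfolding test_function_def using clK KU zero has_partials_C1_closure[OF ext]
      by (intro conjI exI[of _ ?K]) (auto simp: \<phi>_def)
    with weak have 0: "(LINT x:S|lborel. F x \<bullet> grad UNIV \<phi> x + f x * \<phi> x) = 0"
      by (simp add: has_weak_div_def)
    have g\<phi>: "grad UNIV \<phi> x = (\<chi> i. if x \<in> S \<inter> U then ?D i x else 0)" for x
      by (rule grad_eq[OF ext]) auto
    have "F x \<bullet> grad UNIV \<phi> x + f x * \<phi> x = a x * ?l x - b x * ?l' x" if "x \<in> S" for x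
    proof (cases "x \<in> U")
      case True
      have "grad UNIV \<phi> x = (- (\<zeta> x * ?l' x)) *\<^sub>R ?N x + ?l x *\<^sub>R grad UNIV \<zeta> x"
        unfolding g\<phi> using that True by (simp add: vec_eq_iff grad_def)
      moreover have "\<phi> x = \<zeta> x * ?l x" using that True by (simp add: \<phi>_def)
      ultimately show ?thesis
        by (simp only: a_def b_def inner_add_right inner_scaleR_right) (simp add: algebra_simps)
    next
      case False
      then have "x \<notin> K" using K(2) by auto
      then have "a x = 0" "b x = 0" by (auto simp: a_def b_def K grad\<zeta>)
      moreover have "grad UNIV \<phi> x = 0" unfolding g\<phi> using False by (simp add: vec_eq_iff)
      ultimately show ?thesis using False by (simp add: \<phi>_def)
    qed
    then have "(LINT x:S|lborel. F x \<bullet> grad UNIV \<phi> x + f x * \<phi> x) =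
        (LINT x:S|lborel. a x * ?l x - b x * ?l' x)"
      using S by (intro set_lebesgue_integral_cong) auto
    also have "\<dots> = (LINT x:S|lborel. a x * ?l x) - (LINT x:S|lborel. b x * ?l' x)"
      by (intro set_integral_diff set_integrable_continuous S continuous_intros ca cb
          continuous_on_subset[OF has_partialsD(2)[OF l]]
          continuous_on_compose2[OF continuous_layer'[of UNIV]]
          continuous_on_subset[OF has_partialsD(2)[OF \<rho>p]])
         (use e in \<open>auto simp: less_imp_neq[symmetric]\<close>)
    finally show ?thesis using 0 by simp
  qed

  \<comment> \<open>On \<open>S \<inter> U\<close> the layer is eventually 1, since
    \<open>\<rho> x / e n\<close> exceeds 2 for large \<open>n\<close>; off \<open>U\<close> the
    integrand vanishes together with the cutoff and its gradient.\<close>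
  have lim1: "(\<lambda>n. LINT x:S|lborel. a x * layer (\<rho> x / e n)) \<longlonglongrightarrow> (LINT x:S|lborel. a x)"
    unfolding set_lebesgue_integral_def
  proof (rule integral_dominated_convergence[where w = "\<lambda>x. norm (indicator S x *\<^sub>R a x)"])
    have ia: "integrable lborel (\<lambda>x. indicator S x *\<^sub>R a x)"
      using set_integrable_continuous[OF S ca] by (simp add: set_integrable_def)
    then show "integrable lborel (\<lambda>x. norm (indicator S x *\<^sub>R a x))" by (rule integrable_norm)
    show "(\<lambda>x. indicator S x *\<^sub>R a x) \<in> borel_measurable lborel" using ia by auto
    have "continuous_on UNIV (\<lambda>x. layer (\<rho> x / e n))" for n
    proof -
      have "continuous_on UNIV layer"
        by (intro continuous_at_imp_continuous_on) (use DERIV_layer DERIV_isCont in blast)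
      then show ?thesis using e
        by (intro continuous_on_compose2[OF \<open>continuous_on UNIV layer\<close>] continuous_intros
            continuous_on_subset[OF has_partialsD(2)[OF \<rho>p]]) (auto simp: less_imp_neq[symmetric])
    qed
    then have "(\<lambda>x. layer (\<rho> x / e n)) \<in> borel_measurable lborel" for n
      by (simp add: borel_measurable_continuous_onI)
    then have "(\<lambda>x. (indicator S x *\<^sub>R a x) * layer (\<rho> x / e n)) \<in> borel_measurable lborel" for n
      using ia by (intro borel_measurable_times) auto
    then show "(\<lambda>x. indicator S x *\<^sub>R (a x * layer (\<rho> x / e n))) \<in> borel_measurable lborel" for n
      by (simp add: mult.assoc)
    show "AE x in lborel. (\<lambda>n. indicator S x *\<^sub>R (a x * layer (\<rho> x / e n))) \<longlonglongrightarrow> indicator S x *\<^sub>R a x"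
    proof (rule AE_I2)
      fix x
      consider "x \<in> S" "x \<in> U" | "x \<notin> S" | "x \<notin> U" by blast
      then show "(\<lambda>n. indicator S x *\<^sub>R (a x * layer (\<rho> x / e n))) \<longlonglongrightarrow> indicator S x *\<^sub>R a x"
      proof cases
        case 1
        then have "0 < \<rho> x" using inS by simp
        obtain m where m: "2 / \<rho> x < real m" using reals_Archimedean2 by blast
        have "layer (\<rho> x / e n) = 1" if "m \<le> n" for n
        proof -
          have "2 / \<rho> x < real (Suc n)" using m that by simp
          then have "2 \<le> \<rho> x / e n" using \<open>0 < \<rho> x\<close>
            by (simp add: e_def divide_inverse pos_divide_less_eq mult.commute) (simp add: field_simps)
          then show ?thesis by (rule layer_upper)
        qed
        then have "\<forall>\<^sub>F n in sequentially. indicator S x *\<^sub>R a x = indicator S x *\<^sub>R (a x * layer (\<rho> x / e n))"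
          by (auto simp: eventually_sequentially)
        then show ?thesis by (rule Lim_transform_eventually[OF tendsto_const])
      next
        case 3
        then have "x \<notin> K" using K(2) by auto
        then show ?thesis by (simp add: a_def K grad\<zeta>)
      qed simp
    qed
    show "AE x in lborel. norm (indicator S x *\<^sub>R (a x * layer (\<rho> x / e n))) \<le> norm (indicator S x *\<^sub>R a x)" for n
      using layer_bounds by (auto simp: abs_mult indicator_def intro!: AE_I2 mult_left_le)
  qed

  define B where "B x = indicator S x *\<^sub>R b x" for x
  obtain M where M: "0 \<le> M" "\<And>x. x \<in> closure S \<Longrightarrow> norm (b x) \<le> M"
    using continuous_bounded_on_closure[OF S(1) cb] by blast
  have BM: "\<bar>B x\<bar> \<le> M" for x
    using M closure_subset[of S] by (auto simp: B_def indicator_def)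
  have BK: "B x = 0" if "x \<notin> K" for x using that K(3) by (simp add: B_def b_def)
  have Bm: "B \<in> borel_measurable borel"
    using set_integrable_continuous[OF S cb] by (auto simp: B_def[abs_def] set_integrable_def)
  \<comment> \<open>For \<open>z\<close> in the hyperplane this is the point over \<open>z\<close>
    at which \<open>\<rho> / e n\<close> equals \<open>\<sigma>\<close>; in this variable the
    rescaled derivative of the layer becomes the fixed density \<open>layer'\<close>.\<close>
  define p where "p n z \<sigma> = z + (s * (h z - e n * \<sigma>)) *\<^sub>R axis k 1" for n z \<sigma>
  define J where "J n z = (LINT \<sigma>|lborel. B (p n z \<sigma>) * layer' \<sigma>)" for n z
  have s2: "s * (s * x) = x" for x using local_graphD(2)[OF g] by (metis mult.assoc mult_1)
  have Jm: "J n \<in> borel_measurable (hyperplane_lborel k)" for n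
  proof -
    have "continuous_on UNIV (\<lambda>q. p n (fst q) (snd q))" unfolding p_def
      by (intro continuous_intros continuous_on_compose2[OF ch[of UNIV]]) auto
    then have "(\<lambda>q. B (p n (fst q) (snd q)) * layer' (snd q)) \<in> borel_measurable (borel \<Otimes>\<^sub>M borel)"
      unfolding borel_prod
      by (intro borel_measurable_times measurable_compose[OF borel_measurable_continuous_onI Bm]
          borel_measurable_continuous_onI continuous_on_compose2[OF continuous_layer'[of UNIV]])
         (auto intro!: continuous_intros)
    then have "(\<lambda>q. B (p n (fst q) (snd q)) * layer' (snd q)) \<in> borel_measurable (borel \<Otimes>\<^sub>M lborel)"
      by (simp add: measurable_cong_sets[OF sets_pair_measure_cong[OF refl sets_lborel] refl])
    then have "J n \<in> borel_measurable borel" unfolding J_def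
      by (intro lborel.borel_measurable_lebesgue_integral) (simp add: case_prod_beta')
    then show ?thesis by (simp add: measurable_cong_sets[OF sets_hyperplane_lborel refl])
  qed
  have fubini: "(LINT x:S|lborel. b x * (layer' (\<rho> x / e n) / e n)) = (LINT z|hyperplane_lborel k. J n z)" for n
  proof -
    let ?G = "\<lambda>x. B x * (layer' (\<rho> x / e n) / e n)"
    have "set_integrable lborel S (\<lambda>x. b x * (layer' (\<rho> x / e n) / e n))"
      by (intro set_integrable_continuous S continuous_intros cb
          continuous_on_compose2[OF continuous_layer'[of UNIV]]
          continuous_on_subset[OF has_partialsD(2)[OF \<rho>p]])
         (use e in \<open>auto simp: less_imp_neq[symmetric]\<close>)
    then have "integrable lborel ?G" by (simp add: set_integrable_def B_def mult.assoc)
    from lborel_integral_axis[OF this, of k]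
    have "(LINT x:S|lborel. b x * (layer' (\<rho> x / e n) / e n)) =
        (LINT z|hyperplane_lborel k. LINT c|lborel. ?G (z + c *\<^sub>R axis k 1))"
      by (simp add: set_lebesgue_integral_def B_def mult.assoc)
    also have "\<dots> = (LINT z|hyperplane_lborel k. J n z)"
    proof (rule integral_cong_AE)
      show "AE z in hyperplane_lborel k. (LINT c|lborel. ?G (z + c *\<^sub>R axis k 1)) = J n z"
        using AE_hyperplane
      proof eventually_elim
        fix z :: "real^'n" assume z: "z $ k = 0"
        \<comment> \<open>The affine substitution \<open>c = s * h z - s * e n * \<sigma>\<close>
          has Jacobian \<open>e n\<close>, which cancels the factor \<open>1 / e n\<close> in the
          derivative of the layer.\<close>
        have ne: "- s * e n \<noteq> 0" and ab: "\<bar>- s * e n\<bar> = e n"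
          using g e[of n] by (auto simp: local_graph_def abs_mult)
        have "(LINT c|lborel. ?G (z + c *\<^sub>R axis k 1)) =
           e n * (LINT \<sigma>|lborel. ?G (z + (s * h z + (- s * e n) * \<sigma>) *\<^sub>R axis k 1))"
          using lborel_integral_real_affine[OF ne, of "\<lambda>c. ?G (z + c *\<^sub>R axis k 1)" "s * h z",
              unfolded ab real_scaleR_def] .
        also have "(\<lambda>\<sigma>. ?G (z + (s * h z + (- s * e n) * \<sigma>) *\<^sub>R axis k 1)) =
           (\<lambda>\<sigma>. B (p n z \<sigma>) * layer' \<sigma> / e n)"
        proof
          fix \<sigma>
          have 1: "z + (s * h z + (- s * e n) * \<sigma>) *\<^sub>R axis k 1 = p n z \<sigma>"
            by (simp add: p_def algebra_simps)
          have "\<rho> (p n z \<sigma>) = h z - s * (s * (h z - e n * \<sigma>))"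
            using z by (simp add: \<rho>_def p_def local_graphD(3)[OF g])
          then have "\<rho> (p n z \<sigma>) / e n = \<sigma>" using s2 e[of n] by simp
          then show "?G (z + (s * h z + (- s * e n) * \<sigma>) *\<^sub>R axis k 1) = B (p n z \<sigma>) * layer' \<sigma> / e n"
            unfolding 1 by simp
        qed
        also have "e n * (LINT \<sigma>|lborel. B (p n z \<sigma>) * layer' \<sigma> / e n) = J n z"
          using e[of n] by (simp add: J_def)
        finally show "(LINT c|lborel. ?G (z + c *\<^sub>R axis k 1)) = J n z" .
      qed
      have Gm: "?G \<in> borel_measurable borel"
        using \<open>integrable lborel ?G\<close> by auto
      have "(\<lambda>q. ?G (fst q + snd q *\<^sub>R axis k 1)) \<in> borel_measurable (borel \<Otimes>\<^sub>M borel)"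
        unfolding borel_prod
        by (rule measurable_compose[OF borel_measurable_continuous_onI Gm]) (intro continuous_intros)
      then have "(\<lambda>q. ?G (fst q + snd q *\<^sub>R axis k 1)) \<in> borel_measurable (borel \<Otimes>\<^sub>M lborel)"
        by (simp add: measurable_cong_sets[OF sets_pair_measure_cong[OF refl sets_lborel] refl])
      then have "(\<lambda>z. LINT c|lborel. ?G (z + c *\<^sub>R axis k 1)) \<in> borel_measurable borel"
        by (intro lborel.borel_measurable_lebesgue_integral) (simp add: case_prod_beta')
      then show "(\<lambda>z. LINT c|lborel. ?G (z + c *\<^sub>R axis k 1)) \<in> borel_measurable (hyperplane_lborel k)"
        by (simp add: measurable_cong_sets[OF sets_hyperplane_lborel refl])
    qed (rule Jm)
    finally show ?thesis .
  qed
  have limJ: "(\<lambda>n. J n z) \<longlonglongrightarrow> \<zeta> (?g z) * (F (?g z) \<bullet> ?N (?g z))" if z: "z $ k = 0" for z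
  proof -
    have gz: "?g z = z + (s * h z) *\<^sub>R axis k 1" using z by (simp add: graph_point_eq)
    have pg: "(\<lambda>n. p n z \<sigma>) \<longlonglongrightarrow> ?g z" for \<sigma>
    proof -
      have "(\<lambda>n. p n z \<sigma>) \<longlonglongrightarrow> z + (s * (h z - 0 * \<sigma>)) *\<^sub>R axis k 1"
        unfolding p_def by (intro tendsto_intros e0)
      then show ?thesis by (simp add: gz)
    qed
    have lim: "(\<lambda>n. B (p n z \<sigma>) * layer' \<sigma>) \<longlonglongrightarrow> b (?g z) * layer' \<sigma>" for \<sigma>
    \<comment> \<open>For \<open>\<sigma>\<close> at most 1 the density vanishes. Otherwise
      \<open>\<rho>\<close> is positive at \<open>p n z \<sigma>\<close>, so within the chart the
      graph is approached from inside \<open>S\<close>, where \<open>B\<close> equals the continuous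
      function \<open>b\<close>.\<close>
    proof (cases "1 < \<sigma>")
      case False
      then show ?thesis by (simp add: layer'_outside)
    next
      case True
      have "(\<lambda>n. B (p n z \<sigma>)) \<longlonglongrightarrow> b (?g z)"
      proof (cases "?g z \<in> U")
        case U: True
        have ev: "\<forall>\<^sub>F n in sequentially. p n z \<sigma> \<in> U"
          using topological_tendstoD[OF pg local_graphD(1)[OF g] U] .
        have pS: "p n z \<sigma> \<in> S" if "p n z \<sigma> \<in> U" for n
        proof -
          have "\<rho> (p n z \<sigma>) = h z - s * (s * (h z - e n * \<sigma>))"
            using z by (simp add: \<rho>_def p_def local_graphD(3)[OF g])
          also have "\<dots> = e n * \<sigma>" unfolding s2 by simp
          finally have "\<rho> (p n z \<sigma>) = e n * \<sigma>" .
          then show ?thesis using inS[OF that] e[of n] True by simp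
        qed
        have "(\<lambda>n. b (p n z \<sigma>)) \<longlonglongrightarrow> b (?g z)"
          using cb graph_point_frontier(2)[OF g U] pg ev pS closure_subset[of S]
          by (intro continuous_on_tendsto_compose[OF cb pg]) (auto elim!: eventually_mono)
        then show ?thesis
          by (rule Lim_transform_eventually) (use ev pS in \<open>auto simp: B_def elim!: eventually_mono\<close>)
      next
        case False
        then have nK: "?g z \<notin> K" using K(2) by auto
        have "\<forall>\<^sub>F n in sequentially. p n z \<sigma> \<in> - K"
          by (rule topological_tendstoD[OF pg]) (use nK K(1) in \<open>auto intro: compact_imp_closed\<close>)
        then have "\<forall>\<^sub>F n in sequentially. 0 = B (p n z \<sigma>)"
          by eventually_elim (simp add: BK)
        then have "(\<lambda>n. B (p n z \<sigma>)) \<longlonglongrightarrow> 0" by (rule Lim_transform_eventually[OF tendsto_const])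
        then show ?thesis using K(3)[OF nK] by (simp add: b_def)
      qed
      then show ?thesis by (intro tendsto_intros)
    qed
    have "(\<lambda>n. LINT \<sigma>|lborel. B (p n z \<sigma>) * layer' \<sigma>) \<longlonglongrightarrow> (LINT \<sigma>|lborel. b (?g z) * layer' \<sigma>)"
    proof (rule integral_dominated_convergence[where w = "\<lambda>\<sigma>. M * layer' \<sigma>"])
      have lm: "layer' \<in> borel_measurable lborel"
        by (simp add: borel_measurable_continuous_onI[OF continuous_layer'])
      show "(\<lambda>\<sigma>. b (?g z) * layer' \<sigma>) \<in> borel_measurable lborel" using lm by simp
      have "continuous_on UNIV (p n z)" for n unfolding p_def by (intro continuous_intros)
      then have "(\<lambda>\<sigma>. B (p n z \<sigma>)) \<in> borel_measurable borel" for n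
        by (rule measurable_compose[OF borel_measurable_continuous_onI Bm])
      then show "(\<lambda>\<sigma>. B (p n z \<sigma>) * layer' \<sigma>) \<in> borel_measurable lborel" for n
        using lm by (intro borel_measurable_times) simp_all
      show "integrable lborel (\<lambda>\<sigma>. M * layer' \<sigma>)" using layer'_has_integral by simp
      show "AE \<sigma> in lborel. (\<lambda>n. B (p n z \<sigma>) * layer' \<sigma>) \<longlonglongrightarrow> b (?g z) * layer' \<sigma>" using lim by simp
      show "AE \<sigma> in lborel. norm (B (p n z \<sigma>) * layer' \<sigma>) \<le> M * layer' \<sigma>" for n
        using BM layer'_nonneg by (auto simp: abs_mult intro!: AE_I2 mult_right_mono)
    qed
    then show ?thesis by (simp add: J_def layer'_has_integral b_def)
  qed

  obtain r where r: "\<And>x. x \<in> K \<Longrightarrow> norm x \<le> r"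
    using compact_imp_bounded[OF K(1)] unfolding bounded_iff by auto
  have lim2: "(\<lambda>n. LINT z|hyperplane_lborel k. J n z) \<longlonglongrightarrow>
      (LINT z|hyperplane_lborel k. \<zeta> (?g z) * (F (?g z) \<bullet> ?N (?g z)))"
  proof (rule integral_dominated_convergence[where w = "\<lambda>z. M * indicator (cball 0 r) z"])
    have "continuous_on (frontier S) (\<lambda>x. F x \<bullet> ?N x)"
      using F cN by (intro continuous_intros continuous_on_subset[OF F]) (auto simp: frontier_def)
    from continuous_graph_integrand[OF g ch c\<zeta> K this]
    have "(\<lambda>z. \<zeta> (?g z) * (F (?g z) \<bullet> ?N (?g z))) \<in> borel_measurable borel"
      by (rule borel_measurable_continuous_onI)
    then show "(\<lambda>z. \<zeta> (?g z) * (F (?g z) \<bullet> ?N (?g z))) \<in> borel_measurable (hyperplane_lborel k)"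
      by (simp add: measurable_cong_sets[OF sets_hyperplane_lborel refl])
    show "integrable (hyperplane_lborel k) (\<lambda>z. M * indicator (cball 0 r) z)"
      using emeasure_hyperplane_cball[of k r] by auto
    show "AE z in hyperplane_lborel k. (\<lambda>n. J n z) \<longlonglongrightarrow> \<zeta> (?g z) * (F (?g z) \<bullet> ?N (?g z))"
      using AE_hyperplane by eventually_elim (rule limJ)
    show "AE z in hyperplane_lborel k. norm (J n z) \<le> M * indicator (cball 0 r) z" for n
      using AE_hyperplane
    proof eventually_elim
      fix z :: "real^'n" assume z: "z $ k = 0"
      show "norm (J n z) \<le> M * indicator (cball 0 r) z"
      proof (cases "z \<in> cball 0 r")
        case True
        have "norm (J n z) \<le> (LINT \<sigma>|lborel. norm (B (p n z \<sigma>) * layer' \<sigma>))"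
          unfolding J_def by (rule integral_norm_bound)
        also have "\<dots> \<le> (LINT \<sigma>|lborel. M * layer' \<sigma>)"
          using layer'_has_integral(1) BM layer'_nonneg
          by (intro integral_mono') (auto simp: abs_mult M(1) intro!: mult_right_mono)
        finally show ?thesis using True layer'_has_integral by simp
      next
        case False
        have "p n z \<sigma> \<notin> K" for \<sigma>
        proof
          assume "p n z \<sigma> \<in> K"
          then have "norm (p n z \<sigma>) \<le> r" using r by auto
          moreover have "norm z \<le> norm (p n z \<sigma>)" unfolding p_def by (rule norm_graph_point[OF z])
          ultimately show False using False by simp
        qed
        then show ?thesis using False by (simp add: J_def BK)
      qed
    qed
  qed (rule Jm)
  have "(\<lambda>n. LINT z|hyperplane_lborel k. J n z) \<longlonglongrightarrow> (LINT x:S|lborel. a x)"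
    using lim1 unfolding test fubini .
  with lim2 show ?thesis unfolding a_def using LIMSEQ_unique by blast
qed


lemma set_integral_sum_list:
  fixes f :: "'a \<Rightarrow> real^'n \<Rightarrow> real"
  assumes "\<And>p. p \<in> set ps \<Longrightarrow> set_integrable lborel S (f p)"
  shows "(LINT x:S|lborel. (\<Sum>p\<leftarrow>ps. f p x)) = (\<Sum>p\<leftarrow>ps. LINT x:S|lborel. f p x)"
    and "set_integrable lborel S (\<lambda>x. \<Sum>p\<leftarrow>ps. f p x)"
proof -
  have "(LINT x:S|lborel. (\<Sum>p\<leftarrow>ps. f p x)) = (\<Sum>p\<leftarrow>ps. LINT x:S|lborel. f p x) \<and>
    set_integrable lborel S (\<lambda>x. \<Sum>p\<leftarrow>ps. f p x)"
    using assms by (induction ps) (auto simp: set_lebesgue_integral_def set_integrable_def distrib_left)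
  then show "(LINT x:S|lborel. (\<Sum>p\<leftarrow>ps. f p x)) = (\<Sum>p\<leftarrow>ps. LINT x:S|lborel. f p x)"
    and "set_integrable lborel S (\<lambda>x. \<Sum>p\<leftarrow>ps. f p x)" by auto
qed

lemma boundary_atlasD:
  assumes "boundary_atlas S ps" "(U, k, s, h, \<zeta>) \<in> set ps"
  shows "local_graph S U k s h" "C1_closure UNIV h" "C1_closure UNIV \<zeta>" "0 \<le> \<zeta> x"
    and "\<exists>K. compact K \<and> K \<subseteq> U \<and> (\<forall>x. x \<notin> K \<longrightarrow> \<zeta> x = 0)"
  using assms by (auto simp: boundary_atlas_def)

lemma boundary_atlas_sum:
  assumes "boundary_atlas S ps" "x \<in> frontier S"
  shows "(\<Sum>(U, k, s, h, \<zeta>)\<leftarrow>ps. \<zeta> x) = 1"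
  using assms by (auto simp: boundary_atlas_def)

text \<open>The atlas is an argument, since the divergence theorem is proved for an arbitrary atlas
  and then specialised to the chosen one. The surface element and the normalisation of the normal
  have already cancelled.\<close>

definition flux :: "'n patch list \<Rightarrow> (real^'n \<Rightarrow> real^'n) \<Rightarrow> real" where
  "flux ps F = (\<Sum>(U, k, s, h, \<zeta>)\<leftarrow>ps. LINT z|hyperplane_lborel k. \<zeta> (graph_point k s h z) *
       (F (graph_point k s h z) \<bullet> patch_normal k s h (graph_point k s h z)))"

text \<open>Near the frontier the cutoffs sum to 1, so the remainder, cut off to \<open>S\<close>,
  is a test function. Testing with it expresses the integral of \<open>f\<close> as a sum over the
  patches of the terms evaluated by \<open>patch_flux\<close>.\<close>

theorem weak_divergence_theorem:
  fixes F :: "real^'n \<Rightarrow> real^'n"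
  assumes S: "bounded S" "open S" and atlas: "boundary_atlas S ps"
    and F: "continuous_on (closure S) F" and f: "continuous_on (closure S) f"
    and weak: "has_weak_div S F f"
  shows "(LINT x:S|lborel. f x) = flux ps F"
proof -
  define z where "z p = snd (snd (snd (snd p)))" for p :: "'n patch"
  have z: "z (U, k, s, h, \<zeta>) = \<zeta>" for U k s h \<zeta> by (simp add: z_def)
  have zp: "has_partials UNIV (z p) (\<lambda>i. partial UNIV i (z p))" if "p \<in> set ps" for p
    using boundary_atlasD(3)[OF atlas] that by (cases p) (auto simp: z intro: has_partials_partial)
  obtain V where V: "open V" "frontier S \<subseteq> V" "\<And>x. x \<in> V \<Longrightarrow> (\<Sum>p\<leftarrow>ps. z p x) = 1"
  proof -
    have "(\<Sum>(U, k, s, h, \<zeta>)\<leftarrow>ps. \<zeta> x) = (\<Sum>p\<leftarrow>ps. z p x)" for x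
      by (rule arg_cong[where f = sum_list], rule map_cong) (auto simp: z)
    then show thesis using atlas that unfolding boundary_atlas_def by auto
  qed
  let ?a = "\<lambda>p x. F x \<bullet> grad UNIV (z p) x + f x * z p x"
  have ca: "continuous_on (closure S) (?a p)" if "p \<in> set ps" for p
    using has_partialsD(2)[OF zp[OF that]]
      continuous_on_grad[OF has_partials_C1_closure[OF zp[OF that] open_UNIV]]
    by (intro continuous_intros F f) (auto intro: continuous_on_subset)
  define \<phi> where "\<phi> x = (if x \<in> S then 1 - (\<Sum>p\<leftarrow>ps. z p x) else 0)" for x
  let ?D = "\<lambda>i x. 0 - (\<Sum>p\<leftarrow>ps. partial UNIV i (z p) x)"
  have p1: "has_partials UNIV (\<lambda>x. 1 - (\<Sum>p\<leftarrow>ps. z p x)) ?D"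
    by (intro has_partials_diff has_partials_const has_partials_sum_list zp)
  \<comment> \<open>Compact, and inside the open set \<open>S\<close> because \<open>V\<close>
    contains the frontier; off it the remainder vanishes on \<open>S\<close>.\<close>
  let ?K = "closure S - V"
  have K: "compact ?K" "?K \<subseteq> S"
    using S V(1,2) by (auto simp: compact_diff frontier_def interior_open)
  have ext: "has_partials UNIV \<phi> (\<lambda>i x. if x \<in> S then ?D i x else 0)"
    unfolding \<phi>_def
    by (rule has_partials_extend_zero[OF S(2) compact_imp_closed[OF K(1)] K(2)])
       (use has_partialsD[OF p1] V(3) subsetD[OF closure_subset[of S]] in \<open>auto intro: continuous_on_subset\<close>)
  have "test_function S \<phi>"
    unfolding test_function_def using K V(3) has_partials_C1_closure[OF ext] closure_subset[of S]
    by (intro conjI exI[of _ ?K]) (auto simp: \<phi>_def)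
  with weak have "0 = (LINT x:S|lborel. F x \<bullet> grad UNIV \<phi> x + f x * \<phi> x)"
    by (simp add: has_weak_div_def)
  also have "\<dots> = (LINT x:S|lborel. f x - (\<Sum>p\<leftarrow>ps. ?a p x))"
  proof (rule set_lebesgue_integral_cong)
    show "\<forall>x. x \<in> S \<longrightarrow> F x \<bullet> grad UNIV \<phi> x + f x * \<phi> x = f x - (\<Sum>p\<leftarrow>ps. ?a p x)"
    proof (intro allI impI)
      fix x assume x: "x \<in> S"
      have "grad UNIV \<phi> x = - (\<Sum>p\<leftarrow>ps. grad UNIV (z p) x)"
      proof -
        have "(\<Sum>p\<leftarrow>ps. grad UNIV (z p) x) $ i = (\<Sum>p\<leftarrow>ps. partial UNIV i (z p) x)" for i
          by (induction ps) (auto simp: grad_def)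
        then show ?thesis using x by (simp add: grad_eq[OF ext] vec_eq_iff)
      qed
      moreover have "F x \<bullet> (\<Sum>p\<leftarrow>ps. grad UNIV (z p) x) = (\<Sum>p\<leftarrow>ps. F x \<bullet> grad UNIV (z p) x)"
        by (induction ps) (auto simp: inner_add_right)
      ultimately show "F x \<bullet> grad UNIV \<phi> x + f x * \<phi> x = f x - (\<Sum>p\<leftarrow>ps. ?a p x)"
        using x by (simp add: \<phi>_def sum_list_addf sum_list_const_mult algebra_simps)
    qed
  qed (use S in auto)
  also have "\<dots> = (LINT x:S|lborel. f x) - (\<Sum>p\<leftarrow>ps. LINT x:S|lborel. ?a p x)"
    using set_integral_sum_list[of ps S ?a] set_integrable_continuous[OF S ca]
    by (subst set_integral_diff) (auto intro: set_integrable_continuous S f)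
  finally have "(LINT x:S|lborel. f x) = (\<Sum>p\<leftarrow>ps. LINT x:S|lborel. ?a p x)" by simp
  also have "\<dots> = flux ps F"
    unfolding flux_def
  proof (rule arg_cong[where f = sum_list], rule map_cong[OF refl])
    fix p assume p: "p \<in> set ps"
    obtain U k s h \<zeta> where P: "p = (U, k, s, h, \<zeta>)" by (cases p)
    note A = boundary_atlasD[OF atlas p[unfolded P]]
    from A(5) obtain K where "compact K" "K \<subseteq> U" "\<And>x. x \<notin> K \<Longrightarrow> \<zeta> x = 0" by auto
    from patch_flux[OF S F f weak A(1-3) this]
    show "(LINT x:S|lborel. ?a p x) = (case p of (U, k, s, h, \<zeta>) \<Rightarrow>
      LINT z|hyperplane_lborel k. \<zeta> (graph_point k s h z) *
       (F (graph_point k s h z) \<bullet> patch_normal k s h (graph_point k s h z)))"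
      by (simp add: P z)
  qed
  finally show ?thesis .
qed

section \<open>Domains with a boundary atlas\<close>

text \<open>The point is uniqueness: if \<open>m\<close> is another candidate, no direction can both
  enter and leave, so \<open>d \<bullet> n < 0\<close> forces \<open>d \<bullet> m \<le> 0\<close>.
  Directions close to the part of \<open>m\<close> orthogonal to \<open>n\<close> then show
  \<open>m \<bullet> n = 1\<close>.\<close>

lemma outer_normal_eqI:
  assumes n: "norm n = 1"
    and i: "\<And>d. d \<bullet> n < 0 \<Longrightarrow> \<forall>\<^sub>F s in at_right 0. x + s *\<^sub>R d \<in> \<Omega>"
    and o: "\<And>d. d \<bullet> n > 0 \<Longrightarrow> \<forall>\<^sub>F s in at_right 0. x + s *\<^sub>R d \<notin> closure \<Omega>"
  shows "outer_normal \<Omega> x = n"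
  unfolding outer_normal_def
proof (rule the_equality, intro conjI allI impI n)
  show "\<forall>\<^sub>F s in at_right 0. x + s *\<^sub>R d \<in> \<Omega>" if "d \<bullet> n < 0" for d by (rule i[OF that])
  show "\<forall>\<^sub>F s in at_right 0. x + s *\<^sub>R d \<notin> closure \<Omega>" if "0 < d \<bullet> n" for d by (rule o[OF that])
  fix m assume m: "norm m = 1 \<and>
      (\<forall>d. d \<bullet> m < 0 \<longrightarrow> (\<forall>\<^sub>F s in at_right 0. x + s *\<^sub>R d \<in> \<Omega>)) \<and>
      (\<forall>d. 0 < d \<bullet> m \<longrightarrow> (\<forall>\<^sub>F s in at_right 0. x + s *\<^sub>R d \<notin> closure \<Omega>))"
  have neg: "d \<bullet> m \<le> 0" if "d \<bullet> n < 0" for d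
  proof (rule ccontr)
    assume "\<not> d \<bullet> m \<le> 0"
    then have "\<forall>\<^sub>F s in at_right 0. x + s *\<^sub>R d \<notin> closure \<Omega>" using m by auto
    with i[OF that] have "\<forall>\<^sub>F s in at_right (0::real). False"
      by eventually_elim (use closure_subset in blast)
    then show False by simp
  qed
  define c where "c = m \<bullet> n"
  have mm: "m \<bullet> m = 1" and nn: "n \<bullet> n = 1"
    using m n by (simp_all add: dot_square_norm)
  \<comment> \<open>The test direction is the component of \<open>m\<close> orthogonal to
    \<open>n\<close>, tilted inwards by \<open>\<delta>\<close>; letting \<open>\<delta>\<close>
    tend to 0 yields \<open>1 - c\<^sup>2 \<le> 0\<close>.\<close>
  have ineq: "1 - c\<^sup>2 \<le> \<delta> * c" if "0 < \<delta>" for \<delta>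
  proof -
    have "(m - c *\<^sub>R n - \<delta> *\<^sub>R n) \<bullet> n < 0"
      using that nn by (simp add: inner_diff_left c_def)
    from neg[OF this] show ?thesis
      by (simp add: inner_diff_left mm c_def inner_commute[of n m] power2_eq_square)
  qed
  have "c\<^sup>2 \<le> 1"
    using Cauchy_Schwarz_ineq[of m n] by (simp add: mm nn c_def)
  moreover have "0 \<le> c" using ineq[of 1] \<open>c\<^sup>2 \<le> 1\<close> by simp
  moreover have "1 - c\<^sup>2 \<le> 0"
  proof (rule field_le_epsilon)
    fix e :: real assume e: "0 < e"
    have "c \<le> 1" using \<open>c\<^sup>2 \<le> 1\<close> by (simp add: abs_square_le_1 abs_le_iff)
    then have "e * c \<le> e" using e by simp
    then show "1 - c\<^sup>2 \<le> 0 + e" using ineq[OF e] by simp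
  qed
  ultimately have "c = 1" by (simp add: power2_eq_1_iff)
  then have "(norm (m - n))\<^sup>2 = 0"
    using mm nn by (simp add: power2_norm_eq_inner inner_diff_left inner_diff_right inner_commute c_def)
  then show "m = n" by simp
qed

lemma norm_patch_normal:
  assumes g: "local_graph \<Omega> U k s h" and h: "C1_closure UNIV h"
  shows "norm (patch_normal k s h x) = sqrt (1 + (norm (grad UNIV h x))\<^sup>2)"
    and "0 < norm (patch_normal k s h x)"
proof -
  have "axis k 1 \<bullet> grad UNIV h x = 0"
    by (simp add: inner_axis' grad_def partial_graph_axis[OF g h])
  then have "patch_normal k s h x \<bullet> patch_normal k s h x = 1 + grad UNIV h x \<bullet> grad UNIV h x"
    using local_graphD(2)[OF g]
    by (simp add: patch_normal_def inner_diff_left inner_diff_right inner_axis_axis inner_commute)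
  then show 1: "norm (patch_normal k s h x) = sqrt (1 + (norm (grad UNIV h x))\<^sup>2)"
    by (simp add: norm_eq_sqrt_inner power2_norm_eq_inner)
  show "0 < norm (patch_normal k s h x)" unfolding 1
    by (simp add: add_pos_nonneg)
qed

text \<open>The derivative of \<open>\<rho>\<close> along \<open>d\<close> is
  \<open>- (d \<bullet> ?N)\<close>, and inside \<open>U\<close> the sign of \<open>\<rho>\<close>
  decides between domain and exterior. Exclusion from the closure uses that the closure of an open
  set consists of the set and its frontier.\<close>

lemma outer_normal_patch:
  assumes g: "local_graph \<Omega> U k s h" and h: "C1_closure UNIV h"
    and "open \<Omega>" and x: "x \<in> U" "x \<in> frontier \<Omega>"
  shows "outer_normal \<Omega> x = patch_normal k s h x /\<^sub>R norm (patch_normal k s h x)"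
proof (rule outer_normal_eqI)
  let ?N = "patch_normal k s h x"
  define \<rho> where "\<rho> x = h x - s * x $ k" for x
  have Npos: "0 < norm ?N" by (rule norm_patch_normal(2)[OF g h])
  show "norm (?N /\<^sub>R norm ?N) = 1" using Npos by simp
  have \<rho>0: "\<rho> x = 0" using local_graphD(5)[OF g x(1)] x(2) by (simp add: \<rho>_def)
  have der: "((\<lambda>t. \<rho> (x + t *\<^sub>R d)) has_real_derivative - (d \<bullet> ?N)) (at 0)" for d
    using has_partials_along[OF has_partials_graph_distance[OF h, of s k], of x 0 d]
    by (simp add: \<rho>_def has_real_derivative_iff_has_vector_derivative inner_vec_def sum_negf)
  have inU: "\<forall>\<^sub>F t in at_right 0. x + t *\<^sub>R d \<in> U" for d
  proof -
    have "((\<lambda>t. x + t *\<^sub>R d) \<longlongrightarrow> x + 0 *\<^sub>R d) (at_right 0)" by (intro tendsto_intros)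
    then show ?thesis by (rule topological_tendstoD) (use local_graphD(1)[OF g] x in auto)
  qed
  show "\<forall>\<^sub>F t in at_right 0. x + t *\<^sub>R d \<in> \<Omega>" if "d \<bullet> (?N /\<^sub>R norm ?N) < 0" for d
  proof -
    have "d \<bullet> ?N < 0" using that Npos by (simp add: mult_less_0_iff)
    then obtain \<delta> where \<delta>: "0 < \<delta>" "\<And>t. 0 < t \<Longrightarrow> t < \<delta> \<Longrightarrow> \<rho> (x + 0 *\<^sub>R d) < \<rho> (x + (0 + t) *\<^sub>R d)"
      using DERIV_pos_inc_right[OF der, of d] by auto
    have "\<forall>\<^sub>F t in at_right 0. 0 < \<rho> (x + t *\<^sub>R d)"
      unfolding eventually_at_right_field using \<delta> \<rho>0 by (intro exI[of _ \<delta>]) auto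
    with inU[of d] show ?thesis
      by eventually_elim (use local_graphD(4)[OF g] in \<open>simp add: \<rho>_def\<close>)
  qed
  show "\<forall>\<^sub>F t in at_right 0. x + t *\<^sub>R d \<notin> closure \<Omega>" if "d \<bullet> (?N /\<^sub>R norm ?N) > 0" for d
  proof -
    have "- (d \<bullet> ?N) < 0" using that Npos by (simp add: zero_less_mult_iff)
    then obtain \<delta> where \<delta>: "0 < \<delta>" "\<And>t. 0 < t \<Longrightarrow> t < \<delta> \<Longrightarrow> \<rho> (x + (0 + t) *\<^sub>R d) < \<rho> (x + 0 *\<^sub>R d)"
      using DERIV_neg_dec_right[OF der, of d] by auto
    have "\<forall>\<^sub>F t in at_right 0. \<rho> (x + t *\<^sub>R d) < 0"
      unfolding eventually_at_right_field using \<delta> \<rho>0 by (intro exI[of _ \<delta>]) auto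
    with inU[of d] show ?thesis
    proof eventually_elim
      case (elim t)
      then have "x + t *\<^sub>R d \<notin> \<Omega>" "x + t *\<^sub>R d \<notin> frontier \<Omega>"
        using local_graphD(4,5)[OF g elim(1)] by (auto simp: \<rho>_def)
      then show ?case using \<open>open \<Omega>\<close> by (simp add: frontier_def interior_open)
    qed
  qed
qed

section \<open>Differentiation under the integral sign\<close>

lemma DERIV_integral_dominated:
  fixes f :: "real \<Rightarrow> 'a \<Rightarrow> real"
  assumes \<delta>: "0 < \<delta>" and f: "\<And>s. \<bar>s - t\<bar> < \<delta> \<Longrightarrow> integrable M (f s)" and w: "integrable M w"
    and m: "f' t \<in> borel_measurable M"
    and d: "AE x in M. \<forall>s. \<bar>s - t\<bar> < \<delta> \<longrightarrow> ((\<lambda>s. f s x) has_real_derivative f' s x) (at s) \<and> \<bar>f' s x\<bar> \<le> w x"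
  shows "((\<lambda>s. LINT x|M. f s x) has_real_derivative (LINT x|M. f' t x)) (at t)"
proof -
  let ?q = "\<lambda>r x. (f (t + r) x - f t x) / r"
  \<comment> \<open>Restricting the filter to \<open>{-\<delta><..<\<delta>}\<close> puts every
    member of an approximating sequence into the range where the integrands are integrable and
    dominated; the restriction is dropped afterwards because the interval is open.\<close>
  have "((\<lambda>r. LINT x|M. ?q r x) \<longlongrightarrow> (LINT x|M. f' t x)) (at 0 within {-\<delta><..<\<delta>})"
    unfolding tendsto_at_iff_sequentially
  proof (intro allI impI)
    fix X :: "nat \<Rightarrow> real" assume X: "\<forall>i. X i \<in> {-\<delta><..<\<delta>} - {0}" "X \<longlonglongrightarrow> 0"
    show "((\<lambda>r. LINT x|M. ?q r x) \<circ> X) \<longlonglongrightarrow> (LINT x|M. f' t x)"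
      unfolding comp_def
    proof (rule integral_dominated_convergence[OF m _ w])
      show "?q (X n) \<in> borel_measurable M" for n
      proof -
        have "integrable M (f (t + X n))" "integrable M (f t)"
          using f[of "t + X n"] f[of t] X(1) \<delta> by (auto simp: abs_less_iff minus_less_iff)
        then show ?thesis by simp
      qed
      show "AE x in M. (\<lambda>n. ?q (X n) x) \<longlonglongrightarrow> f' t x"
        using d
      proof eventually_elim
        case (elim x)
        then have "((\<lambda>r. ?q r x) \<longlongrightarrow> f' t x) (at 0)" using \<delta> by (auto simp: DERIV_def)
        moreover have "filterlim X (at 0) sequentially" using X by (auto simp: filterlim_at)
        ultimately show ?case by (rule filterlim_compose)
      qed
      show "AE x in M. norm (?q (X n) x) \<le> w x" for n
        using d
      proof eventually_elim
        case (elim x)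
        have Xn: "\<bar>X n\<bar> < \<delta>" "X n \<noteq> 0" using X(1) by (auto simp: abs_less_iff minus_less_iff)
        have "norm (f (t + X n) x - f t x) \<le> w x * norm (t + X n - t)"
        proof (rule field_differentiable_bound[where S = "ball t \<delta>"])
          show "((\<lambda>s. f s x) has_field_derivative f' s x) (at s within ball t \<delta>)" if "s \<in> ball t \<delta>" for s
            using elim that by (auto simp: dist_real_def abs_minus_commute intro: has_field_derivative_at_within)
          show "norm (f' s x) \<le> w x" if "s \<in> ball t \<delta>" for s
            using elim that by (auto simp: dist_real_def abs_minus_commute)
        qed (use Xn \<delta> in \<open>auto simp: dist_real_def\<close>)
        then show ?case using Xn by (simp add: abs_div divide_le_eq)
      qed
    qed
  qed
  then have "((\<lambda>r. LINT x|M. ?q r x) \<longlongrightarrow> (LINT x|M. f' t x)) (at 0)"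
    using \<delta> by (simp add: at_within_open_NO_MATCH)
  moreover have "\<forall>\<^sub>F r in at 0. (LINT x|M. ?q r x) = ((LINT x|M. f (t + r) x) - (LINT x|M. f t x)) / r"
    unfolding eventually_at
  proof (intro exI[of _ \<delta>] conjI ballI impI)
    fix r :: real assume r: "r \<noteq> 0 \<and> dist r 0 < \<delta>"
    then have "integrable M (f (t + r))" "integrable M (f t)" using f \<delta> by auto
    then show "(LINT x|M. ?q r x) = ((LINT x|M. f (t + r) x) - (LINT x|M. f t x)) / r" by simp
  qed (rule \<delta>)
  ultimately have "((\<lambda>r. ((LINT x|M. f (t + r) x) - (LINT x|M. f t x)) / r) \<longlongrightarrow> (LINT x|M. f' t x)) (at 0)"
    by (rule Lim_transform_eventually)
  then show ?thesis by (simp add: DERIV_def)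
qed

lemma continuous_on_slice:
  assumes "continuous_on (I \<times> K) (\<lambda>(t, x). f t x)" "t \<in> I"
  shows "continuous_on K (f t)"
proof -
  have "continuous_on K (\<lambda>x. (\<lambda>(t, x). f t x) (t, x))"
    by (rule continuous_on_compose2[OF assms(1)]) (use assms(2) in \<open>auto intro!: continuous_intros\<close>)
  then show ?thesis by simp
qed

text \<open>Half the distance from \<open>t\<close> to the endpoints keeps a closed interval around
  \<open>t\<close> inside the open one, so that compactness yields a bound. It supplies the
  dominating functions for integrals over the domain and over its frontier.\<close>

lemma bounded_near:
  fixes f :: "real \<Rightarrow> 'a::metric_space \<Rightarrow> real"
  assumes c: "continuous_on ({-a<..<a} \<times> K) (\<lambda>(t, x). f t x)" and "compact K" and t: "\<bar>t\<bar> < a"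
  obtains \<delta> M where "0 < \<delta>" "0 \<le> M" "\<And>s. \<bar>s - t\<bar> < \<delta> \<Longrightarrow> \<bar>s\<bar> < a"
    "\<And>s x. \<bar>s - t\<bar> < \<delta> \<Longrightarrow> x \<in> K \<Longrightarrow> \<bar>f s x\<bar> \<le> M"
proof -
  define \<delta> where "\<delta> = (a - \<bar>t\<bar>) / 2"
  have \<delta>: "0 < \<delta>" "\<And>s. \<bar>s - t\<bar> \<le> \<delta> \<Longrightarrow> \<bar>s\<bar> < a"
  proof -
    show "0 < \<delta>" using t by (simp add: \<delta>_def)
    show "\<bar>s\<bar> < a" if "\<bar>s - t\<bar> \<le> \<delta>" for s
    proof -
      have "\<bar>s\<bar> \<le> \<bar>s - t\<bar> + \<bar>t\<bar>" by simp
      then show ?thesis using that t by (simp add: \<delta>_def field_simps)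
    qed
  qed
  have "compact ({t - \<delta>..t + \<delta>} \<times> K)" using \<open>compact K\<close> by (intro compact_Times) auto
  moreover have "continuous_on ({t - \<delta>..t + \<delta>} \<times> K) (\<lambda>(t, x). f t x)"
  proof (rule continuous_on_subset[OF c])
    show "{t - \<delta>..t + \<delta>} \<times> K \<subseteq> {- a<..<a} \<times> K"
    proof
      fix p assume p: "p \<in> {t - \<delta>..t + \<delta>} \<times> K"
      then have "\<bar>fst p\<bar> < a" by (intro \<delta>) auto
      then show "p \<in> {- a<..<a} \<times> K" using p by auto
    qed
  qed
  ultimately have "bounded ((\<lambda>(t, x). f t x) ` ({t - \<delta>..t + \<delta>} \<times> K))"
    using compact_continuous_image compact_imp_bounded by blast
  then obtain M where M: "\<And>p. p \<in> {t - \<delta>..t + \<delta>} \<times> K \<Longrightarrow> norm ((\<lambda>(t, x). f t x) p) \<le> M"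
    by (auto simp: bounded_iff)
  show thesis
  proof (rule that[of \<delta> "max 0 M"])
    show "\<bar>f s x\<bar> \<le> max 0 M" if "\<bar>s - t\<bar> < \<delta>" "x \<in> K" for s x
    proof -
      have "(s, x) \<in> {t - \<delta>..t + \<delta>} \<times> K" using that by auto
      from M[OF this] show ?thesis by simp
    qed
  qed (use \<delta> in auto)
qed

text \<open>Charts of class C^1 are all that is asked for, since this is what the image of a domain
  is shown to have; charts of class C^2 are requested separately where they are used.\<close>

locale regular_domain =
  fixes \<Omega> :: "(real^'n) set"
  assumes bounded_domain: "bounded \<Omega>" and open_domain: "open \<Omega>"
    and ex_atlas: "\<exists>ps. boundary_atlas \<Omega> ps"
begin

definition atlas where "atlas = (SOME ps. boundary_atlas \<Omega> ps)"

lemma atlas: "boundary_atlas \<Omega> atlas"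
  unfolding atlas_def using someI_ex[OF ex_atlas] .

lemma compact_frontier: "compact (frontier \<Omega>)" and compact_cl: "compact (closure \<Omega>)"
  and frontier_subset: "frontier \<Omega> \<subseteq> closure \<Omega>"
  using bounded_domain by (simp_all add: compact_frontier_bounded compact_closure) (simp add: frontier_def)

lemma surface_integral_eq:
  "surface_integral \<Omega> f = (\<Sum>(U, k, s, h, \<zeta>)\<leftarrow>atlas. graph_integral k s h (\<lambda>x. \<zeta> x * f x))"
  by (simp add: surface_integral_def atlas_def)

text \<open>A graph point outside the chart domain may lie off the frontier, but there the cutoff
  vanishes, so only frontier values of the integrand count.\<close>

lemma surface_integral_cong:
  assumes "\<And>x. x \<in> frontier \<Omega> \<Longrightarrow> f x = g x"
  shows "surface_integral \<Omega> f = surface_integral \<Omega> g"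
  unfolding surface_integral_eq
proof (rule arg_cong[where f = sum_list], rule map_cong[OF refl])
  fix p assume p: "p \<in> set atlas"
  obtain U k s h \<zeta> where P: "p = (U, k, s, h, \<zeta>)" by (cases p)
  note A = boundary_atlasD[OF atlas p[unfolded P]]
  from A(5) obtain K where K: "K \<subseteq> U" "\<And>x. x \<notin> K \<Longrightarrow> \<zeta> x = 0" by auto
  have "\<zeta> (graph_point k s h z) * f (graph_point k s h z) = \<zeta> (graph_point k s h z) * g (graph_point k s h z)" for z
    using K assms graph_point_frontier(1)[OF A(1)] by (cases "graph_point k s h z \<in> U") auto
  then show "(case p of (U, k, s, h, \<zeta>) \<Rightarrow> graph_integral k s h (\<lambda>x. \<zeta> x * f x)) =
      (case p of (U, k, s, h, \<zeta>) \<Rightarrow> graph_integral k s h (\<lambda>x. \<zeta> x * g x))"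
    by (simp only: P prod.case graph_integral_def)
qed

text \<open>The surface element is the length of \<open>patch_normal\<close> and cancels its
  normalisation. This links \<open>surface_integral\<close> to \<open>flux\<close>, and with it to
  volume integrals.\<close>

lemma surface_integral_flux:
  "surface_integral \<Omega> (\<lambda>x. F x \<bullet> outer_normal \<Omega> x) = flux atlas F"
  unfolding surface_integral_eq flux_def
proof (rule arg_cong[where f = sum_list], rule map_cong[OF refl])
  fix p assume p: "p \<in> set atlas"
  obtain U k s h \<zeta> where P: "p = (U, k, s, h, \<zeta>)" by (cases p)
  note A = boundary_atlasD[OF atlas p[unfolded P]]
  from A(5) obtain K where K: "K \<subseteq> U" "\<And>x. x \<notin> K \<Longrightarrow> \<zeta> x = 0" by auto
  let ?g = "graph_point k s h" and ?N = "patch_normal k s h"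
  have "\<zeta> (?g z) * (F (?g z) \<bullet> outer_normal \<Omega> (?g z)) * sqrt (1 + (norm (grad UNIV h z))\<^sup>2) =
      \<zeta> (?g z) * (F (?g z) \<bullet> ?N (?g z))" for z
  proof (cases "?g z \<in> U")
    case True
    have "norm (?N (?g z)) = sqrt (1 + (norm (grad UNIV h z))\<^sup>2)"
      using norm_patch_normal(1)[OF A(1,2), of z] patch_normal_graph_point[OF A(1,2), of z] by simp
    moreover have "outer_normal \<Omega> (?g z) = ?N (?g z) /\<^sub>R norm (?N (?g z))"
      by (rule outer_normal_patch[OF A(1,2) open_domain True graph_point_frontier(1)[OF A(1) True]])
    ultimately show ?thesis using norm_patch_normal(2)[OF A(1,2), of "?g z"] by simp
  next
    case False
    then have "\<zeta> (?g z) = 0" using K by auto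
    then show ?thesis by simp
  qed
  then show "(case p of (U, k, s, h, \<zeta>) \<Rightarrow> graph_integral k s h (\<lambda>x. \<zeta> x * (F x \<bullet> outer_normal \<Omega> x))) =
     (case p of (U, k, s, h, \<zeta>) \<Rightarrow> LINT z|hyperplane_lborel k. \<zeta> (graph_point k s h z) *
       (F (graph_point k s h z) \<bullet> patch_normal k s h (graph_point k s h z)))"
    by (simp only: P prod.case graph_integral_def)
qed

theorem divergence_theorem:
  assumes "continuous_on (closure \<Omega>) F" "continuous_on (closure \<Omega>) f" "has_weak_div \<Omega> F f"
  shows "(LINT x:\<Omega>|lborel. f x) = surface_integral \<Omega> (\<lambda>x. F x \<bullet> outer_normal \<Omega> x)"
  unfolding surface_integral_flux
  by (rule weak_divergence_theorem[OF bounded_domain open_domain atlas assms])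

text \<open>Cutoff times surface element is a bounded weight with bounded support on the hyperplane,
  the form in which the chart enters dominated convergence.\<close>

lemma patch_weight:
  assumes p: "(U, k, s, h, \<zeta>) \<in> set atlas"
  obtains r C where "0 \<le> C"
    "\<And>f. continuous_on (frontier \<Omega>) f \<Longrightarrow> integrable (hyperplane_lborel k)
        (\<lambda>z. \<zeta> (graph_point k s h z) * f (graph_point k s h z) * sqrt (1 + (norm (grad UNIV h z))\<^sup>2))"
    "\<And>z. z $ k = 0 \<Longrightarrow> \<zeta> (graph_point k s h z) \<noteq> 0 \<Longrightarrow> norm z \<le> r"
    "\<And>z. z $ k = 0 \<Longrightarrow> \<bar>\<zeta> (graph_point k s h z) * sqrt (1 + (norm (grad UNIV h z))\<^sup>2)\<bar> \<le> C"
    "\<And>z. \<zeta> (graph_point k s h z) \<noteq> 0 \<Longrightarrow> graph_point k s h z \<in> frontier \<Omega>"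
proof -
  let ?g = "graph_point k s h"
  let ?w = "\<lambda>f z. \<zeta> (?g z) * f (?g z) * sqrt (1 + (norm (grad UNIV h z))\<^sup>2)"
  note A = boundary_atlasD[OF atlas p]
  from A(5) obtain K where K: "compact K" "K \<subseteq> U" "\<And>x. x \<notin> K \<Longrightarrow> \<zeta> x = 0" by auto
  obtain r where r: "\<And>x. x \<in> K \<Longrightarrow> norm x \<le> r"
    using compact_imp_bounded[OF K(1)] unfolding bounded_iff by auto
  have supp: "norm z \<le> r" if "z $ k = 0" "\<zeta> (?g z) \<noteq> 0" for z
  proof -
    have "norm (?g z) \<le> r" using K(3) r that by blast
    moreover have "norm z \<le> norm (?g z)" unfolding graph_point_eq by (rule norm_graph_point[OF that(1)])
    ultimately show ?thesis by linarith
  qed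
  have cont: "continuous_on UNIV (?w f)" if f: "continuous_on (frontier \<Omega>) f" for f
    using has_partialsD(2)[OF has_partials_partial[OF A(2)]] has_partialsD(2)[OF has_partials_partial[OF A(3)]]
      continuous_on_grad[OF A(2)]
    by (intro continuous_on_mult continuous_on_real_sqrt continuous_on_add continuous_on_const
        continuous_on_power continuous_on_norm continuous_graph_integrand[OF A(1) _ _ K f]) auto
  have bd: "\<exists>B\<ge>0. \<forall>z. z $ k = 0 \<longrightarrow> \<bar>?w f z\<bar> \<le> B" if f: "continuous_on (frontier \<Omega>) f" for f
  proof -
    have "bounded (?w f ` cball 0 r)"
      by (intro compact_imp_bounded compact_continuous_image continuous_on_subset[OF cont[OF f]]) auto
    then obtain B where "\<forall>v\<in>?w f ` cball 0 r. norm v \<le> B" unfolding bounded_iff by blast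
    then have B: "\<And>z. z \<in> cball 0 r \<Longrightarrow> \<bar>?w f z\<bar> \<le> B" by auto
    have "\<bar>?w f z\<bar> \<le> max 0 B" if z: "z $ k = 0" for z
    proof (cases "\<zeta> (?g z) = 0")
      case False
      from B[of z] supp[OF z False] show ?thesis by simp
    qed simp
    then show ?thesis by (intro exI[of _ "max 0 B"]) auto
  qed
  obtain C where C: "0 \<le> C" "\<And>z. z $ k = 0 \<Longrightarrow> \<bar>?w (\<lambda>_. 1) z\<bar> \<le> C"
    using bd[OF continuous_on_const] by blast
  show thesis
  proof (rule that[of C r])
    show "integrable (hyperplane_lborel k) (?w f)" if f: "continuous_on (frontier \<Omega>) f" for f
    proof -
      obtain B where B: "\<And>z. z $ k = 0 \<Longrightarrow> \<bar>?w f z\<bar> \<le> B" using bd[OF f] by blast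
      have "?w f z = 0" if "z $ k = 0" "r < norm z" for z
        using supp[OF that(1)] that(2) by (cases "\<zeta> (?g z) = 0") auto
      with B show ?thesis
        by (rule integrable_hyperplane[OF borel_measurable_continuous_onI[OF cont[OF f]], of k B r])
    qed
    show "?g z \<in> frontier \<Omega>" if "\<zeta> (?g z) \<noteq> 0" for z
      using K that graph_point_frontier(1)[OF A(1)] by blast
  qed (use C supp in auto)
qed

lemma patch_integrable:
  assumes p: "(U, k, s, h, \<zeta>) \<in> set atlas" and f: "continuous_on (frontier \<Omega>) f"
  shows "integrable (hyperplane_lborel k)
      (\<lambda>z. \<zeta> (graph_point k s h z) * f (graph_point k s h z) * sqrt (1 + (norm (grad UNIV h z))\<^sup>2))"
proof (rule patch_weight[OF p])
  assume "\<And>f. continuous_on (frontier \<Omega>) f \<Longrightarrow> integrable (hyperplane_lborel k)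
      (\<lambda>z. \<zeta> (graph_point k s h z) * f (graph_point k s h z) * sqrt (1 + (norm (grad UNIV h z))\<^sup>2))"
  from this[OF f] show ?thesis .
qed

lemma patch_bounds:
  assumes p: "(U, k, s, h, \<zeta>) \<in> set atlas"
  shows "\<exists>r C. 0 \<le> C \<and> (\<forall>z. z $ k = 0 \<longrightarrow> \<zeta> (graph_point k s h z) \<noteq> 0 \<longrightarrow> norm z \<le> r) \<and>
    (\<forall>z. z $ k = 0 \<longrightarrow> \<bar>\<zeta> (graph_point k s h z) * sqrt (1 + (norm (grad UNIV h z))\<^sup>2)\<bar> \<le> C) \<and>
    (\<forall>z. \<zeta> (graph_point k s h z) \<noteq> 0 \<longrightarrow> graph_point k s h z \<in> frontier \<Omega>)"
proof (rule patch_weight[OF p])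
  fix r C
  assume "0 \<le> C" "\<And>z. z $ k = 0 \<Longrightarrow> \<zeta> (graph_point k s h z) \<noteq> 0 \<Longrightarrow> norm z \<le> r"
    "\<And>z. z $ k = 0 \<Longrightarrow> \<bar>\<zeta> (graph_point k s h z) * sqrt (1 + (norm (grad UNIV h z))\<^sup>2)\<bar> \<le> C"
    "\<And>z. \<zeta> (graph_point k s h z) \<noteq> 0 \<Longrightarrow> graph_point k s h z \<in> frontier \<Omega>"
  then show ?thesis by (intro exI[of _ r] exI[of _ C]) simp
qed

lemma surface_integral_add:
  assumes "continuous_on (frontier \<Omega>) f" "continuous_on (frontier \<Omega>) g"
  shows "surface_integral \<Omega> (\<lambda>x. f x + g x) = surface_integral \<Omega> f + surface_integral \<Omega> g"
proof -
  have "graph_integral k s h (\<lambda>x. \<zeta> x * (f x + g x)) =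
      graph_integral k s h (\<lambda>x. \<zeta> x * f x) + graph_integral k s h (\<lambda>x. \<zeta> x * g x)"
    if p: "(U, k, s, h, \<zeta>) \<in> set atlas" for U k s h \<zeta>
  proof -
    note I = Bochner_Integration.integral_add[OF patch_integrable[OF p assms(1)] patch_integrable[OF p assms(2)]]
    show ?thesis
      unfolding graph_integral_def I[symmetric]
      by (intro Bochner_Integration.integral_cong refl) (simp add: algebra_simps)
  qed
  then have "surface_integral \<Omega> (\<lambda>x. f x + g x) =
      (\<Sum>p\<leftarrow>atlas. (case p of (U, k, s, h, \<zeta>) \<Rightarrow> graph_integral k s h (\<lambda>x. \<zeta> x * f x)) +
        (case p of (U, k, s, h, \<zeta>) \<Rightarrow> graph_integral k s h (\<lambda>x. \<zeta> x * g x)))"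
    unfolding surface_integral_eq by (intro arg_cong[where f = sum_list] map_cong) auto
  then show ?thesis by (simp add: surface_integral_eq sum_list_addf)
qed

lemma surface_integral_cmult: "surface_integral \<Omega> (\<lambda>x. c * f x) = c * surface_integral \<Omega> f"
proof -
  have "graph_integral k s h (\<lambda>x. \<zeta> x * (c * f x)) = c * graph_integral k s h (\<lambda>x. \<zeta> x * f x)" for k s h and \<zeta> :: "real^'n \<Rightarrow> real"
    unfolding graph_integral_def by (simp add: mult.assoc mult.left_commute[of _ c])
  then show ?thesis
    unfolding surface_integral_eq by (simp add: case_prod_beta' sum_list_const_mult)
qed

lemma surface_integral_diff:
  assumes "continuous_on (frontier \<Omega>) f" "continuous_on (frontier \<Omega>) g"
  shows "surface_integral \<Omega> (\<lambda>x. f x - g x) = surface_integral \<Omega> f - surface_integral \<Omega> g"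
  using surface_integral_add[OF assms(1), of "\<lambda>x. (-1) * g x"] surface_integral_cmult[of "-1" g] assms(2)
  by (auto intro!: continuous_intros)

lemma DERIV_sum_list:
  assumes "\<And>p. p \<in> set ps \<Longrightarrow> ((\<lambda>t. f p t) has_real_derivative d p) (at t)"
  shows "((\<lambda>t. \<Sum>p\<leftarrow>ps. f p t) has_real_derivative (\<Sum>p\<leftarrow>ps. d p)) (at t)"
  using assms by (induction ps) (auto intro!: DERIV_add)

lemma DERIV_surface_integral:
  fixes f f' :: "real \<Rightarrow> real^'n \<Rightarrow> real"
  assumes d: "\<And>t x. \<bar>t\<bar> < a \<Longrightarrow> x \<in> frontier \<Omega> \<Longrightarrow> ((\<lambda>t. f t x) has_real_derivative f' t x) (at t)"
    and f: "\<And>t. \<bar>t\<bar> < a \<Longrightarrow> continuous_on (frontier \<Omega>) (f t)"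
    and f': "continuous_on ({-a<..<a} \<times> frontier \<Omega>) (\<lambda>(t, x). f' t x)"
    and t: "\<bar>t\<bar> < a"
  shows "((\<lambda>t. surface_integral \<Omega> (f t)) has_real_derivative surface_integral \<Omega> (f' t)) (at t)"
  unfolding surface_integral_eq
proof (rule DERIV_sum_list)
  fix p assume p: "p \<in> set atlas"
  obtain U k s h \<zeta> where P: "p = (U, k, s, h, \<zeta>)" by (cases p)
  let ?g = "graph_point k s h"
  let ?w = "\<lambda>f z. \<zeta> (?g z) * f (?g z) * sqrt (1 + (norm (grad UNIV h z))\<^sup>2)"
  note I = patch_integrable[OF p[unfolded P]]
  obtain r C where C: "0 \<le> C"
    "\<And>z. z $ k = 0 \<Longrightarrow> \<zeta> (?g z) \<noteq> 0 \<Longrightarrow> norm z \<le> r"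
    "\<And>z. z $ k = 0 \<Longrightarrow> \<bar>\<zeta> (?g z) * sqrt (1 + (norm (grad UNIV h z))\<^sup>2)\<bar> \<le> C"
    "\<And>z. \<zeta> (?g z) \<noteq> 0 \<Longrightarrow> ?g z \<in> frontier \<Omega>"
    using patch_bounds[OF p[unfolded P]] by blast
  obtain \<delta> M where \<delta>: "0 < \<delta>" "0 \<le> M" "\<And>s. \<bar>s - t\<bar> < \<delta> \<Longrightarrow> \<bar>s\<bar> < a"
    "\<And>s x. \<bar>s - t\<bar> < \<delta> \<Longrightarrow> x \<in> frontier \<Omega> \<Longrightarrow> \<bar>f' s x\<bar> \<le> M"
    using bounded_near[OF f' compact_frontier t] by blast
  have f't: "continuous_on (frontier \<Omega>) (f' t)"
    by (rule continuous_on_slice[OF f']) (use t in \<open>auto simp: abs_less_iff minus_less_iff\<close>)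
  have "((\<lambda>t. LINT z|hyperplane_lborel k. ?w (f t) z) has_real_derivative
      (LINT z|hyperplane_lborel k. ?w (f' t) z)) (at t)"
  proof (rule DERIV_integral_dominated[OF \<delta>(1), where w = "\<lambda>z. M * C * indicator (cball 0 r) z"])
    show "integrable (hyperplane_lborel k) (\<lambda>z. ?w (f s) z)" if "\<bar>s - t\<bar> < \<delta>" for s
      by (intro I f \<delta>(3)[OF that])
    show "integrable (hyperplane_lborel k) (\<lambda>z. M * C * indicator (cball 0 r) z)"
      using emeasure_hyperplane_cball[of k r] by auto
    show "?w (f' t) \<in> borel_measurable (hyperplane_lborel k)" using I[OF f't] by auto
    show "AE z in hyperplane_lborel k. \<forall>s. \<bar>s - t\<bar> < \<delta> \<longrightarrow>
       ((\<lambda>s. ?w (f s) z) has_real_derivative ?w (f' s) z) (at s) \<and> \<bar>?w (f' s) z\<bar> \<le> M * C * indicator (cball 0 r) z"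
      using AE_hyperplane
    proof eventually_elim
      case (elim z)
      show ?case
      proof (intro allI impI)
        fix \<tau> assume \<tau>: "\<bar>\<tau> - t\<bar> < \<delta>"
        show "((\<lambda>s. ?w (f s) z) has_real_derivative ?w (f' \<tau>) z) (at \<tau>) \<and> \<bar>?w (f' \<tau>) z\<bar> \<le> M * C * indicator (cball 0 r) z"
        proof (cases "\<zeta> (?g z) = 0")
          case True
          then show ?thesis using C(1) \<delta>(2) by simp
        next
          case False
          have fr: "?g z \<in> frontier \<Omega>" by (rule C(4)[OF False])
          have "((\<lambda>s. ?w (f s) z) has_real_derivative ?w (f' \<tau>) z) (at \<tau>)"
            using DERIV_cmult_right[OF DERIV_cmult[OF d[OF \<delta>(3)[OF \<tau>] fr]]] .
          moreover have "\<bar>?w (f' \<tau>) z\<bar> \<le> M * C"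
          proof -
            have "\<bar>?w (f' \<tau>) z\<bar> = \<bar>f' \<tau> (?g z)\<bar> * \<bar>\<zeta> (?g z) * sqrt (1 + (norm (grad UNIV h z))\<^sup>2)\<bar>"
              by (simp add: abs_mult)
            also have "\<dots> \<le> M * C" using \<delta>(2) by (intro mult_mono \<delta>(4) \<tau> fr C(3) elim) auto
            finally show ?thesis .
          qed
          ultimately show ?thesis using C(2)[OF elim False] by simp
        qed
      qed
    qed
  qed
  then show "((\<lambda>t. case p of (U, k, s, h, \<zeta>) \<Rightarrow> graph_integral k s h (\<lambda>x. \<zeta> x * f t x)) has_real_derivative
        (case p of (U, k, s, h, \<zeta>) \<Rightarrow> graph_integral k s h (\<lambda>x. \<zeta> x * f' t x))) (at t)"
    by (simp add: P graph_integral_def)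
qed

lemma DERIV_domain_integral:
  fixes f f' :: "real \<Rightarrow> real^'n \<Rightarrow> real"
  assumes d: "\<And>t x. \<bar>t\<bar> < a \<Longrightarrow> x \<in> \<Omega> \<Longrightarrow> ((\<lambda>t. f t x) has_real_derivative f' t x) (at t)"
    and f: "\<And>t. \<bar>t\<bar> < a \<Longrightarrow> continuous_on (closure \<Omega>) (f t)"
    and f': "continuous_on ({-a<..<a} \<times> closure \<Omega>) (\<lambda>(t, x). f' t x)"
    and t: "\<bar>t\<bar> < a"
  shows "((\<lambda>t. LINT x:\<Omega>|lborel. f t x) has_real_derivative (LINT x:\<Omega>|lborel. f' t x)) (at t)"
proof -
  obtain \<delta> M where \<delta>: "0 < \<delta>" "0 \<le> M" "\<And>s. \<bar>s - t\<bar> < \<delta> \<Longrightarrow> \<bar>s\<bar> < a"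
    "\<And>s x. \<bar>s - t\<bar> < \<delta> \<Longrightarrow> x \<in> closure \<Omega> \<Longrightarrow> \<bar>f' s x\<bar> \<le> M"
    using bounded_near[OF f' compact_cl t] by blast
  have f't: "continuous_on (closure \<Omega>) (f' t)"
    by (rule continuous_on_slice[OF f']) (use t in \<open>auto simp: abs_less_iff minus_less_iff\<close>)
  note I = set_integrable_continuous[OF bounded_domain open_domain, unfolded set_integrable_def]
  show ?thesis
    unfolding set_lebesgue_integral_def
  proof (rule DERIV_integral_dominated[OF \<delta>(1), where w = "\<lambda>x. indicator \<Omega> x *\<^sub>R M"])
    show "integrable lborel (\<lambda>x. indicator \<Omega> x *\<^sub>R f s x)" if "\<bar>s - t\<bar> < \<delta>" for s
      using I f \<delta>(3)[OF that] by blast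
    show "integrable lborel (\<lambda>x. indicator \<Omega> x *\<^sub>R M)" by (intro I continuous_on_const)
    show "(\<lambda>x. indicator \<Omega> x *\<^sub>R f' t x) \<in> borel_measurable lborel" using I[OF f't] by auto
    show "AE x in lborel. \<forall>s. \<bar>s - t\<bar> < \<delta> \<longrightarrow>
       ((\<lambda>s. indicator \<Omega> x *\<^sub>R f s x) has_real_derivative indicator \<Omega> x *\<^sub>R f' s x) (at s) \<and>
       \<bar>indicator \<Omega> x *\<^sub>R f' s x\<bar> \<le> indicator \<Omega> x *\<^sub>R M"
    proof (intro AE_I2 allI impI)
      fix x s assume s: "\<bar>s - t\<bar> < \<delta>"
      show "((\<lambda>s. indicator \<Omega> x *\<^sub>R f s x) has_real_derivative indicator \<Omega> x *\<^sub>R f' s x) (at s) \<and>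
       \<bar>indicator \<Omega> x *\<^sub>R f' s x\<bar> \<le> indicator \<Omega> x *\<^sub>R M"
        using d[OF \<delta>(3)[OF s], of x] \<delta>(4)[OF s, of x] closure_subset[of \<Omega>] by (cases "x \<in> \<Omega>") auto
    qed
  qed
qed

end

section \<open>Change of variables\<close>

text \<open>
  The change of variables theorem of the library requires a well-ordered index type, which is
  supplied by a copy of the given finite index type.
\<close>

typedef 'a wo_copy = "UNIV :: 'a set" ..

instance wo_copy :: (finite) finite
proof
  have "(UNIV :: 'a wo_copy set) = Abs_wo_copy ` UNIV"
    by (metis Abs_wo_copy_cases surjI UNIV_I)
  then show "finite (UNIV :: 'a wo_copy set)" by (metis finite finite_imageI)
qed

instantiation wo_copy :: (finite) wellorder
begin

definition less_eq_wo_copy :: "'a wo_copy \<Rightarrow> 'a wo_copy \<Rightarrow> bool" where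
  "less_eq_wo_copy a b \<longleftrightarrow> to_nat_on UNIV a \<le> to_nat_on UNIV b"

definition less_wo_copy :: "'a wo_copy \<Rightarrow> 'a wo_copy \<Rightarrow> bool" where
  "less_wo_copy a b \<longleftrightarrow> to_nat_on UNIV a < to_nat_on UNIV b"

instance
proof
  have inj: "inj (to_nat_on (UNIV :: 'a wo_copy set))"
    by (rule inj_on_to_nat_on) (simp add: countable_finite)
  fix a b c :: "'a wo_copy" and P :: "'a wo_copy \<Rightarrow> bool"
  show "a < b \<longleftrightarrow> a \<le> b \<and> \<not> b \<le> a" "a \<le> a" "a \<le> b \<Longrightarrow> b \<le> c \<Longrightarrow> a \<le> c" "a \<le> b \<or> b \<le> a"
    by (auto simp: less_eq_wo_copy_def less_wo_copy_def)
  show "a \<le> b \<Longrightarrow> b \<le> a \<Longrightarrow> a = b"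
    using injD[OF inj] by (auto simp: less_eq_wo_copy_def)
  show "(\<And>x. (\<And>y. y < x \<Longrightarrow> P y) \<Longrightarrow> P x) \<Longrightarrow> P a"
    unfolding less_wo_copy_def by (induction "to_nat_on UNIV a" arbitrary: a rule: less_induct) blast
qed

end

definition to_wo :: "real^'n \<Rightarrow> real^('n wo_copy)" where
  "to_wo x = (\<chi> i. x $ Rep_wo_copy i)"

definition of_wo :: "real^('n wo_copy) \<Rightarrow> real^'n" where
  "of_wo x = (\<chi> i. x $ Abs_wo_copy i)"

lemma wo_inverse [simp]: "of_wo (to_wo x) = x" "to_wo (of_wo z) = z"
  by (simp_all add: to_wo_def of_wo_def vec_eq_iff Abs_wo_copy_inverse Rep_wo_copy_inverse)

lemma linear_wo: "linear to_wo" "linear of_wo"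
  by (auto simp: linear_iff to_wo_def of_wo_def vec_eq_iff)

lemma bounded_linear_wo: "bounded_linear to_wo" "bounded_linear of_wo"
  using linear_wo linear_conv_bounded_linear by blast+

lemma continuous_wo: "continuous_on A to_wo" "continuous_on B of_wo"
  using bounded_linear_wo linear_continuous_on by blast+

text \<open>Relabelling the coordinates turns boxes into boxes with the same side lengths.\<close>

lemma distr_to_wo: "distr lborel borel to_wo = (lborel :: (real^('n::finite wo_copy)) measure)"
proof (rule lborel_eqI[symmetric])
  have m: "to_wo \<in> borel_measurable lborel"
    using borel_measurable_continuous_onI[OF continuous_wo(1)[of UNIV]] by simp
  fix l u :: "real^('n wo_copy)" assume "\<And>b. b \<in> Basis \<Longrightarrow> l \<bullet> b \<le> u \<bullet> b"
  then have le: "l $ i \<le> u $ i" for i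
    using inner_axis[of l i 1] inner_axis[of u i 1] by (metis axis_in_Basis_iff Basis_real_def inner_real_def mult.right_neutral singletonI)
  have eq: "to_wo -` box l u = box (of_wo l) (of_wo u)"
  proof -
    have "(\<forall>i. l $ i < x $ Rep_wo_copy i \<and> x $ Rep_wo_copy i < u $ i) \<longleftrightarrow>
        (\<forall>i. l $ Abs_wo_copy i < x $ i \<and> x $ i < u $ Abs_wo_copy i)" for x :: "real^'n"
      by (metis Abs_wo_copy_inverse Rep_wo_copy_inverse UNIV_I)
    then show ?thesis
      by (auto simp: mem_box_cart to_wo_def of_wo_def)
  qed
  have "emeasure (distr lborel borel to_wo) (box l u) = emeasure lborel (box (of_wo l) (of_wo u))"
    by (subst emeasure_distr[OF m]) (auto simp: eq)
  also have "\<dots> = (\<Prod>b\<in>Basis. (of_wo u - of_wo l) \<bullet> b)"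
    using le by (intro emeasure_lborel_box) (auto simp: Basis_vec_def inner_axis of_wo_def)
  also have "(\<Prod>b\<in>Basis. (of_wo u - of_wo l) \<bullet> b) = (\<Prod>b\<in>Basis. (u - l) \<bullet> b)"
  proof -
    have "(\<Prod>i\<in>UNIV. (u - l) $ Abs_wo_copy i) = (\<Prod>j\<in>UNIV. (u - l) $ j)"
      by (rule prod.reindex_bij_witness[of _ Rep_wo_copy Abs_wo_copy])
         (auto simp: Abs_wo_copy_inverse Rep_wo_copy_inverse)
    then show ?thesis by (simp add: prod_Basis_vec inner_axis of_wo_def)
  qed
  finally show "emeasure (distr lborel borel to_wo) (box l u) = (\<Prod>b\<in>Basis. (u - l) \<bullet> b)" .
qed simp

lemma integral_to_wo:
  fixes f :: "real^('n::finite wo_copy) \<Rightarrow> real"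
  assumes "f \<in> borel_measurable borel"
  shows "(LINT z|lborel. f z) = (LINT x|lborel. f (to_wo x))"
  using borel_measurable_continuous_onI[OF continuous_wo(1)[of UNIV]] assms
  by (subst distr_to_wo[symmetric]) (rule integral_distr, auto)

text \<open>Conjugation by the relabelling is a sign-preserving bijection between the permutations
  of the two index types, so the Leibniz sums agree term by term.\<close>

lemma det_to_wo:
  fixes A :: "real^'n^'n"
  shows "det (\<chi> i j. A $ Rep_wo_copy i $ Rep_wo_copy j) = det A"
proof -
  let ?r = "Rep_wo_copy :: 'n wo_copy \<Rightarrow> 'n" and ?a = "Abs_wo_copy :: 'n \<Rightarrow> 'n wo_copy"
  have ra: "?r (?a x) = x" and ar: "?a (?r y) = y" for x y
    by (simp_all add: Abs_wo_copy_inverse Rep_wo_copy_inverse)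
  have inj: "inj ?a" by (metis injI ra)
  have bij: "bij ?a" "bij ?r" by (rule o_bij[of ?r] o_bij[of ?a]; simp add: fun_eq_iff ar ra)+
  have mp: "map_permutation UNIV ?a p = ?a \<circ> p \<circ> ?r" if "p permutes UNIV" for p
  proof
    fix y
    have "map_permutation UNIV ?a p (?a (?r y)) = ?a (p (?r y))"
      by (rule map_permutation_apply) (use inj in auto)
    then show "map_permutation UNIV ?a p y = (?a \<circ> p \<circ> ?r) y" by (simp add: ar)
  qed
  have perm: "(?a \<circ> p \<circ> ?r) permutes UNIV" and sgn: "sign (?a \<circ> p \<circ> ?r) = sign p"
    if "p permutes UNIV" for p
  proof -
    show "(?a \<circ> p \<circ> ?r) permutes UNIV"
      by (intro bij_imp_permutes bij_comp permutes_bij[OF that] bij) simp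
    show "sign (?a \<circ> p \<circ> ?r) = sign p"
      using sign_map_permutation[of ?a UNIV p] inj that by (simp add: mp[OF that])
  qed
  show ?thesis
    unfolding det_def
  proof (rule sum.reindex_bij_witness[of _ "\<lambda>p. ?a \<circ> p \<circ> ?r" "\<lambda>q. ?r \<circ> q \<circ> ?a"])
    fix q assume "q \<in> {p. p permutes (UNIV :: 'n wo_copy set)}"
    then have q: "q permutes UNIV" by simp
    have "bij (?r \<circ> q \<circ> ?a)"
      by (intro bij_comp permutes_bij[OF q] bij)
    then show qp: "?r \<circ> q \<circ> ?a \<in> {p. p permutes UNIV}" by (auto intro: bij_imp_permutes)
    show qq: "?a \<circ> (?r \<circ> q \<circ> ?a) \<circ> ?r = q" by (simp add: fun_eq_iff ar)
    have "sign q = sign (?r \<circ> q \<circ> ?a)" using sgn[of "?r \<circ> q \<circ> ?a"] qp qq by simp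
    moreover have "(\<Prod>i\<in>UNIV. A $ i $ (?r \<circ> q \<circ> ?a) i) = (\<Prod>i\<in>UNIV. A $ ?r i $ ?r (q i))"
      by (rule prod.reindex_bij_witness[of _ ?r ?a]) (auto simp: ar ra)
    ultimately show "of_int (sign (?r \<circ> q \<circ> ?a)) * (\<Prod>i\<in>UNIV. A $ i $ (?r \<circ> q \<circ> ?a) i) =
       of_int (sign q) * (\<Prod>i\<in>UNIV. (\<chi> i j. A $ ?r i $ ?r j) $ i $ q i)"
      by simp
  next
    fix p assume "p \<in> {p. p permutes (UNIV :: 'n set)}"
    then show "?a \<circ> p \<circ> ?r \<in> {p. p permutes UNIV}" using perm by simp
    show "?r \<circ> (?a \<circ> p \<circ> ?r) \<circ> ?a = p" by (simp add: fun_eq_iff ra)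
  qed
qed

text \<open>The integrands are lifted to \<open>real^1\<close>, because the underlying change of
  variables theorem speaks of vector-valued functions and of the Henstock-Kurzweil integral; for
  Lebesgue integrable functions the two integrals agree.\<close>

lemma set_integral_change_of_variables_wo:
  fixes f :: "real^('m::{finite,wellorder}) \<Rightarrow> real"
  assumes S: "open S" and der: "\<And>x. x \<in> S \<Longrightarrow> (g has_derivative g' x) (at x)" and inj: "inj_on g S"
    and gS: "open (g ` S)" and f: "set_integrable lborel (g ` S) f"
    and fg: "set_integrable lborel S (\<lambda>x. \<bar>det (matrix (g' x))\<bar> * f (g x))"
  shows "(LINT x:g ` S|lborel. f x) = (LINT x:S|lborel. \<bar>det (matrix (g' x))\<bar> * f (g x))"
proof -
  let ?v = "vec :: real \<Rightarrow> real^1"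
  have bl: "bounded_linear ?v"
    by (auto simp: linear_conv_bounded_linear[symmetric] linear_iff vec_eq_iff)
  have lift: "(\<lambda>x. ?v (h x)) absolutely_integrable_on A \<and> integral A (\<lambda>x. ?v (h x)) = ?v (LINT x:A|lborel. h x)"
    if h: "set_integrable lborel A h" for A and h :: "real^('m::{finite,wellorder}) \<Rightarrow> real"
  proof -
    have a: "h absolutely_integrable_on A"
      using h unfolding set_integrable_def by (subst integrable_completion) auto
    have "h integrable_on A" "(LINT x:A|lborel. h x) = integral A h"
      using set_borel_integral_eq_integral[OF h] by auto
    then show ?thesis
      using absolutely_integrable_linear[OF a bl] integral_linear[OF _ bl, of h A] by (simp add: comp_def)
  qed
  have SL: "S \<in> sets lebesgue" using S by auto
  have "?v (LINT x:S|lborel. \<bar>det (matrix (g' x))\<bar> * f (g x)) = ?v (LINT x:g ` S|lborel. f x)"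
  proof -
    have eq: "(\<lambda>x. ?v (\<bar>det (matrix (g' x))\<bar> * f (g x))) = (\<lambda>x. \<bar>det (matrix (g' x))\<bar> *\<^sub>R ?v (f (g x)))"
      by (auto simp: vec_eq_iff)
    have "(\<lambda>x. ?v (f x)) absolutely_integrable_on g ` S \<and>
        integral (g ` S) (\<lambda>x. ?v (f x)) = ?v (LINT x:S|lborel. \<bar>det (matrix (g' x))\<bar> * f (g x))"
      using has_absolute_integral_change_of_variables[OF SL has_derivative_at_withinI[OF der] inj, of "\<lambda>x. ?v (f x)"]
        lift[OF fg] unfolding eq by blast
    with lift[OF f] show ?thesis by simp
  qed
  from arg_cong[OF this, of "\<lambda>v. v $ 1"] show ?thesis by simp
qed

lemma integrable_to_wo:
  fixes f :: "real^('n::finite) \<Rightarrow> real"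
  assumes "integrable lborel f"
  shows "integrable lborel (\<lambda>z. f (of_wo z))"
proof -
  have m: "to_wo \<in> measurable lborel borel" "of_wo \<in> measurable borel borel"
    using borel_measurable_continuous_onI[OF continuous_wo(1)[of UNIV]]
      borel_measurable_continuous_onI[OF continuous_wo(2)[of UNIV]] by simp_all
  have "(\<lambda>z. f (of_wo z)) \<in> borel_measurable borel"
    using assms by (intro measurable_compose[OF m(2)]) auto
  from integrable_distr_eq[OF m(1) this] assms show ?thesis
    by (simp add: distr_to_wo)
qed

lemma indicator_to_wo: "indicator (to_wo ` A) z = (indicator A (of_wo z) :: real)"
  by (metis (mono_tags, lifting) image_iff indicator_simps wo_inverse)

lemma set_integral_to_wo:
  fixes f :: "real^('n::finite) \<Rightarrow> real"
  assumes "set_integrable lborel A f"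
  shows "set_integrable lborel (to_wo ` A) (\<lambda>z. f (of_wo z))"
    and "(LINT z:to_wo ` A|lborel. f (of_wo z)) = (LINT x:A|lborel. f x)"
proof -
  show "set_integrable lborel (to_wo ` A) (\<lambda>z. f (of_wo z))"
    using integrable_to_wo[OF assms[unfolded set_integrable_def]]
    by (simp add: set_integrable_def indicator_to_wo)
  then have "(\<lambda>z. indicator A (of_wo z) * f (of_wo z)) \<in> borel_measurable borel"
    by (auto simp: set_integrable_def indicator_to_wo)
  from integral_to_wo[OF this]
  show "(LINT z:to_wo ` A|lborel. f (of_wo z)) = (LINT x:A|lborel. f x)"
    by (simp add: set_lebesgue_integral_def indicator_to_wo)
qed

lemma open_to_wo: "open A \<Longrightarrow> open (to_wo ` A)"
proof -
  assume "open A"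
  moreover have "to_wo ` A = of_wo -` A" by (force simp: image_iff)
  ultimately show ?thesis using open_vimage[OF _ continuous_wo(2)] by metis
qed

theorem set_integral_change_of_variables:
  fixes f :: "real^'n \<Rightarrow> real"
  assumes S: "open S" and der: "\<And>x. x \<in> S \<Longrightarrow> (g has_derivative g' x) (at x)" and inj: "inj_on g S"
    and gS: "open (g ` S)" and f: "set_integrable lborel (g ` S) f"
    and fg: "set_integrable lborel S (\<lambda>x. \<bar>det (matrix (g' x))\<bar> * f (g x))"
  shows "(LINT x:g ` S|lborel. f x) = (LINT x:S|lborel. \<bar>det (matrix (g' x))\<bar> * f (g x))"
proof -
  define h where "h z = to_wo (g (of_wo z))" for z
  define h' where "h' z v = to_wo (g' (of_wo z) (of_wo v))" for z v
  have hS: "h ` to_wo ` S = to_wo ` g ` S" by (simp add: h_def image_image)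
  have det: "det (matrix (h' z)) = det (matrix (g' (of_wo z)))" for z
  proof -
    have "of_wo (axis j 1) = axis (Rep_wo_copy j) 1" for j :: "'n wo_copy"
      by (auto simp: of_wo_def axis_def vec_eq_iff Abs_wo_copy_inverse Rep_wo_copy_inverse)
    then have "matrix (h' z) = (\<chi> i j. matrix (g' (of_wo z)) $ Rep_wo_copy i $ Rep_wo_copy j)"
      by (simp add: matrix_def h'_def to_wo_def)
    then show ?thesis by (simp add: det_to_wo)
  qed
  have "(LINT z:h ` to_wo ` S|lborel. f (of_wo z)) =
      (LINT z:to_wo ` S|lborel. \<bar>det (matrix (h' z))\<bar> * f (of_wo (h z)))"
  proof (rule set_integral_change_of_variables_wo)
    show "open (to_wo ` S)" "open (h ` to_wo ` S)"
      unfolding hS by (intro open_to_wo S gS)+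
    show "(h has_derivative h' z) (at z)" if "z \<in> to_wo ` S" for z
    proof -
      have "of_wo z \<in> S" using that by auto
      from bounded_linear.has_derivative[OF bounded_linear_wo(1)
          has_derivative_compose[OF bounded_linear_imp_has_derivative[OF bounded_linear_wo(2)] der[OF this]]]
      show ?thesis by (simp add: h_def[abs_def] h'_def[abs_def])
    qed
    show "inj_on h (to_wo ` S)"
      using inj unfolding h_def inj_on_def by (metis imageE wo_inverse(1))
    show "set_integrable lborel (h ` to_wo ` S) (\<lambda>z. f (of_wo z))"
      unfolding hS by (rule set_integral_to_wo(1)[OF f])
    show "set_integrable lborel (to_wo ` S) (\<lambda>z. \<bar>det (matrix (h' z))\<bar> * f (of_wo (h z)))"
      using set_integral_to_wo(1)[OF fg] by (simp add: det h_def)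
  qed
  also have "\<dots> = (LINT z:to_wo ` S|lborel. \<bar>det (matrix (g' (of_wo z)))\<bar> * f (g (of_wo z)))"
    by (simp add: det h_def)
  finally show ?thesis
    unfolding hS set_integral_to_wo(2)[OF f] set_integral_to_wo(2)[OF fg] .
qed

section \<open>Calculus of weak divergences\<close>

lemma set_integrable_compact_support:
  fixes f :: "real^'n \<Rightarrow> real"
  assumes K: "compact K" "K \<subseteq> W" and f: "continuous_on W f" and z: "\<And>x. x \<in> W \<Longrightarrow> x \<notin> K \<Longrightarrow> f x = 0"
  shows "set_integrable lborel W f"
proof -
  have "(\<lambda>x. indicator W x *\<^sub>R f x) = (\<lambda>x. indicator K x *\<^sub>R f x)"
    using K(2) z by (auto simp: indicator_def fun_eq_iff)
  moreover have "integrable lborel (\<lambda>x. indicator K x *\<^sub>R f x)"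
    by (rule borel_integrable_compact[OF K(1) continuous_on_subset[OF f K(2)]])
  ultimately show ?thesis by (simp add: set_integrable_def)
qed

text \<open>Fubini along axis \<open>i\<close> and the fundamental theorem of calculus: on each line
  the integral of \<open>D i\<close> is a difference of two values of \<open>g\<close> outside its
  support.\<close>

lemma integral_partial_zero:
  fixes g :: "real^'n \<Rightarrow> real"
  assumes g: "has_partials UNIV g D" and K: "compact K" and z: "\<And>x. x \<notin> K \<Longrightarrow> g x = 0"
  shows "integrable lborel (D i)" and "(LINT x|lborel. D i x) = 0"
proof -
  have D0: "D i x = 0" if "x \<notin> K" for x
    by (rule has_partials_zero_outside[OF g compact_imp_closed[OF K] z that])
  have cD: "continuous_on A (D i)" for A
    using has_partialsD(3)[OF g] by (auto intro: continuous_on_subset[of UNIV])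
  show int: "integrable lborel (D i)"
  proof -
    have "set_integrable lborel UNIV (D i)"
      by (rule set_integrable_compact_support[OF K _ cD]) (use D0 in auto)
    then show ?thesis by (simp add: set_integrable_def)
  qed
  obtain R where R: "\<And>x. x \<in> K \<Longrightarrow> norm x \<le> R"
    using compact_imp_bounded[OF K] unfolding bounded_iff by auto
  have "(LINT c|lborel. D i (z + c *\<^sub>R axis i 1)) = 0" for z
  proof -
    \<comment> \<open>A displacement of this length from \<open>z\<close> along the axis leads to a
      norm above \<open>R\<close>, so both endpoints lie outside \<open>K\<close>.\<close>
    define M where "M = \<bar>R\<bar> + norm z + 1"
    have M: "0 < M" unfolding M_def by (simp add: add_nonneg_pos)
    have out: "z + c *\<^sub>R axis i 1 \<notin> K" if "M \<le> \<bar>c\<bar>" for c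
    proof
      assume "z + c *\<^sub>R axis i 1 \<in> K"
      then have "norm (z + c *\<^sub>R axis i 1) \<le> R" by (rule R)
      moreover have "norm (c *\<^sub>R axis i (1::real)) \<le> norm (z + c *\<^sub>R axis i 1) + norm z"
        using norm_triangle_ineq4[of "z + c *\<^sub>R axis i 1" z] by simp
      ultimately show False using that by (simp add: M_def)
    qed
    have "(LINT c|lborel. D i (z + c *\<^sub>R axis i 1)) =
        (LINT c|lborel. indicator {-M..M} c *\<^sub>R D i (z + c *\<^sub>R axis i 1))"
    proof (intro Bochner_Integration.integral_cong refl)
      fix c show "D i (z + c *\<^sub>R axis i 1) = indicator {-M..M} c *\<^sub>R D i (z + c *\<^sub>R axis i 1)"
        using D0[OF out[of c]] by (cases "c \<in> {-M..M}") auto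
    qed
    also have "\<dots> = g (z + M *\<^sub>R axis i 1) - g (z + (- M) *\<^sub>R axis i 1)"
    proof (rule integral_FTC_Icc)
      show "((\<lambda>c. g (z + c *\<^sub>R axis i 1)) has_vector_derivative D i (z + c *\<^sub>R axis i 1)) (at c within {-M..M})" for c
        by (rule has_vector_derivative_at_within[OF has_partials_along_axis[OF g UNIV_I]])
      show "continuous_on {-M..M} (\<lambda>c. D i (z + c *\<^sub>R axis i 1))"
        by (intro continuous_on_compose2[OF cD[of UNIV]] continuous_intros) auto
    qed (use M in auto)
    also have "\<dots> = 0" using z[OF out[of M]] z[OF out[of "-M"]] M by simp
    finally show ?thesis .
  qed
  then show "(LINT x|lborel. D i x) = 0"
    by (simp add: lborel_integral_axis[OF int, of i])
qed

text \<open>By the product rule the tested integrand is the sum over \<open>i\<close> of the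
  \<open>i\<close>-th partial derivatives of the compactly supported functions
  \<open>F x $ i * \<phi> x\<close>, each of which has integral 0.\<close>

lemma has_weak_div_classical:
  fixes F :: "real^'n \<Rightarrow> real^'n"
  assumes "open S" and F: "\<And>x. x \<in> S \<Longrightarrow> (F has_derivative (\<lambda>h. \<Sum>i\<in>UNIV. h $ i *\<^sub>R D i x)) (at x)"
    and D: "\<And>i. continuous_on S (D i)"
  shows "has_weak_div S F (\<lambda>x. \<Sum>i\<in>UNIV. D i x $ i)"
  unfolding has_weak_div_def
proof (intro allI impI)
  fix \<phi> assume \<phi>: "test_function S \<phi>"
  then obtain K where K: "compact K" "K \<subseteq> S" "\<And>x. x \<notin> K \<Longrightarrow> \<phi> x = 0"
    by (auto simp: test_function_def)
  have \<phi>p: "has_partials UNIV \<phi> (\<lambda>i. partial UNIV i \<phi>)"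
    using \<phi> by (auto simp: test_function_def intro: has_partials_partial)
  have cF: "continuous_on S F"
    by (intro continuous_at_imp_continuous_on ballI has_derivative_continuous[OF F])
  let ?G = "\<lambda>i j x. F x $ i * partial UNIV j \<phi> x + D j x $ i * \<phi> x"
  have ext: "has_partials UNIV (\<lambda>x. if x \<in> S then F x $ i * \<phi> x else 0)
      (\<lambda>j x. if x \<in> S then ?G i j x else 0)" for i
  proof (rule has_partials_extend_zero[OF \<open>open S\<close> compact_imp_closed[OF K(1)] K(2)])
    fix x assume x: "x \<in> S"
    show "((\<lambda>x. F x $ i * \<phi> x) has_derivative (\<lambda>h. \<Sum>j\<in>UNIV. h $ j *\<^sub>R ?G i j x)) (at x)"
      using has_derivative_mult[OF bounded_linear.has_derivative[OF bounded_linear_vec_nth[of i] F[OF x]]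
          has_partialsD(1)[OF \<phi>p UNIV_I, of x]]
      by (simp add: sum_distrib_left sum_distrib_right sum.distrib[symmetric] algebra_simps)
  next
    have "continuous_on S \<phi>" "continuous_on S (partial UNIV j \<phi>)" for j
      using has_partialsD(2,3)[OF \<phi>p] by (auto intro: continuous_on_subset[of UNIV])
    then show "continuous_on S (?G i j)" for j
      by (intro continuous_on_add continuous_on_mult continuous_on_component cF D)
    show "F x $ i * \<phi> x = 0" if "x \<notin> K" for x using K(3)[OF that] by simp
  qed
  have z: "(if x \<in> S then F x $ i * \<phi> x else 0) = 0" if "x \<notin> K" for x i using K(3)[OF that] by simp
  have I: "integrable lborel (\<lambda>x. if x \<in> S then ?G i i x else 0)"
    "(LINT x|lborel. (if x \<in> S then ?G i i x else 0)) = 0" for i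
    by (rule integral_partial_zero[where g = "\<lambda>x. if x \<in> S then F x $ i * \<phi> x else 0"
        and D = "\<lambda>j x. if x \<in> S then ?G i j x else 0" and K = K and i = i, OF ext K(1) z], assumption)+
  have "(LINT x:S|lborel. F x \<bullet> grad UNIV \<phi> x + (\<Sum>i\<in>UNIV. D i x $ i) * \<phi> x) =
      (LINT x|lborel. (\<Sum>i\<in>UNIV. if x \<in> S then ?G i i x else 0))"
    unfolding set_lebesgue_integral_def
    by (intro Bochner_Integration.integral_cong refl)
       (auto simp: inner_grad_eq sum_distrib_right sum.distrib indicator_def)
  also have "\<dots> = (\<Sum>i\<in>UNIV. LINT x|lborel. (if x \<in> S then ?G i i x else 0))"
    by (rule Bochner_Integration.integral_sum) (rule I(1))
  also have "\<dots> = 0" by (simp only: I(2) sum.neutral_const)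
  finally show "(LINT x:S|lborel. F x \<bullet> grad UNIV \<phi> x + (\<Sum>i\<in>UNIV. D i x $ i) * \<phi> x) = 0" .
qed

lemma has_weak_div_cong:
  assumes "has_weak_div S F f" "open S" "\<And>x. x \<in> S \<Longrightarrow> F x = F' x" "\<And>x. x \<in> S \<Longrightarrow> f x = f' x"
  shows "has_weak_div S F' f'"
proof -
  have "(LINT x:S|lborel. F x \<bullet> grad UNIV \<phi> x + f x * \<phi> x) =
      (LINT x:S|lborel. F' x \<bullet> grad UNIV \<phi> x + f' x * \<phi> x)" for \<phi>
    by (rule set_lebesgue_integral_cong) (use assms in auto)
  then show ?thesis using assms(1) by (simp add: has_weak_div_def)
qed

text \<open>A C^1 function times a C^1 test function, extended by zero, is again a C^1 test
  function; testing \<open>F\<close> with this product is the product rule. With smooth test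
  functions an approximation would be required here.\<close>

lemma has_weak_div_scaleR:
  fixes F :: "real^'n \<Rightarrow> real^'n" and \<psi> :: "real^'n \<Rightarrow> real"
  assumes "open S" and F: "has_weak_div S F f"
    and \<psi>: "\<And>x. x \<in> S \<Longrightarrow> (\<psi> has_derivative (\<lambda>h. \<Sum>i\<in>UNIV. h $ i *\<^sub>R E i x)) (at x)"
    and E: "\<And>i. continuous_on S (E i)"
  shows "has_weak_div S (\<lambda>x. \<psi> x *\<^sub>R F x) (\<lambda>x. \<psi> x * f x + F x \<bullet> (\<chi> i. E i x))"
  unfolding has_weak_div_def
proof (intro allI impI)
  fix \<phi> assume \<phi>: "test_function S \<phi>"
  then obtain K where K: "compact K" "K \<subseteq> S" "\<And>x. x \<notin> K \<Longrightarrow> \<phi> x = 0"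
    by (auto simp: test_function_def)
  have \<phi>p: "has_partials UNIV \<phi> (\<lambda>i. partial UNIV i \<phi>)"
    using \<phi> by (auto simp: test_function_def intro: has_partials_partial)
  have c\<psi>: "continuous_on S \<psi>"
    by (intro continuous_at_imp_continuous_on ballI has_derivative_continuous[OF \<psi>])
  let ?G = "\<lambda>j x. \<psi> x * partial UNIV j \<phi> x + E j x * \<phi> x"
  define \<phi>' where "\<phi>' x = (if x \<in> S then \<psi> x * \<phi> x else 0)" for x
  have ext: "has_partials UNIV \<phi>' (\<lambda>j x. if x \<in> S then ?G j x else 0)"
    unfolding \<phi>'_def
  proof (rule has_partials_extend_zero[OF \<open>open S\<close> compact_imp_closed[OF K(1)] K(2)])
    fix x assume x: "x \<in> S"
    show "((\<lambda>x. \<psi> x * \<phi> x) has_derivative (\<lambda>h. \<Sum>j\<in>UNIV. h $ j *\<^sub>R ?G j x)) (at x)"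
      using has_derivative_mult[OF \<psi>[OF x] has_partialsD(1)[OF \<phi>p UNIV_I, of x]]
      by (simp add: sum_distrib_left sum_distrib_right sum.distrib[symmetric] algebra_simps)
  next
    have "continuous_on S \<phi>" "continuous_on S (partial UNIV j \<phi>)" for j
      using has_partialsD(2,3)[OF \<phi>p] by (auto intro: continuous_on_subset[of UNIV])
    then show "continuous_on S (?G j)" for j
      by (intro continuous_on_add continuous_on_mult c\<psi> E)
    show "\<psi> x * \<phi> x = 0" if "x \<notin> K" for x using K(3)[OF that] by simp
  qed
  have "test_function S \<phi>'"
    unfolding test_function_def using K has_partials_C1_closure[OF ext]
    by (intro conjI exI[of _ K]) (auto simp: \<phi>'_def)
  with F have "0 = (LINT x:S|lborel. F x \<bullet> grad UNIV \<phi>' x + f x * \<phi>' x)"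
    by (simp add: has_weak_div_def)
  also have "\<dots> = (LINT x:S|lborel. (\<psi> x *\<^sub>R F x) \<bullet> grad UNIV \<phi> x + (\<psi> x * f x + F x \<bullet> (\<chi> i. E i x)) * \<phi> x)"
  proof (rule set_lebesgue_integral_cong)
    show "\<forall>x. x \<in> S \<longrightarrow> F x \<bullet> grad UNIV \<phi>' x + f x * \<phi>' x =
        (\<psi> x *\<^sub>R F x) \<bullet> grad UNIV \<phi> x + (\<psi> x * f x + F x \<bullet> (\<chi> i. E i x)) * \<phi> x"
    proof (intro allI impI)
      fix x assume x: "x \<in> S"
      have "grad UNIV \<phi>' x = (\<chi> j. if x \<in> S then ?G j x else 0)" by (rule grad_eq[OF ext]) auto
      also have "\<dots> = \<psi> x *\<^sub>R grad UNIV \<phi> x + \<phi> x *\<^sub>R (\<chi> i. E i x)"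
        using x by (simp add: vec_eq_iff grad_def)
      finally show "F x \<bullet> grad UNIV \<phi>' x + f x * \<phi>' x =
        (\<psi> x *\<^sub>R F x) \<bullet> grad UNIV \<phi> x + (\<psi> x * f x + F x \<bullet> (\<chi> i. E i x)) * \<phi> x"
        using x by (simp add: \<phi>'_def inner_add_right algebra_simps)
    qed
  qed (use \<open>open S\<close> in auto)
  finally show "(LINT x:S|lborel. (\<psi> x *\<^sub>R F x) \<bullet> grad UNIV \<phi> x + (\<psi> x * f x + F x \<bullet> (\<chi> i. E i x)) * \<phi> x) = 0"
    by simp
qed

section \<open>Commuting derivatives of functions of class C^1\<close>

lemma lborel_integral_translate:
  fixes g :: "real^'n \<Rightarrow> real"
  assumes "g \<in> borel_measurable borel"
  shows "(LINT x|lborel. g (c + x)) = (LINT x|lborel. g x)"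
  by (subst lborel_distr_plus[of c, symmetric]) (rule integral_distr[symmetric], use assms in auto)

lemma has_partials_shift:
  assumes "has_partials UNIV f D"
  shows "has_partials UNIV (\<lambda>x. f (x + c)) (\<lambda>i x. D i (x + c))"
proof (rule has_partialsI)
  have sh: "((\<lambda>x. x + c) has_derivative (\<lambda>v. v)) (at x)" for x by (auto intro!: derivative_eq_intros)
  show "((\<lambda>x. f (x + c)) has_derivative (\<lambda>h. \<Sum>i\<in>UNIV. h $ i *\<^sub>R D i (x + c))) (at x)" for x
    using has_derivative_compose[OF sh has_partialsD(1)[OF assms UNIV_I]] .
  show "continuous_on (closure UNIV) (\<lambda>x. f (x + c))"
    by (rule continuous_on_compose2[OF has_partialsD(2)[OF assms]]) (auto intro!: continuous_intros)
  show "continuous_on (closure UNIV) (\<lambda>x. D i (x + c))" for i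
    by (rule continuous_on_compose2[OF has_partialsD(3)[OF assms]]) (auto intro!: continuous_intros)
qed

text \<open>
  Commuting partial derivatives of a function that is only \<open>C\<^sup>1\<close>, in weak form: one derivative is replaced
  by a difference quotient, which is moved from the test function to \<open>f\<close>.
\<close>

lemma weak_partials_commute:
  fixes f :: "real^'n \<Rightarrow> real"
  assumes S: "open S" "bounded S" and f: "has_partials S f D"
  shows "has_weak_div S (\<lambda>x. D j x *\<^sub>R axis i 1 - D i x *\<^sub>R axis j 1) (\<lambda>x. 0)"
  unfolding has_weak_div_def
proof (intro allI impI)
  fix \<phi> assume \<phi>: "test_function S \<phi>"
  then obtain K where K: "compact K" "K \<subseteq> S" "\<And>x. x \<notin> K \<Longrightarrow> \<phi> x = 0"
    by (auto simp: test_function_def)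
  define P where "P i = partial UNIV i \<phi>" for i
  have \<phi>p: "has_partials UNIV \<phi> P"
    using \<phi> unfolding P_def by (auto simp: test_function_def intro: has_partials_partial)
  have P0: "P i x = 0" if "x \<notin> K" for x i
    by (rule has_partials_zero_outside[OF \<phi>p compact_imp_closed[OF K(1)] K(3) that])
  have cP: "continuous_on A (P i)" and c\<phi>: "continuous_on A \<phi>" for A i
    using has_partialsD(2,3)[OF \<phi>p] by (auto intro: continuous_on_subset[of UNIV])
  \<comment> \<open>A uniform distance by which points of \<open>K\<close> can be shifted without
    leaving \<open>S\<close>; all steps \<open>h n\<close> are at most
    \<open>\<delta>\<close>.\<close>
  obtain \<delta> where \<delta>: "0 < \<delta>" "(\<Union>x\<in>K. cball x \<delta>) \<subseteq> S"
    using compact_subset_open_imp_cball_epsilon_subset[OF K(1) S(1) K(2)] by blast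
  define e where "e = (axis i 1 :: real^'n)"
  define h where "h n = \<delta> / real (Suc n)" for n
  have h: "0 < h n" "h n \<le> \<delta>" for n
    using \<delta>(1) by (auto simp: h_def divide_le_eq mult_left_le)
  have h0: "h \<longlonglongrightarrow> 0" unfolding h_def
    using tendsto_mult_right_zero[OF LIMSEQ_inverse_real_of_nat, of \<delta>] by (simp add: divide_inverse)
  have near: "x + s *\<^sub>R e \<in> S" if "x \<in> K" "\<bar>s\<bar> \<le> \<delta>" for x s
    using \<delta>(2) that by (force simp: e_def dist_norm)
  let ?\<psi> = "\<lambda>n x. (\<phi> (x + h n *\<^sub>R e) - \<phi> x) / h n"
  have filt: "filterlim (\<lambda>n. h n) (at 0) sequentially" "filterlim (\<lambda>n. - h n) (at 0) sequentially"
    using h h0 tendsto_minus[OF h0] by (auto simp: filterlim_at less_imp_neq[symmetric])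
  obtain M where M: "0 \<le> M" "\<And>x. x \<in> closure S \<Longrightarrow> norm (D j x) \<le> M"
    using continuous_bounded_on_closure[OF S(2) has_partialsD(3)[OF f]] by blast
  obtain M' where M': "0 \<le> M'" "\<And>x. x \<in> closure S \<Longrightarrow> norm (D i x) \<le> M'"
    using continuous_bounded_on_closure[OF S(2) has_partialsD(3)[OF f]] by blast
  obtain B where B: "0 \<le> B" "\<And>x i. norm (P i x) \<le> B"
  proof -
    have "\<exists>B\<ge>0. \<forall>x. norm (P i x) \<le> B" for i
    proof -
      have "bounded (P i ` K)" by (intro compact_imp_bounded compact_continuous_image cP K)
      then obtain b where b: "\<forall>v\<in>P i ` K. norm v \<le> b" unfolding bounded_iff by blast
      have "norm (P i x) \<le> max 0 b" for x using b P0[of x i] by (cases "x \<in> K") force+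
      then show ?thesis by (intro exI[of _ "max 0 b"]) auto
    qed
    then obtain b where b: "\<And>i. 0 \<le> b i" "\<And>i x. norm (P i x) \<le> b i" by metis
    have "norm (P i x) \<le> (\<Sum>i\<in>UNIV. b i)" for i x
      using member_le_sum[of i UNIV b] b by (meson UNIV_I finite order_trans)
    then show thesis using b by (intro that[of "\<Sum>i\<in>UNIV. b i"]) (auto intro: sum_nonneg)
  qed

  \<comment> \<open>The classical divergence of the field \<open>f x *\<^sub>R axis j 1\<close>,
    tested with the difference quotient of \<open>\<phi>\<close> in direction
    \<open>i\<close>.\<close>
  have test: "(LINT x:S|lborel. f x * ((P j (x + h n *\<^sub>R e) - P j x) / h n) + D j x * ?\<psi> n x) = 0" for n
  proof -
    have "has_partials UNIV (?\<psi> n) (\<lambda>i x. (P i (x + h n *\<^sub>R e) - P i x) / h n)"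
      by (intro has_partials_bounded_linear[OF bounded_linear_divide] has_partials_diff has_partials_shift \<phi>p)
    note p = this
    have "test_function S (?\<psi> n)"
      unfolding test_function_def
    proof (intro conjI exI allI impI)
      show "compact (K \<union> (\<lambda>x. x + (- h n) *\<^sub>R e) ` K)"
        by (intro compact_Un K compact_continuous_image continuous_intros)
      show "K \<union> (\<lambda>x. x + (- h n) *\<^sub>R e) ` K \<subseteq> S"
        using K(2) near[of _ "- h n"] h[of n] by auto
      show "?\<psi> n x = 0" if "x \<notin> K \<union> (\<lambda>x. x + (- h n) *\<^sub>R e) ` K" for x
      proof -
        have "x + h n *\<^sub>R e \<notin> K"
        proof
          assume "x + h n *\<^sub>R e \<in> K"
          then have "x + h n *\<^sub>R e + (- h n) *\<^sub>R e \<in> (\<lambda>x. x + (- h n) *\<^sub>R e) ` K" by blast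
          then show False using that by simp
        qed
        then show ?thesis using that K(3) by simp
      qed
    qed (rule has_partials_C1_closure[OF p open_UNIV])
    moreover have "has_weak_div S (\<lambda>x. f x *\<^sub>R axis j 1) (\<lambda>x. \<Sum>i\<in>UNIV. (D i x *\<^sub>R axis j 1) $ i)"
    proof (rule has_weak_div_classical[OF S(1)])
      show "((\<lambda>x. f x *\<^sub>R axis j 1 :: real^'n) has_derivative (\<lambda>h. \<Sum>i\<in>UNIV. h $ i *\<^sub>R (D i x *\<^sub>R axis j 1))) (at x)" if "x \<in> S" for x
        using has_derivative_scaleR_left[OF has_partialsD(1)[OF f that], of "axis j 1 :: real^'n"]
        by (simp add: scaleR_sum_left)
      show "continuous_on S (\<lambda>x. D i x *\<^sub>R axis j 1 :: real^'n)" for i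
        by (intro continuous_intros continuous_on_subset[OF has_partialsD(3)[OF f] closure_subset])
    qed
    ultimately have "(LINT x:S|lborel. (f x *\<^sub>R axis j 1) \<bullet> grad UNIV (?\<psi> n) x +
        (\<Sum>i\<in>UNIV. (D i x *\<^sub>R axis j 1) $ i) * ?\<psi> n x) = 0"
      unfolding has_weak_div_def by blast
    moreover have "(f x *\<^sub>R axis j 1) \<bullet> grad UNIV (?\<psi> n) x + (\<Sum>i\<in>UNIV. (D i x *\<^sub>R axis j 1) $ i) * ?\<psi> n x
       = f x * ((P j (x + h n *\<^sub>R e) - P j x) / h n) + D j x * ?\<psi> n x" for x
    proof -
      have "grad UNIV (?\<psi> n) x = (\<chi> i. (P i (x + h n *\<^sub>R e) - P i x) / h n)" by (rule grad_eq[OF p]) auto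
      moreover have "(\<Sum>i\<in>UNIV. (D i x *\<^sub>R axis j 1) $ i) = D j x"
        by (simp add: axis_def if_distrib cong: if_cong)
      ultimately show ?thesis by (simp add: inner_axis')
    qed
    ultimately show ?thesis by simp
  qed

  \<comment> \<open>Extension by zero makes translations of the whole space possible; on
    \<open>K\<close> shifted by at most \<open>\<delta>\<close> it still coincides with
    \<open>f\<close>.\<close>
  define f0 where "f0 x = indicator S x * f x" for x
  have f0m: "f0 \<in> borel_measurable borel"
    using set_integrable_continuous[OF S(2,1) has_partialsD(2)[OF f]] unfolding set_integrable_def f0_def[abs_def] by auto
  let ?q = "\<lambda>n x. (f0 (x + (- h n) *\<^sub>R e) - f0 x) / h n"
  \<comment> \<open>Discrete integration by parts: a translation moves the forward difference off
    \<open>P j\<close> and onto \<open>f\<close>, where it becomes a backward difference with the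
    opposite sign.\<close>
  have shift: "(LINT x:S|lborel. f x * ((P j (x + h n *\<^sub>R e) - P j x) / h n)) = (LINT x|lborel. ?q n x * P j x)" for n
  proof -
    have Ka: "compact ((\<lambda>x. x + (- h n) *\<^sub>R e) ` K)" by (intro K compact_continuous_image continuous_intros)
    have Ki: "x \<in> (\<lambda>x. x + (- h n) *\<^sub>R e) ` K" if "x + h n *\<^sub>R e \<in> K" for x
      using image_eqI[of x "\<lambda>x. x + (- h n) *\<^sub>R e", OF _ that] by simp
    have i1: "set_integrable lborel S (\<lambda>x. f x * P j (x + h n *\<^sub>R e))"
    proof (rule set_integrable_compact_support[OF Ka])
      show "continuous_on S (\<lambda>x. f x * P j (x + h n *\<^sub>R e))"
        by (intro continuous_intros continuous_on_subset[OF has_partialsD(2)[OF f] closure_subset]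
            continuous_on_compose2[OF cP[of UNIV]]) auto
      show "(\<lambda>x. x + (- h n) *\<^sub>R e) ` K \<subseteq> S"
        using near[of _ "- h n"] h[of n] by (intro image_subsetI) simp
      show "f x * P j (x + h n *\<^sub>R e) = 0" if "x \<notin> (\<lambda>x. x + (- h n) *\<^sub>R e) ` K" for x
        using P0[of "x + h n *\<^sub>R e"] Ki[of x] that by (cases "x + h n *\<^sub>R e \<in> K") simp_all
    qed
    have i2: "set_integrable lborel S (\<lambda>x. f x * P j x)"
      by (rule set_integrable_compact_support[OF K(1,2)])
         (use P0 in \<open>auto intro!: continuous_intros cP continuous_on_subset[OF has_partialsD(2)[OF f] closure_subset]\<close>)
    have Pm: "P j \<in> borel_measurable borel" by (rule borel_measurable_continuous_onI[OF cP])
    have tm: "(\<lambda>x. f0 (x + (- h n) *\<^sub>R e)) \<in> borel_measurable borel"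
      by (rule measurable_compose[OF borel_measurable_continuous_onI f0m]) (intro continuous_intros)
    have tr: "(LINT x|lborel. f0 (x + (- h n) *\<^sub>R e) * P j x) = (LINT x|lborel. f0 x * P j (x + h n *\<^sub>R e))"
      using lborel_integral_translate[of "\<lambda>x. f0 (x + (- h n) *\<^sub>R e) * P j x" "h n *\<^sub>R e"]
        borel_measurable_times[OF tm Pm] by (simp add: add.commute)
    have j1: "integrable lborel (\<lambda>x. f0 (x + (- h n) *\<^sub>R e) * P j x)"
    proof -
      have "integrable lborel (\<lambda>x. f0 x * P j (x + h n *\<^sub>R e))"
        using i1 by (simp add: set_integrable_def f0_def mult.assoc)
      then have "integrable (distr lborel borel ((+) (- h n *\<^sub>R e))) (\<lambda>x. f0 x * P j (x + h n *\<^sub>R e))"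
        by (simp add: lborel_distr_plus)
      then show ?thesis
        by (subst (asm) integrable_distr_eq) (auto intro!: borel_measurable_times f0m
            measurable_compose[OF _ Pm] simp: add.commute)
    qed
    have j2: "integrable lborel (\<lambda>x. f0 x * P j x)"
      using i2 by (simp add: set_integrable_def f0_def mult.assoc)
    have "(LINT x:S|lborel. f x * ((P j (x + h n *\<^sub>R e) - P j x) / h n)) =
        ((LINT x|lborel. f0 x * P j (x + h n *\<^sub>R e)) - (LINT x|lborel. f0 x * P j x)) / h n"
    proof -
      have "(LINT x:S|lborel. f x * ((P j (x + h n *\<^sub>R e) - P j x) / h n)) =
          (LINT x:S|lborel. f x * P j (x + h n *\<^sub>R e) - f x * P j x) / h n"
        by (subst set_integral_divide_zero[symmetric]) (simp add: algebra_simps)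
      also have "(LINT x:S|lborel. f x * P j (x + h n *\<^sub>R e) - f x * P j x) =
          (LINT x:S|lborel. f x * P j (x + h n *\<^sub>R e)) - (LINT x:S|lborel. f x * P j x)"
        by (rule set_integral_diff(2)[OF i1 i2])
      finally show ?thesis by (simp add: set_lebesgue_integral_def f0_def mult.assoc)
    qed
    also have "\<dots> = (LINT x|lborel. f0 (x + (- h n) *\<^sub>R e) * P j x - f0 x * P j x) / h n"
      unfolding tr[symmetric] by (simp only: Bochner_Integration.integral_diff[OF j1 j2])
    also have "\<dots> = (LINT x|lborel. (f0 (x + (- h n) *\<^sub>R e) * P j x - f0 x * P j x) / h n)"
      by (rule integral_divide_zero[symmetric])
    also have "\<dots> = (LINT x|lborel. ?q n x * P j x)"
      by (intro Bochner_Integration.integral_cong refl) (simp add: left_diff_distrib)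
    finally show ?thesis .
  qed

  have quot: "((\<lambda>s. f (x + s *\<^sub>R e)) has_real_derivative D i (x + s *\<^sub>R e)) (at s)" if "x + s *\<^sub>R e \<in> S" for x s
    using has_partials_along_axis[OF f, of x s i] that
    by (simp add: e_def has_real_derivative_iff_has_vector_derivative)
  have lim1: "(\<lambda>n. LINT x|lborel. ?q n x * P j x) \<longlonglongrightarrow> (LINT x|lborel. - (indicator S x * D i x) * P j x)"
  proof (rule integral_dominated_convergence[where w = "\<lambda>x. indicator K x *\<^sub>R (M' * B)"])
    have Pm: "P j \<in> borel_measurable lborel" using borel_measurable_continuous_onI[OF cP] by simp
    have "(\<lambda>x. indicator S x *\<^sub>R D i x) \<in> borel_measurable lborel"
      using set_integrable_continuous[OF S(2,1) has_partialsD(3)[OF f]] unfolding set_integrable_def by auto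
    then show "(\<lambda>x. - (indicator S x * D i x) * P j x) \<in> borel_measurable lborel" using Pm by simp
    have "(\<lambda>x. f0 (x + (- h n) *\<^sub>R e)) \<in> borel_measurable borel" for n
      by (rule measurable_compose[OF borel_measurable_continuous_onI f0m]) (intro continuous_intros)
    then have tm: "(\<lambda>x. f0 (x + (- h n) *\<^sub>R e)) \<in> borel_measurable lborel" for n by simp
    then show "(\<lambda>x. ?q n x * P j x) \<in> borel_measurable lborel" for n
      using Pm f0m by (intro borel_measurable_times borel_measurable_divide borel_measurable_diff) auto
    show "integrable lborel (\<lambda>x. indicator K x *\<^sub>R (M' * B))"
      by (rule borel_integrable_compact[OF K(1) continuous_on_const])
    have f0K: "f0 (x + s *\<^sub>R e) = f (x + s *\<^sub>R e)" if "x \<in> K" "\<bar>s\<bar> \<le> \<delta>" for x s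
      using near[OF that] by (simp add: f0_def)
    show "AE x in lborel. (\<lambda>n. ?q n x * P j x) \<longlonglongrightarrow> - (indicator S x * D i x) * P j x"
    proof (rule AE_I2)
      fix x
      show "(\<lambda>n. ?q n x * P j x) \<longlonglongrightarrow> - (indicator S x * D i x) * P j x"
      proof (cases "x \<in> K")
        case True
        have "((\<lambda>r. (f (x + (0 + r) *\<^sub>R e) - f (x + 0 *\<^sub>R e)) / r) \<longlongrightarrow> D i (x + 0 *\<^sub>R e)) (at 0)"
          using quot[of x 0] near[OF True, of 0] \<delta>(1) by (simp add: DERIV_def)
        from filterlim_compose[OF this filt(2)]
        have "(\<lambda>n. (f (x + (- h n) *\<^sub>R e) - f x) / (- h n)) \<longlonglongrightarrow> D i x" by simp
        from tendsto_minus[OF this]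
        have "(\<lambda>n. ?q n x) \<longlonglongrightarrow> - D i x"
          using f0K[OF True, of "- h _"] f0K[OF True, of 0] h \<delta>(1) by (simp add: less_imp_le)
        then show ?thesis using K(2) True by (intro tendsto_intros) auto
      qed (simp add: P0)
    qed
    show "AE x in lborel. norm (?q n x * P j x) \<le> indicator K x *\<^sub>R (M' * B)" for n
    proof (rule AE_I2)
      fix x
      show "norm (?q n x * P j x) \<le> indicator K x *\<^sub>R (M' * B)"
      proof (cases "x \<in> K")
        case True
        have "norm (f (x + (- h n) *\<^sub>R e) - f (x + 0 *\<^sub>R e)) \<le> M' * norm (- h n - 0)"
        proof (rule field_differentiable_bound[where S = "{-\<delta>..\<delta>}" and f' = "\<lambda>s. D i (x + s *\<^sub>R e)"])
          show "((\<lambda>s. f (x + s *\<^sub>R e)) has_field_derivative D i (x + s *\<^sub>R e)) (at s within {-\<delta>..\<delta>})"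
            if "s \<in> {-\<delta>..\<delta>}" for s
            by (rule has_field_derivative_at_within[OF quot[OF near[OF True]]]) (use that in auto)
          show "norm (D i (x + s *\<^sub>R e)) \<le> M'" if "s \<in> {-\<delta>..\<delta>}" for s
            by (rule M'(2)[OF subsetD[OF closure_subset near[OF True]]]) (use that in auto)
          show "- h n \<in> {-\<delta>..\<delta>}" "0 \<in> {-\<delta>..\<delta>}" using h[of n] \<delta>(1) by auto
        qed simp
        then have "norm (?q n x) \<le> M'"
          using f0K[OF True, of "- h n"] f0K[OF True, of 0] h[of n] \<delta>(1) by (simp add: divide_le_eq)
        then have "norm (?q n x) * norm (P j x) \<le> M' * B"
          using M'(1) by (intro mult_mono B) auto
        then show ?thesis using True by (simp only: norm_mult) simp
      qed (simp add: P0)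
    qed
  qed

  have lim2: "(\<lambda>n. LINT x:S|lborel. D j x * ?\<psi> n x) \<longlonglongrightarrow> (LINT x:S|lborel. D j x * P i x)"
    unfolding set_lebesgue_integral_def
  proof (rule integral_dominated_convergence[where w = "\<lambda>x. indicator S x *\<^sub>R (M * B)"])
    have Dm: "(\<lambda>x. indicator S x *\<^sub>R D j x) \<in> borel_measurable lborel"
      using set_integrable_continuous[OF S(2,1) has_partialsD(3)[OF f]] unfolding set_integrable_def by auto
    then have "(\<lambda>x. (indicator S x *\<^sub>R D j x) * P i x) \<in> borel_measurable lborel"
      by (intro borel_measurable_times) (simp_all add: borel_measurable_continuous_onI[OF cP])
    then show "(\<lambda>x. indicator S x *\<^sub>R (D j x * P i x)) \<in> borel_measurable lborel" by (simp add: mult.assoc)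
    have "continuous_on UNIV (?\<psi> n)" for n
      using h[of n] by (intro continuous_intros continuous_on_compose2[OF c\<phi>[of UNIV]] c\<phi>) auto
    then have "(\<lambda>x. (indicator S x *\<^sub>R D j x) * ?\<psi> n x) \<in> borel_measurable lborel" for n
      using Dm by (intro borel_measurable_times) (simp_all add: borel_measurable_continuous_onI)
    then show "(\<lambda>x. indicator S x *\<^sub>R (D j x * ?\<psi> n x)) \<in> borel_measurable lborel" for n by (simp add: mult.assoc)
    show "integrable lborel (\<lambda>x. indicator S x *\<^sub>R (M * B))"
      using set_integrable_continuous[OF S(2,1) continuous_on_const] by (simp add: set_integrable_def)
    have q: "((\<lambda>s. \<phi> (x + s *\<^sub>R e)) has_real_derivative P i (x + s *\<^sub>R e)) (at s)" for x s
      using has_partials_along_axis[OF \<phi>p, of x s i]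
      by (simp add: e_def has_real_derivative_iff_has_vector_derivative)
    show "AE x in lborel. (\<lambda>n. indicator S x *\<^sub>R (D j x * ?\<psi> n x)) \<longlonglongrightarrow> indicator S x *\<^sub>R (D j x * P i x)"
    proof (rule AE_I2)
      fix x
      have "((\<lambda>r. (\<phi> (x + (0 + r) *\<^sub>R e) - \<phi> (x + 0 *\<^sub>R e)) / r) \<longlongrightarrow> P i (x + 0 *\<^sub>R e)) (at 0)"
        using q[of x 0] by (simp add: DERIV_def)
      from filterlim_compose[OF this filt(1)]
      have "(\<lambda>n. ?\<psi> n x) \<longlonglongrightarrow> P i x" by simp
      then show "(\<lambda>n. indicator S x *\<^sub>R (D j x * ?\<psi> n x)) \<longlonglongrightarrow> indicator S x *\<^sub>R (D j x * P i x)"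
        by (intro tendsto_intros)
    qed
    show "AE x in lborel. norm (indicator S x *\<^sub>R (D j x * ?\<psi> n x)) \<le> indicator S x *\<^sub>R (M * B)" for n
    proof (rule AE_I2)
      fix x
      have "norm (\<phi> (x + h n *\<^sub>R e) - \<phi> (x + 0 *\<^sub>R e)) \<le> B * norm (h n - 0)"
        by (rule field_differentiable_bound[where S = UNIV and f' = "\<lambda>s. P i (x + s *\<^sub>R e)",
              OF convex_UNIV has_field_derivative_at_within[OF q] B(2) UNIV_I UNIV_I])
      then have "norm (?\<psi> n x) \<le> B" using h[of n] by (simp add: divide_le_eq)
      then show "norm (indicator S x *\<^sub>R (D j x * ?\<psi> n x)) \<le> indicator S x *\<^sub>R (M * B)"
      proof (cases "x \<in> S")
        case True
        then have "norm (D j x) * norm (?\<psi> n x) \<le> M * B"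
          using \<open>norm (?\<psi> n x) \<le> B\<close> M(1) subsetD[OF closure_subset True] by (intro mult_mono M(2)) auto
        then show ?thesis using True by (simp only: norm_mult norm_scaleR) simp
      qed simp
    qed
  qed

  have i\<psi>: "set_integrable lborel S (\<lambda>x. D j x * ?\<psi> n x)"
    and iP: "set_integrable lborel S (\<lambda>x. f x * ((P j (x + h n *\<^sub>R e) - P j x) / h n))" for n
  proof -
    have "continuous_on (closure S) (\<lambda>x. \<phi> (x + h n *\<^sub>R e))" "continuous_on (closure S) (\<lambda>x. P j (x + h n *\<^sub>R e))"
      by (rule continuous_on_compose2[OF c\<phi>[of UNIV]] continuous_on_compose2[OF cP[of UNIV]];
          auto intro!: continuous_intros)+
    then have c: "continuous_on (closure S) (\<lambda>x. D j x * ?\<psi> n x)"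
      "continuous_on (closure S) (\<lambda>x. f x * ((P j (x + h n *\<^sub>R e) - P j x) / h n))"
      using h[of n] by (auto intro!: continuous_on_mult continuous_on_divide continuous_on_diff
          continuous_on_const has_partialsD[OF f] c\<phi> cP)
    show "set_integrable lborel S (\<lambda>x. D j x * ?\<psi> n x)"
      by (rule set_integrable_continuous[OF S(2,1) c(1)])
    show "set_integrable lborel S (\<lambda>x. f x * ((P j (x + h n *\<^sub>R e) - P j x) / h n))"
      by (rule set_integrable_continuous[OF S(2,1) c(2)])
  qed
  have "(LINT x|lborel. ?q n x * P j x) + (LINT x:S|lborel. D j x * ?\<psi> n x) = 0" for n
    using test[of n] unfolding set_integral_add(2)[OF iP[of n] i\<psi>[of n]] shift[of n] .
  with tendsto_add[OF lim1 lim2]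
  have "(LINT x|lborel. - (indicator S x * D i x) * P j x) + (LINT x:S|lborel. D j x * P i x) = 0"
    by (simp add: LIMSEQ_const_iff)
  moreover have "(LINT x:S|lborel. (D j x *\<^sub>R axis i 1 - D i x *\<^sub>R axis j 1) \<bullet> grad UNIV \<phi> x + 0 * \<phi> x) =
     (LINT x:S|lborel. D j x * P i x) - (LINT x:S|lborel. D i x * P j x)"
  proof -
    have "(D j x *\<^sub>R axis i 1 - D i x *\<^sub>R axis j 1) \<bullet> grad UNIV \<phi> x + 0 * \<phi> x = D j x * P i x - D i x * P j x" for x
      by (simp add: inner_diff_left inner_axis' grad_def P_def)
    moreover have "set_integrable lborel S (\<lambda>x. D a x * P b x)" for a b
      by (intro set_integrable_continuous S continuous_intros has_partialsD[OF f] cP)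
    ultimately show ?thesis by (simp add: set_integral_diff)
  qed
  moreover have "(LINT x|lborel. - (indicator S x * D i x) * P j x) = - (LINT x:S|lborel. D i x * P j x)"
    unfolding set_lebesgue_integral_def Bochner_Integration.integral_minus[symmetric]
    by (intro Bochner_Integration.integral_cong refl) simp
  ultimately show "(LINT x:S|lborel. (D j x *\<^sub>R axis i 1 - D i x *\<^sub>R axis j 1) \<bullet> grad UNIV \<phi> x + 0 * \<phi> x) = 0"
    by linarith
qed

section \<open>Transport of weak divergences by diffeomorphisms\<close>

lemma matrix_partials:
  fixes E :: "'n::finite \<Rightarrow> real^'m"
  shows "matrix (\<lambda>h. \<Sum>i\<in>UNIV. h $ i *\<^sub>R E i) = (\<chi> i j. E j $ i)"
  by (simp add: matrix_def sum_axis_scaleR)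

text \<open>The test function is carried along by \<open>q\<close>, and the change of variables
  formula compares the two weak identities. The last hypothesis is the Piola transform of
  \<open>F\<close>, written without inverting the Jacobian matrix.\<close>

lemma has_weak_div_transport:
  fixes y q F Fh :: "real^'n \<Rightarrow> real^'n"
  assumes S: "open S" "open (y ` S)" and qy: "\<And>x. x \<in> S \<Longrightarrow> q (y x) = x"
    and y: "\<And>x. x \<in> S \<Longrightarrow> (y has_derivative (\<lambda>h. \<Sum>i\<in>UNIV. h $ i *\<^sub>R E i x)) (at x)"
    and E: "\<And>i. continuous_on S (E i)"
    and q: "\<And>x. x \<in> y ` S \<Longrightarrow> (q has_derivative (\<lambda>h. \<Sum>i\<in>UNIV. h $ i *\<^sub>R E' i x)) (at x)"
    and E': "\<And>i. continuous_on (y ` S) (E' i)"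
    and F: "continuous_on (y ` S) F" and f: "continuous_on (y ` S) f"
    and weak: "has_weak_div (y ` S) F f"
    and rel: "\<And>x. x \<in> S \<Longrightarrow> \<bar>det (\<chi> i j. E j x $ i)\<bar> *\<^sub>R F (y x) = (\<chi> i j. E j x $ i) *v Fh x"
  shows "has_weak_div S Fh (\<lambda>x. \<bar>det (\<chi> i j. E j x $ i)\<bar> * f (y x))"
  unfolding has_weak_div_def
proof (intro allI impI)
  let ?J = "\<lambda>x. \<bar>det (\<chi> i j. E j x $ i)\<bar>"
  fix \<phi> assume \<phi>: "test_function S \<phi>"
  then obtain K where K: "compact K" "K \<subseteq> S" "\<And>x. x \<notin> K \<Longrightarrow> \<phi> x = 0"
    by (auto simp: test_function_def)
  define P where "P i = partial UNIV i \<phi>" for i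
  have \<phi>p: "has_partials UNIV \<phi> P"
    using \<phi> unfolding P_def by (auto simp: test_function_def intro: has_partials_partial)
  have cP: "continuous_on A (P i)" and c\<phi>: "continuous_on A \<phi>" for A i
    using has_partialsD(2,3)[OF \<phi>p] by (auto intro: continuous_on_subset[of UNIV])
  have cy: "continuous_on S y" by (intro continuous_at_imp_continuous_on ballI has_derivative_continuous[OF y])
  have cq: "continuous_on (y ` S) q" by (intro continuous_at_imp_continuous_on ballI has_derivative_continuous[OF q])
  define \<psi> where "\<psi> x = (if x \<in> y ` S then \<phi> (q x) else 0)" for x
  let ?D = "\<lambda>i x. \<Sum>j\<in>UNIV. E' i x $ j * P j (q x)"
  have K': "compact (y ` K)" "y ` K \<subseteq> y ` S"
    using K by (auto intro!: compact_continuous_image continuous_on_subset[OF cy])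
  have \<psi>0: "\<phi> (q x) = 0" if "x \<in> y ` S" "x \<notin> y ` K" for x
    using that qy K(3) by (metis imageE imageI)
  have ext: "has_partials UNIV \<psi> (\<lambda>i x. if x \<in> y ` S then ?D i x else 0)"
    unfolding \<psi>_def
  proof (rule has_partials_extend_zero[OF S(2) compact_imp_closed[OF K'(1)] K'(2)])
    fix x assume x: "x \<in> y ` S"
    have "(\<Sum>j\<in>UNIV. (\<Sum>i\<in>UNIV. h $ i *\<^sub>R E' i x) $ j *\<^sub>R P j (q x)) = (\<Sum>i\<in>UNIV. h $ i *\<^sub>R ?D i x)" for h
      by (simp add: scaleR_sum_left scaleR_sum_right sum_distrib_left sum_distrib_right mult.assoc) (rule sum.swap)
    with has_derivative_compose[OF q[OF x] has_partialsD(1)[OF \<phi>p UNIV_I]]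
    show "((\<lambda>x. \<phi> (q x)) has_derivative (\<lambda>h. \<Sum>i\<in>UNIV. h $ i *\<^sub>R ?D i x)) (at x)" by simp
  next
    show "continuous_on (y ` S) (?D i)" for i
      by (intro continuous_intros E' continuous_on_compose2[OF cP[of UNIV] cq]) auto
  qed (rule \<psi>0)
  have "test_function (y ` S) \<psi>"
    unfolding test_function_def using K' \<psi>0 has_partials_C1_closure[OF ext]
    by (intro conjI exI[of _ "y ` K"]) (auto simp: \<psi>_def)
  with weak have 0: "(LINT x:y ` S|lborel. F x \<bullet> grad UNIV \<psi> x + f x * \<psi> x) = 0"
    by (simp add: has_weak_div_def)
  have cg\<psi>: "continuous_on A (grad UNIV \<psi>)" for A
    using continuous_on_grad[OF has_partials_C1_closure[OF ext open_UNIV]] by (auto intro: continuous_on_subset[of UNIV])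
  have c\<psi>: "continuous_on A \<psi>" for A using has_partialsD(2)[OF ext] by (auto intro: continuous_on_subset[of UNIV])
  have chain: "P j x = (\<Sum>i\<in>UNIV. E j x $ i * grad UNIV \<psi> (y x) $ i)" if x: "x \<in> S" for x j
  proof -
    have "((\<lambda>x. \<psi> (y x)) has_derivative
       (\<lambda>h. \<Sum>k\<in>UNIV. (\<Sum>i\<in>UNIV. h $ i *\<^sub>R E i x) $ k *\<^sub>R partial UNIV k \<psi> (y x))) (at x)"
      by (rule has_derivative_compose[OF y[OF x]])
         (rule has_partialsD(1)[OF has_partials_partial[OF has_partials_C1_closure[OF ext open_UNIV]] UNIV_I])
    then have "(\<phi> has_derivative
       (\<lambda>h. \<Sum>k\<in>UNIV. (\<Sum>i\<in>UNIV. h $ i *\<^sub>R E i x) $ k *\<^sub>R partial UNIV k \<psi> (y x))) (at x)"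
      by (rule has_derivative_transform_within_open[OF _ S(1) x]) (simp add: \<psi>_def qy)
    from has_derivative_unique[OF has_partialsD(1)[OF \<phi>p UNIV_I] this]
    have "(\<Sum>i\<in>UNIV. axis j 1 $ i *\<^sub>R P i x) =
      (\<Sum>k\<in>UNIV. (\<Sum>i\<in>UNIV. axis j 1 $ i *\<^sub>R E i x) $ k *\<^sub>R partial UNIV k \<psi> (y x))" by (rule fun_cong)
    then show ?thesis unfolding sum_axis_scaleR by (simp add: grad_def)
  qed
  have pt: "Fh x \<bullet> grad UNIV \<phi> x + (?J x * f (y x)) * \<phi> x = ?J x * (F (y x) \<bullet> grad UNIV \<psi> (y x) + f (y x) * \<psi> (y x))"
    if x: "x \<in> S" for x
  proof -
    have "Fh x \<bullet> grad UNIV \<phi> x = (\<Sum>j\<in>UNIV. \<Sum>i\<in>UNIV. Fh x $ j * (E j x $ i * grad UNIV \<psi> (y x) $ i))"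
      unfolding inner_grad_eq P_def[symmetric] chain[OF x] by (simp add: sum_distrib_left)
    also have "\<dots> = (\<Sum>i\<in>UNIV. \<Sum>j\<in>UNIV. Fh x $ j * (E j x $ i * grad UNIV \<psi> (y x) $ i))" by (rule sum.swap)
    also have "\<dots> = ((\<chi> i j. E j x $ i) *v Fh x) \<bullet> grad UNIV \<psi> (y x)"
      by (simp add: inner_vec_def matrix_vector_mult_def sum_distrib_right sum_distrib_left mult_ac)
    also have "\<dots> = ?J x * (F (y x) \<bullet> grad UNIV \<psi> (y x))" unfolding rel[OF x, symmetric] by simp
    finally show ?thesis using x by (simp add: \<psi>_def qy algebra_simps)
  qed
  have gz: "F (y x) \<bullet> grad UNIV \<psi> (y x) + f (y x) * \<psi> (y x) = 0" if "x \<in> S" "x \<notin> K" for x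
  proof -
    have "y x \<notin> y ` K" using that qy K(2) by (metis imageE subsetD)
    moreover from this have "grad UNIV \<psi> (y x) = 0"
      using has_partials_zero_outside[OF ext compact_imp_closed[OF K'(1)], of "y x"] \<psi>0 that
      by (subst grad_eq[OF ext]) (auto simp: vec_eq_iff \<psi>_def)
    ultimately show ?thesis using \<psi>0[of "y x"] that by (auto simp: \<psi>_def)
  qed
  have inj: "inj_on y S" by (metis inj_onI qy)
  have I1: "set_integrable lborel (y ` S) (\<lambda>x. F x \<bullet> grad UNIV \<psi> x + f x * \<psi> x)"
  proof (rule set_integrable_compact_support[OF K'])
    show "continuous_on (y ` S) (\<lambda>x. F x \<bullet> grad UNIV \<psi> x + f x * \<psi> x)"
      by (intro continuous_intros F f c\<psi> cg\<psi>)
    show "F x \<bullet> grad UNIV \<psi> x + f x * \<psi> x = 0" if "x \<in> y ` S" "x \<notin> y ` K" for x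
      using gz that by auto
  qed
  have I2: "set_integrable lborel S (\<lambda>x. ?J x * (F (y x) \<bullet> grad UNIV \<psi> (y x) + f (y x) * \<psi> (y x)))"
  proof (rule set_integrable_compact_support[OF K(1,2)])
    have "continuous_on S (\<lambda>x. det (\<chi> i j. E j x $ i))"
      unfolding det_def vec_lambda_beta
      by (intro continuous_on_sum continuous_on_mult continuous_on_const continuous_on_prod continuous_on_component E)
    moreover have "continuous_on S (\<lambda>x. F (y x))" "continuous_on S (\<lambda>x. f (y x))"
      by (rule continuous_on_compose2[OF F cy] continuous_on_compose2[OF f cy]; simp)+
    moreover have "continuous_on S (\<lambda>x. \<psi> (y x))" "continuous_on S (\<lambda>x. grad UNIV \<psi> (y x))"
      by (rule continuous_on_compose2[OF c\<psi>[of UNIV] cy] continuous_on_compose2[OF cg\<psi>[of UNIV] cy]; simp)+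
    ultimately show "continuous_on S (\<lambda>x. ?J x * (F (y x) \<bullet> grad UNIV \<psi> (y x) + f (y x) * \<psi> (y x)))"
      by (intro continuous_on_mult continuous_on_rabs continuous_on_add continuous_on_inner)
    show "?J x * (F (y x) \<bullet> grad UNIV \<psi> (y x) + f (y x) * \<psi> (y x)) = 0" if "x \<in> S" "x \<notin> K" for x
      using gz[OF that] by simp
  qed
  have "(LINT x:S|lborel. Fh x \<bullet> grad UNIV \<phi> x + (?J x * f (y x)) * \<phi> x) =
      (LINT x:S|lborel. ?J x * (F (y x) \<bullet> grad UNIV \<psi> (y x) + f (y x) * \<psi> (y x)))"
    using pt S(1) by (intro set_lebesgue_integral_cong) auto
  also have "\<dots> = (LINT x:y ` S|lborel. F x \<bullet> grad UNIV \<psi> x + f x * \<psi> x)"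
    using set_integral_change_of_variables[OF S(1) y inj S(2) I1, unfolded matrix_partials, OF _ I2] by simp
  finally show "(LINT x:S|lborel. Fh x \<bullet> grad UNIV \<phi> x + (?J x * f (y x)) * \<phi> x) = 0" using 0 by simp
qed

section \<open>Images of graph domains\<close>

lemma bounded_linear_partials:
  fixes D :: "'n::finite \<Rightarrow> 'b::real_normed_vector"
  shows "bounded_linear (\<lambda>v. \<Sum>i\<in>UNIV. v $ i *\<^sub>R D i)"
  by (intro bounded_linear_sum bounded_linear_scaleR_left[THEN bounded_linear_compose] bounded_linear_vec_nth)

lemma norm_partials_diff_le:
  fixes D E :: "'n::finite \<Rightarrow> 'b::real_normed_vector"
  shows "norm ((\<Sum>i\<in>UNIV. v $ i *\<^sub>R D i) - (\<Sum>i\<in>UNIV. v $ i *\<^sub>R E i)) \<le> norm v * (\<Sum>i\<in>UNIV. norm (D i - E i))"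
proof -
  have "(\<Sum>i\<in>UNIV. v $ i *\<^sub>R D i) - (\<Sum>i\<in>UNIV. v $ i *\<^sub>R E i) = (\<Sum>i\<in>UNIV. v $ i *\<^sub>R (D i - E i))"
    by (simp add: sum_subtractf scaleR_diff_right)
  also have "norm \<dots> \<le> (\<Sum>i\<in>UNIV. norm v * norm (D i - E i))"
    by (rule sum_norm_le) (simp add: component_le_norm_cart mult_right_mono)
  finally show ?thesis by (simp add: sum_distrib_left)
qed

text \<open>The mean value inequality on the convex open set, applied to \<open>g\<close> minus its
  candidate linearisation at \<open>x\<close>, gives the estimate for pairs of interior points near
  \<open>x\<close>; both points are then moved to the closure by continuity.\<close>

lemma has_derivative_within_convex_closure:
  fixes g :: "real^'n \<Rightarrow> 'b::real_normed_vector"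
  assumes C: "convex C" "open C" "C \<subseteq> C'" "C' \<subseteq> closure C"
    and der: "\<And>x. x \<in> C \<Longrightarrow> (g has_derivative (\<lambda>v. \<Sum>i\<in>UNIV. v $ i *\<^sub>R D i x)) (at x)"
    and g: "continuous_on C' g" and D: "\<And>i. continuous_on C' (D i)" and x: "x \<in> C'"
  shows "(g has_derivative (\<lambda>v. \<Sum>i\<in>UNIV. v $ i *\<^sub>R D i x)) (at x within C')"
  unfolding has_derivative_within_alt
proof (intro conjI allI impI bounded_linear_partials)
  fix e :: real assume e: "0 < e"
  define L where "L y v = (\<Sum>i\<in>UNIV. v $ i *\<^sub>R D i y)" for y v
  have "((\<lambda>y. \<Sum>i\<in>UNIV. norm (D i y - D i x)) \<longlongrightarrow> (\<Sum>i\<in>(UNIV::'n set). norm (D i x - D i x))) (at x within C')"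
    using D x by (intro tendsto_intros) (auto simp: continuous_on_def)
  then have "\<forall>\<^sub>F y in at x within C'. (\<Sum>i\<in>UNIV. norm (D i y - D i x)) < e"
    by (rule order_tendstoD(2)) (use e in simp)
  then obtain d where d0: "0 < d" "\<And>y. y \<in> C' \<Longrightarrow> y \<noteq> x \<Longrightarrow> dist y x < d \<Longrightarrow> (\<Sum>i\<in>UNIV. norm (D i y - D i x)) < e"
    unfolding eventually_at by blast
  have d: "0 < d" "\<And>y. y \<in> C' \<Longrightarrow> dist y x < d \<Longrightarrow> (\<Sum>i\<in>UNIV. norm (D i y - D i x)) < e"
  proof -
    show "(\<Sum>i\<in>UNIV. norm (D i y - D i x)) < e" if "y \<in> C'" "dist y x < d" for y
      using d0(2)[of y] that e by (cases "y = x") simp_all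
  qed (rule d0(1))
  have conv: "convex (C \<inter> ball x d)" using C(1) by (intro convex_Int convex_ball)
  have cl: "C' \<inter> ball x d \<subseteq> closure (C \<inter> ball x d)"
    using C(4) open_Int_closure_subset[of "ball x d" C] by (auto simp: Int_commute)
  have main: "norm (g b - g a - L x (b - a)) \<le> e * norm (b - a)" if "a \<in> C \<inter> ball x d" "b \<in> C \<inter> ball x d" for a b
  proof -
    have "norm ((g b - L x b) - (g a - L x a)) \<le> e * norm (b - a)"
    proof (rule differentiable_bound[OF conv])
      fix y assume y: "y \<in> C \<inter> ball x d"
      show "((\<lambda>y. g y - L x y) has_derivative (\<lambda>v. L y v - L x v)) (at y within C \<inter> ball x d)"
      proof -
        have "y \<in> C" using y by simp
        show ?thesis
          unfolding L_def
          by (rule has_derivative_diff[OF has_derivative_at_withinI[OF der[OF \<open>y \<in> C\<close>]]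
              bounded_linear_imp_has_derivative[OF bounded_linear_partials]])
      qed
      show "onorm (\<lambda>v. L y v - L x v) \<le> e"
      proof (rule onorm_le)
        fix v
        have "norm (L y v - L x v) \<le> norm v * (\<Sum>i\<in>UNIV. norm (D i y - D i x))"
          unfolding L_def by (rule norm_partials_diff_le)
        also have "\<dots> \<le> norm v * e"
          using d(2)[of y] y C(3) by (intro mult_left_mono) (auto simp: dist_commute less_imp_le)
        finally show "norm (L y v - L x v) \<le> e * norm v" by (simp add: mult.commute)
      qed
    qed (use that in auto)
    moreover have "L x (b - a) = L x b - L x a"
      unfolding L_def by (simp add: scaleR_diff_left sum_subtractf)
    then have "g b - g a - L x (b - a) = (g b - L x b) - (g a - L x a)" by simp
    ultimately show ?thesis by (simp only:)
  qed
  have cL: "continuous_on UNIV (L x)" unfolding L_def by (intro continuous_intros)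
  have "norm (g y - g x - L x (y - x)) \<le> e * norm (y - x)" if y: "y \<in> C'" "norm (y - x) < d" for y
  proof -
    have yc: "y \<in> closure (C \<inter> ball x d)" and xc: "x \<in> closure (C \<inter> ball x d)"
      using cl y x d(1) by (auto simp: dist_norm norm_minus_commute)
    obtain ys where ys: "\<And>n. ys n \<in> C \<inter> ball x d" "ys \<longlonglongrightarrow> y" using yc closure_sequential by metis
    obtain xs where xs: "\<And>n. xs n \<in> C \<inter> ball x d" "xs \<longlonglongrightarrow> x" using xc closure_sequential by metis
    have g_y: "(\<lambda>n. g (ys n)) \<longlonglongrightarrow> g y"
      by (rule continuous_on_tendsto_compose[OF g ys(2) y(1)]) (use ys(1) C(3) in \<open>auto intro!: always_eventually\<close>)
    have g_x: "(\<lambda>n. g (xs n)) \<longlonglongrightarrow> g x"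
      by (rule continuous_on_tendsto_compose[OF g xs(2) x]) (use xs(1) C(3) in \<open>auto intro!: always_eventually\<close>)
    have "(\<lambda>n. L x (ys n - xs n)) \<longlonglongrightarrow> L x (y - x)"
      by (rule continuous_on_tendsto_compose[OF cL tendsto_diff[OF ys(2) xs(2)]]) auto
    then have "(\<lambda>n. norm (g (ys n) - g (xs n) - L x (ys n - xs n))) \<longlonglongrightarrow> norm (g y - g x - L x (y - x))"
      by (intro tendsto_intros g_y g_x)
    moreover have "(\<lambda>n. e * norm (ys n - xs n)) \<longlonglongrightarrow> e * norm (y - x)"
      by (intro tendsto_intros ys xs)
    ultimately show ?thesis
      by (rule LIMSEQ_le) (use main ys(1) xs(1) in blast)
  qed
  then show "\<exists>d>0. \<forall>y\<in>C'. norm (y - x) < d \<longrightarrow> norm (g y - g x - (\<Sum>i\<in>UNIV. (y - x) $ i *\<^sub>R D i x)) \<le> e * norm (y - x)"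
    using d(1) unfolding L_def by blast
qed

text \<open>A shear along axis \<open>k\<close> straightens the boundary patch. Pieces of \<Omega>
  near the frontier are in general not convex, but half balls are, so the mean value inequality
  applies in the straightened coordinates.\<close>

locale flattening =
  fixes \<Omega> U :: "(real^'n) set" and k :: 'n and s :: real and h :: "real^'n \<Rightarrow> real"
  assumes graph: "local_graph \<Omega> U k s h" and h: "C1_closure UNIV h" and open_\<Omega>: "open \<Omega>"
begin

definition T where "T a = a + (s * h a) *\<^sub>R axis k 1"
definition S where "S x = x - (s * h x) *\<^sub>R axis k 1"

lemma TS [simp]: "T (S x) = x" and ST [simp]: "S (T a) = a"
proof -
  have inv: "h (x + c *\<^sub>R axis k 1) = h x" for x c by (rule local_graphD(3)[OF graph])
  have "h (S x) = h x" using inv[of x "- (s * h x)"] by (simp add: S_def)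
  then show "T (S x) = x" by (simp add: T_def) (simp add: S_def)
  have "h (T a) = h a" by (simp add: T_def inv)
  then show "S (T a) = a" by (simp add: S_def) (simp add: T_def)
qed

lemma hT: "h (T a) = h a" and Tk: "s * T a $ k = s * a $ k + h a"
proof -
  show "h (T a) = h a" unfolding T_def by (rule local_graphD(3)[OF graph])
  have "s * (s * h a) = h a" using local_graphD(2)[OF graph] by (metis mult.assoc mult_1)
  then show "s * T a $ k = s * a $ k + h a" by (simp add: T_def distrib_left)
qed

lemma s_nonzero: "s \<noteq> 0"
  using graph by (auto simp: local_graph_def)

lemma T_domain: "T a \<in> U \<Longrightarrow> T a \<in> \<Omega> \<longleftrightarrow> s * a $ k < 0"
  and T_frontier: "T a \<in> U \<Longrightarrow> T a \<in> frontier \<Omega> \<longleftrightarrow> a $ k = 0"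
  and T_closure: "T a \<in> U \<Longrightarrow> T a \<in> closure \<Omega> \<longleftrightarrow> s * a $ k \<le> 0"
proof -
  assume U: "T a \<in> U"
  show 1: "T a \<in> \<Omega> \<longleftrightarrow> s * a $ k < 0" using local_graphD(4)[OF graph U] hT[of a] Tk[of a] by auto
  show 2: "T a \<in> frontier \<Omega> \<longleftrightarrow> a $ k = 0"
    using local_graphD(5)[OF graph U] hT[of a] Tk[of a] s_nonzero by auto
  have "closure \<Omega> = \<Omega> \<union> frontier \<Omega>" using open_\<Omega> closure_subset[of \<Omega>] by (auto simp: frontier_def interior_open)
  with 1 2 s_nonzero show "T a \<in> closure \<Omega> \<longleftrightarrow> s * a $ k \<le> 0" by (auto simp: le_less)
qed

lemma has_partials_T: "has_partials UNIV T (\<lambda>i a. axis i 1 + (s * partial UNIV i h a) *\<^sub>R axis k 1)"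
  using has_partials_add[OF has_partials_id has_partials_bounded_linear[OF bounded_linear_scaleR_left
        has_partials_bounded_linear[OF bounded_linear_mult_right has_partials_partial[OF h]]]]
  by (simp add: T_def[abs_def])

lemma has_partials_S: "has_partials UNIV S (\<lambda>i a. axis i 1 - (s * partial UNIV i h a) *\<^sub>R axis k 1)"
  using has_partials_diff[OF has_partials_id has_partials_bounded_linear[OF bounded_linear_scaleR_left
        has_partials_bounded_linear[OF bounded_linear_mult_right has_partials_partial[OF h]]]]
  by (simp add: S_def[abs_def])

lemma continuous_T: "continuous_on A T" and continuous_S: "continuous_on A S"
  using has_partialsD(2)[OF has_partials_T] has_partialsD(2)[OF has_partials_S]
  by (auto intro: continuous_on_subset[of UNIV])

lemma half_ball:
  assumes "a0 $ k = 0" "0 < r"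
  defines "C \<equiv> ball a0 r \<inter> {a. s * a $ k < 0}" and "C' \<equiv> ball a0 r \<inter> {a. s * a $ k \<le> 0}"
  shows "convex C" "open C" "C \<subseteq> C'" "C' \<subseteq> closure C"
proof -
  have eq: "{a :: real^'n. s * a $ k < 0} = {a. (s *\<^sub>R axis k 1) \<bullet> a < 0}"
    "{a :: real^'n. s * a $ k \<le> 0} = {a. (s *\<^sub>R axis k 1) \<bullet> a \<le> 0}"
    by (auto simp: inner_axis')
  have nz: "s *\<^sub>R axis k (1::real) \<noteq> 0" using s_nonzero by (simp add: axis_eq_0_iff)
  show "convex C" unfolding C_def eq by (intro convex_Int convex_ball convex_halfspace_lt)
  show "open C" unfolding C_def eq by (intro open_Int open_ball open_halfspace_lt)
  show "C \<subseteq> C'" by (auto simp: C_def C'_def)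
  have "closure {a. (s *\<^sub>R axis k 1) \<bullet> a < 0} = {a :: real^'n. (s *\<^sub>R axis k 1) \<bullet> a \<le> 0}"
    by (rule closure_halfspace_lt[OF nz])
  then show "C' \<subseteq> closure C"
    unfolding C_def C'_def eq using open_Int_closure_subset[of "ball a0 r"] by force
qed

text \<open>\<open>E i\<close> comes from the chain rule for the shear, whose \<open>i\<close>-th
  derivative is axis \<open>i\<close> plus \<open>s\<close> times the \<open>i\<close>-th derivative
  of \<open>h\<close> along axis \<open>k\<close>. On the flat side of the half ball the derivative
  is one-sided, by convexity.\<close>

lemma flattened_derivative:
  fixes f :: "real^'n \<Rightarrow> 'b::real_normed_vector"
  assumes f: "has_partials \<Omega> f D" and r: "T ` ball a0 r \<subseteq> U" "0 < r" and a0: "a0 $ k = 0"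
    and a: "a \<in> ball a0 r" "s * a $ k \<le> 0"
  defines "E \<equiv> \<lambda>i a. D i (T a) + (s * partial UNIV i h a) *\<^sub>R D k (T a)"
    and "C' \<equiv> ball a0 r \<inter> {a. s * a $ k \<le> 0}"
  shows "((\<lambda>a. f (T a)) has_derivative (\<lambda>v. \<Sum>i\<in>UNIV. v $ i *\<^sub>R E i a)) (at a within C')"
    and "continuous_on C' (E i)" and "continuous_on C' (\<lambda>a. f (T a))"
proof -
  note hb = half_ball[OF a0 r(2)]
  have T\<Omega>: "T b \<in> \<Omega>" if "b \<in> ball a0 r \<inter> {a. s * a $ k < 0}" for b
  proof -
    have "T b \<in> U" using r(1) that by auto
    then show ?thesis using T_domain[of b] that by simp
  qed
  have Tcl: "T ` C' \<subseteq> closure \<Omega>" using T_closure r(1) by (auto simp: C'_def)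
  show cE: "continuous_on C' (E i)" for i
    unfolding E_def
    by (intro continuous_intros continuous_on_compose2[OF has_partialsD(3)[OF f] continuous_T Tcl]
        continuous_on_subset[OF has_partialsD(3)[OF has_partials_partial[OF h]]]) auto
  show cf: "continuous_on C' (\<lambda>a. f (T a))"
    by (rule continuous_on_compose2[OF has_partialsD(2)[OF f] continuous_T Tcl])
  have der: "((\<lambda>a. f (T a)) has_derivative (\<lambda>v. \<Sum>i\<in>UNIV. v $ i *\<^sub>R E i b)) (at b)"
    if b: "b \<in> ball a0 r \<inter> {a. s * a $ k < 0}" for b
  proof -
    have p: "has_partials (ball a0 r \<inter> {a. s * a $ k < 0}) T (\<lambda>i a. axis i 1 + (s * partial UNIV i h a) *\<^sub>R axis k 1)"
      by (rule has_partials_subset[OF has_partials_T]) auto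
    have "(\<Sum>j\<in>UNIV. (axis i 1 + (s * partial UNIV i h b) *\<^sub>R axis k 1) $ j *\<^sub>R D j (T b)) = E i b" for i
      by (simp add: scaleR_add_left sum.distrib sum_axis_scaleR E_def)
         (simp add: scaleR_scaleR[symmetric] scaleR_sum_right[symmetric] sum_axis_scaleR del: scaleR_scaleR)
    then show ?thesis
      using has_partialsD(1)[OF has_partials_comp[OF f p] b] T\<Omega> by (simp add: image_subset_iff)
  qed
  show "((\<lambda>a. f (T a)) has_derivative (\<lambda>v. \<Sum>i\<in>UNIV. v $ i *\<^sub>R E i a)) (at a within C')"
    unfolding C'_def
    by (rule has_derivative_within_convex_closure[OF hb der cf[unfolded C'_def] cE[unfolded C'_def]])
       (use a in auto)
qed

lemma small_ball:
  assumes "x0 \<in> U"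
  obtains r where "0 < r" "T ` ball (S x0) r \<subseteq> U"
proof -
  have "open (T -` U)" using local_graphD(1)[OF graph] continuous_T by (intro open_vimage) auto
  then obtain r where "0 < r" "ball (S x0) r \<subseteq> T -` U"
    using assms openE[of "T -` U" "S x0"] by auto
  then show thesis using that[of r] by auto
qed

lemma Sk: "x0 \<in> U \<Longrightarrow> x0 \<in> frontier \<Omega> \<Longrightarrow> S x0 $ k = 0"
  using T_frontier[of "S x0"] by simp

text \<open>One-sided differentiability in straightened coordinates is composed with the shear
  \<open>S\<close>. It upgrades the continuous extension of the derivatives to true
  differentiability relative to the closure, which is used along rays entering \<Omega>.\<close>

lemma has_derivative_at_boundary:
  fixes f :: "real^'n \<Rightarrow> 'b::real_normed_vector"
  assumes f: "has_partials \<Omega> f D" and x0: "x0 \<in> U" "x0 \<in> frontier \<Omega>"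
  shows "(f has_derivative (\<lambda>v. \<Sum>i\<in>UNIV. v $ i *\<^sub>R D i x0)) (at x0 within closure \<Omega>)"
proof -
  obtain r where r: "0 < r" "T ` ball (S x0) r \<subseteq> U" using small_ball[OF x0(1)] .
  let ?C = "ball (S x0) r \<inter> {a. s * a $ k \<le> 0}"
  define B where "B = S -` ball (S x0) r"
  have oB: "open B" unfolding B_def using continuous_S by (intro open_vimage) auto
  have xB: "x0 \<in> B" using r(1) by (simp add: B_def)
  have SB: "S ` (closure \<Omega> \<inter> B) \<subseteq> ?C"
  proof
    fix a assume "a \<in> S ` (closure \<Omega> \<inter> B)"
    then obtain x where x: "x \<in> closure \<Omega>" "x \<in> B" "a = S x" by auto
    then have "T a \<in> U" using r(2) by (metis B_def TS imageI subsetD vimageE)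
    then show "a \<in> ?C" using T_closure[of a] x by (auto simp: B_def)
  qed
  have "((\<lambda>a. f (T a)) has_derivative (\<lambda>v. \<Sum>i\<in>UNIV. v $ i *\<^sub>R (D i (T (S x0)) + (s * partial UNIV i h (S x0)) *\<^sub>R D k (T (S x0)))))
      (at (S x0) within ?C)"
    using r Sk[OF x0] by (intro flattened_derivative(1)[OF f]) auto
  then have 1: "((\<lambda>a. f (T a)) has_derivative (\<lambda>v. \<Sum>i\<in>UNIV. v $ i *\<^sub>R (D i x0 + (s * partial UNIV i h x0) *\<^sub>R D k x0)))
      (at (S x0) within S ` (closure \<Omega> \<inter> B))"
  proof -
    have "partial UNIV i h (S x0) = partial UNIV i h x0" for i
      using partial_shift_invariant[OF h local_graphD(3)[OF graph], of i x0 "- (s * h x0)"] by (simp add: S_def)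
    with has_derivative_subset[OF _ SB] \<open>((\<lambda>a. f (T a)) has_derivative _) _\<close> show ?thesis by simp
  qed
  have 2: "(S has_derivative (\<lambda>v. \<Sum>i\<in>UNIV. v $ i *\<^sub>R (axis i 1 - (s * partial UNIV i h x0) *\<^sub>R axis k 1))) (at x0 within closure \<Omega> \<inter> B)"
    by (rule has_derivative_at_withinI[OF has_partialsD(1)[OF has_partials_S UNIV_I]])
  \<comment> \<open>The derivative of \<open>S\<close> undoes that of \<open>T\<close>; the cross
    term drops out since the derivative of \<open>h\<close> along axis \<open>k\<close> is
    0.\<close>
  have eq: "(\<Sum>i\<in>UNIV. (\<Sum>j\<in>UNIV. v $ j *\<^sub>R (axis j 1 - (s * partial UNIV j h x0) *\<^sub>R axis k 1)) $ i *\<^sub>R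
      (D i x0 + (s * partial UNIV i h x0) *\<^sub>R D k x0)) = (\<Sum>i\<in>UNIV. v $ i *\<^sub>R D i x0)" for v
  proof -
    let ?E = "\<lambda>i. D i x0 + (s * partial UNIV i h x0) *\<^sub>R D k x0"
    let ?c = "\<Sum>j\<in>UNIV. v $ j * (s * partial UNIV j h x0)"
    have "(\<Sum>j\<in>UNIV. v $ j *\<^sub>R (axis j 1 - (s * partial UNIV j h x0) *\<^sub>R axis k 1)) = v - ?c *\<^sub>R axis k 1"
      using basis_expansion[of v, unfolded scalar_mult_eq_scaleR]
      by (simp add: scaleR_diff_right sum_subtractf scaleR_sum_left)
    then have "(\<Sum>i\<in>UNIV. (\<Sum>j\<in>UNIV. v $ j *\<^sub>R (axis j 1 - (s * partial UNIV j h x0) *\<^sub>R axis k 1)) $ i *\<^sub>R ?E i)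
        = (\<Sum>i\<in>UNIV. v $ i *\<^sub>R ?E i) - ?c *\<^sub>R (\<Sum>i\<in>UNIV. axis k 1 $ i *\<^sub>R ?E i)"
      by (simp add: scaleR_diff_left sum_subtractf scaleR_sum_right)
    also have "\<dots> = (\<Sum>i\<in>UNIV. v $ i *\<^sub>R ?E i) - ?c *\<^sub>R D k x0"
      by (simp add: sum_axis_scaleR partial_graph_axis[OF graph h])
    also have "\<dots> = (\<Sum>i\<in>UNIV. v $ i *\<^sub>R D i x0)"
      by (simp add: scaleR_add_right sum.distrib scaleR_sum_left)
    finally show ?thesis .
  qed
  have "((\<lambda>x. f (T (S x))) has_derivative (\<lambda>v. \<Sum>i\<in>UNIV. v $ i *\<^sub>R D i x0)) (at x0 within closure \<Omega> \<inter> B)"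
    using has_derivative_in_compose[OF 2 1] unfolding eq .
  then have "(f has_derivative (\<lambda>v. \<Sum>i\<in>UNIV. v $ i *\<^sub>R D i x0)) (at x0 within closure \<Omega> \<inter> B)" by simp
  then show ?thesis
    using at_within_nhd[OF xB oB, of "closure \<Omega> \<inter> B" "closure \<Omega>"] by auto
qed

text \<open>The extension is the odd reflection across the hyperplane.\<close>

lemma reflect_extension:
  fixes g :: "real^'n \<Rightarrow> 'b::real_normed_vector"
  assumes a0: "a0 $ k = 0" and r: "0 < r"
  defines "C' \<equiv> ball a0 r \<inter> {a. s * a $ k \<le> 0}"
  assumes g: "\<And>a. a \<in> C' \<Longrightarrow> (g has_derivative (\<lambda>v. \<Sum>i\<in>UNIV. v $ i *\<^sub>R D i a)) (at a within C')"
    and D: "\<And>i. continuous_on C' (D i)"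
  shows "\<exists>G E. (\<forall>a\<in>C'. G a = g a) \<and> (\<forall>a\<in>C'. \<forall>i. E i a = D i a) \<and> (\<forall>i. continuous_on (ball a0 r) (E i)) \<and>
     (\<forall>a\<in>ball a0 r. (G has_derivative (\<lambda>v. \<Sum>i\<in>UNIV. v $ i *\<^sub>R E i a)) (at a))"
proof -
  define \<pi> where "\<pi> a = a - (a $ k) *\<^sub>R axis k 1" for a :: "real^'n"
  define \<rho> where "\<rho> a = a - (2 * a $ k) *\<^sub>R axis k 1" for a :: "real^'n"
  define C'' where "C'' = ball a0 r \<inter> {a. s * a $ k \<ge> 0}"
  have \<pi>k: "\<pi> a $ k = 0" and \<rho>k: "\<rho> a $ k = - a $ k" for a by (simp_all add: \<pi>_def \<rho>_def)
  have near: "norm (\<pi> a - a0) \<le> norm (a - a0)" "norm (\<rho> a - a0) = norm (a - a0)" for a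
  proof -
    have 1: "norm (\<pi> a - a0) \<le> norm ((\<pi> a - a0) + (a $ k) *\<^sub>R axis k 1)"
      by (rule norm_graph_point) (simp add: \<pi>k a0)
    then show "norm (\<pi> a - a0) \<le> norm (a - a0)" by (simp add: \<pi>_def)
    define b where "b = a - a0"
    have b: "\<rho> a - a0 = b - (2 * b $ k) *\<^sub>R axis k 1" by (simp add: \<rho>_def b_def a0)
    have "(b - (2 * b $ k) *\<^sub>R axis k 1) \<bullet> (b - (2 * b $ k) *\<^sub>R axis k 1) = b \<bullet> b"
      by (simp add: inner_diff_left inner_diff_right inner_axis inner_axis' inner_axis_axis algebra_simps)
    then show "norm (\<rho> a - a0) = norm (a - a0)"
      unfolding b norm_eq_sqrt_inner b_def[symmetric] by simp
  qed
  have bl: "bounded_linear \<pi>" "bounded_linear \<rho>"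
    unfolding \<pi>_def \<rho>_def
    by (intro bounded_linear_sub bounded_linear_ident bounded_linear_scaleR_left[THEN bounded_linear_compose]
        bounded_linear_vec_nth bounded_linear_mult_right[THEN bounded_linear_compose])+
  have im: "\<pi> ` C'' \<subseteq> C'" "\<rho> ` C'' \<subseteq> C'"
  proof -
    have d: "dist a0 (\<pi> a) \<le> dist a0 a" "dist a0 (\<rho> a) = dist a0 a" for a
      unfolding dist_norm norm_minus_commute[of a0] by (rule near)+
    then show "\<pi> ` C'' \<subseteq> C'" "\<rho> ` C'' \<subseteq> C'"
      by (auto simp: C'_def C''_def \<pi>k \<rho>k intro: le_less_trans[OF d(1)])
  qed
  \<comment> \<open>With \<open>\<pi>\<close> the projection onto the hyperplane and
    \<open>\<rho>\<close> the reflection, this agrees with \<open>g\<close> on the hyperplane. There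
    the normal derivative changes sign twice and the tangential ones are twice the old minus the
    old, so all first derivatives match.\<close>
  define G2 where "G2 a = 2 *\<^sub>R g (\<pi> a) - g (\<rho> a)" for a
  define E2 where "E2 i a = (if i = k then D k (\<rho> a) else 2 *\<^sub>R D i (\<pi> a) - D i (\<rho> a))" for i a
  have der2: "(G2 has_derivative (\<lambda>v. \<Sum>i\<in>UNIV. v $ i *\<^sub>R E2 i a)) (at a within C'')" if a: "a \<in> C''" for a
  proof -
    have "(G2 has_derivative (\<lambda>v. 2 *\<^sub>R (\<Sum>i\<in>UNIV. \<pi> v $ i *\<^sub>R D i (\<pi> a)) - (\<Sum>i\<in>UNIV. \<rho> v $ i *\<^sub>R D i (\<rho> a)))) (at a within C'')"
      unfolding G2_def
      using im a
      by (intro has_derivative_diff has_derivative_scaleR_right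
          has_derivative_in_compose[where g = g, OF bounded_linear_imp_has_derivative[OF bl(1)] has_derivative_subset[OF g im(1)]]
          has_derivative_in_compose[where g = g, OF bounded_linear_imp_has_derivative[OF bl(2)] has_derivative_subset[OF g im(2)]]) auto
    moreover have "2 *\<^sub>R (\<Sum>i\<in>UNIV. \<pi> v $ i *\<^sub>R D i (\<pi> a)) - (\<Sum>i\<in>UNIV. \<rho> v $ i *\<^sub>R D i (\<rho> a)) = (\<Sum>i\<in>UNIV. v $ i *\<^sub>R E2 i a)" for v
    proof -
      have "2 *\<^sub>R (\<Sum>i\<in>UNIV. \<pi> v $ i *\<^sub>R D i (\<pi> a)) - (\<Sum>i\<in>UNIV. \<rho> v $ i *\<^sub>R D i (\<rho> a)) =
          (\<Sum>i\<in>UNIV. 2 *\<^sub>R (\<pi> v $ i *\<^sub>R D i (\<pi> a)) - \<rho> v $ i *\<^sub>R D i (\<rho> a))"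
        by (simp only: scaleR_sum_right sum_subtractf)
      also have "\<dots> = (\<Sum>i\<in>UNIV. v $ i *\<^sub>R E2 i a)"
      proof (intro sum.cong refl)
        fix i
        show "2 *\<^sub>R (\<pi> v $ i *\<^sub>R D i (\<pi> a)) - \<rho> v $ i *\<^sub>R D i (\<rho> a) = v $ i *\<^sub>R E2 i a"
        proof (cases "i = k")
          case False
          then have "\<pi> v $ i = v $ i" "\<rho> v $ i = v $ i" by (auto simp: \<pi>_def \<rho>_def axis_def)
          then show ?thesis using False by (simp add: E2_def scaleR_diff_right)
        qed (simp add: E2_def \<pi>k \<rho>k)
      qed
      finally show ?thesis .
    qed
    ultimately show ?thesis by simp
  qed
  define G where "G a = (if a \<in> C' then g a else G2 a)" for a
  define E where "E i a = (if a \<in> C' then D i a else E2 i a)" for i a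
  have bd: "\<pi> a = a" "\<rho> a = a" if "a $ k = 0" for a using that by (simp_all add: \<pi>_def \<rho>_def)
  have both: "a $ k = 0" if "a \<in> C'" "a \<in> C''" for a
    using that s_nonzero by (auto simp: C'_def C''_def)
  have G2: "G a = G2 a" "E i a = E2 i a" if "a \<in> C''" for a i
    using bd[OF both, of a] that by (auto simp: G_def E_def G2_def E2_def scaleR_2)
  have un: "ball a0 r = C' \<union> C''" by (auto simp: C'_def C''_def)
  have cl: "closedin (top_of_set (ball a0 r)) C'" "closedin (top_of_set (ball a0 r)) C''"
    unfolding C'_def C''_def
    by (auto intro!: closedin_closed_Int closed_Collect_le continuous_intros)

  have derG: "(G has_derivative (\<lambda>v. \<Sum>i\<in>UNIV. v $ i *\<^sub>R E i a)) (at a within C')" if "a \<in> C'" for a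
    using has_derivative_transform[OF that _ g[OF that], of G] that by (simp add: G_def E_def)
  have derG2: "(G has_derivative (\<lambda>v. \<Sum>i\<in>UNIV. v $ i *\<^sub>R E i a)) (at a within C'')" if "a \<in> C''" for a
    using has_derivative_transform[OF that _ der2[OF that], of G] G2 that by simp
  have "(G has_derivative (\<lambda>v. \<Sum>i\<in>UNIV. v $ i *\<^sub>R E i a)) (at a)" if a: "a \<in> ball a0 r" for a
  proof -
    consider "s * a $ k < 0" | "s * a $ k > 0" | "s * a $ k = 0" by linarith
    then show ?thesis
    proof cases
      case 1
      have "open (ball a0 r \<inter> {a. s * a $ k < 0})"
        by (intro open_Int open_ball open_Collect_less continuous_intros)
      moreover have "C' \<inter> (ball a0 r \<inter> {a. s * a $ k < 0}) - {a} = UNIV \<inter> (ball a0 r \<inter> {a. s * a $ k < 0}) - {a}"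
        by (auto simp: C'_def)
      ultimately have "at a within C' = at a within UNIV"
        using 1 a by (intro at_within_nhd[where S = "ball a0 r \<inter> {a. s * a $ k < 0}"]) auto
      then show ?thesis using derG[of a] 1 a by (simp add: C'_def)
    next
      case 2
      have "open (ball a0 r \<inter> {a. 0 < s * a $ k})"
        by (intro open_Int open_ball open_Collect_less continuous_intros)
      moreover have "C'' \<inter> (ball a0 r \<inter> {a. 0 < s * a $ k}) - {a} = UNIV \<inter> (ball a0 r \<inter> {a. 0 < s * a $ k}) - {a}"
        by (auto simp: C''_def)
      ultimately have "at a within C'' = at a within UNIV"
        using 2 a by (intro at_within_nhd[where S = "ball a0 r \<inter> {a. 0 < s * a $ k}"]) auto
      then show ?thesis using derG2[of a] 2 a by (simp add: C''_def)
    next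
      \<comment> \<open>On the hyperplane the one-sided derivatives from \<open>C'\<close> and
        \<open>C''\<close> are the same linear map, which is then a derivative within the
        union.\<close>
      case 3
      then have "a \<in> C'" "a \<in> C''" using a by (auto simp: C'_def C''_def)
      from derG[OF this(1)] derG2[OF this(2)]
      have "(G has_derivative (\<lambda>v. \<Sum>i\<in>UNIV. v $ i *\<^sub>R E i a)) (at a within C' \<union> C'')"
        unfolding has_derivative_within by (auto intro: Lim_Un)
      then show ?thesis using a at_within_open[OF a open_ball] by (simp add: un[symmetric])
    qed
  qed
  moreover have "continuous_on (ball a0 r) (E i)" for i
  proof -
    have "continuous_on C' (E i)"
      by (rule continuous_on_cong[THEN iffD2, OF refl _ D]) (simp add: E_def)
    moreover have "continuous_on C'' (E i)"
    proof (rule continuous_on_cong[THEN iffD2, OF refl G2(2)])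
      show "continuous_on C'' (E2 i)"
      proof -
        have "continuous_on C'' (\<lambda>a. D j (\<pi> a))" "continuous_on C'' (\<lambda>a. D j (\<rho> a))" for j
          by (rule continuous_on_compose2[OF D linear_continuous_on[OF bl(1)] im(1)]
              continuous_on_compose2[OF D linear_continuous_on[OF bl(2)] im(2)])+
        then show ?thesis
          unfolding E2_def by (cases "i = k") (simp_all add: continuous_on_diff continuous_on_scaleR)
      qed
    qed
    ultimately show ?thesis unfolding un using cl
      by (intro continuous_on_Un_local) (auto simp: un)
  qed
  ultimately show ?thesis by (intro exI[of _ G] exI[of _ E]) (auto simp: G_def E_def)
qed

end

text \<open>Invariance of domain makes the image open, compactness of the closure of \<Omega>
  identifies the closure of the image, and injectivity lets the map respect the difference of the
  two, the frontier.\<close>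

lemma closure_frontier_image:
  fixes y :: "real^'n \<Rightarrow> real^'n"
  assumes \<Omega>: "bounded \<Omega>" "open \<Omega>" and y: "continuous_on (closure \<Omega>) y" and inj: "inj_on y (closure \<Omega>)"
  shows "open (y ` \<Omega>)" and "closure (y ` \<Omega>) = y ` closure \<Omega>" and "frontier (y ` \<Omega>) = y ` frontier \<Omega>"
    and "bounded (y ` \<Omega>)"
proof -
  show o: "open (y ` \<Omega>)"
    by (rule invariance_of_domain[OF continuous_on_subset[OF y closure_subset] \<Omega>(2) inj_on_subset[OF inj closure_subset]])
  have comp: "compact (y ` closure \<Omega>)"
    using \<Omega> y by (intro compact_continuous_image) (auto simp: compact_closure)
  show c: "closure (y ` \<Omega>) = y ` closure \<Omega>"
  proof
    show "closure (y ` \<Omega>) \<subseteq> y ` closure \<Omega>"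
      by (rule closure_minimal) (use comp closure_subset compact_imp_closed in auto)
    show "y ` closure \<Omega> \<subseteq> closure (y ` \<Omega>)"
      by (rule image_closure_subset[OF y closed_closure closure_subset])
  qed
  show "frontier (y ` \<Omega>) = y ` frontier \<Omega>"
    unfolding frontier_def c interior_open[OF o] interior_open[OF \<Omega>(2)]
    by (rule inj_on_image_set_diff[symmetric, OF inj Diff_subset closure_subset])
  show "bounded (y ` \<Omega>)"
    by (rule bounded_subset[OF compact_imp_bounded[OF comp] image_mono[OF closure_subset]])
qed

section \<open>The inverse function theorem with explicit partial derivatives, and cutoffs\<close>

lemma cramer_component:
  fixes A :: "real^'n^'n"
  assumes "det A \<noteq> 0" "A *v x = b"
  shows "x $ k = det (\<chi> i j. if j = k then b $ i else A $ i $ j) / det A"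
  using cramer[OF assms(1), of x b] assms(2) by simp

lemma continuous_on_det:
  fixes A :: "'a::topological_space \<Rightarrow> real^'n^'n"
  assumes "\<And>i j. continuous_on S (\<lambda>x. A x $ i $ j)"
  shows "continuous_on S (\<lambda>x. det (A x))"
  unfolding det_def
  by (intro continuous_on_sum continuous_on_mult continuous_on_const continuous_on_prod assms)

lemma partials_matrix: "(\<Sum>j\<in>UNIV. v $ j *\<^sub>R E j) = (\<chi> a b. E b $ a) *v v" for E :: "'n::finite \<Rightarrow> real^'m"
  by (simp add: vec_eq_iff matrix_vector_mult_def mult.commute)

lemma sum_scaled_axis:
  fixes f :: "'n::finite \<Rightarrow> 'b::real_vector"
  shows "(\<Sum>i\<in>UNIV. (c *\<^sub>R axis k 1) $ i *\<^sub>R f i) = c *\<^sub>R f k"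
  using sum_axis_scaleR[of k c f] by (simp add: axis_def if_distrib[of "\<lambda>a. c * a"] cong: if_cong)

text \<open>The inverse \<open>g\<close> is differentiable by the inverse function theorem. Its
  partial derivatives solve linear systems with the matrix of the \<open>E i (g y)\<close>, and
  Cramer's rule shows that they depend continuously on \<open>y\<close>.\<close>

lemma inverse_function_partials:
  fixes f :: "real^'n \<Rightarrow> real^'n"
  assumes B: "open B" "x0 \<in> B"
    and f: "\<And>x. x \<in> B \<Longrightarrow> (f has_derivative (\<lambda>v. \<Sum>i\<in>UNIV. v $ i *\<^sub>R E i x)) (at x)"
    and E: "\<And>i. continuous_on B (E i)"
    and inj: "\<And>v. (\<Sum>i\<in>UNIV. v $ i *\<^sub>R E i x0) = 0 \<Longrightarrow> v = 0"
  obtains W V g E' where "open W" "W \<subseteq> B" "x0 \<in> W" "open V" "f x0 \<in> V" "homeomorphism W V f g"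
    "\<And>y. y \<in> V \<Longrightarrow> (g has_derivative (\<lambda>v. \<Sum>i\<in>UNIV. v $ i *\<^sub>R E' i y)) (at y)"
    "\<And>i. continuous_on V (E' i)"
    "\<And>y v. y \<in> V \<Longrightarrow> (\<Sum>i\<in>UNIV. (\<Sum>j\<in>UNIV. v $ j *\<^sub>R E' j y) $ i *\<^sub>R E i (g y)) = v"
proof -
  define f' where "f' x = Blinfun (\<lambda>v. \<Sum>i\<in>UNIV. v $ i *\<^sub>R E i x)" for x
  have f': "blinfun_apply (f' x) = (\<lambda>v. \<Sum>i\<in>UNIV. v $ i *\<^sub>R E i x)" for x
    unfolding f'_def by (rule bounded_linear_Blinfun_apply[OF bounded_linear_partials])
  have cf': "continuous_on B f'"
  proof (rule continuous_on_blinfun_componentwise)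
    show "continuous_on B (\<lambda>x. blinfun_apply (f' x) i)" for i
      unfolding f' by (intro continuous_on_sum continuous_on_scaleR continuous_on_const E)
  qed
  have lin: "linear (\<lambda>v. \<Sum>i\<in>UNIV. v $ i *\<^sub>R E i x0)"
    by (rule bounded_linear.linear[OF bounded_linear_partials])
  moreover have "inj (\<lambda>v. \<Sum>i\<in>UNIV. v $ i *\<^sub>R E i x0)"
    using linear_injective_0[OF lin] inj by blast
  ultimately obtain l where l: "linear l" "l \<circ> (\<lambda>v. \<Sum>i\<in>UNIV. v $ i *\<^sub>R E i x0) = id"
    using linear_injective_left_inverse by blast
  have l2: "l (\<Sum>i\<in>UNIV. v $ i *\<^sub>R E i x0) = v" for v using fun_cong[OF l(2), of v] by simp
  have "bounded_linear l" using l(1) linear_conv_bounded_linear by blast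
  note bl = bounded_linear_Blinfun_apply[OF this]
  have li: "Blinfun l o\<^sub>L f' x0 = id_blinfun"
    by (rule blinfun_eqI) (simp only: blinfun_apply_blinfun_compose bl f' l2 blinfun_apply_id_blinfun)
  obtain W V g g' where inv: "open W" "W \<subseteq> B" "x0 \<in> W" "open V" "f x0 \<in> V" "homeomorphism W V f g"
    and g: "\<And>y. y \<in> V \<Longrightarrow> (g has_derivative g' y) (at y)"
    and g': "\<And>y. y \<in> V \<Longrightarrow> g' y = inv (blinfun_apply (f' (g y)))"
    and bij: "\<And>y. y \<in> V \<Longrightarrow> bij (blinfun_apply (f' (g y)))"
    by (rule inverse_function_theorem[OF B(1) _ cf' B(2) li, of f]) (auto simp: f' f)
  define E' where "E' i y = g' y (axis i 1)" for i y
  have E': "g' y v = (\<Sum>i\<in>UNIV. v $ i *\<^sub>R E' i y)" if "y \<in> V" for y v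
  proof -
    interpret bounded_linear "g' y" by (rule has_derivative_bounded_linear[OF g[OF that]])
    have "g' y v = g' y (\<Sum>i\<in>UNIV. v $ i *\<^sub>R axis i 1)"
      using basis_expansion[of v, unfolded scalar_mult_eq_scaleR] by simp
    then show ?thesis by (simp add: sum scaleR E'_def)
  qed
  have right: "(\<Sum>i\<in>UNIV. (\<Sum>j\<in>UNIV. v $ j *\<^sub>R E' j y) $ i *\<^sub>R E i (g y)) = v" if "y \<in> V" for y v
  proof -
    have "blinfun_apply (f' (g y)) (g' y v) = v"
      unfolding g'[OF that] using bij[OF that] by (simp add: bij_is_surj surj_f_inv_f)
    then show ?thesis by (simp only: f' E'[OF that])
  qed
  have gW: "g y \<in> W" if "y \<in> V" for y using inv(6) that by (auto simp: homeomorphism_def)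
  have cg: "continuous_on V g" using inv(6) by (simp add: homeomorphism_def)
  define A where "A y = (\<chi> a b. E b (g y) $ a)" for y
  have det: "det (A y) \<noteq> 0" if "y \<in> V" for y
  proof -
    have "A y *v (\<Sum>j\<in>UNIV. v $ j *\<^sub>R E' j y) = v" for v
      using right[OF that, of v] by (simp add: partials_matrix A_def)
    then have "surj ((*v) (A y))" by (rule surjI)
    then obtain B where "A y ** B = mat 1" using matrix_right_invertible_surjective by blast
    then have "det (A y) * det B = 1" by (metis det_I det_mul)
    then show ?thesis by auto
  qed
  have cE: "continuous_on V (\<lambda>y. E i (g y))" for i
    by (rule continuous_on_compose2[OF E cg]) (use gW inv(2) in auto)
  have "continuous_on V (E' i)" for i
  proof -
    have eq: "E' i y = (\<chi> k. det (\<chi> a b. if b = k then axis i 1 $ a else A y $ a $ b) / det (A y))" if "y \<in> V" for y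
    proof -
      have "A y *v E' i y = axis i 1"
        using right[OF that, of "axis i 1"] by (simp add: partials_matrix[symmetric] sum_axis_scaleR A_def)
      from cramer_component[OF det[OF that] this] show ?thesis
        unfolding vec_eq_iff vec_lambda_beta by blast
    qed
    have "continuous_on V (\<lambda>y. if b = k then axis i 1 $ a else A y $ a $ b)" for a b k
      by (cases "b = k") (auto simp: A_def intro!: continuous_intros cE)
    then have "continuous_on V (\<lambda>y. \<chi> k. det (\<chi> a b. if b = k then axis i 1 $ a else A y $ a $ b) / det (A y))"
      using det by (intro continuous_on_vec_lambda continuous_on_divide continuous_on_det)
         (auto simp: A_def intro!: continuous_on_component cE)
    then show ?thesis by (rule continuous_on_eq) (rule eq[symmetric])
  qed
  moreover have "(g has_derivative (\<lambda>v. \<Sum>i\<in>UNIV. v $ i *\<^sub>R E' i y)) (at y)" if "y \<in> V" for y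
  proof -
    have "g' y = (\<lambda>v. \<Sum>i\<in>UNIV. v $ i *\<^sub>R E' i y)" by (rule ext) (rule E'[OF that])
    with g[OF that] show ?thesis by (simp only:)
  qed
  ultimately show thesis using that[OF inv _ _ right] by blast
qed

text \<open>The argument of \<open>layer\<close> is 3 minus the squared ratio of
  \<open>norm (x - c)\<close> to \<open>r\<close>: it is at least 2 for ratios up to 1, and at most
  1 as soon as the squared ratio is at least 2. The radius \<open>3/2 * r\<close> is safe because
  9/4 exceeds 2.\<close>

lemma has_partials_cutoff:
  fixes c :: "real^'n"
  assumes "0 < r"
  defines "cutf \<equiv> \<lambda>x. layer (3 - ((x - c) \<bullet> (x - c)) / r\<^sup>2)"
  shows "\<exists>D. has_partials UNIV cutf D" and "norm (x - c) \<le> r \<Longrightarrow> cutf x = 1" and "3/2 * r \<le> norm (x - c) \<Longrightarrow> cutf x = 0"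
proof -
  have 1: "has_partials UNIV (\<lambda>x. 3 - ((x - c) \<bullet> (x - c)) / r\<^sup>2)
     (\<lambda>i x. 0 - ((x - c) \<bullet> (axis i 1 - 0) + (axis i 1 - 0) \<bullet> (x - c)) / r\<^sup>2)"
    by (intro has_partials_diff has_partials_const has_partials_inner has_partials_id
        has_partials_bounded_linear[OF bounded_linear_divide])
  show "\<exists>D. has_partials UNIV cutf D"
    unfolding cutf_def
    by (rule exI, rule has_partials_comp_real[where \<phi> = layer and \<phi>' = layer', OF 1])
       (auto simp: has_real_derivative_iff_has_vector_derivative[symmetric] DERIV_layer continuous_layer')
  show "cutf x = 1" if "norm (x - c) \<le> r"
  proof -
    have "(norm (x - c))\<^sup>2 \<le> r\<^sup>2" using that by (intro power_mono) auto
    then have "((x - c) \<bullet> (x - c)) / r\<^sup>2 \<le> 1" using assms(1) by (simp add: power2_norm_eq_inner)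
    then show ?thesis unfolding cutf_def by (intro layer_upper) simp
  qed
  show "cutf x = 0" if "3/2 * r \<le> norm (x - c)"
  proof -
    have "(3/2 * r)\<^sup>2 \<le> (norm (x - c))\<^sup>2" using that assms(1) by (intro power_mono) auto
    moreover have "(3/2 * r)\<^sup>2 = 9/4 * r\<^sup>2" by (simp add: power2_eq_square)
    ultimately have "9/4 * r\<^sup>2 \<le> (x - c) \<bullet> (x - c)" by (simp only: power2_norm_eq_inner)
    then have "9/4 \<le> ((x - c) \<bullet> (x - c)) / r\<^sup>2" using assms(1) by (simp add: pos_le_divide_eq)
    then show ?thesis unfolding cutf_def by (intro layer_lower) linarith
  qed
qed

section \<open>Graph charts for the image of a domain\<close>

context flattening
begin

text \<open>In straightened coordinates, extended by reflection, \<open>y\<close> becomes a local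
  diffeomorphism \<open>G\<close> with inverse \<open>q\<close>, and near \<open>y x0\<close> the
  image of \<Omega> is the set where \<open>s * q p $ k < 0\<close>. An implicit function argument
  solves \<open>q p $ k = 0\<close> for a coordinate \<open>k'\<close> of \<open>p\<close>, and a
  cutoff makes the resulting graph function global.\<close>

lemma image_local_graph:
  fixes y :: "real^'n \<Rightarrow> real^'n"
  assumes bd: "bounded \<Omega>" and y: "has_partials \<Omega> y D" and inj: "inj_on y (closure \<Omega>)"
    and det: "\<And>x. x \<in> closure \<Omega> \<Longrightarrow> det (\<chi> i j. D j x $ i) \<noteq> 0"
    and x0: "x0 \<in> U" "x0 \<in> frontier \<Omega>"
  shows "\<exists>U' k' s' h'. y x0 \<in> U' \<and> local_graph (y ` \<Omega>) U' k' s' h' \<and> C1_closure UNIV h'"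
proof -
  note im = closure_frontier_image[OF bd open_\<Omega> has_partialsD(2)[OF y] inj]
  obtain r where r: "0 < r" "T ` ball (S x0) r \<subseteq> U" using small_ball[OF x0(1)] .
  define a0 where "a0 = S x0"
  have a0k: "a0 $ k = 0" unfolding a0_def by (rule Sk[OF x0])
  have Ta0: "T a0 = x0" by (simp add: a0_def)
  let ?B = "ball a0 r" and ?C = "ball a0 r \<inter> {a. s * a $ k \<le> 0}"
  define E0 where "E0 i a = D i (T a) + (s * partial UNIV i h a) *\<^sub>R D k (T a)" for i a
  have TB: "T ` ball a0 r \<subseteq> U" using r by (simp add: a0_def)
  note fl = flattened_derivative[OF y TB r(1) a0k, folded E0_def]
  obtain G E where GE: "\<forall>a\<in>?C. G a = y (T a)" "\<forall>a\<in>?C. \<forall>i. E i a = E0 i a" "\<And>i. continuous_on ?B (E i)"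
    "\<And>a. a \<in> ?B \<Longrightarrow> (G has_derivative (\<lambda>v. \<Sum>i\<in>UNIV. v $ i *\<^sub>R E i a)) (at a)"
  proof -
    have "((\<lambda>a. y (T a)) has_derivative (\<lambda>v. \<Sum>i\<in>UNIV. v $ i *\<^sub>R E0 i a)) (at a within ?C)" if "a \<in> ?C" for a
      using fl(1)[of a] that by auto
    moreover have "continuous_on ?C (E0 i)" for i using fl(2)[of a0] r(1) a0k by simp
    ultimately show thesis
      using reflect_extension[OF a0k r(1), of "\<lambda>a. y (T a)" E0] that by blast
  qed
  have a0C: "a0 \<in> ?C" and a0B: "a0 \<in> ?B" using r(1) a0k by auto
  \<comment> \<open>Undoing the shear turns a null vector of the derivative of \<open>G\<close> into
    a null vector of the invertible Jacobian matrix of \<open>y\<close>.\<close>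
  have injL: "v = 0" if v: "(\<Sum>i\<in>UNIV. v $ i *\<^sub>R E i a0) = 0" for v
  proof -
    have x0c: "x0 \<in> closure \<Omega>" using x0 by (simp add: frontier_def)
    let ?c = "\<Sum>i\<in>UNIV. v $ i * (s * partial UNIV i h a0)"
    let ?w = "v + ?c *\<^sub>R axis k 1"
    have "(\<Sum>i\<in>UNIV. ?w $ i *\<^sub>R D i x0) = (\<Sum>i\<in>UNIV. v $ i *\<^sub>R D i x0) + ?c *\<^sub>R (\<Sum>i\<in>UNIV. axis k 1 $ i *\<^sub>R D i x0)"
      by (simp add: scaleR_add_left sum.distrib scaleR_sum_right)
    also have "\<dots> = (\<Sum>i\<in>UNIV. v $ i *\<^sub>R E i a0)"
      using GE(2) a0C by (simp add: E0_def Ta0 sum_axis_scaleR scaleR_add_right sum.distrib scaleR_sum_left)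
    finally have "(\<Sum>i\<in>UNIV. ?w $ i *\<^sub>R D i x0) = 0" using v by (simp only:)
    then have "(\<chi> a b. D b x0 $ a) *v ?w = 0" by (simp only: partials_matrix)
    then have w: "?w = 0"
      using det[OF x0c] matrix_left_invertible_ker invertible_det_nz invertible_left_inverse by blast
    then have wi: "?w $ i = 0" for i by (simp only: zero_index)
    have vi: "v $ i = 0" if "i \<noteq> k" for i using wi[of i] that by (simp add: axis_def)
    have "v $ i * (s * partial UNIV i h a0) = 0" for i
      using vi[of i] partial_graph_axis[OF graph h, of a0] by (cases "i = k") auto
    then have "?c = 0" by (intro sum.neutral) simp
    then show ?thesis using w by simp
  qed
  obtain O1 W1 q E1 where q: "open O1" "O1 \<subseteq> ?B" "a0 \<in> O1" "open W1" "G a0 \<in> W1" "homeomorphism O1 W1 G q"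
    and E1: "\<And>p v. p \<in> W1 \<Longrightarrow> (\<Sum>i\<in>UNIV. (\<Sum>j\<in>UNIV. v $ j *\<^sub>R E1 j p) $ i *\<^sub>R E i (q p)) = v"
    by (rule inverse_function_partials[OF open_ball a0B GE(4) GE(3) injL]) blast+
  define p0 where "p0 = y x0"
  have Ga0: "G a0 = p0" using GE(1) a0C by (auto simp: Ta0 p0_def)
  have qp0: "q p0 = a0" using q(3,6) by (auto simp: homeomorphism_def Ga0[symmetric])
  have p0W: "p0 \<in> W1" using q(5) Ga0 by simp
  define L where "L v = (\<Sum>i\<in>UNIV. v $ i *\<^sub>R E i a0)" for v
  have Ladd: "L (v - w) = L v - L w" and Lsc: "L (c *\<^sub>R v) = c *\<^sub>R L v" for v w c
    by (simp_all add: L_def scaleR_diff_left sum_subtractf scaleR_sum_right)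
  have Linj: "v = w" if "L v = L w" for v w
    using injL[of "v - w"] that Ladd[of v w] by (simp add: L_def)
  have LE1: "L (\<Sum>j\<in>UNIV. v $ j *\<^sub>R E1 j p0) = v" for v using E1[OF p0W, of v] by (simp add: L_def qp0)
  \<comment> \<open>A coordinate in which component \<open>k\<close> of \<open>q\<close> has nonzero
    derivative at \<open>p0\<close>; if there were none, the derivative of \<open>q\<close> could
    not reach axis \<open>k\<close>.\<close>
  obtain k' where k': "E1 k' p0 $ k \<noteq> 0"
  proof (rule ccontr)
    assume "\<not> thesis"
    then have z: "E1 j p0 $ k = 0" for j using that by blast
    have "L (\<Sum>j\<in>UNIV. L (axis k 1) $ j *\<^sub>R E1 j p0) = L (axis k 1)" by (rule LE1)
    then have "(\<Sum>j\<in>UNIV. L (axis k 1) $ j *\<^sub>R E1 j p0) = axis k 1" by (rule Linj)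
    then have "(\<Sum>j\<in>UNIV. L (axis k 1) $ j *\<^sub>R E1 j p0) $ k = 1" by simp
    then show False by (simp add: z)
  qed
  have LE1k: "L (E1 k' p0) = axis k' 1" using LE1[of "axis k' 1"] by (simp add: sum_axis_scaleR)
  \<comment> \<open>\<open>M\<close> replaces coordinate \<open>k'\<close> of \<open>G\<close> by
    the height \<open>- s * a $ k\<close>. Its local inverse \<open>m\<close> recovers a point from
    its height over the straightened boundary and the remaining coordinates of its image.\<close>
  define M where "M a = G a + (- s * a $ k - G a $ k') *\<^sub>R axis k' 1" for a
  define EM where "EM i a = E i a + (- s * axis i 1 $ k - E i a $ k') *\<^sub>R axis k' 1" for i a
  have EMsum: "(\<Sum>i\<in>UNIV. v $ i *\<^sub>R EM i a) =
     (\<Sum>i\<in>UNIV. v $ i *\<^sub>R E i a) + (- s * v $ k - (\<Sum>i\<in>UNIV. v $ i *\<^sub>R E i a) $ k') *\<^sub>R axis k' 1" for v a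
  proof -
    have "(\<Sum>i\<in>UNIV. v $ i *\<^sub>R EM i a) = (\<Sum>i\<in>UNIV. v $ i *\<^sub>R E i a) +
        (\<Sum>i\<in>UNIV. v $ i * (- s * axis i 1 $ k - E i a $ k')) *\<^sub>R axis k' 1"
      by (simp add: EM_def scaleR_add_right sum.distrib scaleR_sum_left)
    also have "(\<Sum>i\<in>UNIV. v $ i * (- s * axis i 1 $ k - E i a $ k')) = - s * v $ k - (\<Sum>i\<in>UNIV. v $ i *\<^sub>R E i a) $ k'"
      by (simp add: right_diff_distrib sum_subtractf axis_def if_distrib[of "\<lambda>x. _ * x"] cong: if_cong)
    finally show ?thesis .
  qed
  have Mder: "(M has_derivative (\<lambda>v. \<Sum>i\<in>UNIV. v $ i *\<^sub>R EM i a)) (at a)" if "a \<in> ?B" for a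
  proof -
    have "(M has_derivative (\<lambda>v. (\<Sum>i\<in>UNIV. v $ i *\<^sub>R E i a) +
       (- s * v $ k - (\<Sum>i\<in>UNIV. v $ i *\<^sub>R E i a) $ k') *\<^sub>R axis k' 1)) (at a)"
      unfolding M_def
      by (intro has_derivative_add GE(4)[OF that] has_derivative_scaleR_left has_derivative_diff
          has_derivative_mult_right bounded_linear.has_derivative[OF bounded_linear_vec_nth] has_derivative_ident)
    then show ?thesis by (simp only: EMsum)
  qed
  have cEM: "continuous_on ?B (EM i)" for i
    unfolding EM_def by (intro continuous_intros GE(3))
  have injM: "v = 0" if v: "(\<Sum>i\<in>UNIV. v $ i *\<^sub>R EM i a0) = 0" for v
  proof -
    have eq: "L v + (- s * v $ k - L v $ k') *\<^sub>R axis k' 1 = 0" using v unfolding EMsum L_def .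
    then have "(L v + (- s * v $ k - L v $ k') *\<^sub>R axis k' 1) $ k' = 0" by simp
    then have vk: "v $ k = 0" using s_nonzero by simp
    then have "L v = (L v $ k') *\<^sub>R axis k' 1" using eq by (simp add: algebra_simps)
    also have "\<dots> = L ((L v $ k') *\<^sub>R E1 k' p0)" by (simp add: Lsc LE1k)
    finally have ve: "v = (L v $ k') *\<^sub>R E1 k' p0" by (rule Linj)
    then have "L v $ k' * E1 k' p0 $ k = 0" using vk by (metis vector_scaleR_component real_scaleR_def)
    then have "L v $ k' = 0" using k' by simp
    then show ?thesis using ve by simp
  qed
  obtain O2 V m Em where m: "open O2" "O2 \<subseteq> ?B" "a0 \<in> O2" "open V" "M a0 \<in> V" "homeomorphism O2 V M m"
    and mder: "\<And>x. x \<in> V \<Longrightarrow> (m has_derivative (\<lambda>v. \<Sum>i\<in>UNIV. v $ i *\<^sub>R Em i x)) (at x)"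
    and cEm: "\<And>i. continuous_on V (Em i)"
    and Em: "\<And>x v. x \<in> V \<Longrightarrow> (\<Sum>i\<in>UNIV. (\<Sum>j\<in>UNIV. v $ j *\<^sub>R Em j x) $ i *\<^sub>R EM i (m x)) = v"
    by (rule inverse_function_partials[OF open_ball a0B Mder cEM injM]) blast+
  define c where "c = M a0"
  have mc: "m c = a0" using m(3,6) by (auto simp: homeomorphism_def c_def)
  have cV: "c \<in> V" using m(5) by (simp add: c_def)
  have mB: "m x \<in> ?B" if "x \<in> V" for x using m(2,6) that by (auto simp: homeomorphism_def)
  have cm: "continuous_on V m" using m(6) by (simp add: homeomorphism_def)
  \<comment> \<open>Coordinate \<open>k'\<close> of the image point that has height
    \<open>x $ k'\<close> and shares the remaining coordinates of \<open>x\<close>; at height 0 it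
    parametrises the new boundary.\<close>
  define H where "H x = G (m x) $ k'" for x
  define EH where "EH i x = (\<Sum>j\<in>UNIV. Em i x $ j *\<^sub>R E j (m x)) $ k'" for i x
  have Hder: "(H has_derivative (\<lambda>v. \<Sum>i\<in>UNIV. v $ i *\<^sub>R EH i x)) (at x)" if x: "x \<in> V" for x
  proof -
    have d: "(H has_derivative (\<lambda>v. (\<Sum>j\<in>UNIV. (\<Sum>i\<in>UNIV. v $ i *\<^sub>R Em i x) $ j *\<^sub>R E j (m x)) $ k')) (at x)"
      unfolding H_def
      by (intro bounded_linear.has_derivative[OF bounded_linear_vec_nth]
          has_derivative_compose[where g = G, OF mder[OF x] GE(4)[OF mB[OF x]]])
    have eq: "(\<Sum>j\<in>UNIV. (\<Sum>i\<in>UNIV. v $ i *\<^sub>R Em i x) $ j *\<^sub>R E j (m x)) = (\<Sum>i\<in>UNIV. v $ i *\<^sub>R (\<Sum>j\<in>UNIV. Em i x $ j *\<^sub>R E j (m x)))" for v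
      by (simp add: scaleR_sum_left scaleR_sum_right) (rule sum.swap)
    show ?thesis
    proof (rule has_derivative_eq_rhs[OF d], rule ext)
      show "(\<Sum>j\<in>UNIV. (\<Sum>i\<in>UNIV. v $ i *\<^sub>R Em i x) $ j *\<^sub>R E j (m x)) $ k' = (\<Sum>i\<in>UNIV. v $ i *\<^sub>R EH i x)" for v
        unfolding eq by (simp add: EH_def)
    qed
  qed
  have cEH: "continuous_on V (EH i)" for i
    unfolding EH_def
    by (intro continuous_on_component continuous_on_sum continuous_on_scaleR cEm continuous_on_compose2[OF GE(3) cm])
       (use mB in auto)
  define \<kappa> where "\<kappa> = EH k'"
  \<comment> \<open>If \<open>\<kappa> c\<close> were 0, changing the height would, to first order,
    move no coordinate of the image point, contradicting the injectivity of
    \<open>L\<close>.\<close>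
  have \<kappa>c: "\<kappa> c \<noteq> 0"
  proof
    assume \<kappa>0: "\<kappa> c = 0"
    let ?v = "Em k' c"
    have Lv: "L ?v + (- s * ?v $ k - L ?v $ k') *\<^sub>R axis k' 1 = axis k' 1"
      using Em[OF cV, of "axis k' 1"] unfolding sum_axis_scaleR mc EMsum L_def by simp
    have "L ?v $ k' = 0" using \<kappa>0 by (simp add: \<kappa>_def EH_def mc L_def)
    moreover from this have "- s * ?v $ k = 1" using arg_cong[OF Lv, of "\<lambda>v. v $ k'"] by simp
    ultimately have "L ?v = L 0" using Lv by (simp add: L_def)
    then have "?v = 0" by (rule Linj)
    then show False using \<open>- s * ?v $ k = 1\<close> by simp
  qed
  define \<sigma> where "\<sigma> = sgn (\<kappa> c)"
  have \<sigma>: "\<sigma> \<in> {-1, 1}" "\<sigma> * \<sigma> = 1" "0 < \<sigma> * \<kappa> c" using \<kappa>c by (auto simp: \<sigma>_def sgn_if)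
  obtain R where R: "0 < R" "ball c R \<subseteq> V" "\<And>x. x \<in> ball c R \<Longrightarrow> 0 < \<sigma> * \<kappa> x"
  proof -
    have "open (V \<inter> (\<lambda>x. \<sigma> * \<kappa> x) -` {0<..})"
      using cEH[of k'] m(4) by (intro continuous_open_preimage continuous_intros) (auto simp: \<kappa>_def)
    moreover have "c \<in> V \<inter> (\<lambda>x. \<sigma> * \<kappa> x) -` {0<..}" using cV \<sigma> by simp
    ultimately obtain R where "0 < R" and sub: "ball c R \<subseteq> V \<inter> (\<lambda>x. \<sigma> * \<kappa> x) -` {0<..}" using openE by blast
    show thesis using subsetD[OF sub] by (intro that[OF \<open>0 < R\<close>]) auto
  qed
  \<comment> \<open>The projection forgets coordinate \<open>k'\<close>; functions of
    \<open>\<pi> p\<close> are independent of it, as \<open>local_graph\<close> demands, and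
    \<open>\<pi> p\<close> has height 0 as an argument of \<open>H\<close>.\<close>
  define \<pi> where "\<pi> p = p - (p $ k') *\<^sub>R axis k' 1" for p :: "real^'n"
  have \<pi>p: "has_partials UNIV \<pi> (\<lambda>i x. axis i 1 - (axis i 1 $ k') *\<^sub>R axis k' 1)"
    unfolding \<pi>_def
    by (intro has_partials_diff has_partials_id has_partials_bounded_linear[OF bounded_linear_scaleR_left] has_partials_component)
  have c\<pi>: "\<pi> p0 = c" using a0k by (simp add: \<pi>_def c_def M_def Ga0)
  let ?cut = "\<lambda>x. layer (3 - ((x - c) \<bullet> (x - c)) / (R / 2)\<^sup>2)"
  note cut = has_partials_cutoff[where r = "R / 2" and c = c]
  obtain Dcut where Dcut: "has_partials UNIV ?cut Dcut" using cut(1) R(1) by auto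
  let ?K = "cball c (3 / 4 * R)"
  have KV: "?K \<subseteq> V" using R by (intro subset_trans[OF _ R(2)]) auto
  have ext: "has_partials UNIV (\<lambda>x. if x \<in> V then ?cut x * H x else 0) (\<lambda>i x. if x \<in> V then ?cut x * EH i x + Dcut i x * H x else 0)"
  proof (rule has_partials_extend_zero[OF m(4) closed_cball KV])
    fix x assume x: "x \<in> V"
    show "((\<lambda>x. ?cut x * H x) has_derivative (\<lambda>h. \<Sum>i\<in>UNIV. h $ i *\<^sub>R (?cut x * EH i x + Dcut i x * H x))) (at x)"
      using has_derivative_mult[OF has_partialsD(1)[OF Dcut UNIV_I, of x] Hder[OF x]]
      by (simp add: sum_distrib_left sum_distrib_right sum.distrib[symmetric] algebra_simps)
    show "?cut x * H x = 0" if "x \<notin> ?K"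
      using cut(3)[of x] that R(1) by (simp add: dist_norm norm_minus_commute)
  next
    have cH: "continuous_on V H"
      by (intro continuous_at_imp_continuous_on ballI has_derivative_continuous[OF Hder])
    have "continuous_on V ?cut" "continuous_on V (Dcut i)" for i
      using has_partialsD(2,3)[OF Dcut] by (auto intro: continuous_on_subset[of UNIV])
    then show "continuous_on V (\<lambda>x. ?cut x * EH i x + Dcut i x * H x)" for i
      by (intro continuous_on_add continuous_on_mult cEH cH)
  qed
  \<comment> \<open>\<open>H\<close> is available on \<open>V\<close> only, while the graph function
    of a chart has to be C^1 on the whole space; near \<open>c\<close> the cutoff is 1.\<close>
  define h' where "h' p = - \<sigma> * (if \<pi> p \<in> V then ?cut (\<pi> p) * H (\<pi> p) else 0)" for p
  have h'1: "C1_closure UNIV h'"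
    unfolding h'_def
    by (rule has_partials_C1_closure[OF has_partials_bounded_linear[OF bounded_linear_mult_right
          has_partials_comp[OF ext \<pi>p]]]) auto
  have h'H: "h' p = - \<sigma> * H (\<pi> p)" if "\<pi> p \<in> ball c (R / 2)" for p
  proof -
    have "\<pi> p \<in> V" using that R by (auto intro: subsetD[OF R(2)])
    moreover have "?cut (\<pi> p) = 1" using that R(1) by (intro cut(2)) (auto simp: dist_norm norm_minus_commute)
    ultimately show ?thesis by (simp add: h'_def)
  qed
  define Z where "Z = inv_into (closure \<Omega>) y"
  have cZ: "continuous_on (y ` closure \<Omega>) Z"
    unfolding Z_def using bd inj
    by (intro continuous_on_inv[OF has_partialsD(2)[OF y]]) (simp_all add: compact_closure)
  have Zy: "Z (y x) = x" if "x \<in> closure \<Omega>" for x using inj that by (simp add: Z_def)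
  have oTO: "open (S -` O1)" using continuous_S q(1) by (intro open_vimage) auto
  \<comment> \<open>\<open>W2\<close> excludes points of the image that come from a distant part of
    the closure of \<Omega>: a point of the closed image in \<open>W2\<close> has its preimage in
    the region covered by the chart.\<close>
  obtain W2 where W2: "open W2" "W2 \<inter> y ` closure \<Omega> = y ` closure \<Omega> \<inter> Z -` (S -` O1)"
    using cZ oTO unfolding continuous_on_open_invariant by (metis Int_commute)
  have x0c: "x0 \<in> closure \<Omega>" using x0 by (simp add: frontier_def)
  have p0W2: "p0 \<in> W2"
  proof -
    have "p0 \<in> y ` closure \<Omega> \<inter> Z -` (S -` O1)"
      using x0c q(3) by (auto simp: p0_def Zy a0_def[symmetric])
    then show ?thesis using W2(2) by blast
  qed
  have cM: "continuous_on ?B M" by (intro continuous_at_imp_continuous_on ballI has_derivative_continuous[OF Mder])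
  have cq: "continuous_on W1 q" using q(6) by (simp add: homeomorphism_def)
  define A where "A = O2 \<inter> M -` ball c R"
  have oA: "open A" unfolding A_def
    by (rule continuous_open_preimage[OF continuous_on_subset[OF cM m(2)] m(1) open_ball])
  define W where "W = (W1 \<inter> q -` A) \<inter> W2 \<inter> \<pi> -` ball c (R / 2)"
  have c\<pi>': "continuous_on UNIV \<pi>" using has_partialsD(2)[OF \<pi>p] by simp
  have oW: "open W" unfolding W_def
    by (intro open_Int continuous_open_preimage[OF cq q(4) oA] W2(1) open_vimage open_ball c\<pi>')
  have "p0 \<in> W"
    using p0W p0W2 R(1) m(3) by (simp add: W_def A_def qp0 c_def[symmetric] c\<pi>)
  have main: "(p \<in> y ` \<Omega> \<longleftrightarrow> s * q p $ k < 0) \<and> (p \<in> frontier (y ` \<Omega>) \<longleftrightarrow> q p $ k = 0) \<and>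
      (\<exists>\<kappa>'. 0 < \<sigma> * \<kappa>' \<and> p $ k' - H (\<pi> p) = (- s * q p $ k) * \<kappa>')" if p: "p \<in> W" for p
  proof -
    define a where "a = q p"
    have pW1: "p \<in> W1" and aA: "a \<in> A" and pW2: "p \<in> W2" and \<pi>b: "\<pi> p \<in> ball c (R / 2)"
      using p by (auto simp: W_def a_def)
    have aO1: "a \<in> O1" and Ga: "G a = p" using q(6) pW1 by (auto simp: homeomorphism_def a_def)
    have aB: "a \<in> ?B" using aO1 q(2) by auto
    have TU: "T a \<in> U" using aB TB by auto
    have below: "p = y (T a)" if "s * a $ k \<le> 0" using GE(1) that aB Ga by auto
    \<comment> \<open>By the choice of \<open>W2\<close> a point of the closed image has a preimage
      \<open>x\<close> with \<open>S x\<close> in the domain where \<open>G\<close> is injective, so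
      \<open>S x\<close> is \<open>a\<close>; but \<open>S x\<close> lies on the side of \<Omega> or
      on the hyperplane.\<close>
    have above: "p \<notin> closure (y ` \<Omega>)" if "0 < s * a $ k"
    proof
      assume "p \<in> closure (y ` \<Omega>)"
      then obtain x where x: "x \<in> closure \<Omega>" "p = y x" unfolding im(2) by auto
      then have "p \<in> y ` closure \<Omega> \<inter> Z -` (S -` O1)" using W2(2) pW2 by blast
      then have SO: "S x \<in> O1" using x Zy by simp
      then have SB: "S x \<in> ?B" using q(2) by auto
      have "T (S x) \<in> U" using SB TB by blast
      then have "s * S x $ k \<le> 0" using T_closure[of "S x"] x(1) by simp
      then have "G (S x) = p" using GE(1) SB x by auto
      then have "S x = a" using homeomorphism_apply1[OF q(6) SO] by (simp add: a_def)
      then show False using \<open>s * S x $ k \<le> 0\<close> that by simp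
    qed
    have disj: "frontier (y ` \<Omega>) \<inter> y ` \<Omega> = {}" using im(1) by (auto simp: frontier_def interior_open)
    have "p \<in> y ` \<Omega> \<longleftrightarrow> s * a $ k < 0"
    proof
      assume p\<Omega>: "p \<in> y ` \<Omega>"
      then have "\<not> 0 < s * a $ k" using above subsetD[OF closure_subset p\<Omega>] by blast
      moreover have "s * a $ k \<noteq> 0"
      proof
        assume z: "s * a $ k = 0"
        then have "T a \<in> frontier \<Omega>" using T_frontier[OF TU] s_nonzero by simp
        then have "p \<in> frontier (y ` \<Omega>)" using below z im(3) by auto
        then show False using disj p\<Omega> by auto
      qed
      ultimately show "s * a $ k < 0" by linarith
    next
      assume "s * a $ k < 0"
      then show "p \<in> y ` \<Omega>" using below T_domain[OF TU] by auto
    qed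
    moreover have "p \<in> frontier (y ` \<Omega>) \<longleftrightarrow> a $ k = 0"
    proof
      assume pf: "p \<in> frontier (y ` \<Omega>)"
      then have "p \<in> closure (y ` \<Omega>)" by (simp add: frontier_def)
      then have "\<not> 0 < s * a $ k" using above by blast
      moreover have "\<not> s * a $ k < 0" using below T_domain[OF TU] pf disj by auto
      ultimately show "a $ k = 0" using s_nonzero by (simp add: not_less antisym)
    next
      assume "a $ k = 0"
      then show "p \<in> frontier (y ` \<Omega>)" using below T_frontier[OF TU] im(3) by auto
    qed
    moreover have "\<exists>\<kappa>'. 0 < \<sigma> * \<kappa>' \<and> p $ k' - H (\<pi> p) = (- s * a $ k) * \<kappa>'"
    proof -
      define \<tau> where "\<tau> = - s * a $ k"
      have Ma: "M a = \<pi> p + \<tau> *\<^sub>R axis k' 1"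
        by (simp add: M_def Ga \<pi>_def \<tau>_def algebra_simps)
      have "m (M a) = a" using aA m(6) by (auto simp: A_def homeomorphism_def)
      then have HM: "H (M a) = p $ k'" by (simp add: H_def Ga)
      have Mb: "M a \<in> ball c R" using aA by (simp add: A_def)
      have pb: "\<pi> p \<in> ball c R" using \<pi>b R(1) by auto
      have seg: "\<pi> p + (u * \<tau>) *\<^sub>R axis k' 1 \<in> ball c R" if "0 \<le> u" "u \<le> 1" for u
      proof -
        have "(1 - u) *\<^sub>R \<pi> p + u *\<^sub>R M a \<in> ball c R"
          using convexD_alt[OF convex_ball pb Mb that] .
        moreover have "(1 - u) *\<^sub>R \<pi> p + u *\<^sub>R M a = \<pi> p + (u * \<tau>) *\<^sub>R axis k' 1"
          by (simp add: Ma algebra_simps)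
        ultimately show ?thesis by simp
      qed
      \<comment> \<open>The mean value theorem along axis \<open>k'\<close> writes
        \<open>p $ k' - H (\<pi> p)\<close> as the height \<open>\<tau>\<close> times a value of
        \<open>\<kappa>\<close>, whose sign is constant on the ball.\<close>
      have "\<exists>z>0. z < 1 \<and> H (\<pi> p + (1 * \<tau>) *\<^sub>R axis k' 1) - H (\<pi> p + (0 * \<tau>) *\<^sub>R axis k' 1) =
          (1 - 0) * (\<tau> * \<kappa> (\<pi> p + (z * \<tau>) *\<^sub>R axis k' 1))"
      proof (rule MVT2)
        fix u :: real assume u: "0 \<le> u" "u \<le> 1"
        have d: "((\<lambda>u. \<pi> p + (u * \<tau>) *\<^sub>R axis k' 1) has_derivative (\<lambda>v. (v * \<tau>) *\<^sub>R axis k' 1)) (at u)"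
          by (auto intro!: derivative_eq_intros)
        have "\<pi> p + (u * \<tau>) *\<^sub>R axis k' 1 \<in> V" using seg[OF u] R(2) by auto
        note dH = has_derivative_compose[OF d Hder[OF this]]
        show "((\<lambda>u. H (\<pi> p + (u * \<tau>) *\<^sub>R axis k' 1)) has_real_derivative \<tau> * \<kappa> (\<pi> p + (u * \<tau>) *\<^sub>R axis k' 1)) (at u)"
        proof -
          have "(\<lambda>v. \<Sum>i\<in>UNIV. ((v * \<tau>) *\<^sub>R axis k' 1) $ i *\<^sub>R EH i (\<pi> p + (u * \<tau>) *\<^sub>R axis k' 1)) =
              (\<lambda>v. \<tau> * \<kappa> (\<pi> p + (u * \<tau>) *\<^sub>R axis k' 1) * v)"
            unfolding sum_scaled_axis unfolding \<kappa>_def real_scaleR_def by (simp only: mult_ac)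
          with dH show ?thesis by (simp only: has_field_derivative_def)
        qed
      qed simp
      then obtain z where z: "0 < z" "z < 1" "H (M a) - H (\<pi> p) = \<tau> * \<kappa> (\<pi> p + (z * \<tau>) *\<^sub>R axis k' 1)"
        by (auto simp: Ma)
      then show ?thesis
        using R(3)[OF seg[of z]] HM by (intro exI[of _ "\<kappa> (\<pi> p + (z * \<tau>) *\<^sub>R axis k' 1)"]) (simp add: \<tau>_def)
    qed
    ultimately show ?thesis by (simp add: a_def)
  qed
  \<comment> \<open>The sign is \<open>- \<sigma>\<close> because points of the image have positive
    height, so that \<open>\<sigma> * (p $ k' - H (\<pi> p))\<close> is positive on them.\<close>
  have "local_graph (y ` \<Omega>) W k' (- \<sigma>) h'"
    unfolding local_graph_def
  proof (intro conjI)
    show "open W" by (rule oW)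
    show "- \<sigma> \<in> {-1, 1}" using \<sigma>(1) by auto
    show "\<forall>x c. h' (x + c *\<^sub>R axis k' 1) = h' x"
    proof (intro allI)
      fix x c
      have "\<pi> (x + c *\<^sub>R axis k' 1) = \<pi> x" by (simp add: \<pi>_def algebra_simps)
      then show "h' (x + c *\<^sub>R axis k' 1) = h' x" by (simp add: h'_def)
    qed
    have "(p \<in> y ` \<Omega> \<longleftrightarrow> - \<sigma> * p $ k' < h' p) \<and> (p \<in> frontier (y ` \<Omega>) \<longleftrightarrow> - \<sigma> * p $ k' = h' p)" if p: "p \<in> W" for p
    proof -
      have hp: "h' p = - \<sigma> * H (\<pi> p)" by (rule h'H) (use p in \<open>simp add: W_def\<close>)
      obtain \<kappa>' where \<kappa>': "0 < \<sigma> * \<kappa>'" "p $ k' - H (\<pi> p) = (- s * q p $ k) * \<kappa>'"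
        and iff: "p \<in> y ` \<Omega> \<longleftrightarrow> s * q p $ k < 0" "p \<in> frontier (y ` \<Omega>) \<longleftrightarrow> q p $ k = 0" using main[OF p] by blast
      define d where "d = (- (s * q p $ k)) * (\<sigma> * \<kappa>')"
      have "h' p - (- \<sigma> * p $ k') = \<sigma> * (p $ k' - H (\<pi> p))" unfolding hp by (simp add: algebra_simps)
      then have "h' p - (- \<sigma> * p $ k') = d" unfolding \<kappa>'(2) d_def by simp
      moreover have "0 < (- X) * P \<longleftrightarrow> X < 0" "(- X) * P = 0 \<longleftrightarrow> X = 0" if "0 < P" for X P :: real
        using that by (auto simp: mult_less_0_iff)
      from this[OF \<kappa>'(1), of "s * q p $ k"] have "0 < d \<longleftrightarrow> s * q p $ k < 0" "d = 0 \<longleftrightarrow> q p $ k = 0"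
        using s_nonzero by (simp_all only: d_def mult_eq_0_iff simp_thms)
      ultimately show ?thesis unfolding iff by linarith
    qed
    then show "W \<inter> y ` \<Omega> = {x \<in> W. - \<sigma> * x $ k' < h' x}" "W \<inter> frontier (y ` \<Omega>) = {x \<in> W. - \<sigma> * x $ k' = h' x}"
      by blast+
  qed
  with \<open>p0 \<in> W\<close> h'1 show ?thesis unfolding p0_def by blast
qed

end

section \<open>Outer normals and tangential Jacobians\<close>

lemma inner_transpose: "(transpose A *v x) \<bullet> y = x \<bullet> (A *v y)" for A :: "real^'n^'m"
  by (simp add: dot_lmul_matrix)

lemma matrix_add_rdistrib: "(A + B) ** C = A ** C + B ** C" for A B :: "real^'n^'m"
  by (simp add: vec_eq_iff matrix_matrix_mult_def distrib_right sum.distrib)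

lemma matrix_sub_rdistrib: "(A - B) ** C = A ** C - B ** C" for A B :: "real^'n^'m"
  by (simp add: vec_eq_iff matrix_matrix_mult_def left_diff_distrib sum_subtractf)

text \<open>Test with \<open>c - \<delta> *\<^sub>R n\<close>, where \<open>c\<close> is the part of
  \<open>b\<close> orthogonal to \<open>n\<close>; letting \<open>\<delta>\<close> tend to 0 forces
  \<open>c = 0\<close>.\<close>

lemma supporting_normal:
  fixes b n :: "'a::real_inner"
  assumes n: "norm n = 1" and d: "\<And>d. d \<bullet> n < 0 \<Longrightarrow> d \<bullet> b \<le> 0"
  shows "b = (b \<bullet> n) *\<^sub>R n" and "0 \<le> b \<bullet> n"
proof -
  have nn: "n \<bullet> n = 1" using n by (simp add: dot_square_norm)
  define c where "c = b - (b \<bullet> n) *\<^sub>R n"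
  have cn: "c \<bullet> n = 0" by (simp add: c_def inner_diff_left nn)
  have cb: "c \<bullet> b = c \<bullet> c" using cn by (simp add: c_def inner_diff_right inner_commute)
  show "0 \<le> b \<bullet> n" using d[of "- n"] nn by (simp add: inner_commute)
  have "c \<bullet> c \<le> \<delta> * (b \<bullet> n)" if "0 < \<delta>" for \<delta>
  proof -
    have "(c - \<delta> *\<^sub>R n) \<bullet> n < 0" using that nn cn by (simp add: inner_diff_left)
    from d[OF this] show ?thesis using cb by (simp add: inner_diff_left inner_commute[of n b])
  qed
  have "c \<bullet> c \<le> 0"
  proof (rule field_le_epsilon)
    fix e :: real assume e: "0 < e"
    have "c \<bullet> c \<le> (e / (1 + b \<bullet> n)) * (b \<bullet> n)"
      using e \<open>0 \<le> b \<bullet> n\<close> by (intro \<open>\<And>\<delta>. 0 < \<delta> \<Longrightarrow> c \<bullet> c \<le> \<delta> * (b \<bullet> n)\<close>) simp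
    also have "\<dots> \<le> e" using e \<open>0 \<le> b \<bullet> n\<close> by (simp add: field_simps)
    finally show "c \<bullet> c \<le> 0 + e" by simp
  qed
  then have "c \<bullet> c = 0" using inner_ge_zero[of c] by (rule antisym)
  then have "c = 0" by simp
  then show "b = (b \<bullet> n) *\<^sub>R n" by (simp add: c_def)
qed

context flattening
begin

lemma enters_domain:
  assumes x: "x \<in> U" "x \<in> frontier \<Omega>" and d: "d \<bullet> outer_normal \<Omega> x < 0"
  shows "\<forall>\<^sub>F t in at_right 0. x + t *\<^sub>R d \<in> \<Omega>"
proof -
  let ?N = "patch_normal k s h x"
  define \<rho> where "\<rho> x = h x - s * x $ k" for x
  have Npos: "0 < norm ?N" by (rule norm_patch_normal(2)[OF graph h])
  have \<rho>0: "\<rho> x = 0" using local_graphD(5)[OF graph x(1)] x(2) by (simp add: \<rho>_def)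
  have der: "((\<lambda>t. \<rho> (x + t *\<^sub>R d)) has_real_derivative - (d \<bullet> ?N)) (at 0)"
    using has_partials_along[OF has_partials_graph_distance[OF h, of s k], of x 0 d]
    by (simp add: \<rho>_def has_real_derivative_iff_has_vector_derivative inner_vec_def sum_negf)
  have "((\<lambda>t. x + t *\<^sub>R d) \<longlongrightarrow> x + 0 *\<^sub>R d) (at_right 0)" by (intro tendsto_intros)
  then have inU: "\<forall>\<^sub>F t in at_right 0. x + t *\<^sub>R d \<in> U"
    by (rule topological_tendstoD) (use local_graphD(1)[OF graph] x in auto)
  have "d \<bullet> ?N < 0"
    using d Npos unfolding outer_normal_patch[OF graph h open_\<Omega> x] by (simp add: mult_less_0_iff)
  then obtain \<delta> where \<delta>: "0 < \<delta>" "\<And>t. 0 < t \<Longrightarrow> t < \<delta> \<Longrightarrow> \<rho> (x + 0 *\<^sub>R d) < \<rho> (x + (0 + t) *\<^sub>R d)"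
    using DERIV_pos_inc_right[OF der] by auto
  have "\<forall>\<^sub>F t in at_right 0. 0 < \<rho> (x + t *\<^sub>R d)"
    unfolding eventually_at_right_field using \<delta> \<rho>0 by (intro exI[of _ \<delta>]) auto
  with inU show ?thesis
    by eventually_elim (use local_graphD(4)[OF graph] in \<open>simp add: \<rho>_def\<close>)
qed

text \<open>Directions pointing into \<Omega> are mapped by \<open>A\<close> to directions along
  which the defining function of the image does not decrease. Hence \<open>transpose A *v ?N\<close>
  is a nonnegative multiple of the old normal, and since \<open>transpose A\<close> is injective,
  \<open>?N\<close> is a positive multiple of \<open>m\<close>.\<close>

lemma outer_normal_image:
  fixes y :: "real^'n \<Rightarrow> real^'n"
  assumes y: "has_partials \<Omega> y D" and x0: "x0 \<in> U" "x0 \<in> frontier \<Omega>"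
    and graph': "local_graph (y ` \<Omega>) U' k' s' h'" and h': "C1_closure UNIV h'" and o': "open (y ` \<Omega>)"
    and yx: "y x0 \<in> U'" "y x0 \<in> frontier (y ` \<Omega>)"
    and det: "det (\<chi> i j. D j x0 $ i) \<noteq> 0" and c: "0 < c"
    and m: "transpose (\<chi> i j. D j x0 $ i) *v m = c *\<^sub>R outer_normal \<Omega> x0"
  shows "outer_normal (y ` \<Omega>) (y x0) = m /\<^sub>R norm m"
proof -
  define A where "A = (\<chi> i j. D j x0 $ i)"
  let ?\<nu> = "outer_normal \<Omega> x0" and ?N = "patch_normal k' s' h' (y x0)"
  have n\<nu>: "norm ?\<nu> = 1"
    unfolding outer_normal_patch[OF graph h open_\<Omega> x0] using norm_patch_normal(2)[OF graph h, of x0] by simp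
  have Npos: "0 < norm ?N" by (rule norm_patch_normal(2)[OF graph' h'])
  define \<rho> where "\<rho> x = h' x - s' * x $ k'" for x
  have dv: "(A *v d) \<bullet> ?N \<le> 0" if d: "d \<bullet> ?\<nu> < 0" for d
  proof -
    obtain \<delta> where \<delta>: "0 < \<delta>" "\<And>t. 0 < t \<Longrightarrow> t < \<delta> \<Longrightarrow> x0 + t *\<^sub>R d \<in> \<Omega>"
      using enters_domain[OF x0 d] unfolding eventually_at_right_field by auto
    have im: "(\<lambda>t. x0 + t *\<^sub>R d) ` {0..<\<delta>} \<subseteq> closure \<Omega>"
    proof
      fix z assume "z \<in> (\<lambda>t. x0 + t *\<^sub>R d) ` {0..<\<delta>}"
      then obtain t where t: "0 \<le> t" "t < \<delta>" "z = x0 + t *\<^sub>R d" by auto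
      show "z \<in> closure \<Omega>"
      proof (cases "t = 0")
        case True
        then show ?thesis using t x0(2) by (simp add: frontier_def)
      next
        case False
        then show ?thesis using \<delta>(2)[of t] t subsetD[OF closure_subset] by auto
      qed
    qed
    have d1: "((\<lambda>t. x0 + t *\<^sub>R d) has_derivative (\<lambda>t. t *\<^sub>R d)) (at 0 within {0..<\<delta>})"
      by (auto intro!: derivative_eq_intros)
    have d2: "(y has_derivative (\<lambda>v. \<Sum>i\<in>UNIV. v $ i *\<^sub>R D i x0)) (at (x0 + 0 *\<^sub>R d) within (\<lambda>t. x0 + t *\<^sub>R d) ` {0..<\<delta>})"
      using has_derivative_subset[OF has_derivative_at_boundary[OF y x0] im] by simp
    have d3: "(\<rho> has_derivative (\<lambda>v. \<Sum>i\<in>UNIV. v $ i *\<^sub>R (- ?N $ i))) (at (y (x0 + 0 *\<^sub>R d)))"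
      using has_partialsD(1)[OF has_partials_graph_distance[OF h', of s' k'] UNIV_I, of "y x0"] by (simp add: \<rho>_def[abs_def])
    have "((\<lambda>t. \<rho> (y (x0 + t *\<^sub>R d))) has_derivative (\<lambda>t. \<Sum>i\<in>UNIV. (\<Sum>j\<in>UNIV. (t *\<^sub>R d) $ j *\<^sub>R D j x0) $ i *\<^sub>R (- ?N $ i))) (at 0 within {0..<\<delta>})"
      by (rule has_derivative_compose[OF has_derivative_in_compose[OF d1 d2] d3])
    moreover have "(\<lambda>t. \<Sum>i\<in>UNIV. (\<Sum>j\<in>UNIV. (t *\<^sub>R d) $ j *\<^sub>R D j x0) $ i *\<^sub>R (- ?N $ i)) = (*) (- ((A *v d) \<bullet> ?N))"
    proof
      fix t
      have "(\<Sum>j\<in>UNIV. (t *\<^sub>R d) $ j *\<^sub>R D j x0) = t *\<^sub>R (A *v d)"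
        unfolding partials_matrix A_def by (rule matrix_vector_mult_scaleR)
      then show "(\<Sum>i\<in>UNIV. (\<Sum>j\<in>UNIV. (t *\<^sub>R d) $ j *\<^sub>R D j x0) $ i *\<^sub>R (- ?N $ i)) = - ((A *v d) \<bullet> ?N) * t"
        by (simp add: inner_vec_def sum_distrib_left sum_negf mult_ac)
    qed
    ultimately have "((\<lambda>t. \<rho> (y (x0 + t *\<^sub>R d))) has_field_derivative - ((A *v d) \<bullet> ?N)) (at 0 within {0..<\<delta>})"
      by (simp add: has_field_derivative_def)
    then have lim: "((\<lambda>t. (\<rho> (y (x0 + t *\<^sub>R d)) - \<rho> (y (x0 + 0 *\<^sub>R d))) / (t - 0)) \<longlongrightarrow> - ((A *v d) \<bullet> ?N)) (at 0 within {0..<\<delta>})"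
      unfolding has_field_derivative_iff .
    have "((\<lambda>t. y (x0 + t *\<^sub>R d)) \<longlongrightarrow> y (x0 + 0 *\<^sub>R d)) (at 0 within {0..<\<delta>})"
      using has_derivative_continuous[OF has_derivative_in_compose[OF d1 d2]] by (simp add: continuous_within)
    then have "\<forall>\<^sub>F t in at 0 within {0..<\<delta>}. y (x0 + t *\<^sub>R d) \<in> U'"
      by (rule topological_tendstoD) (use local_graphD(1)[OF graph'] yx(1) in auto)
    moreover have "\<forall>\<^sub>F t in at 0 within {0..<\<delta>}. t \<in> {0<..<\<delta>}"
      unfolding eventually_at_filter by (auto simp: less_le intro!: always_eventually)
    ultimately have "\<forall>\<^sub>F t in at 0 within {0..<\<delta>}. 0 \<le> (\<rho> (y (x0 + t *\<^sub>R d)) - \<rho> (y (x0 + 0 *\<^sub>R d))) / (t - 0)"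
    proof eventually_elim
      case (elim t)
      then have "y (x0 + t *\<^sub>R d) \<in> y ` \<Omega>" using \<delta>(2)[of t] by auto
      then have "0 < \<rho> (y (x0 + t *\<^sub>R d))" using local_graphD(4)[OF graph' elim(1)] by (simp add: \<rho>_def)
      moreover have "\<rho> (y x0) = 0" using local_graphD(5)[OF graph' yx(1)] yx(2) by (simp add: \<rho>_def)
      ultimately show ?case using elim by simp
    qed
    moreover have "at 0 within {0..<\<delta>} \<noteq> bot"
    proof -
      have "(0::real) islimpt {0..<\<delta>}"
        using \<delta>(1) islimpt_greaterThanLessThan1[of 0 \<delta>] islimpt_subset[of 0 "{0<..<\<delta>}" "{0..<\<delta>}"] by auto
      then show ?thesis by (simp add: trivial_limit_within)
    qed
    ultimately have "0 \<le> - ((A *v d) \<bullet> ?N)" using tendsto_lowerbound[OF lim] by blast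
    then show ?thesis by simp
  qed
  define b where "b = transpose A *v ?N"
  have "d \<bullet> b \<le> 0" if "d \<bullet> ?\<nu> < 0" for d
  proof -
    have "d \<bullet> b = b \<bullet> d" by (rule inner_commute)
    also have "\<dots> = ?N \<bullet> (A *v d)" unfolding b_def by (rule inner_transpose)
    finally show ?thesis using dv[OF that] by (simp only: inner_commute)
  qed
  note b = supporting_normal[OF n\<nu> this]
  have dA: "det A \<noteq> 0" using det by (simp add: A_def)
  have inj: "v = w" if "transpose A *v v = transpose A *v w" for v w
  proof -
    have "invertible (transpose A)" using dA by (simp add: invertible_det_nz)
    then obtain B where "B ** transpose A = mat 1" unfolding invertible_def by blast
    then show ?thesis using that by (metis matrix_vector_mul_assoc matrix_vector_mul_lid)
  qed
  define \<mu> where "\<mu> = (b \<bullet> ?\<nu>) / c"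
  have "transpose A *v ?N = transpose A *v (\<mu> *\<^sub>R m)"
    unfolding b_def[symmetric] matrix_vector_mult_scaleR m[folded A_def] using b(1) c by (simp add: \<mu>_def)
  then have N: "?N = \<mu> *\<^sub>R m" by (rule inj)
  have "0 \<le> \<mu>" using b(2) c by (simp add: \<mu>_def)
  moreover have "\<mu> \<noteq> 0" using N Npos by auto
  ultimately have "0 < \<mu>" by simp
  then show ?thesis
    unfolding outer_normal_patch[OF graph' h' o' yx] N by simp
qed

end

context regular_domain
begin

lemma frontier_patch:
  assumes "x \<in> frontier \<Omega>"
  shows "\<exists>U k s h \<zeta>. (U, k, s, h, \<zeta>) \<in> set atlas \<and> x \<in> U \<and> flattening \<Omega> U k s h"
proof -
  have "(\<Sum>(U, k, s, h, \<zeta>)\<leftarrow>atlas. \<zeta> x) \<noteq> 0" using boundary_atlas_sum[OF atlas assms] by simp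
  then obtain p where p: "p \<in> set atlas" "(case p of (U, k, s, h, \<zeta>) \<Rightarrow> \<zeta> x) \<noteq> 0"
    by (metis (no_types, lifting) map_eq_conv sum_list_0 )
  obtain U k s h \<zeta> where P: "p = (U, k, s, h, \<zeta>)" by (cases p)
  note A = boundary_atlasD[OF atlas p(1)[unfolded P]]
  obtain K where "K \<subseteq> U" "\<And>x. x \<notin> K \<Longrightarrow> \<zeta> x = 0" using A(5) by auto
  then have "x \<in> U" using p(2) P by auto
  moreover have "flattening \<Omega> U k s h" using A open_domain by unfold_locales auto
  ultimately show ?thesis using p(1) P by blast
qed

lemma norm_outer_normal:
  assumes "x \<in> frontier \<Omega>"
  shows "norm (outer_normal \<Omega> x) = 1"
proof -
  obtain U k s h where x: "x \<in> U" "flattening \<Omega> U k s h" using frontier_patch[OF assms] by blast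
  then interpret flattening \<Omega> U k s h by simp
  show ?thesis
    unfolding outer_normal_patch[OF graph h open_\<Omega> x(1) assms] using norm_patch_normal(2)[OF graph h, of x] by simp
qed

lemma continuous_on_outer_normal: "continuous_on (frontier \<Omega>) (outer_normal \<Omega>)"
  unfolding continuous_on_eq_continuous_within continuous_within
proof
  fix x assume xf: "x \<in> frontier \<Omega>"
  obtain U k s h where x: "x \<in> U" "flattening \<Omega> U k s h" using frontier_patch[OF xf] by blast
  then interpret flattening \<Omega> U k s h by simp
  let ?n = "\<lambda>x. patch_normal k s h x /\<^sub>R norm (patch_normal k s h x)"
  have "continuous_on UNIV ?n"
    using norm_patch_normal(2)[OF graph h]
    by (intro continuous_on_scaleR continuous_on_inverse continuous_on_norm continuous_on_patch_normal[OF h]) (simp add: less_imp_neq[symmetric])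
  then have "(?n \<longlongrightarrow> ?n x) (at x within frontier \<Omega>)"
    by (simp add: continuous_on_eq_continuous_at continuous_at Lim_at_imp_Lim_at_within)
  moreover have "\<forall>\<^sub>F z in at x within frontier \<Omega>. ?n z = outer_normal \<Omega> z"
  proof -
    have "\<forall>\<^sub>F z in at x within frontier \<Omega>. z \<in> U"
      by (rule topological_tendstoD[OF tendsto_ident_at local_graphD(1)[OF graph] x(1)])
    moreover have "\<forall>\<^sub>F z in at x within frontier \<Omega>. z \<in> frontier \<Omega>"
      by (auto simp: eventually_at_filter)
    ultimately show ?thesis
      by eventually_elim (simp add: outer_normal_patch[OF graph h open_\<Omega>])
  qed
  ultimately have "(outer_normal \<Omega> \<longlongrightarrow> ?n x) (at x within frontier \<Omega>)" by (rule Lim_transform_eventually)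
  then show "(outer_normal \<Omega> \<longlongrightarrow> outer_normal \<Omega> x) (at x within frontier \<Omega>)"
    by (simp add: outer_normal_patch[OF graph h open_\<Omega> x(1) xf])
qed

lemma image_regular_domain:
  assumes y: "has_partials \<Omega> y D" and inj: "inj_on y (closure \<Omega>)"
    and det: "\<And>x. x \<in> closure \<Omega> \<Longrightarrow> det (\<chi> i j. D j x $ i) \<noteq> 0"
  shows "regular_domain (y ` \<Omega>)"
proof
  note im = closure_frontier_image[OF bounded_domain open_domain has_partialsD(2)[OF y] inj]
  show "bounded (y ` \<Omega>)" "open (y ` \<Omega>)" by (rule im)+
  have "\<exists>ps. boundary_atlas (y ` \<Omega>) ps \<and> (\<forall>(U, k, s, h, \<zeta>)\<in>set ps. True)"
  proof (rule boundary_atlas_exists[OF im(4)])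
    fix p assume "p \<in> frontier (y ` \<Omega>)"
    then obtain x where xf: "x \<in> frontier \<Omega>" "p = y x" unfolding im(3) by auto
    obtain U k s h where x: "x \<in> U" "flattening \<Omega> U k s h" using frontier_patch[OF xf(1)] by blast
    then interpret flattening \<Omega> U k s h by simp
    show "\<exists>U k s h. p \<in> U \<and> local_graph (y ` \<Omega>) U k s h \<and> C1_closure UNIV h \<and> True"
      using image_local_graph[OF bounded_domain y inj det x(1) xf(1)] xf(2) by auto
  qed
  then show "\<exists>ps. boundary_atlas (y ` \<Omega>) ps" by blast
qed

lemma outer_normal_image:
  assumes y: "has_partials \<Omega> y D" and inj: "inj_on y (closure \<Omega>)"
    and det: "\<And>x. x \<in> closure \<Omega> \<Longrightarrow> det (\<chi> i j. D j x $ i) \<noteq> 0"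
    and x: "x \<in> frontier \<Omega>" and c: "0 < c"
    and m: "transpose (\<chi> i j. D j x $ i) *v m = c *\<^sub>R outer_normal \<Omega> x"
  shows "outer_normal (y ` \<Omega>) (y x) = m /\<^sub>R norm m"
proof -
  note im = closure_frontier_image[OF bounded_domain open_domain has_partialsD(2)[OF y] inj]
  interpret I: regular_domain "y ` \<Omega>" by (rule image_regular_domain[OF y inj det])
  have yx: "y x \<in> frontier (y ` \<Omega>)" unfolding im(3) using x by blast
  obtain U k s h where U: "x \<in> U" "flattening \<Omega> U k s h" using frontier_patch[OF x] by blast
  obtain U' k' s' h' where U': "y x \<in> U'" "flattening (y ` \<Omega>) U' k' s' h'" using I.frontier_patch[OF yx] by blast
  interpret flattening \<Omega> U k s h by (rule U(2))
  have g': "local_graph (y ` \<Omega>) U' k' s' h'" "C1_closure UNIV h'"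
    using flattening.graph[OF U'(2)] flattening.h[OF U'(2)] by auto
  have "x \<in> closure \<Omega>" using x by (simp add: frontier_def)
  show ?thesis
    by (rule outer_normal_image[OF y U(1) x g' im(1) U'(1) yx det[OF \<open>x \<in> closure \<Omega>\<close>] c m])
qed

end

section \<open>Determinants: rank-one updates, tangential Gram determinants and Jacobi's
  formula\<close>

lemma det_axis_rows:
  fixes A :: "real^'n^'n"
  assumes "\<And>i. i \<noteq> k \<Longrightarrow> A $ i = axis i 1"
  shows "det A = A $ k $ k"
proof -
  have "of_int (sign p) * (\<Prod>i\<in>UNIV. A $ i $ p i) = 0" if p: "p permutes UNIV" "p \<noteq> id" for p
  proof -
    \<comment> \<open>A map that moves \<open>k\<close> and fixes everything else is not injective,
      so a nontrivial permutation moves another index, whose row has a zero entry at the new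
      place.\<close>
    have "\<exists>i. i \<noteq> k \<and> p i \<noteq> i"
    proof (rule ccontr)
      assume "\<not> (\<exists>i. i \<noteq> k \<and> p i \<noteq> i)"
      then have fixp: "p i = i" if "i \<noteq> k" for i using that by blast
      have "p k = k"
      proof (rule ccontr)
        assume "p k \<noteq> k"
        then have "p (p k) = p k" by (rule fixp)
        then show False using permutes_inj[OF p(1)] \<open>p k \<noteq> k\<close> by (simp add: inj_eq)
      qed
      then have "p = id" using fixp by (metis eq_id_iff)
      then show False using p(2) by simp
    qed
    then obtain i where "i \<noteq> k" "p i \<noteq> i" by blast
    then have "A $ i $ p i = 0" using assms by (simp add: axis_def)
    then show ?thesis by (metis UNIV_I finite mult_zero_right prod_zero)
  qed
  then have "det A = (\<Sum>p\<in>{id}. of_int (sign p) * (\<Prod>i\<in>UNIV. A $ i $ p i))"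
    unfolding det_def by (intro sum.mono_neutral_right) (auto simp: permutes_id)
  also have "\<dots> = (\<Prod>i\<in>UNIV. A $ i $ i)" by (simp add: sign_id)
  also have "\<dots> = A $ k $ k * (\<Prod>i\<in>UNIV - {k}. A $ i $ i)" by (rule prod.remove) auto
  also have "(\<Prod>i\<in>UNIV - {k}. A $ i $ i) = 1" using assms by (intro prod.neutral) simp
  finally show ?thesis by simp
qed

definition outer_product :: "real^'n \<Rightarrow> real^'n \<Rightarrow> real^'n^'n" where
  "outer_product a b = (\<chi> i j. a $ i * b $ j)"

text \<open>An orthogonal map taking \<open>a\<close> to a multiple of an axis vector reduces the
  claim to a matrix with all rows but one equal to those of the identity.\<close>

lemma matrix_determinant_lemma: "det (mat 1 + outer_product a b) = 1 + a \<bullet> (b :: real^'n)"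
proof -
  obtain k :: 'n where True by simp
  have "norm a = norm (norm a *\<^sub>R axis k (1::real))" by simp
  then obtain f :: "real^'n \<Rightarrow> real^'n" where f: "orthogonal_transformation f" "f a = norm a *\<^sub>R axis k 1"
    by (rule orthogonal_transformation_exists)
  define R where "R = matrix f"
  have R: "orthogonal_matrix R" using f(1) by (simp add: R_def orthogonal_transformation_matrix)
  have Rv: "R *v v = f v" for v
    using f(1) by (simp add: R_def matrix_works orthogonal_transformation_linear linear_matrix_vector_mul_eq
        orthogonal_transformation_def)
  have RR: "R ** transpose R = mat 1" using R by (simp add: orthogonal_matrix_def)
  have op: "R ** outer_product a b ** transpose R = outer_product (R *v a) (R *v b)"
  proof -
    have "(\<Sum>l\<in>UNIV. (\<Sum>m\<in>UNIV. R $ i $ m * (a $ m * b $ l)) * R $ j $ l) =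
        (\<Sum>m\<in>UNIV. R $ i $ m * a $ m) * (\<Sum>l\<in>UNIV. R $ j $ l * b $ l)" (is "?l = ?r") for i j
    proof -
      have "?r = (\<Sum>m\<in>UNIV. \<Sum>l\<in>UNIV. R $ i $ m * a $ m * (R $ j $ l * b $ l))" by (rule sum_product)
      also have "\<dots> = (\<Sum>l\<in>UNIV. \<Sum>m\<in>UNIV. R $ i $ m * a $ m * (R $ j $ l * b $ l))" by (rule sum.swap)
      also have "\<dots> = ?l" by (intro sum.cong refl) (simp only: sum_distrib_left sum_distrib_right mult_ac)
      finally show ?thesis by simp
    qed
    then show ?thesis
      by (simp add: vec_eq_iff outer_product_def matrix_matrix_mult_def matrix_vector_mult_def transpose_def)
  qed
  have "R ** (mat 1 + outer_product a b) ** transpose R = mat 1 + outer_product (R *v a) (R *v b)"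
    by (simp add: matrix_add_ldistrib matrix_add_rdistrib RR op)
  then have "det R * det (mat 1 + outer_product a b) * det R = det (mat 1 + outer_product (R *v a) (R *v b))"
    by (metis det_mul det_transpose)
  moreover have "det R * det R = 1" using RR by (metis det_I det_mul det_transpose)
  ultimately have "det (mat 1 + outer_product a b) = det (mat 1 + outer_product (R *v a) (R *v b))"
    by (metis mult.assoc mult.commute mult_1)
  also have "\<dots> = (mat 1 + outer_product (R *v a) (R *v b)) $ k $ k"
    by (rule det_axis_rows) (auto simp: vec_eq_iff mat_def outer_product_def Rv f(2) axis_def)
  also have "\<dots> = 1 + norm a * f b $ k" by (simp add: mat_def outer_product_def Rv f(2))
  also have "norm a * f b $ k = f a \<bullet> f b" by (simp add: f(2) inner_axis')
  also have "f a \<bullet> f b = a \<bullet> b" using f(1) by (simp add: orthogonal_transformation_def)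
  finally show ?thesis .
qed

lemma outer_product_mult:
  "outer_product a b ** outer_product c d = (b \<bullet> c) *\<^sub>R outer_product a d"
  "M ** outer_product a b = outer_product (M *v a) b"
  "outer_product a b ** M = outer_product a (transpose M *v b)"
  by (simp_all add: vec_eq_iff outer_product_def matrix_matrix_mult_def matrix_vector_mult_def transpose_def
      inner_vec_def sum_distrib_left sum_distrib_right mult_ac)

text \<open>\<open>m\<close> is the cofactor matrix of \<open>A\<close> applied to \<open>n\<close>;
  its length is the factor by which \<open>A\<close> stretches volumes in the hyperplane orthogonal
  to \<open>n\<close>. Two rank-one factors are split off, each evaluated by
  \<open>matrix_determinant_lemma\<close>.\<close>

lemma det_tangential:
  fixes A :: "real^'n^'n"
  assumes n: "norm n = 1" and dA: "det A \<noteq> 0" and m: "transpose A *v m = det A *\<^sub>R n"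
  defines "N \<equiv> outer_product n n" and "P \<equiv> mat 1 - outer_product n n"
  shows "det (P ** transpose A ** A ** P + N) = (norm m)\<^sup>2"
proof -
  have nn: "n \<bullet> n = 1" using n by (simp add: dot_square_norm)
  have Pn: "P *v n = 0"
    by (simp add: P_def matrix_vector_mult_diff_rdistrib)
       (simp add: vec_eq_iff outer_product_def matrix_vector_mult_def inner_vec_def[symmetric] mult.assoc sum_distrib_left[symmetric]
         nn[unfolded inner_vec_def inner_real_def])
  define M where "M = transpose A ** A"
  define C where "C = P ** M ** P + N"
  have PN: "P + N = mat 1" by (simp add: P_def N_def)
  have tP: "transpose P = P"
    by (simp add: P_def outer_product_def transpose_def vec_eq_iff mat_def mult.commute)
  have NP: "N ** P = 0"
  proof -
    have "N ** P = outer_product n (transpose P *v n)" unfolding N_def by (rule outer_product_mult(3))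
    then show ?thesis unfolding tP Pn by (simp add: outer_product_def vec_eq_iff)
  qed
  have NN: "N ** N = N" unfolding N_def outer_product_mult(1) nn by simp
  define a where "a = P *v (M *v n)"
  have na: "n \<bullet> a = 0"
  proof -
    have "(transpose P *v n) \<bullet> (M *v n) = n \<bullet> a" unfolding a_def by (rule inner_transpose)
    then show ?thesis unfolding tP Pn by simp
  qed
  have NC: "N ** C = N"
    by (simp add: C_def matrix_add_ldistrib matrix_mul_assoc NP NN)
  have PMN: "P ** M ** N = outer_product a n"
    unfolding N_def outer_product_mult(2) a_def by (simp add: matrix_vector_mul_assoc)
  \<comment> \<open>The rank-one factor has determinant 1, because \<open>a\<close> lies in the
    range of \<open>P\<close> and is orthogonal to \<open>n\<close>; this removes the projection on
    the right.\<close>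
  have 1: "P ** M + N = (mat 1 + outer_product a n) ** C"
  proof -
    have "P ** M = P ** M ** (P + N)" by (simp add: PN)
    then have "P ** M + N = C + outer_product a n"
      by (simp add: matrix_add_ldistrib PMN C_def algebra_simps)
    also have "outer_product a n = outer_product a n ** N"
      unfolding N_def outer_product_mult(1) nn by simp
    also have "\<dots> = outer_product a n ** (N ** C)" by (simp add: NC)
    also have "\<dots> = outer_product a n ** C"
      unfolding matrix_mul_assoc N_def outer_product_mult(1) nn by simp
    finally show ?thesis by (simp add: matrix_add_rdistrib)
  qed
  have "det C = det (P ** M + N)"
    unfolding 1 det_mul matrix_determinant_lemma using na by (simp add: inner_commute)
  also have "\<dots> = (norm m)\<^sup>2"
  proof -
    define w where "w = m /\<^sub>R det A"
    have Aw: "transpose A *v w = n" unfolding w_def matrix_vector_mult_scaleR m using dA by simp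
    obtain B where B: "A ** B = mat 1" "B ** A = mat 1"
      using dA invertible_det_nz[of A] by (auto simp: invertible_def)
    define z where "z = B *v w"
    have Az: "A *v z = w" by (simp add: z_def matrix_vector_mul_assoc B)
    have Mz: "M *v z = n" unfolding M_def matrix_vector_mul_assoc[symmetric] Az Aw ..
    have tM: "transpose M = M" by (simp add: M_def matrix_transpose_mul transpose_transpose)
    \<comment> \<open>Since \<open>z\<close> solves \<open>M *v z = n\<close> and \<open>n\<close>
      is a unit vector, the factor has determinant \<open>n \<bullet> z\<close>.\<close>
    have "P ** M + N = (mat 1 + outer_product n (z - n)) ** M"
    proof -
      have "outer_product n z ** M = N" unfolding outer_product_mult(3) tM Mz N_def ..
      moreover have "outer_product n (z - n) = outer_product n z - N"
        by (simp add: outer_product_def N_def vec_eq_iff right_diff_distrib)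
      ultimately show ?thesis
        by (simp add: matrix_add_rdistrib matrix_sub_rdistrib P_def N_def[symmetric])
    qed
    then have "det (P ** M + N) = (n \<bullet> z) * (det A)\<^sup>2"
      by (simp add: det_mul matrix_determinant_lemma inner_diff_right nn M_def power2_eq_square)
    also have "n \<bullet> z = w \<bullet> w"
    proof -
      have "n \<bullet> z = (transpose A *v w) \<bullet> z" unfolding Aw ..
      also have "\<dots> = w \<bullet> (A *v z)" by (rule inner_transpose)
      finally show ?thesis by (simp add: Az)
    qed
    also have "(w \<bullet> w) * (det A)\<^sup>2 = (norm m)\<^sup>2"
    proof -
      have "m = det A *\<^sub>R w" using dA by (simp add: w_def)
      then show ?thesis by (simp add: power_mult_distrib dot_square_norm)
    qed
    finally show ?thesis .
  qed
  finally show ?thesis by (simp add: C_def M_def matrix_mul_assoc)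
qed

text \<open>Jacobi's formula in the form suited to flows: with \<open>A' = M ** A t\<close>, row
  \<open>k\<close> of \<open>A'\<close> is a combination of the rows of \<open>A t\<close>, and all
  but the \<open>k\<close>-th of these give a determinant with two equal rows.\<close>

lemma DERIV_det:
  fixes A :: "real \<Rightarrow> real^'n^'n" and A' M :: "real^'n^'n"
  assumes d: "\<And>i j. ((\<lambda>s. A s $ i $ j) has_real_derivative A' $ i $ j) (at t)" and M: "A' = M ** A t"
  shows "((\<lambda>s. det (A s)) has_real_derivative (\<Sum>k\<in>UNIV. M $ k $ k) * det (A t)) (at t)"
proof -
  have prod: "((\<lambda>s. \<Prod>i\<in>UNIV. A s $ i $ p i) has_real_derivative
      (\<Sum>k\<in>UNIV. A' $ k $ p k * (\<Prod>i\<in>UNIV - {k}. A t $ i $ p i))) (at t)" for p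
    using has_field_derivative_prod[of "UNIV :: 'n set" "\<lambda>i s. A s $ i $ p i" "\<lambda>i. A' $ i $ p i" t] d
    by (simp add: mult.commute)
  have "((\<lambda>s. det (A s)) has_real_derivative
     (\<Sum>p\<in>{p. p permutes UNIV}. of_int (sign p) * (\<Sum>k\<in>UNIV. A' $ k $ p k * (\<Prod>i\<in>UNIV - {k}. A t $ i $ p i)))) (at t)"
    unfolding det_def by (intro DERIV_sum DERIV_cmult prod)
  also have "(\<Sum>p\<in>{p. p permutes UNIV}. of_int (sign p) * (\<Sum>k\<in>UNIV. A' $ k $ p k * (\<Prod>i\<in>UNIV - {k}. A t $ i $ p i))) =
      (\<Sum>k\<in>UNIV. det (\<chi> i. if i = k then A' $ k else A t $ i))"
  proof -
    have "(\<Prod>i\<in>UNIV. (\<chi> i. if i = k then A' $ k else A t $ i) $ i $ p i) =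
        A' $ k $ p k * (\<Prod>i\<in>UNIV - {k}. A t $ i $ p i)" for k p
      by (subst prod.remove[of _ k]) (auto intro!: prod.cong)
    then show ?thesis unfolding det_def by (simp add: sum_distrib_left) (rule sum.swap)
  qed
  also have "\<dots> = (\<Sum>k\<in>UNIV. M $ k $ k * det (A t))"
  proof (rule sum.cong[OF refl])
    fix k
    have row: "A' $ k = (\<Sum>l\<in>UNIV. M $ k $ l *s A t $ l)"
      unfolding M by (simp add: vec_eq_iff matrix_matrix_mult_def)
    have "det (\<chi> i. if i = k then A' $ k else A t $ i) =
        (\<Sum>l\<in>UNIV. det (\<chi> i. if i = k then M $ k $ l *s A t $ l else A t $ i))"
      unfolding row using det_linear_row_sum[of UNIV k "\<lambda>i l. M $ k $ l *s A t $ l" "\<lambda>i. A t $ i"] by simp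
    also have "\<dots> = (\<Sum>l\<in>UNIV. M $ k $ l * det (\<chi> i. if i = k then A t $ l else A t $ i))"
      by (intro sum.cong refl) (rule det_row_mul[of k _ "\<lambda>i. A t $ _" "\<lambda>i. A t $ i"])
    also have "\<dots> = (\<Sum>l\<in>UNIV. if l = k then M $ k $ k * det (A t) else 0)"
    proof (rule sum.cong[OF refl])
      fix l
      show "M $ k $ l * det (\<chi> i. if i = k then A t $ l else A t $ i) = (if l = k then M $ k $ k * det (A t) else 0)"
      proof (cases "l = k")
        case True
        then have "(\<chi> i. if i = k then A t $ l else A t $ i) = A t" by (simp add: vec_eq_iff)
        then show ?thesis using True by simp
      next
        case False
        then have "det (\<chi> i. if i = k then A t $ l else A t $ i) = 0"
          by (intro det_identical_rows[of k l]) (auto simp: row_def vec_eq_iff)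
        then show ?thesis using False by simp
      qed
    qed
    finally show "det (\<chi> i. if i = k then A' $ k else A t $ i) = M $ k $ k * det (A t)" by simp
  qed
  finally show ?thesis by (simp add: sum_distrib_right)
qed

section \<open>Surface integrals over deformed domains\<close>

lemma C1_closure_iff: "open \<Omega> \<Longrightarrow> C1_closure \<Omega> f \<longleftrightarrow> (\<exists>D. has_partials \<Omega> f D)"
  using has_partials_partial has_partials_C1_closure by blast

lemma C1_closure_mult:
  fixes f g :: "real^'n \<Rightarrow> real"
  assumes "open \<Omega>" "C1_closure \<Omega> f" "C1_closure \<Omega> g"
  shows "C1_closure \<Omega> (\<lambda>x. f x * g x)"
  by (rule has_partials_C1_closure[OF has_partials_mult[OF has_partials_partial[OF assms(2)] has_partials_partial[OF assms(3)]] assms(1)])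

lemma C1_closure_sum:
  assumes "open \<Omega>" "\<And>a. a \<in> S \<Longrightarrow> C1_closure \<Omega> (f a)"
  shows "C1_closure \<Omega> (\<lambda>x. \<Sum>a\<in>S. f a x)"
  by (rule has_partials_C1_closure[OF has_partials_sum[OF has_partials_partial[OF assms(2)]] assms(1)])

lemma C1_closure_vec:
  fixes f :: "'k::finite \<Rightarrow> real^'n \<Rightarrow> real"
  assumes "open \<Omega>" "\<And>k. C1_closure \<Omega> (f k)"
  shows "C1_closure \<Omega> (\<lambda>x. \<chi> k. f k x)"
  by (rule has_partials_C1_closure[OF has_partials_vec[OF has_partials_partial[OF assms(2)]] assms(1)])

lemma C1_closure_component:
  assumes "open \<Omega>" "C1_closure \<Omega> f"
  shows "C1_closure \<Omega> (\<lambda>x. f x $ k)"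
  by (rule has_partials_C1_closure[OF has_partials_component[OF has_partials_partial[OF assms(2)]] assms(1)])

lemma C1_closure_det:
  fixes A :: "real^'n \<Rightarrow> real^'m^'m"
  assumes "open \<Omega>" "\<And>i j. C1_closure \<Omega> (\<lambda>x. A x $ i $ j)"
  shows "C1_closure \<Omega> (\<lambda>x. det (A x))"
proof -
  have "C1_closure \<Omega> (\<lambda>x. of_int (sign p) * (\<Prod>i\<in>UNIV. A x $ i $ p i))" for p
  proof -
    have "\<exists>E. has_partials \<Omega> (\<lambda>x. \<Prod>i\<in>UNIV. A x $ i $ p i) E"
      by (rule has_partials_prod[OF finite has_partials_partial[OF assms(2)]])
    then have "C1_closure \<Omega> (\<lambda>x. \<Prod>i\<in>UNIV. A x $ i $ p i)" using C1_closure_iff[OF assms(1)] by blast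
    then show ?thesis
      by (rule C1_closure_mult[OF assms(1) has_partials_C1_closure[OF has_partials_const assms(1)]])
  qed
  then show ?thesis unfolding det_def by (intro C1_closure_sum assms(1))
qed

lemma C1_closure_norm:
  fixes f :: "real^'n \<Rightarrow> real^'m"
  assumes "open \<Omega>" "C1_closure \<Omega> f" and nz: "\<And>x. x \<in> closure \<Omega> \<Longrightarrow> f x \<noteq> 0"
  shows "C1_closure \<Omega> (\<lambda>x. norm (f x))"
proof -
  note f = has_partials_partial[OF assms(2)]
  have ff: "has_partials \<Omega> (\<lambda>x. f x \<bullet> f x) (\<lambda>i x. f x \<bullet> partial \<Omega> i f x + partial \<Omega> i f x \<bullet> f x)"
    by (rule has_partials_inner[OF f f])
  have "has_partials \<Omega> (\<lambda>x. sqrt (f x \<bullet> f x))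
      (\<lambda>i x. (f x \<bullet> partial \<Omega> i f x + partial \<Omega> i f x \<bullet> f x) *\<^sub>R (inverse (sqrt (f x \<bullet> f x)) / 2))"
  proof (rule has_partials_comp_real[OF ff])
    fix x assume "x \<in> closure \<Omega>"
    then have "0 < f x \<bullet> f x" using nz by simp
    then show "(sqrt has_vector_derivative inverse (sqrt (f x \<bullet> f x)) / 2) (at (f x \<bullet> f x))"
      by (simp add: DERIV_real_sqrt has_real_derivative_iff_has_vector_derivative[symmetric])
  next
    show "continuous_on ((\<lambda>x. f x \<bullet> f x) ` closure \<Omega>) (\<lambda>s. inverse (sqrt s) / 2)"
      using nz by (intro continuous_intros) auto
  qed
  from has_partials_C1_closure[OF this assms(1)] show ?thesis unfolding norm_eq_sqrt_inner .
qed

lemma continuous_on_matrix_vector: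
  fixes M :: "'a::topological_space \<Rightarrow> real^'n^'m"
  assumes "\<And>i j. continuous_on S (\<lambda>x. M x $ i $ j)" "continuous_on S v"
  shows "continuous_on S (\<lambda>x. M x *v v x)"
  unfolding matrix_vector_mult_def
  by (intro continuous_on_vec_lambda continuous_on_sum continuous_on_mult assms(1) continuous_on_component assms(2))

text \<open>The chain rule holds in the interior; comparing the continuous extensions of two
  families of partial derivatives of the identity carries it to the boundary.\<close>

lemma jacobian_inverse:
  fixes y q :: "real^'n \<Rightarrow> real^'n"
  assumes "open \<Omega>" and y: "has_partials \<Omega> y D" and q: "has_partials (y ` \<Omega>) q Q"
    and qy: "\<And>x. x \<in> closure \<Omega> \<Longrightarrow> q (y x) = x" and x: "x \<in> closure \<Omega>"
  shows "(\<chi> i j. Q j (y x) $ i) ** (\<chi> i j. D j x $ i) = mat 1"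
proof -
  have id: "has_partials \<Omega> (\<lambda>x. q (y x)) (\<lambda>i x. axis i 1)"
    by (rule has_partials_cong[OF has_partials_id \<open>open \<Omega>\<close>]) (simp_all add: qy)
  have c: "has_partials \<Omega> (\<lambda>x. q (y x)) (\<lambda>i x. \<Sum>j\<in>UNIV. D i x $ j *\<^sub>R Q j (y x))"
    by (rule has_partials_comp[OF q y]) simp
  have "(\<Sum>j\<in>UNIV. D i x $ j *\<^sub>R Q j (y x)) = axis i 1" for i
    using partial_eq[OF c \<open>open \<Omega>\<close> x, of i] partial_eq[OF id \<open>open \<Omega>\<close> x, of i] by simp
  then have "(\<Sum>j\<in>UNIV. D i x $ j *\<^sub>R Q j (y x)) $ k = (axis i 1 :: real^'n) $ k" for i k by simp
  then show ?thesis by (auto simp: vec_eq_iff matrix_matrix_mult_def mat_def axis_def mult.commute)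
qed

text \<open>The inverse \<open>q\<close> is part of the data, with its own derivatives up to the
  boundary. The inverse Jacobian matrix is thus given by derivatives of \<open>q\<close> and has the
  regularity that they have.\<close>

locale deformation = regular_domain \<Omega> for \<Omega> :: "(real^'n) set" +
  fixes y q :: "real^'n \<Rightarrow> real^'n" and D Q :: "'n \<Rightarrow> real^'n \<Rightarrow> real^'n"
  assumes y: "has_partials \<Omega> y D" and q: "has_partials (y ` \<Omega>) q Q"
    and qy: "\<And>x. x \<in> closure \<Omega> \<Longrightarrow> q (y x) = x"
    and orientation: "\<And>x. x \<in> closure \<Omega> \<Longrightarrow> 0 < det (\<chi> i j. D j x $ i)"
begin

definition A where "A x = (\<chi> i j. D j x $ i)"

definition B where "B x = (\<chi> i j. Q j (y x) $ i)"

abbreviation J where "J x \<equiv> det (A x)"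

text \<open>The cofactor matrix of \<open>A\<close> applied to the normal: its direction is the
  outer normal of the image, its length the tangential Jacobian.\<close>

definition conormal where "conormal x = J x *\<^sub>R (transpose (B x) *v outer_normal \<Omega> x)"

lemma inj: "inj_on y (closure \<Omega>)"
  using qy by (metis inj_onI)

lemmas image = closure_frontier_image[OF bounded_domain open_domain has_partialsD(2)[OF y] inj]

lemma J_pos: "x \<in> closure \<Omega> \<Longrightarrow> 0 < J x"
  using orientation by (simp add: A_def)

sublocale image: regular_domain "y ` \<Omega>"
  by (rule image_regular_domain[OF y inj]) (use orientation in force)

lemma frontier_closure: "x \<in> frontier \<Omega> \<Longrightarrow> x \<in> closure \<Omega>" and interior_closure: "x \<in> \<Omega> \<Longrightarrow> x \<in> closure \<Omega>"
  using frontier_subset closure_subset by blast+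

lemma pull_partials:
  assumes "has_partials (y ` \<Omega>) f E"
  shows "has_partials \<Omega> (\<lambda>x. f (y x)) (\<lambda>i x. \<Sum>j\<in>UNIV. D i x $ j *\<^sub>R E j (y x))"
  by (rule has_partials_comp[OF assms y]) simp

lemma inverse_matrix:
  assumes x: "x \<in> closure \<Omega>"
  shows "B x ** A x = mat 1" and "A x ** B x = mat 1"
proof -
  show "B x ** A x = mat 1"
    using jacobian_inverse[OF open_domain y q qy x] by (simp add: A_def B_def)
  then show "A x ** B x = mat 1" by (simp add: matrix_left_right_inverse)
qed

lemma transpose_inverse: "x \<in> closure \<Omega> \<Longrightarrow> transpose (A x) *v (transpose (B x) *v z) = z"
  unfolding matrix_vector_mul_assoc matrix_transpose_mul[symmetric] by (simp add: inverse_matrix transpose_mat)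

lemma transpose_cancel:
  assumes "x \<in> closure \<Omega>" "transpose (A x) *v a = transpose (A x) *v b"
  shows "a = b"
proof -
  have "transpose (B x) *v (transpose (A x) *v z) = z" for z
    unfolding matrix_vector_mul_assoc matrix_transpose_mul[symmetric] using assms(1) by (simp add: inverse_matrix transpose_mat)
  then show ?thesis using assms(2) by metis
qed

lemma transpose_conormal: "x \<in> closure \<Omega> \<Longrightarrow> transpose (A x) *v conormal x = J x *\<^sub>R outer_normal \<Omega> x"
  unfolding conormal_def matrix_vector_mult_scaleR transpose_inverse ..

lemma conormal_nonzero: "x \<in> frontier \<Omega> \<Longrightarrow> 0 < norm (conormal x)"
  using transpose_conormal[OF frontier_closure, of x] J_pos[OF frontier_closure, of x] norm_outer_normal[of x] by auto

lemma outer_normal_conormal: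
  assumes x: "x \<in> frontier \<Omega>"
  shows "outer_normal (y ` \<Omega>) (y x) = conormal x /\<^sub>R norm (conormal x)"
  by (rule outer_normal_image[OF y inj _ x J_pos[OF frontier_closure[OF x], unfolded A_def]])
     (use orientation transpose_conormal[OF frontier_closure[OF x], unfolded A_def] in \<open>force+\<close>)

lemma tangential_jacobian:
  assumes x: "x \<in> frontier \<Omega>"
  shows "tangential_jacobian \<Omega> y x = norm (conormal x)"
proof -
  have "jacobian_matrix \<Omega> y x = A x"
    using partial_eq[OF y open_domain frontier_closure[OF x]] by (simp add: jacobian_matrix_def A_def)
  then show ?thesis
    using det_tangential[OF norm_outer_normal[OF x] _ transpose_conormal[OF frontier_closure[OF x]]] J_pos[OF frontier_closure[OF x]]
    by (simp add: tangential_jacobian_def Let_def outer_product_def[symmetric] del: transpose_matrix_vector)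
qed

lemma q_image: "q ` (y ` \<Omega>) = \<Omega>" and q_closure: "q ` closure (y ` \<Omega>) = closure \<Omega>"
  using qy subsetD[OF closure_subset] unfolding image(2) by (force simp: image_iff)+

lemma push_partials:
  assumes f: "has_partials \<Omega> f E"
  obtains E' where "has_partials (y ` \<Omega>) (\<lambda>z. f (q z)) E'"
    "\<And>i x. x \<in> closure \<Omega> \<Longrightarrow> E i x = (\<Sum>j\<in>UNIV. D i x $ j *\<^sub>R E' j (y x))"
proof -
  have E': "has_partials (y ` \<Omega>) (\<lambda>z. f (q z)) (\<lambda>j z. \<Sum>l\<in>UNIV. Q j z $ l *\<^sub>R E l (q z))" (is "has_partials _ _ ?E")
    by (rule has_partials_comp[OF f q]) (simp add: q_image)
  have f': "has_partials \<Omega> (\<lambda>x. f (q (y x))) E"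
    by (rule has_partials_cong[OF f open_domain]) (simp_all add: qy)
  have "E i x = (\<Sum>j\<in>UNIV. D i x $ j *\<^sub>R ?E j (y x))" if "x \<in> closure \<Omega>" for i x
    using partial_eq[OF pull_partials[OF E'] open_domain that, of i] partial_eq[OF f' open_domain that, of i] by simp
  with E' show thesis by (rule that)
qed

lemma continuous_on_A: "continuous_on (closure \<Omega>) (\<lambda>x. A x $ i $ j)"
  unfolding A_def by (simp add: has_partialsD(3)[OF y] continuous_on_component)

lemma continuous_on_pull: "continuous_on (closure (y ` \<Omega>)) f \<Longrightarrow> continuous_on (closure \<Omega>) (\<lambda>x. f (y x))"
  by (erule continuous_on_compose2[OF _ has_partialsD(2)[OF y]]) (simp add: image(2))

lemma continuous_on_push: "continuous_on (closure \<Omega>) f \<Longrightarrow> continuous_on (closure (y ` \<Omega>)) (\<lambda>x. f (q x))"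
  by (erule continuous_on_compose2[OF _ has_partialsD(2)[OF q]]) (simp add: q_closure)

lemma continuous_on_B: "continuous_on (closure \<Omega>) (\<lambda>x. B x $ i $ j)"
  unfolding B_def by (simp add: continuous_on_pull[OF has_partialsD(3)[OF q]] continuous_on_component)

lemma continuous_on_J: "continuous_on (closure \<Omega>) (\<lambda>x. J x)"
  by (intro continuous_on_det continuous_on_A)

lemma integral_image:
  assumes f: "continuous_on (closure (y ` \<Omega>)) f"
  shows "(LINT z:y ` \<Omega>|lborel. f z) = (LINT x:\<Omega>|lborel. J x * f (y x))"
proof -
  have c: "continuous_on (closure \<Omega>) (\<lambda>x. \<bar>J x\<bar> * f (y x))"
    by (intro continuous_intros continuous_on_J continuous_on_pull f)
  have "(LINT z:y ` \<Omega>|lborel. f z) = (LINT x:\<Omega>|lborel. \<bar>det (matrix (\<lambda>h. \<Sum>i\<in>UNIV. h $ i *\<^sub>R D i x))\<bar> * f (y x))"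
  proof (rule set_integral_change_of_variables[OF open_domain has_partialsD(1)[OF y] inj_on_subset[OF inj closure_subset] image(1)])
    show "set_integrable lborel (y ` \<Omega>) f" by (rule set_integrable_continuous[OF image(4,1) f])
    show "set_integrable lborel \<Omega> (\<lambda>x. \<bar>det (matrix (\<lambda>h. \<Sum>i\<in>UNIV. h $ i *\<^sub>R D i x))\<bar> * f (y x))"
      using set_integrable_continuous[OF bounded_domain open_domain c] by (simp add: matrix_partials A_def)
  qed
  also have "\<dots> = (LINT x:\<Omega>|lborel. J x * f (y x))"
  proof (rule set_lebesgue_integral_cong)
    show "\<Omega> \<in> sets lborel" using open_domain by simp
    show "\<forall>x. x \<in> \<Omega> \<longrightarrow> \<bar>det (matrix (\<lambda>h. \<Sum>i\<in>UNIV. h $ i *\<^sub>R D i x))\<bar> * f (y x) = J x * f (y x)"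
      by (simp add: matrix_partials A_def[symmetric] abs_of_pos J_pos interior_closure)
  qed
  finally show ?thesis .
qed

lemma continuous_on_interior: "continuous_on (closure S) f \<Longrightarrow> continuous_on S f" for f :: "real^'n \<Rightarrow> 'b::topological_space"
  by (rule continuous_on_subset[OF _ closure_subset])

text \<open>The Piola transform of \<open>X\<close> carries its divergence back to \<Omega>, and the
  divergence theorem is applied on \<Omega> alone. At this level the transform is known to be
  continuous only, so its divergence is a weak one.\<close>

lemma integral_divergence_image:
  assumes X: "has_partials (y ` \<Omega>) X E"
  shows "(LINT x:\<Omega>|lborel. J x * (\<Sum>i\<in>UNIV. E i (y x) $ i)) = surface_integral \<Omega> (\<lambda>x. X (y x) \<bullet> conormal x)"
proof -
  let ?F = "\<lambda>x. J x *\<^sub>R (B x *v X (y x))"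
  have f: "continuous_on (closure (y ` \<Omega>)) (\<lambda>z. \<Sum>i\<in>UNIV. E i z $ i)"
    by (intro continuous_on_sum continuous_on_component has_partialsD(3)[OF X])
  have "has_weak_div \<Omega> ?F (\<lambda>x. \<bar>det (\<chi> i j. D j x $ i)\<bar> * (\<Sum>i\<in>UNIV. E i (y x) $ i))"
  proof (rule has_weak_div_transport[OF open_domain image(1) _ has_partialsD(1)[OF y] continuous_on_interior[OF has_partialsD(3)[OF y]]
        has_partialsD(1)[OF q] continuous_on_interior[OF has_partialsD(3)[OF q]] continuous_on_interior[OF has_partialsD(2)[OF X]] continuous_on_interior[OF f]])
    show "q (y x) = x" if "x \<in> \<Omega>" for x using qy that closure_subset by blast
    show "has_weak_div (y ` \<Omega>) X (\<lambda>z. \<Sum>i\<in>UNIV. E i z $ i)"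
      by (rule has_weak_div_classical[OF image(1) has_partialsD(1)[OF X] continuous_on_interior[OF has_partialsD(3)[OF X]]])
    show "\<bar>det (\<chi> i j. D j x $ i)\<bar> *\<^sub>R X (y x) = (\<chi> i j. D j x $ i) *v ?F x" if "x \<in> \<Omega>" for x
    proof -
      have x: "x \<in> closure \<Omega>" using that closure_subset by blast
      have "A x *v ?F x = J x *\<^sub>R X (y x)"
        unfolding matrix_vector_mult_scaleR matrix_vector_mul_assoc by (simp add: inverse_matrix[OF x])
      then show ?thesis using J_pos[OF x] by (simp add: A_def)
    qed
  qed
  then have w: "has_weak_div \<Omega> ?F (\<lambda>x. J x * (\<Sum>i\<in>UNIV. E i (y x) $ i))"
    by (rule has_weak_div_cong[OF _ open_domain refl]) (use J_pos closure_subset in \<open>force simp: A_def\<close>)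
  have cF: "continuous_on (closure \<Omega>) ?F"
    by (intro continuous_on_scaleR continuous_on_J continuous_on_matrix_vector continuous_on_B continuous_on_pull has_partialsD(2)[OF X])
  have cf: "continuous_on (closure \<Omega>) (\<lambda>x. J x * (\<Sum>i\<in>UNIV. E i (y x) $ i))"
    by (intro continuous_on_mult continuous_on_J continuous_on_pull[OF f])
  have "?F x \<bullet> outer_normal \<Omega> x = X (y x) \<bullet> conormal x" for x
    unfolding conormal_def inner_scaleR_left inner_scaleR_right
    by (simp only: inner_commute[of "X (y x)"] inner_transpose) (simp only: inner_commute)
  then show ?thesis using divergence_theorem[OF cF cf w] by simp
qed

text \<open>The two atlases being unrelated, the integrand is realised as a flux. A C^1 field
  \<open>F\<close> on \<Omega> with normal component \<open>f (y x) * norm (conormal x)\<close> is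
  pushed forward by the Piola transform to a field \<open>X\<close> whose normal component on the
  image is \<open>f\<close>; both fluxes equal the integral of the divergence. The C^2 graph
  functions and the C^1 derivatives of \<open>y\<close> and \<open>q\<close> make \<open>F\<close>
  differentiable.\<close>

lemma surface_integral_image:
  assumes ps: "boundary_atlas \<Omega> ps"
    and h2: "\<And>U k s h \<zeta> i. (U, k, s, h, \<zeta>) \<in> set ps \<Longrightarrow> C1_closure UNIV (partial UNIV i h)"
    and D: "\<And>i. C1_closure \<Omega> (D i)" and Q: "\<And>i. C1_closure (y ` \<Omega>) (Q i)" and f: "C1_closure (y ` \<Omega>) f"
  shows "surface_integral (y ` \<Omega>) f = surface_integral \<Omega> (\<lambda>x. f (y x) * norm (conormal x))"
proof -
  define \<mu> where "\<mu> k s h x = J x * norm (transpose (B x) *v patch_normal k s h x)" for k s h x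
  \<comment> \<open>The axis of a chart is transversal to the frontier, with
    \<open>axis k 1 \<bullet> outer_normal \<Omega> x\<close> equal to \<open>s / norm N\<close> for
    the patch normal \<open>N\<close>. On the frontier in the patch \<open>\<mu> k s h x\<close> is
    \<open>norm (conormal x) * norm N\<close>, so the normal component of \<open>Fp\<close> is
    \<open>f (y x) * \<zeta> x * norm (conormal x)\<close>.\<close>
  define Fp :: "'n patch \<Rightarrow> real^'n \<Rightarrow> real^'n" where
    "Fp = (\<lambda>(U, k, s, h, \<zeta>) x. (f (y x) * \<zeta> x * \<mu> k s h x * s) *\<^sub>R axis k 1)"
  define F where "F x = (\<Sum>p\<leftarrow>ps. Fp p x)" for x
  have sub: "C1_closure \<Omega> z" if "C1_closure UNIV z" for z :: "real^'n \<Rightarrow> real"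
    by (rule has_partials_C1_closure[OF has_partials_subset[OF has_partials_partial[OF that]] open_domain]) simp
  have cB: "C1_closure \<Omega> (\<lambda>x. B x $ i $ j)" for i j
    unfolding B_def using has_partials_C1_closure[OF has_partials_component[OF pull_partials[OF has_partials_partial[OF Q]]] open_domain]
    by simp
  have cJ: "C1_closure \<Omega> (\<lambda>x. J x)"
    by (intro C1_closure_det open_domain) (simp add: A_def C1_closure_component[OF open_domain D])
  have cf: "C1_closure \<Omega> (\<lambda>x. f (y x))"
    by (rule has_partials_C1_closure[OF pull_partials[OF has_partials_partial[OF f]] open_domain])
  have cFp: "C1_closure \<Omega> (Fp p)" if "p \<in> set ps" for p
  proof -
    obtain U k s h \<zeta> where p: "p = (U, k, s, h, \<zeta>)" by (cases p)
    note P = boundary_atlasD[OF ps that[unfolded p]]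
    have cN: "C1_closure \<Omega> (\<lambda>x. patch_normal k s h x $ l)" for l
    proof -
      have "has_partials UNIV (\<lambda>x. s * axis k 1 $ l - partial UNIV l h x) (\<lambda>i x. 0 - partial UNIV i (partial UNIV l h) x)"
        by (rule has_partials_diff[OF has_partials_const has_partials_partial[OF h2[OF that[unfolded p]]]])
      then show ?thesis by (intro sub has_partials_C1_closure[OF _ open_UNIV]) (simp add: patch_normal_def grad_def)
    qed
    have "C1_closure \<Omega> (\<lambda>x. \<chi> i. \<Sum>l\<in>UNIV. B x $ l $ i * patch_normal k s h x $ l)"
      by (intro C1_closure_vec C1_closure_sum C1_closure_mult open_domain cB cN)
    then have cv: "C1_closure \<Omega> (\<lambda>x. transpose (B x) *v patch_normal k s h x)"
      by (simp add: matrix_vector_mult_def transpose_def del: transpose_matrix_vector)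
    have nz: "transpose (B x) *v patch_normal k s h x \<noteq> 0" if "x \<in> closure \<Omega>" for x
      using transpose_inverse[OF that, of "patch_normal k s h x"] norm_patch_normal(2)[OF P(1,2), of x] by auto
    have "C1_closure \<Omega> (\<mu> k s h)" unfolding \<mu>_def by (intro C1_closure_mult C1_closure_norm open_domain cJ cv nz)
    then have "C1_closure \<Omega> (\<lambda>x. f (y x) * \<zeta> x * \<mu> k s h x * s)"
      by (intro C1_closure_mult open_domain cf sub[OF P(3)] has_partials_C1_closure[OF has_partials_const])
    then have "has_partials \<Omega> (\<lambda>x. (f (y x) * \<zeta> x * \<mu> k s h x * s) *\<^sub>R (axis k 1 :: real^'n))
        (\<lambda>i x. partial \<Omega> i (\<lambda>x. f (y x) * \<zeta> x * \<mu> k s h x * s) x *\<^sub>R axis k 1)"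
      by (rule has_partials_bounded_linear[OF bounded_linear_scaleR_left has_partials_partial])
    then show ?thesis unfolding p Fp_def prod.case by (rule has_partials_C1_closure[OF _ open_domain])
  qed
  define E where "E i x = (\<Sum>p\<leftarrow>ps. partial \<Omega> i (Fp p) x)" for i x
  have F: "has_partials \<Omega> F E"
    unfolding F_def[abs_def] E_def[abs_def] by (rule has_partials_sum_list[OF has_partials_partial[OF cFp]])
  have FN: "F x \<bullet> outer_normal \<Omega> x = f (y x) * norm (conormal x)" if x: "x \<in> frontier \<Omega>" for x
  proof -
    have "Fp p x \<bullet> outer_normal \<Omega> x = (f (y x) * norm (conormal x)) * (case p of (U, k, s, h, \<zeta>) \<Rightarrow> \<zeta> x)" if "p \<in> set ps" for p
    proof -
      obtain U k s h \<zeta> where p: "p = (U, k, s, h, \<zeta>)" by (cases p)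
      note P = boundary_atlasD[OF ps that[unfolded p]]
      show ?thesis
      proof (cases "\<zeta> x = 0")
        case True
        then show ?thesis by (simp add: p Fp_def)
      next
        case False
        then have xU: "x \<in> U" using P(5) by blast
        let ?N = "patch_normal k s h x"
        have \<nu>: "outer_normal \<Omega> x = ?N /\<^sub>R norm ?N" by (rule outer_normal_patch[OF P(1,2) open_domain xU x])
        have "conormal x = (J x / norm ?N) *\<^sub>R (transpose (B x) *v ?N)"
          unfolding conormal_def \<nu> matrix_vector_mult_scaleR by (simp add: divide_inverse)
        then have "norm (conormal x) = \<mu> k s h x / norm ?N"
          using J_pos[OF frontier_closure[OF x]] by (simp add: \<mu>_def del: transpose_matrix_vector)
        then have nc: "\<mu> k s h x / norm ?N = norm (conormal x)" by simp
        have "axis k 1 \<bullet> ?N = s"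
          using partial_graph_axis[OF P(1,2)] by (simp add: inner_axis' patch_normal_def grad_def)
        then have ax: "axis k 1 \<bullet> outer_normal \<Omega> x = s / norm ?N" unfolding \<nu> by (simp add: divide_inverse)
        have "Fp p x \<bullet> outer_normal \<Omega> x = f (y x) * \<zeta> x * \<mu> k s h x * s * (s / norm ?N)" by (simp add: p Fp_def ax)
        also have "\<dots> = f (y x) * \<zeta> x * (\<mu> k s h x / norm ?N) * (s * s)" by simp
        also have "\<dots> = f (y x) * norm (conormal x) * \<zeta> x" unfolding nc local_graphD(2)[OF P(1)] by simp
        finally show ?thesis by (simp add: p)
      qed
    qed
    then have "F x \<bullet> outer_normal \<Omega> x = (\<Sum>p\<leftarrow>ps. (f (y x) * norm (conormal x)) * (case p of (U, k, s, h, \<zeta>) \<Rightarrow> \<zeta> x))"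
      unfolding F_def by (induct ps) (simp_all add: inner_add_left)
    then show ?thesis using boundary_atlas_sum[OF ps x] by (simp add: sum_list_const_mult)
  qed
  define e where "e x = (\<Sum>i\<in>UNIV. E i x $ i)" for x
  have ce: "continuous_on (closure \<Omega>) e"
    unfolding e_def[abs_def] by (intro continuous_on_sum continuous_on_component has_partialsD(3)[OF F])
  have wF: "has_weak_div \<Omega> F e"
    unfolding e_def[abs_def] by (rule has_weak_div_classical[OF open_domain has_partialsD(1)[OF F] continuous_on_interior[OF has_partialsD(3)[OF F]]])
  define M where "M z = (\<chi> i j. Q j z $ i)" for z
  have MB: "M (y x) = B x" for x by (simp add: M_def B_def)
  have cM: "continuous_on (closure (y ` \<Omega>)) (\<lambda>z. M z $ i $ j)" for i j
    unfolding M_def by (simp add: has_partialsD(3)[OF q] continuous_on_component)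
  define X where "X z = \<bar>det (M z)\<bar> *\<^sub>R (A (q z) *v F (q z))" for z
  have cX: "continuous_on (closure (y ` \<Omega>)) X"
    unfolding X_def[abs_def]
    by (intro continuous_on_scaleR continuous_on_rabs continuous_on_det cM continuous_on_matrix_vector
        continuous_on_push[of "\<lambda>x. A x $ _ $ _"] continuous_on_A continuous_on_push[of F] has_partialsD(2)[OF F])
  have cx: "continuous_on (closure (y ` \<Omega>)) (\<lambda>z. \<bar>det (M z)\<bar> * e (q z))"
    by (intro continuous_on_mult continuous_on_rabs continuous_on_det cM continuous_on_push ce)
  have detB: "J x * \<bar>det (B x)\<bar> = 1" if "x \<in> closure \<Omega>" for x
    using arg_cong[OF inverse_matrix(2)[OF that], of det] J_pos[OF that] by (simp add: det_mul abs_if zero_less_mult_iff) (smt (verit) mult_pos_neg)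
  have "has_weak_div (y ` \<Omega>) X (\<lambda>z. \<bar>det (\<chi> i j. Q j z $ i)\<bar> * e (q z))"
  proof (rule has_weak_div_transport[of _ q y Q D F e X])
    show "open (y ` \<Omega>)" by (rule image(1))
    show "open (q ` y ` \<Omega>)" unfolding q_image by (rule open_domain)
    show "y (q z) = z" if "z \<in> y ` \<Omega>" for z using that qy closure_subset by (metis imageE subsetD)
    show "(q has_derivative (\<lambda>h. \<Sum>i\<in>UNIV. h $ i *\<^sub>R Q i z)) (at z)" if "z \<in> y ` \<Omega>" for z by (rule has_partialsD(1)[OF q that])
    show "continuous_on (y ` \<Omega>) (Q i)" for i by (rule continuous_on_interior[OF has_partialsD(3)[OF q]])
    show "(y has_derivative (\<lambda>h. \<Sum>i\<in>UNIV. h $ i *\<^sub>R D i x)) (at x)" if "x \<in> q ` y ` \<Omega>" for x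
      by (rule has_partialsD(1)[OF y that[unfolded q_image]])
    show "continuous_on (q ` y ` \<Omega>) (D i)" for i unfolding q_image by (rule continuous_on_interior[OF has_partialsD(3)[OF y]])
    show "continuous_on (q ` y ` \<Omega>) F" unfolding q_image by (rule continuous_on_interior[OF has_partialsD(2)[OF F]])
    show "continuous_on (q ` y ` \<Omega>) e" unfolding q_image by (rule continuous_on_interior[OF ce])
    show "has_weak_div (q ` y ` \<Omega>) F e" unfolding q_image by (rule wF)
    show "\<bar>det (\<chi> i j. Q j z $ i)\<bar> *\<^sub>R F (q z) = (\<chi> i j. Q j z $ i) *v X z" if "z \<in> y ` \<Omega>" for z
    proof -
      obtain x where x: "z = y x" "x \<in> closure \<Omega>" using \<open>z \<in> y ` \<Omega>\<close> closure_subset by blast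
      have "M z *v X z = \<bar>det (M z)\<bar> *\<^sub>R F (q z)"
        unfolding X_def matrix_vector_mult_scaleR matrix_vector_mul_assoc x(1) MB qy[OF x(2)] inverse_matrix(1)[OF x(2)] by simp
      then show ?thesis by (simp add: M_def)
    qed
  qed
  then have wX: "has_weak_div (y ` \<Omega>) X (\<lambda>z. \<bar>det (M z)\<bar> * e (q z))" by (simp add: M_def)
  have "surface_integral (y ` \<Omega>) f = surface_integral (y ` \<Omega>) (\<lambda>z. X z \<bullet> outer_normal (y ` \<Omega>) z)"
  proof (rule image.surface_integral_cong)
    fix z assume "z \<in> frontier (y ` \<Omega>)"
    then obtain x where x: "z = y x" "x \<in> frontier \<Omega>" unfolding image(3) by blast
    note xc = frontier_closure[OF x(2)]
    \<comment> \<open>Moving \<open>A x\<close> to the other side turns the conormal into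
      \<open>J x\<close> times the normal; this \<open>J x\<close> is later cancelled by the
      determinant of \<open>B x\<close>.\<close>
    have "(A x *v F x) \<bullet> conormal x = J x * (f z * norm (conormal x))"
    proof -
      have "(A x *v F x) \<bullet> conormal x = (transpose (A x) *v conormal x) \<bullet> F x"
        unfolding inner_transpose by (rule inner_commute)
      then show ?thesis
        unfolding transpose_conormal[OF xc] using FN[OF x(2)] x(1) by (simp add: inner_commute)
    qed
    then show "f z = X z \<bullet> outer_normal (y ` \<Omega>) z"
      using detB[OF xc] conormal_nonzero[OF x(2)]
      unfolding X_def x(1) outer_normal_conormal[OF x(2)] qy[OF xc] MB by (simp add: field_simps)
  qed
  also have "\<dots> = (LINT z:y ` \<Omega>|lborel. \<bar>det (M z)\<bar> * e (q z))"
    by (rule image.divergence_theorem[OF cX cx wX, symmetric])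
  also have "\<dots> = (LINT x:\<Omega>|lborel. J x * (\<bar>det (M (y x))\<bar> * e (q (y x))))" by (rule integral_image[OF cx])
  also have "\<dots> = (LINT x:\<Omega>|lborel. e x)"
  proof (rule set_lebesgue_integral_cong)
    show "\<Omega> \<in> sets lborel" using open_domain by simp
    show "\<forall>x. x \<in> \<Omega> \<longrightarrow> J x * (\<bar>det (M (y x))\<bar> * e (q (y x))) = e x"
      by (simp add: MB mult.assoc[symmetric] detB qy interior_closure)
  qed
  also have "\<dots> = surface_integral \<Omega> (\<lambda>x. F x \<bullet> outer_normal \<Omega> x)"
    by (rule divergence_theorem[OF has_partialsD(2)[OF F] ce wF])
  also have "\<dots> = surface_integral \<Omega> (\<lambda>x. f (y x) * norm (conormal x))"
    by (rule surface_integral_cong) (rule FN)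
  finally show ?thesis .
qed

end

section \<open>Families of functions depending differentiably on time\<close>

definition time_deriv :: "real \<Rightarrow> 'x::metric_space set \<Rightarrow> (real \<Rightarrow> 'x \<Rightarrow> 'b::real_normed_vector) \<Rightarrow> (real \<Rightarrow> 'x \<Rightarrow> 'b) \<Rightarrow> bool" where
  "time_deriv a K f f' \<longleftrightarrow>
     continuous_on ({-a<..<a} \<times> K) (\<lambda>(t, x). f t x) \<and> continuous_on ({-a<..<a} \<times> K) (\<lambda>(t, x). f' t x) \<and>
     (\<forall>t x. \<bar>t\<bar> < a \<longrightarrow> x \<in> K \<longrightarrow> ((\<lambda>s. f s x) has_vector_derivative f' t x) (at t))"

lemma time_derivD:
  assumes "time_deriv a K f f'"
  shows "continuous_on ({-a<..<a} \<times> K) (\<lambda>(t, x). f t x)" "continuous_on ({-a<..<a} \<times> K) (\<lambda>(t, x). f' t x)"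
    and "\<bar>t\<bar> < a \<Longrightarrow> x \<in> K \<Longrightarrow> ((\<lambda>s. f s x) has_vector_derivative f' t x) (at t)"
  using assms unfolding time_deriv_def by auto

lemma time_deriv_subset: "time_deriv a K f f' \<Longrightarrow> K' \<subseteq> K \<Longrightarrow> time_deriv a K' f f'"
  unfolding time_deriv_def by (meson Sigma_mono continuous_on_subset order_refl subsetD)

lemma continuous_on_slice_const: "continuous_on K c \<Longrightarrow> continuous_on (I \<times> K) (\<lambda>(t, x). c x)"
  unfolding case_prod_unfold by (rule continuous_on_compose2[OF _ continuous_on_snd[OF continuous_on_id]]) auto

lemma time_deriv_const: "continuous_on K c \<Longrightarrow> time_deriv a K (\<lambda>t. c) (\<lambda>t x. 0)"
  unfolding time_deriv_def using continuous_on_slice_const by (auto simp: case_prod_unfold)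

lemma time_deriv_bilinear:
  assumes B: "bounded_bilinear B" and f: "time_deriv a K f f'" and g: "time_deriv a K g g'"
  shows "time_deriv a K (\<lambda>t x. B (f t x) (g t x)) (\<lambda>t x. B (f t x) (g' t x) + B (f' t x) (g t x))"
  using time_derivD[OF f] time_derivD[OF g]
  unfolding time_deriv_def case_prod_unfold
  by (intro conjI allI impI bounded_bilinear.continuous_on[OF B] continuous_on_add bounded_bilinear.has_vector_derivative[OF B]) auto

lemmas time_deriv_mult = time_deriv_bilinear[OF bounded_bilinear_mult]
lemmas time_deriv_inner = time_deriv_bilinear[OF bounded_bilinear_inner]

lemma time_deriv_linear:
  assumes L: "bounded_linear L" and f: "time_deriv a K f f'"
  shows "time_deriv a K (\<lambda>t x. L (f t x)) (\<lambda>t x. L (f' t x))"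
  using time_derivD[OF f] unfolding time_deriv_def case_prod_unfold
  by (intro conjI allI impI bounded_linear.continuous_on[OF L] bounded_linear.has_vector_derivative[OF L]) auto

lemma time_deriv_add:
  assumes f: "time_deriv a K f f'" and g: "time_deriv a K g g'"
  shows "time_deriv a K (\<lambda>t x. f t x + g t x) (\<lambda>t x. f' t x + g' t x)"
  using time_derivD[OF f] time_derivD[OF g] unfolding time_deriv_def case_prod_unfold
  by (intro conjI allI impI continuous_on_add has_vector_derivative_add) auto

lemma time_deriv_diff:
  assumes f: "time_deriv a K f f'" and g: "time_deriv a K g g'"
  shows "time_deriv a K (\<lambda>t x. f t x - g t x) (\<lambda>t x. f' t x - g' t x)"
  using time_derivD[OF f] time_derivD[OF g] unfolding time_deriv_def case_prod_unfold
  by (intro conjI allI impI continuous_on_diff has_vector_derivative_diff) auto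

lemma time_deriv_sum:
  assumes "\<And>i. i \<in> S \<Longrightarrow> time_deriv a K (f i) (f' i)"
  shows "time_deriv a K (\<lambda>t x. \<Sum>i\<in>S. f i t x) (\<lambda>t x. \<Sum>i\<in>S. f' i t x)"
  using assms time_derivD unfolding time_deriv_def case_prod_unfold
  by (intro conjI allI impI continuous_on_sum has_vector_derivative_sum) auto

lemma time_deriv_comp:
  fixes f f' :: "real \<Rightarrow> 'x::metric_space \<Rightarrow> real" and \<phi> \<phi>' :: "real \<Rightarrow> real"
  assumes f: "time_deriv a K f f'" and T: "\<And>t x. \<bar>t\<bar> < a \<Longrightarrow> x \<in> K \<Longrightarrow> f t x \<in> T"
    and \<phi>: "\<And>s. s \<in> T \<Longrightarrow> (\<phi> has_real_derivative \<phi>' s) (at s)" and c: "continuous_on T \<phi>'"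
  shows "time_deriv a K (\<lambda>t x. \<phi> (f t x)) (\<lambda>t x. \<phi>' (f t x) * f' t x)"
proof -
  have T': "(\<lambda>p. f (fst p) (snd p)) ` ({-a<..<a} \<times> K) \<subseteq> T" using T by (auto simp: abs_less_iff)
  have c\<phi>: "continuous_on T \<phi>"
    by (rule DERIV_continuous_on) (rule has_field_derivative_at_within[OF \<phi>])
  note F = time_derivD[OF f, unfolded case_prod_unfold]
  have "continuous_on ({-a<..<a} \<times> K) (\<lambda>p. \<phi> (f (fst p) (snd p)))"
    by (rule continuous_on_compose2[OF c\<phi> F(1) T'])
  moreover have "continuous_on ({-a<..<a} \<times> K) (\<lambda>p. \<phi>' (f (fst p) (snd p)) * f' (fst p) (snd p))"
    by (rule continuous_on_mult[OF continuous_on_compose2[OF c F(1) T'] F(2)])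
  moreover have "((\<lambda>s. \<phi> (f s x)) has_vector_derivative \<phi>' (f t x) * f' t x) (at t)" if "\<bar>t\<bar> < a" "x \<in> K" for t x
    using DERIV_chain2[where f = \<phi> and g = "\<lambda>s. f s x" and x = t and s = UNIV, OF \<phi>[OF T[OF that]]] F(3)[OF that] by (simp add: has_real_derivative_iff_has_vector_derivative[symmetric])
  ultimately show ?thesis unfolding time_deriv_def case_prod_unfold by blast
qed

text \<open>Quantities given implicitly are differentiated by means of it: an identity is
  differentiated on both sides and the results are compared.\<close>

lemma time_deriv_unique:
  assumes "time_deriv a K f f'" "\<bar>t\<bar> < a" "x \<in> K" "((\<lambda>s. f s x) has_vector_derivative d) (at t)"
  shows "f' t x = d"
  using vector_derivative_unique_at[OF time_derivD(3)[OF assms(1-3)] assms(4)] .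

lemma time_deriv_cong:
  assumes f: "time_deriv a K f f'" and fg: "\<And>t x. \<bar>t\<bar> < a \<Longrightarrow> x \<in> K \<Longrightarrow> f t x = g t x"
    and fg': "\<And>t x. \<bar>t\<bar> < a \<Longrightarrow> x \<in> K \<Longrightarrow> f' t x = g' t x"
  shows "time_deriv a K g g'"
proof -
  have "continuous_on ({-a<..<a} \<times> K) (\<lambda>(t, x). g t x)"
    by (rule continuous_on_cong[THEN iffD1, OF refl _ time_derivD(1)[OF f]]) (auto simp: fg)
  moreover have "continuous_on ({-a<..<a} \<times> K) (\<lambda>(t, x). g' t x)"
    by (rule continuous_on_cong[THEN iffD1, OF refl _ time_derivD(2)[OF f]]) (auto simp: fg')
  moreover have "((\<lambda>s. g s x) has_vector_derivative g' t x) (at t)" if "\<bar>t\<bar> < a" "x \<in> K" for t x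
  proof (rule has_vector_derivative_transform_within_open[of "\<lambda>s. f s x" _ _ "{-a<..<a}"])
    show "((\<lambda>s. f s x) has_vector_derivative g' t x) (at t)" using time_derivD(3)[OF f that] fg'[OF that] by simp
  qed (use that fg in \<open>auto simp: abs_less_iff\<close>)
  ultimately show ?thesis unfolding time_deriv_def by blast
qed

text \<open>Joint continuity in time and space is built in through \<open>time_deriv\<close>; on
  compact sets it supplies the bounds for differentiating integrals. The class is closed under sums,
  products, determinants and inverses of positive functions, so solutions of linear systems stay in
  it.\<close>

definition time_C2 :: "real \<Rightarrow> 'x::metric_space set \<Rightarrow> (real \<Rightarrow> 'x \<Rightarrow> 'b::real_normed_vector) \<Rightarrow> bool" where
  "time_C2 a K f \<longleftrightarrow> (\<exists>f1 f2. time_deriv a K f f1 \<and> time_deriv a K f1 f2)"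

lemma time_C2_const: "continuous_on K c \<Longrightarrow> time_C2 a K (\<lambda>t. c)"
  unfolding time_C2_def
  by (rule exI, rule exI, rule conjI, erule time_deriv_const, rule time_deriv_const, rule continuous_on_const)

lemma time_C2_subset: "time_C2 a K f \<Longrightarrow> K' \<subseteq> K \<Longrightarrow> time_C2 a K' f"
  unfolding time_C2_def using time_deriv_subset by blast

lemma time_C2_linear: "bounded_linear L \<Longrightarrow> time_C2 a K f \<Longrightarrow> time_C2 a K (\<lambda>t x. L (f t x))"
  unfolding time_C2_def using time_deriv_linear by blast

lemma time_C2_sum:
  assumes "\<And>i. i \<in> S \<Longrightarrow> time_C2 a K (f i)"
  shows "time_C2 a K (\<lambda>t x. \<Sum>i\<in>S. f i t x)"
proof -
  obtain f1 f2 where "\<And>i. i \<in> S \<Longrightarrow> time_deriv a K (f i) (f1 i)" "\<And>i. i \<in> S \<Longrightarrow> time_deriv a K (f1 i) (f2 i)"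
    using assms unfolding time_C2_def by metis
  then show ?thesis unfolding time_C2_def using time_deriv_sum[of S a K f f1] time_deriv_sum[of S a K f1 f2] by blast
qed

lemma time_C2_bilinear:
  assumes B: "bounded_bilinear B" and "time_C2 a K f" "time_C2 a K g"
  shows "time_C2 a K (\<lambda>t x. B (f t x) (g t x))"
proof -
  obtain f1 f2 where f: "time_deriv a K f f1" "time_deriv a K f1 f2" using assms(2) unfolding time_C2_def by blast
  obtain g1 g2 where g: "time_deriv a K g g1" "time_deriv a K g1 g2" using assms(3) unfolding time_C2_def by blast
  show ?thesis
    unfolding time_C2_def
    using time_deriv_bilinear[OF B f(1) g(1)]
      time_deriv_add[OF time_deriv_bilinear[OF B f(1) g(2)] time_deriv_bilinear[OF B f(2) g(1)]] by blast
qed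

lemma time_C2_prod:
  fixes f :: "'i \<Rightarrow> real \<Rightarrow> 'x::metric_space \<Rightarrow> real"
  assumes "finite S" "\<And>i. i \<in> S \<Longrightarrow> time_C2 a K (f i)"
  shows "time_C2 a K (\<lambda>t x. \<Prod>i\<in>S. f i t x)"
  using assms
proof (induction S rule: finite_induct)
  case empty
  then show ?case by (simp add: time_C2_const continuous_on_const)
next
  case (insert i S)
  then show ?case using time_C2_bilinear[OF bounded_bilinear_mult, of a K "f i"] by simp
qed

lemma time_C2_det:
  fixes A :: "real \<Rightarrow> 'x::metric_space \<Rightarrow> real^'n^'n"
  assumes "\<And>i j. time_C2 a K (\<lambda>t x. A t x $ i $ j)"
  shows "time_C2 a K (\<lambda>t x. det (A t x))"
  unfolding det_def
  by (intro time_C2_sum time_C2_bilinear[OF bounded_bilinear_mult] time_C2_prod finite assms time_C2_const continuous_on_const)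

lemma time_C2_comp:
  fixes f :: "real \<Rightarrow> 'x::metric_space \<Rightarrow> real" and \<phi> \<phi>1 \<phi>2 :: "real \<Rightarrow> real"
  assumes f: "time_C2 a K f" and T: "\<And>t x. \<bar>t\<bar> < a \<Longrightarrow> x \<in> K \<Longrightarrow> f t x \<in> T"
    and \<phi>: "\<And>s. s \<in> T \<Longrightarrow> (\<phi> has_real_derivative \<phi>1 s) (at s)" "\<And>s. s \<in> T \<Longrightarrow> (\<phi>1 has_real_derivative \<phi>2 s) (at s)"
    and c: "continuous_on T \<phi>2"
  shows "time_C2 a K (\<lambda>t x. \<phi> (f t x))"
proof -
  obtain f1 f2 where f: "time_deriv a K f f1" "time_deriv a K f1 f2" using f unfolding time_C2_def by blast
  have "continuous_on T \<phi>1" by (rule DERIV_continuous_on) (rule has_field_derivative_at_within[OF \<phi>(2)])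
  from time_deriv_comp[OF f(1) T \<phi>(1) this]
  have "time_deriv a K (\<lambda>t x. \<phi> (f t x)) (\<lambda>t x. \<phi>1 (f t x) * f1 t x)" by blast
  moreover have "time_deriv a K (\<lambda>t x. \<phi>1 (f t x)) (\<lambda>t x. \<phi>2 (f t x) * f1 t x)" by (rule time_deriv_comp[OF f(1) T \<phi>(2) c])
  from time_deriv_mult[OF this f(2)]
  have "time_deriv a K (\<lambda>t x. \<phi>1 (f t x) * f1 t x) (\<lambda>t x. \<phi>1 (f t x) * f2 t x + \<phi>2 (f t x) * f1 t x * f1 t x)" .
  ultimately show ?thesis unfolding time_C2_def by blast
qed

lemma time_C2_sqrt:
  fixes f :: "real \<Rightarrow> 'x::metric_space \<Rightarrow> real"
  assumes "time_C2 a K f" "\<And>t x. \<bar>t\<bar> < a \<Longrightarrow> x \<in> K \<Longrightarrow> 0 < f t x"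
  shows "time_C2 a K (\<lambda>t x. sqrt (f t x))"
proof (rule time_C2_comp[OF assms(1), of "{0<..}" sqrt "\<lambda>s. inverse (sqrt s) / 2" "\<lambda>s. - (inverse (sqrt s) / 2) / (sqrt s)\<^sup>2 / 2"])
  show "((\<lambda>s. inverse (sqrt s) / 2) has_real_derivative - (inverse (sqrt s) / 2) / (sqrt s)\<^sup>2 / 2) (at s)" if "s \<in> {0<..}" for s
    using that by (auto intro!: derivative_eq_intros simp: field_simps power2_eq_square)
qed (use assms(2) in \<open>auto intro!: DERIV_real_sqrt continuous_intros\<close>)

lemma time_C2_inverse:
  fixes f :: "real \<Rightarrow> 'x::metric_space \<Rightarrow> real"
  assumes "time_C2 a K f" "\<And>t x. \<bar>t\<bar> < a \<Longrightarrow> x \<in> K \<Longrightarrow> 0 < f t x"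
  shows "time_C2 a K (\<lambda>t x. inverse (f t x))"
proof (rule time_C2_comp[OF assms(1), of "{0<..}" inverse "\<lambda>s. - (inverse s ^ 2)" "\<lambda>s. 2 * inverse s ^ 3"])
  show "((\<lambda>s. - (inverse s ^ 2)) has_real_derivative 2 * inverse s ^ 3) (at s)" if "s \<in> {0<..}" for s :: real
    using that by (auto intro!: derivative_eq_intros simp: field_simps power2_eq_square power3_eq_cube)
  show "(inverse has_real_derivative - (inverse s ^ 2)) (at s)" if "s \<in> {0<..}" for s :: real
    using that DERIV_inverse[of s] by (simp add: numeral_2_eq_2)
qed (use assms(2) in \<open>auto intro!: continuous_intros\<close>)

lemma time_C2_vec:
  fixes f :: "'k::finite \<Rightarrow> real \<Rightarrow> 'x::metric_space \<Rightarrow> real"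
  assumes "\<And>k. time_C2 a K (f k)"
  shows "time_C2 a K (\<lambda>t x. \<chi> k. f k t x)"
proof -
  have "time_C2 a K (\<lambda>t x. \<Sum>k\<in>UNIV. f k t x *\<^sub>R (axis k 1 :: real^'k))"
    by (intro time_C2_sum time_C2_linear[OF bounded_linear_scaleR_left] assms)
  moreover have "(\<Sum>k\<in>UNIV. f k t x *\<^sub>R (axis k 1 :: real^'k)) = (\<chi> k. f k t x)" for t x
    by (simp add: vec_eq_iff axis_def if_distrib cong: if_cong)
  ultimately show ?thesis by simp
qed

section \<open>From curves in C^2 of the closure to pointwise time derivatives\<close>

lemma continuous_on_uniform_family:
  fixes g :: "real \<Rightarrow> 'x::metric_space \<Rightarrow> 'b::metric_space"
  assumes g: "\<And>t. \<bar>t\<bar> < a \<Longrightarrow> continuous_on K (g t)" and u: "\<And>t. \<bar>t\<bar> < a \<Longrightarrow> uniform_limit K g (g t) (at t)"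
  shows "continuous_on ({-a<..<a} \<times> K) (\<lambda>(t, x). g t x)"
  unfolding continuous_on_iff
proof (intro ballI allI impI)
  fix p and e :: real assume p: "p \<in> {-a<..<a} \<times> K" and e: "0 < e"
  obtain t x where tx: "p = (t, x)" by (cases p)
  have t: "\<bar>t\<bar> < a" "x \<in> K" using p tx by auto
  have "\<forall>\<^sub>F s in at t. \<forall>z\<in>K. dist (g s z) (g t z) < e / 2"
    using uniform_limitD[OF u[OF t(1)], of "e / 2"] e by simp
  then obtain d1 where d1: "0 < d1" "\<And>s z. s \<noteq> t \<Longrightarrow> dist s t < d1 \<Longrightarrow> z \<in> K \<Longrightarrow> dist (g s z) (g t z) < e / 2"
    unfolding eventually_at by blast
  obtain d2 where d2: "0 < d2" "\<And>z. z \<in> K \<Longrightarrow> dist z x < d2 \<Longrightarrow> dist (g t z) (g t x) < e / 2"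
    using g[OF t(1)] t(2) e unfolding continuous_on_iff by (meson half_gt_zero)
  show "\<exists>d>0. \<forall>p'\<in>{-a<..<a} \<times> K. dist p' p < d \<longrightarrow> dist (case p' of (t, x) \<Rightarrow> g t x) (case p of (t, x) \<Rightarrow> g t x) < e"
  proof (intro exI[of _ "min d1 d2"] conjI ballI impI)
    show "0 < min d1 d2" using d1(1) d2(1) by simp
    fix p' assume p': "p' \<in> {-a<..<a} \<times> K" "dist p' p < min d1 d2"
    obtain s z where sz: "p' = (s, z)" by (cases p')
    have "dist s t < d1" "dist z x < d2" "z \<in> K"
      using p' dist_fst_le[of p' p] dist_snd_le[of p' p] by (auto simp: sz tx)
    then have "dist (g s z) (g t z) < e / 2" "dist (g t z) (g t x) < e / 2"
      using d1(2)[of s z] d2(2)[of z] e by (cases "s = t"; simp)+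
    then have "dist (g s z) (g t x) < e" using dist_triangle[of "g s z" "g t x" "g t z"] by simp
    then show "dist (case p' of (t, x) \<Rightarrow> g t x) (case p of (t, x) \<Rightarrow> g t x) < e" by (simp add: sz tx)
  qed
qed

lemma uniform_limit_difference_quotient:
  fixes f :: "real \<Rightarrow> 'x::metric_space \<Rightarrow> 'b::real_normed_vector"
  assumes K: "compact K" and l: "continuous_on K l"
    and u: "uniform_limit K (\<lambda>s x. (f s x - f t x) /\<^sub>R (s - t)) l (at t)"
  shows "uniform_limit K f (f t) (at t)"
proof (rule uniform_limitI)
  fix e :: real assume e: "0 < e"
  obtain M where M: "\<And>x. x \<in> K \<Longrightarrow> norm (l x) \<le> M" "0 < M"
    using compact_imp_bounded[OF compact_continuous_image[OF l K]] unfolding bounded_pos by auto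
  have "\<forall>\<^sub>F s in at t. \<forall>x\<in>K. dist ((f s x - f t x) /\<^sub>R (s - t)) (l x) < 1"
    using uniform_limitD[OF u, of 1] by simp
  moreover have "\<forall>\<^sub>F s in at t. s \<noteq> t \<and> \<bar>s - t\<bar> < e / (M + 1)"
    unfolding eventually_at using e M(2) by (intro exI[of _ "e / (M + 1)"]) (auto simp: dist_real_def)
  ultimately show "\<forall>\<^sub>F s in at t. \<forall>x\<in>K. dist (f s x) (f t x) < e"
  proof eventually_elim
    case (elim s)
    show ?case
    proof
      fix x assume x: "x \<in> K"
      let ?q = "(f s x - f t x) /\<^sub>R (s - t)"
      have "norm ?q < M + 1" using elim(1) x M(1)[OF x] norm_triangle_sub[of ?q "l x"] by (force simp: dist_norm)
      have "f s x - f t x = (s - t) *\<^sub>R ?q" using elim(2) by simp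
      then have "norm (f s x - f t x) = \<bar>s - t\<bar> * norm ?q" by (metis norm_scaleR)
      also have "\<dots> \<le> \<bar>s - t\<bar> * (M + 1)" using \<open>norm ?q < M + 1\<close> by (intro mult_left_mono) auto
      also have "\<dots> < e" using elim(2) M(2) by (simp add: field_simps)
      finally show "dist (f s x) (f t x) < e" by (simp add: dist_norm)
    qed
  qed
qed

lemma time_deriv_uniform:
  fixes f f' :: "real \<Rightarrow> 'x::metric_space \<Rightarrow> 'b::real_normed_vector"
  assumes K: "compact K" and c: "\<And>t. \<bar>t\<bar> < a \<Longrightarrow> continuous_on K (f t)" "\<And>t. \<bar>t\<bar> < a \<Longrightarrow> continuous_on K (f' t)"
    and u: "\<And>t. \<bar>t\<bar> < a \<Longrightarrow> uniform_limit K (\<lambda>s x. (f s x - f t x) /\<^sub>R (s - t)) (f' t) (at t)"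
    and u': "\<And>t. \<bar>t\<bar> < a \<Longrightarrow> uniform_limit K f' (f' t) (at t)"
  shows "time_deriv a K f f'"
  unfolding time_deriv_def
proof (intro conjI allI impI)
  show "continuous_on ({-a<..<a} \<times> K) (\<lambda>(t, x). f t x)"
    by (rule continuous_on_uniform_family[OF c(1) uniform_limit_difference_quotient[OF K c(2) u]])
  show "continuous_on ({-a<..<a} \<times> K) (\<lambda>(t, x). f' t x)" by (rule continuous_on_uniform_family[OF c(2) u'])
  fix t x assume t: "\<bar>t\<bar> < a" and x: "x \<in> K"
  have lim: "((\<lambda>s. (f s x - f t x) /\<^sub>R (s - t)) \<longlongrightarrow> f' t x) (at t)" by (rule tendsto_uniform_limitI[OF u[OF t] x])
  show "((\<lambda>s. f s x) has_vector_derivative f' t x) (at t)"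
    unfolding has_vector_derivative_def has_derivative_iff_norm
  proof
    show "bounded_linear (\<lambda>s. s *\<^sub>R f' t x)" by (rule bounded_linear_scaleR_left)
    have "((\<lambda>s. norm ((f s x - f t x) /\<^sub>R (s - t) - f' t x)) \<longlongrightarrow> 0) (at t)"
      using tendsto_norm[OF tendsto_diff[OF lim tendsto_const[of "f' t x"]]] by simp
    moreover have "\<forall>\<^sub>F s in at t. norm ((f s x - f t x) /\<^sub>R (s - t) - f' t x) = norm (f s x - f t x - (s - t) *\<^sub>R f' t x) / norm (s - t)"
      unfolding eventually_at_filter
    proof (intro always_eventually allI impI)
      fix s assume "s \<noteq> t"
      then have "(f s x - f t x) /\<^sub>R (s - t) - f' t x = (f s x - f t x - (s - t) *\<^sub>R f' t x) /\<^sub>R (s - t)"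
        by (simp add: scaleR_diff_right)
      then show "norm ((f s x - f t x) /\<^sub>R (s - t) - f' t x) = norm (f s x - f t x - (s - t) *\<^sub>R f' t x) / norm (s - t)"
        by (simp add: divide_inverse mult.commute)
    qed
    ultimately show "((\<lambda>s. norm (f s x - f t x - (s - t) *\<^sub>R f' t x) / norm (s - t)) \<longlongrightarrow> 0) (at t)"
      by (rule Lim_transform_eventually)
  qed
qed

lemma C2_closureD:
  assumes "C2_closure \<Omega> f"
  shows "C1_closure \<Omega> f" "C1_closure \<Omega> (partial \<Omega> i f)" "continuous_on (closure \<Omega>) f" "continuous_on (closure \<Omega>) (partial \<Omega> i f)"
    and "has_partials \<Omega> f (\<lambda>i. partial \<Omega> i f)" "has_partials \<Omega> (partial \<Omega> i f) (\<lambda>j. partial \<Omega> j (partial \<Omega> i f))"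
  using assms has_partials_partial unfolding C2_closure_def C1_closure_def by blast+

text \<open>Difference quotients in time commute with partial derivatives in space, so convergence
  in C^2 passes to values and to first partial derivatives. Continuity in time of the lower
  derivatives follows from the convergence of their difference quotients.\<close>

lemma C2_curve_time_deriv:
  fixes \<Omega> :: "(real^'n) set"
  assumes \<Omega>: "bounded \<Omega>" "open \<Omega>" and curve: "C2_curve \<Omega> a f"
  obtains f1 f2 where "\<And>t. \<bar>t\<bar> < a \<Longrightarrow> C2_closure \<Omega> (f t)" "\<And>t. \<bar>t\<bar> < a \<Longrightarrow> C2_closure \<Omega> (f1 t)" "\<And>t. \<bar>t\<bar> < a \<Longrightarrow> C2_closure \<Omega> (f2 t)"
    "time_deriv a (closure \<Omega>) f f1" "time_deriv a (closure \<Omega>) f1 f2"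
    "\<And>i. time_deriv a (closure \<Omega>) (\<lambda>t. partial \<Omega> i (f t)) (\<lambda>t. partial \<Omega> i (f1 t))"
    "\<And>i. time_deriv a (closure \<Omega>) (\<lambda>t. partial \<Omega> i (f1 t)) (\<lambda>t. partial \<Omega> i (f2 t))"
proof -
  obtain f1 f2 where C: "\<And>t. \<bar>t\<bar> < a \<Longrightarrow> C2_closure \<Omega> (f t)" "\<And>t. \<bar>t\<bar> < a \<Longrightarrow> C2_closure \<Omega> (f1 t)" "\<And>t. \<bar>t\<bar> < a \<Longrightarrow> C2_closure \<Omega> (f2 t)"
    and L: "\<And>t. \<bar>t\<bar> < a \<Longrightarrow> C2_limit \<Omega> (\<lambda>s x. (f s x - f t x) /\<^sub>R (s - t)) (f1 t) (at t)"
      "\<And>t. \<bar>t\<bar> < a \<Longrightarrow> C2_limit \<Omega> (\<lambda>s x. (f1 s x - f1 t x) /\<^sub>R (s - t)) (f2 t) (at t)"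
      "\<And>t. \<bar>t\<bar> < a \<Longrightarrow> C2_limit \<Omega> f2 (f2 t) (at t)"
    using curve unfolding C2_curve_def by blast
  have K: "compact (closure \<Omega>)" using \<Omega>(1) by (simp add: compact_closure)
  have near: "\<forall>\<^sub>F s in at t. \<bar>s\<bar> < a" if "\<bar>t\<bar> < a" for t
    unfolding eventually_at using that by (intro exI[of _ "a - \<bar>t\<bar>"]) (auto simp: dist_real_def)
  have pq: "uniform_limit (closure \<Omega>) (\<lambda>s x. (partial \<Omega> i (h s) x - partial \<Omega> i (h t) x) /\<^sub>R (s - t)) (partial \<Omega> i l) (at t)"
    if h: "\<And>t. \<bar>t\<bar> < a \<Longrightarrow> C2_closure \<Omega> (h t)" and t: "\<bar>t\<bar> < a"
      and lim: "C2_limit \<Omega> (\<lambda>s x. (h s x - h t x) /\<^sub>R (s - t)) l (at t)" for h l i t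
  proof -
    have "\<forall>\<^sub>F s in at t. \<forall>x\<in>closure \<Omega>. partial \<Omega> i (\<lambda>x. (h s x - h t x) /\<^sub>R (s - t)) x = (partial \<Omega> i (h s) x - partial \<Omega> i (h t) x) /\<^sub>R (s - t)"
      using near[OF t]
    proof eventually_elim
      case (elim s)
      show ?case
        using partial_eq[OF has_partials_bounded_linear[OF bounded_linear_scaleR_right
            has_partials_diff[OF C2_closureD(5)[OF h[OF elim]] C2_closureD(5)[OF h[OF t]]]] \<Omega>(2)] by blast
    qed
    moreover have "uniform_limit (closure \<Omega>) (\<lambda>s. partial \<Omega> i (\<lambda>x. (h s x - h t x) /\<^sub>R (s - t))) (partial \<Omega> i l) (at t)"
      using lim unfolding C2_limit_def by blast
    ultimately show ?thesis by (simp cong: uniform_limit_cong)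
  qed
  have q: "uniform_limit (closure \<Omega>) (\<lambda>s x. (h s x - h t x) /\<^sub>R (s - t)) l (at t)"
    if "C2_limit \<Omega> (\<lambda>s x. (h s x - h t x) /\<^sub>R (s - t)) l (at t)" for h l t
    using that unfolding C2_limit_def by blast
  have f12: "time_deriv a (closure \<Omega>) f1 f2"
    by (rule time_deriv_uniform[OF K C2_closureD(3)[OF C(2)] C2_closureD(3)[OF C(3)] q[OF L(2)]])
       (use L(3) in \<open>simp_all add: C2_limit_def\<close>)
  have f01: "time_deriv a (closure \<Omega>) f f1"
    by (rule time_deriv_uniform[OF K C2_closureD(3)[OF C(1)] C2_closureD(3)[OF C(2)] q[OF L(1)]
        uniform_limit_difference_quotient[OF K C2_closureD(3)[OF C(3)] q[OF L(2)]]])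
  have p12: "time_deriv a (closure \<Omega>) (\<lambda>t. partial \<Omega> i (f1 t)) (\<lambda>t. partial \<Omega> i (f2 t))" for i
    by (rule time_deriv_uniform[OF K C2_closureD(4)[OF C(2)] C2_closureD(4)[OF C(3)] pq[OF C(2) _ L(2)]])
       (use L(3) in \<open>simp_all add: C2_limit_def\<close>)
  have p01: "time_deriv a (closure \<Omega>) (\<lambda>t. partial \<Omega> i (f t)) (\<lambda>t. partial \<Omega> i (f1 t))" for i
    by (rule time_deriv_uniform[OF K C2_closureD(4)[OF C(1)] C2_closureD(4)[OF C(2)] pq[OF C(1) _ L(1)]
        uniform_limit_difference_quotient[OF K C2_closureD(4)[OF C(3)] pq[OF C(2) _ L(2)]]])
  show thesis by (rule that[OF C f01 f12 p01 p12])
qed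

text \<open>Subtracting the quadratic polynomial leaves a function \<open>f\<close> with
  \<open>f t / t\<^sup>2\<close> tending to 0. Multiplied by \<open>t\<close> this gives a vanishing
  first derivative at 0; l'Hopital's rule then identifies the limit with half the second derivative,
  which vanishes too.\<close>

lemma second_order_expansion:
  fixes F F1 :: "real \<Rightarrow> real^'n"
  assumes a: "0 < a" and d1: "\<And>t. \<bar>t\<bar> < a \<Longrightarrow> (F has_vector_derivative F1 t) (at t)"
    and d2: "(F1 has_vector_derivative F2) (at 0)"
    and lim: "((\<lambda>t. (F t - (F 0 + t *\<^sub>R v + (t\<^sup>2 / 2) *\<^sub>R w)) /\<^sub>R t\<^sup>2) \<longlongrightarrow> 0) (at 0)"
  shows "F1 0 = v" and "F2 = w"
proof -
  have "F1 0 $ k = v $ k \<and> F2 $ k = w $ k" for k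
  proof -
    define f where "f t = F t $ k - (F 0 $ k + t * v $ k + t\<^sup>2 / 2 * w $ k)" for t
    define f1 where "f1 t = F1 t $ k - (v $ k + t * w $ k)" for t
    have comp: "((\<lambda>t. H t $ k) has_real_derivative H' $ k) (at t)" if "(H has_vector_derivative H') (at t)" for H H' t
      using bounded_linear.has_vector_derivative[OF bounded_linear_vec_nth that]
      by (simp add: has_real_derivative_iff_has_vector_derivative)
    have df: "(f has_real_derivative f1 t) (at t)" if "\<bar>t\<bar> < a" for t
    proof -
      have "((\<lambda>t. F 0 $ k + t * v $ k + t\<^sup>2 / 2 * w $ k) has_real_derivative v $ k + t * w $ k) (at t)"
        by (auto intro!: derivative_eq_intros)
      from DERIV_diff[OF comp[OF d1[OF that]] this] show ?thesis by (simp add: f_def[abs_def] f1_def)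
    qed
    have df1: "(f1 has_real_derivative F2 $ k - w $ k) (at 0)"
    proof -
      have "((\<lambda>t. v $ k + t * w $ k) has_real_derivative w $ k) (at 0)"
        by (auto intro!: derivative_eq_intros)
      from DERIV_diff[OF comp[OF d2] this] show ?thesis by (simp add: f1_def[abs_def])
    qed
    have "((\<lambda>t. ((F t - (F 0 + t *\<^sub>R v + (t\<^sup>2 / 2) *\<^sub>R w)) /\<^sub>R t\<^sup>2) $ k) \<longlongrightarrow> 0 $ k) (at 0)" by (rule tendsto_vec_nth[OF lim])
    moreover have "(\<lambda>t. ((F t - (F 0 + t *\<^sub>R v + (t\<^sup>2 / 2) *\<^sub>R w)) /\<^sub>R t\<^sup>2) $ k) = (\<lambda>t. f t / t\<^sup>2)"
    proof (rule HOL.ext)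
      fix t
      show "((F t - (F 0 + t *\<^sub>R v + (t\<^sup>2 / 2) *\<^sub>R w)) /\<^sub>R t\<^sup>2) $ k = f t / t\<^sup>2"
        unfolding f_def vector_scaleR_component vector_minus_component vector_add_component real_scaleR_def
        by (simp only: divide_inverse mult.commute[of _ "inverse (t\<^sup>2)"])
    qed
    ultimately have lf: "((\<lambda>t. f t / t\<^sup>2) \<longlongrightarrow> 0) (at 0)" by simp
    have f0: "f 0 = 0" by (simp add: f_def)
    have "((\<lambda>t. t * (f t / t\<^sup>2)) \<longlongrightarrow> 0 * 0) (at 0)" by (intro tendsto_mult lf tendsto_ident_at)
    moreover have "(\<lambda>t. t * (f t / t\<^sup>2)) = (\<lambda>t. f t / t)" by (simp add: fun_eq_iff power2_eq_square)
    moreover have "((\<lambda>t. f t / t) \<longlongrightarrow> f1 0) (at 0)"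
      using df[of 0] a f0 by (simp add: has_field_derivative_iff)
    ultimately have f10: "f1 0 = 0" using LIM_unique[of "\<lambda>t. f t / t" 0 0 "f1 0"] by simp
    have ev: "\<forall>\<^sub>F t in at 0. \<bar>t\<bar> < a \<and> t \<noteq> 0"
      unfolding eventually_at using a by (intro exI[of _ a]) auto
    have "((\<lambda>t. f1 t / t) \<longlongrightarrow> F2 $ k - w $ k) (at 0)"
      using df1 f10 by (simp add: has_field_derivative_iff)
    then have "((\<lambda>t. f1 t / t / 2) \<longlongrightarrow> (F2 $ k - w $ k) / 2) (at 0)" by (rule tendsto_divide[OF _ tendsto_const]) simp
    then have l2: "((\<lambda>t. f1 t / (2 * t)) \<longlongrightarrow> (F2 $ k - w $ k) / 2) (at 0)" by (simp add: mult.commute)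
    have "((\<lambda>t. f t / t\<^sup>2) \<longlongrightarrow> (F2 $ k - w $ k) / 2) (at 0)"
    proof (rule lhopital[OF _ _ _ _ _ _ l2])
      show "(f \<longlongrightarrow> 0) (at 0)" using DERIV_isCont[OF df[of 0]] a f0 by (simp add: isCont_def)
      show "((\<lambda>t::real. t\<^sup>2) \<longlongrightarrow> 0) (at 0)" by (rule tendsto_eq_intros refl | simp)+
      show "\<forall>\<^sub>F t in at 0. (f has_real_derivative f1 t) (at t)" using ev by eventually_elim (simp add: df)
      show "\<forall>\<^sub>F t in at 0. ((\<lambda>t::real. t\<^sup>2) has_real_derivative 2 * t) (at t)"
        by (intro always_eventually allI) (rule derivative_eq_intros refl | simp)+
    qed (use ev in \<open>auto elim!: eventually_mono\<close>)
    then have "F2 $ k = w $ k" using LIM_unique[OF lf] by fastforce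
    then show ?thesis using f10 by (simp add: f1_def)
  qed
  then show "F1 0 = v" "F2 = w" by (auto simp: vec_eq_iff)
qed

definition time_rate :: "(real \<Rightarrow> 'x \<Rightarrow> 'b::real_normed_vector) \<Rightarrow> real \<Rightarrow> 'x \<Rightarrow> 'b" where
  "time_rate f t x = vector_derivative (\<lambda>s. f s x) (at t)"

lemma time_rate_eq: "time_deriv a K f f' \<Longrightarrow> \<bar>t\<bar> < a \<Longrightarrow> x \<in> K \<Longrightarrow> time_rate f t x = f' t x"
  unfolding time_rate_def by (rule vector_derivative_at[OF time_derivD(3)])

lemma time_C2_rate:
  assumes "time_C2 a K f"
  shows "time_deriv a K f (time_rate f)" and "time_deriv a K (time_rate f) (time_rate (time_rate f))"
proof -
  obtain f1 f2 where f: "time_deriv a K f f1" "time_deriv a K f1 f2" using assms unfolding time_C2_def by blast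
  show "time_deriv a K f (time_rate f)"
    by (rule time_deriv_cong[OF f(1)]) (simp_all add: time_rate_eq[OF f(1)])
  have "time_deriv a K (time_rate f) f2"
    by (rule time_deriv_cong[OF f(2)]) (simp_all add: time_rate_eq[OF f(1)])
  then show "time_deriv a K (time_rate f) (time_rate (time_rate f))"
    by (rule time_deriv_cong) (simp_all add: time_rate_eq[OF \<open>time_deriv a K (time_rate f) f2\<close>])
qed

lemma time_C2_cong:
  assumes f: "time_C2 a K f" and fg: "\<And>t x. \<bar>t\<bar> < a \<Longrightarrow> x \<in> K \<Longrightarrow> f t x = g t x"
  shows "time_C2 a K g"
proof -
  obtain f1 f2 where f: "time_deriv a K f f1" "time_deriv a K f1 f2" using f unfolding time_C2_def by blast
  have "time_deriv a K g f1" by (rule time_deriv_cong[OF f(1)]) (simp_all add: fg)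
  then show ?thesis using f(2) unfolding time_C2_def by blast
qed

text \<open>Cramer's rule writes the solution as a rational expression in the matrix and the
  right-hand side, with a positive denominator.\<close>

lemma time_C2_solve:
  fixes M :: "real \<Rightarrow> 'x::metric_space \<Rightarrow> real^'n^'n"
  assumes M: "\<And>i j. time_C2 a K (\<lambda>t x. M t x $ i $ j)" and b: "\<And>i. time_C2 a K (\<lambda>t x. b t x $ i)"
    and pos: "\<And>t x. \<bar>t\<bar> < a \<Longrightarrow> x \<in> K \<Longrightarrow> 0 < det (M t x)"
    and eq: "\<And>t x. \<bar>t\<bar> < a \<Longrightarrow> x \<in> K \<Longrightarrow> M t x *v z t x = b t x"
  shows "time_C2 a K z"
proof -
  have "time_C2 a K (\<lambda>t x. (\<chi> i j. if j = k then b t x $ i else M t x $ i $ j) $ i $ j)" for i j k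
    using M[of i j] b[of i] by (cases "j = k") simp_all
  then have "time_C2 a K (\<lambda>t x. det (\<chi> i j. if j = k then b t x $ i else M t x $ i $ j) * inverse (det (M t x)))" for k
    by (intro time_C2_bilinear[OF bounded_bilinear_mult] time_C2_det time_C2_inverse M pos)
  then have "time_C2 a K (\<lambda>t x. \<chi> k. det (\<chi> i j. if j = k then b t x $ i else M t x $ i $ j) * inverse (det (M t x)))"
    by (rule time_C2_vec)
  then show ?thesis
  proof (rule time_C2_cong)
    fix t x assume t: "\<bar>t\<bar> < a" "x \<in> K"
    have "z t x $ k = det (\<chi> i j. if j = k then b t x $ i else M t x $ i $ j) / det (M t x)" for k
      by (rule cramer_component[OF _ eq[OF t]]) (use pos[OF t] in simp)
    then show "(\<chi> k. det (\<chi> i j. if j = k then b t x $ i else M t x $ i $ j) * inverse (det (M t x))) = z t x"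
      by (simp add: vec_eq_iff divide_inverse)
  qed
qed

section \<open>The first variation of the energy\<close>

text \<open>With \<open>w\<close> the gradient of a solution, \<open>W\<close> its Hessian,
  \<open>V\<close> the velocity and \<open>e\<close> the rate of the pulled-back solution, the left
  side is the divergence of \<open>f1 V + 2 (e - V \<bullet> w) w\<close>. Symmetry of
  \<open>W\<close> cancels the terms quadratic in \<open>w\<close> with a Hessian, and its trace is
  replaced by the equation.\<close>

lemma divergence_identity:
  fixes w V :: "real^'n" and W DV :: "'n \<Rightarrow> real^'n" and due :: "'n \<Rightarrow> real"
  assumes sym: "\<And>i k. W i $ k = W k $ i" and tr: "(\<Sum>i\<in>UNIV. W i $ i) = - gu"
  shows "(\<Sum>i\<in>UNIV. (f1 *\<^sub>R DV i + (w \<bullet> W i + W i \<bullet> w - 2 * (w $ i * gu)) *\<^sub>R V +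
      ((2 * (e - V \<bullet> w)) *\<^sub>R W i + (2 * (due i - (V \<bullet> W i + DV i \<bullet> w))) *\<^sub>R w)) $ i) =
    f1 * (\<Sum>i\<in>UNIV. DV i $ i) + 2 * (\<Sum>i\<in>UNIV. due i * w $ i) - 2 * (\<Sum>i\<in>UNIV. (DV i \<bullet> w) * w $ i) - 2 * gu * e"
proof -
  have s: "(\<Sum>i\<in>UNIV. (w \<bullet> W i) * V $ i) = (\<Sum>i\<in>UNIV. (V \<bullet> W i) * w $ i)"
  proof -
    have "(\<Sum>i\<in>UNIV. (w \<bullet> W i) * V $ i) = (\<Sum>i\<in>UNIV. \<Sum>k\<in>UNIV. w $ k * W i $ k * V $ i)"
      by (simp add: inner_vec_def sum_distrib_right)
    also have "\<dots> = (\<Sum>k\<in>UNIV. \<Sum>i\<in>UNIV. w $ k * W i $ k * V $ i)" by (rule sum.swap)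
    also have "\<dots> = (\<Sum>k\<in>UNIV. (V \<bullet> W k) * w $ k)"
      by (intro sum.cong refl, simp only: inner_vec_def inner_real_def sum_distrib_right, rule sum.cong[OF refl]) (simp add: sym mult_ac)
    finally show ?thesis .
  qed
  have vw: "(\<Sum>i\<in>UNIV. V $ i * w $ i) = V \<bullet> w" by (simp add: inner_vec_def)
  have "(\<Sum>i\<in>UNIV. (f1 *\<^sub>R DV i + (w \<bullet> W i + W i \<bullet> w - 2 * (w $ i * gu)) *\<^sub>R V +
      ((2 * (e - V \<bullet> w)) *\<^sub>R W i + (2 * (due i - (V \<bullet> W i + DV i \<bullet> w))) *\<^sub>R w)) $ i) =
    (\<Sum>i\<in>UNIV. f1 * DV i $ i + 2 * ((w \<bullet> W i) * V $ i) - 2 * gu * (V $ i * w $ i) +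
      2 * (e - V \<bullet> w) * W i $ i + 2 * (due i * w $ i) - 2 * ((V \<bullet> W i) * w $ i) - 2 * ((DV i \<bullet> w) * w $ i))"
    by (intro sum.cong refl) (simp add: inner_commute[of "W _" w] algebra_simps)
  also have "\<dots> = f1 * (\<Sum>i\<in>UNIV. DV i $ i) + 2 * (\<Sum>i\<in>UNIV. (w \<bullet> W i) * V $ i) - 2 * gu * (V \<bullet> w) +
      2 * (e - V \<bullet> w) * (\<Sum>i\<in>UNIV. W i $ i) + 2 * (\<Sum>i\<in>UNIV. due i * w $ i) - 2 * (\<Sum>i\<in>UNIV. (V \<bullet> W i) * w $ i)
      - 2 * (\<Sum>i\<in>UNIV. (DV i \<bullet> w) * w $ i)"
    unfolding vw[symmetric] by (simp only: sum.distrib sum_subtractf sum_distrib_left)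
  finally show ?thesis unfolding s tr by (simp add: algebra_simps)
qed

text \<open>The problem in Lagrangian coordinates: \<open>h\<close> is the solution pulled back to
  \<Omega>, and the indices 1 and 2 mark time derivatives. The C^2 graph functions in
  \<open>smooth_atlas\<close> serve the comparison of surface integrals.\<close>

locale robin_flow = regular_domain \<Omega> for \<Omega> :: "(real^'n) set" +
  fixes a \<alpha> :: real and G g g' :: "real \<Rightarrow> real" and y y1 y2 :: "real \<Rightarrow> real^'n \<Rightarrow> real^'n"
    and U h h1 h2 :: "real \<Rightarrow> real^'n \<Rightarrow> real"
  assumes a: "0 < a"
    and G: "\<And>r. (G has_real_derivative g r) (at r)" and g: "\<And>r. (g has_real_derivative g' r) (at r)"
    and smooth_atlas: "\<exists>ps. boundary_atlas \<Omega> ps \<and> (\<forall>(U, k, s, h, \<zeta>)\<in>set ps. \<forall>i. C1_closure UNIV (partial UNIV i h))"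
    and y_C2: "\<And>t. \<bar>t\<bar> < a \<Longrightarrow> C2_closure \<Omega> (y t)" and y1_C2: "\<And>t. \<bar>t\<bar> < a \<Longrightarrow> C2_closure \<Omega> (y1 t)"
    and y_time: "time_deriv a (closure \<Omega>) y y1" and y1_time: "time_deriv a (closure \<Omega>) y1 y2"
    and Dy_time: "\<And>i. time_deriv a (closure \<Omega>) (\<lambda>t. partial \<Omega> i (y t)) (\<lambda>t. partial \<Omega> i (y1 t))"
    and Dy1_time: "\<And>i. time_deriv a (closure \<Omega>) (\<lambda>t. partial \<Omega> i (y1 t)) (\<lambda>t. partial \<Omega> i (y2 t))"
    and diffeo: "\<And>t. \<bar>t\<bar> < a \<Longrightarrow> C2_diffeo_closure \<Omega> (y t)"
    and y_0: "\<And>x. x \<in> closure \<Omega> \<Longrightarrow> y 0 x = x"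
    and solution: "\<And>t. \<bar>t\<bar> < a \<Longrightarrow> robin_solution (y t ` \<Omega>) \<alpha> g (U t)"
    and h_eq: "\<And>t x. h t x = U t (y t x)"
    and h1_C2: "\<And>t. \<bar>t\<bar> < a \<Longrightarrow> C2_closure \<Omega> (h1 t)"
    and h_time: "time_deriv a (closure \<Omega>) h h1" and h1_time: "time_deriv a (closure \<Omega>) h1 h2"
    and Dh_time: "\<And>i. time_deriv a (closure \<Omega>) (\<lambda>t. partial \<Omega> i (h t)) (\<lambda>t. partial \<Omega> i (h1 t))"
    and Dh1_time: "\<And>i. time_deriv a (closure \<Omega>) (\<lambda>t. partial \<Omega> i (h1 t)) (\<lambda>t. partial \<Omega> i (h2 t))"
begin

definition q where "q t = inv_into (closure \<Omega>) (y t)"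

definition A where "A t x = (\<chi> i j. partial \<Omega> j (y t) x $ i)"

definition p where "p t x = grad (y t ` \<Omega>) (U t) (y t x)"

definition n where
  "n t = deformation.conormal \<Omega> (y t) (\<lambda>i. partial \<Omega> i (y t)) (\<lambda>i. partial (y t ` \<Omega>) i (q t))"

definition m where "m t x = norm (n t x)"

lemma zero_time [simp]: "\<bar>0\<bar> < a"
  using a by simp

lemma q_y: "\<bar>t\<bar> < a \<Longrightarrow> x \<in> closure \<Omega> \<Longrightarrow> q t (y t x) = x"
  using diffeo unfolding C2_diffeo_closure_def q_def by simp

lemma q_C2: "\<bar>t\<bar> < a \<Longrightarrow> C2_closure (y t ` \<Omega>) (q t)"
  using diffeo unfolding C2_diffeo_closure_def q_def by simp

lemma A_time: "time_C2 a (closure \<Omega>) (\<lambda>t x. A t x $ i $ j)"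
  unfolding time_C2_def A_def
  using time_deriv_linear[OF bounded_linear_vec_nth Dy_time] time_deriv_linear[OF bounded_linear_vec_nth Dy1_time] by simp blast

lemma A_0: "x \<in> closure \<Omega> \<Longrightarrow> A 0 x = mat 1"
proof -
  have id: "has_partials \<Omega> (y 0) (\<lambda>i x. axis i 1)"
    by (rule has_partials_cong[OF has_partials_id open_domain]) (simp_all add: y_0)
  assume "x \<in> closure \<Omega>"
  then show ?thesis
    by (simp add: A_def partial_eq[OF id open_domain] vec_eq_iff mat_def axis_def)
qed

text \<open>The inverse map keeps the determinant away from 0 at all times, it is 1 at time 0, and
  it is continuous in time, so it cannot change sign.\<close>

lemma det_A_pos:
  assumes t: "\<bar>t\<bar> < a" and x: "x \<in> closure \<Omega>"
  shows "0 < det (A t x)"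
proof (rule ccontr)
  assume neg: "\<not> 0 < det (A t x)"
  have nz: "det (A s x) \<noteq> 0" if "\<bar>s\<bar> < a" for s
    using arg_cong[OF jacobian_inverse[OF open_domain C2_closureD(5)[OF y_C2[OF that]] C2_closureD(5)[OF q_C2[OF that]] q_y[OF that] x], of det]
    by (auto simp: det_mul A_def)
  have "time_C2 a (closure \<Omega>) (\<lambda>t x. det (A t x))" by (intro time_C2_det A_time)
  then have "time_deriv a (closure \<Omega>) (\<lambda>t x. det (A t x)) (time_rate (\<lambda>t x. det (A t x)))" by (rule time_C2_rate)
  then have "isCont (\<lambda>t. det (A t x)) s" if "\<bar>s\<bar> < a" for s
    using has_vector_derivative_continuous[OF time_derivD(3)[OF _ that x]] by blast
  then have "continuous_on {-a<..<a} (\<lambda>t. det (A t x))"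
    by (intro continuous_at_imp_continuous_on) (auto simp: abs_less_iff)
  then have "connected ((\<lambda>t. det (A t x)) ` {-a<..<a})" by (rule connected_continuous_image) simp
  moreover have "det (A t x) \<in> (\<lambda>t. det (A t x)) ` {-a<..<a}" using t by (auto simp: abs_less_iff)
  moreover have "det (A 0 x) \<in> (\<lambda>t. det (A t x)) ` {-a<..<a}" using a by auto
  moreover have "det (A t x) \<le> 0" "0 \<le> det (A 0 x)" using neg A_0[OF x] by auto
  ultimately have "0 \<in> (\<lambda>t. det (A t x)) ` {-a<..<a}" unfolding connected_iff_interval by blast
  then show False using nz by (auto simp: abs_less_iff)
qed

lemma deformation:
  "\<bar>t\<bar> < a \<Longrightarrow> deformation \<Omega> (y t) (q t) (\<lambda>i. partial \<Omega> i (y t)) (\<lambda>i. partial (y t ` \<Omega>) i (q t))"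
  using det_A_pos by unfold_locales (auto simp: A_def q_y C2_closureD(5)[OF y_C2] C2_closureD(5)[OF q_C2])

lemma A_eq: "\<bar>t\<bar> < a \<Longrightarrow> deformation.A (\<lambda>i. partial \<Omega> i (y t)) x = A t x"
  by (simp add: deformation.A_def[OF deformation] A_def)

lemma U_C2: "\<bar>t\<bar> < a \<Longrightarrow> C2_closure (y t ` \<Omega>) (U t)"
  using solution unfolding robin_solution_def by blast

lemma transpose_p:
  assumes t: "\<bar>t\<bar> < a" and x: "x \<in> closure \<Omega>"
  shows "transpose (A t x) *v p t x = grad \<Omega> (h t) x"
proof -
  interpret d: deformation \<Omega> "y t" "q t" "\<lambda>i. partial \<Omega> i (y t)" "\<lambda>i. partial (y t ` \<Omega>) i (q t)" by (rule deformation[OF t])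
  have "has_partials \<Omega> (h t) (\<lambda>i x. \<Sum>j\<in>UNIV. partial \<Omega> i (y t) x $ j *\<^sub>R partial (y t ` \<Omega>) j (U t) (y t x))"
    using d.pull_partials[OF C2_closureD(5)[OF U_C2[OF t]]] by (simp add: h_eq[abs_def])
  from grad_eq[OF this open_domain x] show ?thesis
    by (simp add: vec_eq_iff matrix_vector_mult_def transpose_def A_def p_def grad_def del: transpose_matrix_vector)
qed

lemma transpose_n: "\<bar>t\<bar> < a \<Longrightarrow> x \<in> closure \<Omega> \<Longrightarrow> transpose (A t x) *v n t x = det (A t x) *\<^sub>R outer_normal \<Omega> x"
  using deformation.transpose_conormal[OF deformation] by (simp add: n_def A_eq del: transpose_matrix_vector)

lemma m_pos: "\<bar>t\<bar> < a \<Longrightarrow> x \<in> frontier \<Omega> \<Longrightarrow> 0 < m t x"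
  unfolding m_def n_def using deformation.conormal_nonzero[OF deformation] by blast

lemma tangential_jacobian_eq: "\<bar>t\<bar> < a \<Longrightarrow> x \<in> frontier \<Omega> \<Longrightarrow> tangential_jacobian \<Omega> (y t) x = m t x"
  unfolding m_def n_def by (rule deformation.tangential_jacobian[OF deformation])

lemma transpose_A_time: "time_C2 a (closure \<Omega>) (\<lambda>t x. transpose (A t x) $ i $ j)"
  using A_time[of j i] by (simp add: transpose_def)

text \<open>The solutions \<open>U t\<close> live on moving domains, so their gradients are
  differentiated through the linear system \<open>transpose_p\<close>, whose right-hand side is the
  gradient of \<open>h\<close> on the fixed domain.\<close>

lemma p_time: "time_C2 a (closure \<Omega>) p"
proof (rule time_C2_solve[OF transpose_A_time _ _ transpose_p])
  show "time_C2 a (closure \<Omega>) (\<lambda>t x. grad \<Omega> (h t) x $ i)" for i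
    unfolding time_C2_def grad_def using Dh_time Dh1_time by auto
qed (simp_all add: det_A_pos)

lemma n_time: "time_C2 a (frontier \<Omega>) n"
proof (rule time_C2_solve[OF time_C2_subset[OF transpose_A_time frontier_subset] _ _ transpose_n])
  have "time_C2 a (frontier \<Omega>) (\<lambda>t. outer_normal \<Omega>)" by (rule time_C2_const[OF continuous_on_outer_normal])
  moreover have "time_C2 a (frontier \<Omega>) (\<lambda>t x. det (A t x))"
    by (intro time_C2_subset[OF _ frontier_subset] time_C2_det A_time)
  ultimately have "time_C2 a (frontier \<Omega>) (\<lambda>t x. det (A t x) *\<^sub>R outer_normal \<Omega> x)"
    by (rule time_C2_bilinear[OF bounded_bilinear_scaleR, rotated])
  then show "time_C2 a (frontier \<Omega>) (\<lambda>t x. (det (A t x) *\<^sub>R outer_normal \<Omega> x) $ i)" for i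
    by (rule time_C2_linear[OF bounded_linear_vec_nth])
qed (use frontier_subset in \<open>auto simp: det_A_pos\<close>)

lemma m_time: "time_C2 a (frontier \<Omega>) m"
proof -
  have "time_C2 a (frontier \<Omega>) (\<lambda>t x. sqrt (n t x \<bullet> n t x))"
    by (intro time_C2_sqrt time_C2_bilinear[OF bounded_bilinear_inner] n_time) (use m_pos in \<open>force simp: m_def\<close>)
  then show ?thesis by (simp add: m_def[abs_def] norm_eq_sqrt_inner)
qed

lemma det_A_time: "time_C2 a (closure \<Omega>) (\<lambda>t x. det (A t x))"
  by (intro time_C2_det A_time)

lemma continuous_G: "continuous_on X G"
  by (rule DERIV_continuous_on) (rule has_field_derivative_at_within[OF G])

lemma continuous_g: "continuous_on X g"
  by (rule DERIV_continuous_on) (rule has_field_derivative_at_within[OF g])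

section \<open>The first variation of the energy and its time derivative\<close>

definition J1 where "J1 = time_rate (\<lambda>t x. det (A t x))"

abbreviation p1 where "p1 \<equiv> time_rate p"
abbreviation n1 where "n1 \<equiv> time_rate n"
abbreviation m1 where "m1 \<equiv> time_rate m"

definition bulk where "bulk t x = p t x \<bullet> p t x - 2 * G (h t x)"

lemma Gh_time: "time_deriv a (closure \<Omega>) (\<lambda>t x. G (h t x)) (\<lambda>t x. g (h t x) * h1 t x)"
  by (rule time_deriv_comp[OF h_time UNIV_I G continuous_g])

lemma bulk_time:
  "time_deriv a (closure \<Omega>) bulk (\<lambda>t x. p t x \<bullet> p1 t x + p1 t x \<bullet> p t x - 2 * (g (h t x) * h1 t x))"
  unfolding bulk_def[abs_def]
  by (intro time_deriv_diff time_deriv_inner time_C2_rate(1) p_time time_deriv_linear[OF bounded_linear_mult_right] Gh_time)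

lemma robin_energy_eq:
  assumes t: "\<bar>t\<bar> < a"
  shows "robin_energy (y t ` \<Omega>) \<alpha> G (U t) =
    (LINT x:\<Omega>|lborel. det (A t x) * bulk t x) + \<alpha> * surface_integral \<Omega> (\<lambda>x. (h t x * h t x) * m t x)"
proof -
  interpret d: deformation \<Omega> "y t" "q t" "\<lambda>i. partial \<Omega> i (y t)" "\<lambda>i. partial (y t ` \<Omega>) i (q t)" by (rule deformation[OF t])
  let ?V = "y t ` \<Omega>"
  have cg: "continuous_on (closure ?V) (\<lambda>z. (norm (grad ?V (U t) z))\<^sup>2)"
    by (intro continuous_intros continuous_on_grad C2_closureD(1)[OF U_C2[OF t]])
  have cG: "continuous_on (closure ?V) (\<lambda>z. G (U t z))"
    by (rule continuous_on_compose2[OF continuous_G C2_closureD(3)[OF U_C2[OF t]] subset_UNIV])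
  have c: "continuous_on (closure ?V) (\<lambda>z. (norm (grad ?V (U t) z))\<^sup>2 - 2 * G (U t z))"
    by (intro continuous_intros cg cG)
  note I = set_integrable_continuous[OF d.image(4,1)]
  have "(LINT z:?V|lborel. (norm (grad ?V (U t) z))\<^sup>2) - 2 * (LINT z:?V|lborel. G (U t z)) =
      (LINT z:?V|lborel. (norm (grad ?V (U t) z))\<^sup>2 - 2 * G (U t z))"
    using set_integral_diff(2)[OF I[OF cg] set_integrable_mult_right[OF I[OF cG]], of 2] by simp
  also have "\<dots> = (LINT x:\<Omega>|lborel. det (A t x) * bulk t x)"
    unfolding d.integral_image[OF c] A_eq[OF t] by (simp add: bulk_def p_def h_eq dot_square_norm)
  finally have 1: "(LINT z:?V|lborel. (norm (grad ?V (U t) z))\<^sup>2) - 2 * (LINT z:?V|lborel. G (U t z)) =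
      (LINT x:\<Omega>|lborel. det (A t x) * bulk t x)" .
  obtain ps where ps: "boundary_atlas \<Omega> ps" "\<forall>(U, k, s, h, \<zeta>)\<in>set ps. \<forall>i. C1_closure UNIV (partial UNIV i h)"
    using smooth_atlas by blast
  have "surface_integral ?V (\<lambda>z. (U t z)\<^sup>2) = surface_integral \<Omega> (\<lambda>x. (U t (y t x))\<^sup>2 * norm (d.conormal x))"
  proof (rule d.surface_integral_image[OF ps(1) _ C2_closureD(2)[OF y_C2[OF t]] C2_closureD(2)[OF q_C2[OF t]]])
    show "C1_closure UNIV (partial UNIV i h)" if "(U, k, s, h, \<zeta>) \<in> set ps" for U k s h \<zeta> i using ps(2) that by fastforce
    show "C1_closure ?V (\<lambda>z. (U t z)\<^sup>2)"
      unfolding power2_eq_square by (intro C1_closure_mult d.image(1) C2_closureD(1)[OF U_C2[OF t]])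
  qed
  then show ?thesis unfolding robin_energy_def 1 by (simp add: h_eq m_def n_def power2_eq_square)
qed

lemma h_frontier: "time_deriv a (frontier \<Omega>) h h1"
  by (rule time_deriv_subset[OF h_time frontier_subset])

lemma p_frontier: "time_deriv a (frontier \<Omega>) p p1"
  by (rule time_deriv_subset[OF time_C2_rate(1)[OF p_time] frontier_subset])

lemma interior_closure: "x \<in> \<Omega> \<Longrightarrow> x \<in> closure \<Omega>" and frontier_closure: "x \<in> frontier \<Omega> \<Longrightarrow> x \<in> closure \<Omega>"
  using frontier_subset closure_subset by blast+

lemma time_slice: "time_deriv b K f f' \<Longrightarrow> \<bar>t\<bar> < b \<Longrightarrow> continuous_on K (f t)"
  "time_deriv b K f f' \<Longrightarrow> \<bar>t\<bar> < b \<Longrightarrow> continuous_on K (f' t)"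
  by (rule continuous_on_slice[OF time_derivD(1)]; auto simp: abs_less_iff)
     (rule continuous_on_slice[OF time_derivD(2)]; auto simp: abs_less_iff)

lemma Dy1_component_time: "time_deriv a (closure \<Omega>) (\<lambda>t x. partial \<Omega> i (y t) x $ k) (\<lambda>t x. partial \<Omega> i (y1 t) x $ k)"
  by (rule time_deriv_linear[OF bounded_linear_vec_nth Dy_time])

lemma transpose_p1:
  assumes t: "\<bar>t\<bar> < a" and x: "x \<in> closure \<Omega>"
  shows "transpose (A t x) *v p1 t x = grad \<Omega> (h1 t) x - (\<chi> i. partial \<Omega> i (y1 t) x \<bullet> p t x)"
proof -
  have "partial \<Omega> i (y t) x \<bullet> p1 t x + partial \<Omega> i (y1 t) x \<bullet> p t x = partial \<Omega> i (h1 t) x" for i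
  proof -
    have "time_deriv a (closure \<Omega>) (\<lambda>t x. partial \<Omega> i (y t) x \<bullet> p t x)
        (\<lambda>t x. partial \<Omega> i (y t) x \<bullet> p1 t x + partial \<Omega> i (y1 t) x \<bullet> p t x)"
      by (intro time_deriv_inner Dy_time time_C2_rate(1) p_time)
    then have "time_deriv a (closure \<Omega>) (\<lambda>t. partial \<Omega> i (h t))
        (\<lambda>t x. partial \<Omega> i (y t) x \<bullet> p1 t x + partial \<Omega> i (y1 t) x \<bullet> p t x)"
    proof (rule time_deriv_cong)
      fix t x assume t: "\<bar>t\<bar> < a" "x \<in> closure \<Omega>"
      have "(transpose (A t x) *v p t x) $ i = grad \<Omega> (h t) x $ i" unfolding transpose_p[OF t] ..
      then show "partial \<Omega> i (y t) x \<bullet> p t x = partial \<Omega> i (h t) x"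
        by (simp add: matrix_vector_mult_def transpose_def A_def grad_def inner_vec_def del: transpose_matrix_vector)
    qed simp
    from time_deriv_unique[OF this t x time_derivD(3)[OF Dh_time t x]] show ?thesis .
  qed
  then have "grad \<Omega> (h1 t) x $ i = partial \<Omega> i (y t) x \<bullet> p1 t x + partial \<Omega> i (y1 t) x \<bullet> p t x" for i by (simp add: grad_def)
  then show ?thesis
    by (simp add: vec_eq_iff matrix_vector_mult_def transpose_def A_def inner_vec_def del: transpose_matrix_vector)
qed

lemma J1_eq:
  assumes t: "\<bar>t\<bar> < a" and x: "x \<in> closure \<Omega>" and M: "(\<chi> i j. partial \<Omega> j (y1 t) x $ i) = M ** A t x"
  shows "J1 t x = (\<Sum>k\<in>UNIV. M $ k $ k) * det (A t x)"
proof -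
  have "((\<lambda>s. det (A s x)) has_real_derivative (\<Sum>k\<in>UNIV. M $ k $ k) * det (A t x)) (at t)"
  proof (rule DERIV_det[where A = "\<lambda>s. A s x" and M = M, OF _ M])
    show "((\<lambda>s. A s x $ i $ j) has_real_derivative (\<chi> i j. partial \<Omega> j (y1 t) x $ i) $ i $ j) (at t)" for i j
      using time_derivD(3)[OF Dy1_component_time[of j i] t x]
      by (simp add: A_def has_real_derivative_iff_has_vector_derivative)
  qed
  then show ?thesis
    unfolding J1_def using time_deriv_unique[OF time_C2_rate(1)[OF det_A_time] t x]
    by (simp add: has_real_derivative_iff_has_vector_derivative)
qed

lemma boundary_condition:
  assumes t: "\<bar>t\<bar> < a" and x: "x \<in> frontier \<Omega>"
  shows "p t x \<bullet> n t x = - \<alpha> * h t x * m t x"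
proof -
  interpret d: deformation \<Omega> "y t" "q t" "\<lambda>i. partial \<Omega> i (y t)" "\<lambda>i. partial (y t ` \<Omega>) i (q t)" by (rule deformation[OF t])
  have "y t x \<in> frontier (y t ` \<Omega>)" unfolding d.image(3) using x by blast
  then have "normal_deriv (y t ` \<Omega>) (U t) (y t x) + \<alpha> * U t (y t x) = 0"
    using solution[OF t] unfolding robin_solution_def by blast
  then have "(n t x \<bullet> p t x) / m t x + \<alpha> * h t x = 0"
    unfolding normal_deriv_def d.outer_normal_conormal[OF x] by (simp add: n_def m_def p_def h_eq divide_inverse mult.commute)
  then show ?thesis using m_pos[OF t x] by (simp add: field_simps inner_commute)
qed

text \<open>On the deformed domain \<open>e - V \<bullet> w\<close> is the Eulerian rate of the
  solution at time \<open>t\<close>. By \<open>divergence_identity\<close> the time derivative of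
  the volume integrand is \<open>J\<close> times the divergence of
  \<open>f1 V + 2 (e - V \<bullet> w) w\<close>, which \<open>integral_divergence_image\<close>
  turns into a surface integral.\<close>

lemma interior_rate:
  assumes t: "\<bar>t\<bar> < a"
  shows "(LINT x:\<Omega>|lborel. det (A t x) * (p t x \<bullet> p1 t x + p1 t x \<bullet> p t x - 2 * (g (h t x) * h1 t x)) + J1 t x * bulk t x) =
    surface_integral \<Omega> (\<lambda>x. bulk t x * (y1 t x \<bullet> n t x) + 2 * (h1 t x - y1 t x \<bullet> p t x) * (p t x \<bullet> n t x))"
proof -
  interpret d: deformation \<Omega> "y t" "q t" "\<lambda>i. partial \<Omega> i (y t)" "\<lambda>i. partial (y t ` \<Omega>) i (q t)" by (rule deformation[OF t])
  let ?V = "y t ` \<Omega>"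
  obtain DV where Ve: "has_partials ?V (\<lambda>z. y1 t (q t z)) DV"
    and DV: "\<And>i x. x \<in> closure \<Omega> \<Longrightarrow> partial \<Omega> i (y1 t) x = (\<Sum>j\<in>UNIV. partial \<Omega> i (y t) x $ j *\<^sub>R DV j (y t x))"
    by (rule d.push_partials[OF C2_closureD(5)[OF y1_C2[OF t]]]) blast
  obtain due where ue: "has_partials ?V (\<lambda>z. h1 t (q t z)) due"
    and due: "\<And>i x. x \<in> closure \<Omega> \<Longrightarrow> partial \<Omega> i (h1 t) x = (\<Sum>j\<in>UNIV. partial \<Omega> i (y t) x $ j *\<^sub>R due j (y t x))"
    by (rule d.push_partials[OF C2_closureD(5)[OF h1_C2[OF t]]]) blast
  define w where "w z = grad ?V (U t) z" for z
  define W where "W i z = (\<chi> k. partial ?V i (partial ?V k (U t)) z)" for i z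
  define V where "V z = y1 t (q t z)" for z
  define e where "e z = h1 t (q t z)" for z
  note Ve = Ve[folded V_def] and ue = ue[folded e_def]
  have w: "has_partials ?V w W"
    unfolding w_def[abs_def] W_def[abs_def] grad_def by (rule has_partials_vec[OF C2_closureD(6)[OF U_C2[OF t]]])
  have GU: "has_partials ?V (\<lambda>z. G (U t z)) (\<lambda>i z. partial ?V i (U t) z *\<^sub>R g (U t z))"
    by (rule has_partials_comp_real[OF C2_closureD(5)[OF U_C2[OF t]]])
       (simp_all add: G has_real_derivative_iff_has_vector_derivative[symmetric] continuous_g)
  define f1 where "f1 z = w z \<bullet> w z - 2 * G (U t z)" for z
  have f1: "has_partials ?V f1 (\<lambda>i z. w z \<bullet> W i z + W i z \<bullet> w z - 2 * (w z $ i * g (U t z)))"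
    using has_partials_diff[OF has_partials_inner[OF w w] has_partials_bounded_linear[OF bounded_linear_mult_right[of 2] GU]]
    by (simp add: f1_def[abs_def] w_def grad_def)
  have f2: "has_partials ?V (\<lambda>z. 2 * (e z - V z \<bullet> w z)) (\<lambda>i z. 2 * (due i z - (V z \<bullet> W i z + DV i z \<bullet> w z)))"
    by (rule has_partials_bounded_linear[OF bounded_linear_mult_right has_partials_diff[OF ue has_partials_inner[OF Ve w]]])
  define E where "E i z = f1 z *\<^sub>R DV i z + (w z \<bullet> W i z + W i z \<bullet> w z - 2 * (w z $ i * g (U t z))) *\<^sub>R V z +
    ((2 * (e z - V z \<bullet> w z)) *\<^sub>R W i z + (2 * (due i z - (V z \<bullet> W i z + DV i z \<bullet> w z))) *\<^sub>R w z)" for i z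
  have X: "has_partials ?V (\<lambda>z. f1 z *\<^sub>R V z + (2 * (e z - V z \<bullet> w z)) *\<^sub>R w z) E"
    unfolding E_def[abs_def] by (rule has_partials_add[OF has_partials_scaleR[OF f1 Ve] has_partials_scaleR[OF f2 w]])
  have pt: "det (A t x) * (p t x \<bullet> p1 t x + p1 t x \<bullet> p t x - 2 * (g (h t x) * h1 t x)) + J1 t x * bulk t x =
      d.J x * (\<Sum>i\<in>UNIV. E i (y t x) $ i)" if x: "x \<in> \<Omega>" for x
  proof -
    note xc = interior_closure[OF x]
    define z where "z = y t x"
    have z: "z \<in> ?V" "z \<in> closure ?V" using x by (auto simp: z_def intro: subsetD[OF closure_subset])
    have ev: "V z = y1 t x" "e z = h1 t x" "w z = p t x" "U t z = h t x" "f1 z = bulk t x"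
      using q_y[OF t xc] by (simp_all add: V_def e_def w_def p_def z_def h_eq f1_def bulk_def)
    have sym: "W i z $ k = W k z $ i" for i k
      unfolding W_def vec_lambda_beta
      by (rule mixed_partials_eq[OF C2_closureD(5,6)[OF U_C2[OF t]] d.image(1) z(2)])
    have tr: "(\<Sum>i\<in>UNIV. W i z $ i) = - g (U t z)"
      using solution[OF t] z(1) by (force simp: robin_solution_def laplace_def W_def)
    define M where "M = (\<chi> i k. DV k z $ i)"
    \<comment> \<open>\<open>M\<close> is the velocity gradient on the deformed domain, and the time
      derivative of \<open>A\<close> is \<open>M ** A\<close>; Jacobi's formula then gives the rate
      of the determinant as its product with the divergence of the velocity.\<close>
    have A1: "(\<chi> i j. partial \<Omega> j (y1 t) x $ i) = M ** A t x"
      using DV[OF xc] by (simp add: vec_eq_iff matrix_matrix_mult_def M_def A_def z_def mult.commute)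
    have J1: "J1 t x = (\<Sum>k\<in>UNIV. DV k z $ k) * det (A t x)"
      using J1_eq[OF t xc A1] by (simp add: M_def)
    have "transpose (A t x) *v p1 t x = transpose (A t x) *v (\<chi> k. due k z - DV k z \<bullet> p t x)"
    proof -
      have "grad \<Omega> (h1 t) x $ i - partial \<Omega> i (y1 t) x \<bullet> p t x = (\<Sum>j\<in>UNIV. partial \<Omega> i (y t) x $ j * (due j z - DV j z \<bullet> p t x))" for i
        using due[OF xc, of i] DV[OF xc, of i]
        by (simp add: grad_def z_def inner_sum_left right_diff_distrib sum_subtractf del: sum_component)
      then show ?thesis
        unfolding transpose_p1[OF t xc]
        by (simp add: vec_eq_iff matrix_vector_mult_def transpose_def A_def del: transpose_matrix_vector)
    qed
    then have p1: "p1 t x = (\<chi> k. due k z - DV k z \<bullet> p t x)" by (rule d.transpose_cancel[OF xc, unfolded A_eq[OF t]])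
    have pp: "p t x \<bullet> p1 t x = (\<Sum>i\<in>UNIV. due i z * p t x $ i) - (\<Sum>i\<in>UNIV. (DV i z \<bullet> p t x) * p t x $ i)"
      unfolding p1 by (simp add: inner_vec_def[of "p t x" "\<chi> k. _ k"] right_diff_distrib sum_subtractf mult.commute)
    have S: "(\<Sum>i\<in>UNIV. E i z $ i) = bulk t x * (\<Sum>i\<in>UNIV. DV i z $ i) + 2 * (p t x \<bullet> p1 t x) - 2 * g (h t x) * h1 t x"
      unfolding E_def divergence_identity[of "\<lambda>i. W i z", OF sym tr] unfolding ev pp by (simp add: algebra_simps)
    then show ?thesis
      unfolding z_def[symmetric] A_eq[OF t] J1 S by (simp add: inner_commute[of "p1 t x"] algebra_simps)
  qed
  have "(LINT x:\<Omega>|lborel. det (A t x) * (p t x \<bullet> p1 t x + p1 t x \<bullet> p t x - 2 * (g (h t x) * h1 t x)) + J1 t x * bulk t x) =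
      (LINT x:\<Omega>|lborel. d.J x * (\<Sum>i\<in>UNIV. E i (y t x) $ i))"
    by (rule set_lebesgue_integral_cong) (use open_domain pt in auto)
  also have "\<dots> = surface_integral \<Omega> (\<lambda>x. (f1 (y t x) *\<^sub>R V (y t x) + (2 * (e (y t x) - V (y t x) \<bullet> w (y t x))) *\<^sub>R w (y t x)) \<bullet> d.conormal x)"
    by (rule d.integral_divergence_image[OF X])
  also have "\<dots> = surface_integral \<Omega> (\<lambda>x. bulk t x * (y1 t x \<bullet> n t x) + 2 * (h1 t x - y1 t x \<bullet> p t x) * (p t x \<bullet> n t x))"
  proof (rule surface_integral_cong)
    fix x assume "x \<in> frontier \<Omega>"
    then have "q t (y t x) = x" using q_y[OF t] frontier_closure by blast
    then show "(f1 (y t x) *\<^sub>R V (y t x) + (2 * (e (y t x) - V (y t x) \<bullet> w (y t x))) *\<^sub>R w (y t x)) \<bullet> d.conormal x =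
        bulk t x * (y1 t x \<bullet> n t x) + 2 * (h1 t x - y1 t x \<bullet> p t x) * (p t x \<bullet> n t x)"
      by (simp add: f1_def V_def e_def w_def n_def p_def h_eq bulk_def inner_add_left)
  qed
  finally show ?thesis .
qed

text \<open>The terms with \<open>h1\<close> are gone: by the Robin condition
  \<open>2 h1 (p \<bullet> n)\<close> cancels \<open>2 \<alpha> h h1 m\<close> from the surface
  energy. One more time derivative therefore involves \<open>h1\<close> but not
  \<open>h2\<close>.\<close>

definition first_variation where
  "first_variation t x = bulk t x * (y1 t x \<bullet> n t x) - 2 * ((y1 t x \<bullet> p t x) * (p t x \<bullet> n t x)) + \<alpha> * ((h t x * h t x) * m1 t x)"

lemma DERIV_robin_energy:
  assumes t: "\<bar>t\<bar> < a"
  shows "((\<lambda>t. robin_energy (y t ` \<Omega>) \<alpha> G (U t)) has_real_derivative surface_integral \<Omega> (first_variation t)) (at t)"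
proof -
  let ?f' = "\<lambda>t x. det (A t x) * (p t x \<bullet> p1 t x + p1 t x \<bullet> p t x - 2 * (g (h t x) * h1 t x)) + J1 t x * bulk t x"
  let ?s' = "\<lambda>t x. (h t x * h t x) * m1 t x + (h t x * h1 t x + h1 t x * h t x) * m t x"
  have f: "time_deriv a (closure \<Omega>) (\<lambda>t x. det (A t x) * bulk t x) ?f'"
    unfolding J1_def by (intro time_deriv_mult bulk_time time_C2_rate(1) det_A_time)
  have s: "time_deriv a (frontier \<Omega>) (\<lambda>t x. (h t x * h t x) * m t x) ?s'"
    by (intro time_deriv_mult h_frontier time_C2_rate(1) m_time)
  have D1: "((\<lambda>t. LINT x:\<Omega>|lborel. det (A t x) * bulk t x) has_real_derivative (LINT x:\<Omega>|lborel. ?f' t x)) (at t)"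
    by (rule DERIV_domain_integral[OF _ time_slice(1)[OF f] time_derivD(2)[OF f] t])
       (use time_derivD(3)[OF f] interior_closure in \<open>auto simp: has_real_derivative_iff_has_vector_derivative\<close>)
  have D2: "((\<lambda>t. surface_integral \<Omega> (\<lambda>x. (h t x * h t x) * m t x)) has_real_derivative surface_integral \<Omega> (?s' t)) (at t)"
    by (rule DERIV_surface_integral[OF _ time_slice(1)[OF s] time_derivD(2)[OF s] t])
       (use time_derivD(3)[OF s] in \<open>auto simp: has_real_derivative_iff_has_vector_derivative\<close>)
  have "((\<lambda>t. (LINT x:\<Omega>|lborel. det (A t x) * bulk t x) + \<alpha> * surface_integral \<Omega> (\<lambda>x. (h t x * h t x) * m t x))
      has_real_derivative (LINT x:\<Omega>|lborel. ?f' t x) + \<alpha> * surface_integral \<Omega> (?s' t)) (at t)"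
    by (intro DERIV_add D1 DERIV_cmult D2)
  moreover have "(LINT x:\<Omega>|lborel. ?f' t x) + \<alpha> * surface_integral \<Omega> (?s' t) = surface_integral \<Omega> (first_variation t)"
  proof -
    have c: "continuous_on (frontier \<Omega>) (\<lambda>x. bulk t x * (y1 t x \<bullet> n t x) + 2 * (h1 t x - y1 t x \<bullet> p t x) * (p t x \<bullet> n t x))"
      by (intro continuous_intros time_slice(1)[OF _ t])
         (rule time_deriv_subset[OF h1_time frontier_subset] time_deriv_subset[OF bulk_time frontier_subset] time_deriv_subset[OF y1_time frontier_subset]
            time_C2_rate(1)[OF n_time] p_frontier)+
    have "surface_integral \<Omega> (\<lambda>x. bulk t x * (y1 t x \<bullet> n t x) + 2 * (h1 t x - y1 t x \<bullet> p t x) * (p t x \<bullet> n t x)) +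
        \<alpha> * surface_integral \<Omega> (?s' t) =
      surface_integral \<Omega> (\<lambda>x. (bulk t x * (y1 t x \<bullet> n t x) + 2 * (h1 t x - y1 t x \<bullet> p t x) * (p t x \<bullet> n t x)) + \<alpha> * ?s' t x)"
      unfolding surface_integral_cmult[symmetric]
      by (rule surface_integral_add[symmetric, OF c]) (intro continuous_on_mult_left time_slice(2)[OF s t])
    also have "\<dots> = surface_integral \<Omega> (first_variation t)"
    proof (rule surface_integral_cong)
      fix x assume "x \<in> frontier \<Omega>"
      from boundary_condition[OF t this]
      show "(bulk t x * (y1 t x \<bullet> n t x) + 2 * (h1 t x - y1 t x \<bullet> p t x) * (p t x \<bullet> n t x)) + \<alpha> * ?s' t x = first_variation t x"
        unfolding first_variation_def by (simp add: algebra_simps)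
    qed
    finally show ?thesis unfolding interior_rate[OF t] .
  qed
  ultimately have "((\<lambda>t. (LINT x:\<Omega>|lborel. det (A t x) * bulk t x) + \<alpha> * surface_integral \<Omega> (\<lambda>x. (h t x * h t x) * m t x))
      has_real_derivative surface_integral \<Omega> (first_variation t)) (at t)" by simp
  then show ?thesis
    by (rule has_field_derivative_transform_within_open[of _ _ _ "{-a<..<a}"]) (use t in \<open>auto simp: abs_less_iff robin_energy_eq\<close>)
qed

definition second_variation where
  "second_variation t x =
     bulk t x * (y1 t x \<bullet> n1 t x + y2 t x \<bullet> n t x)
       + (p t x \<bullet> p1 t x + p1 t x \<bullet> p t x - 2 * (g (h t x) * h1 t x)) * (y1 t x \<bullet> n t x)
     - 2 * ((y1 t x \<bullet> p t x) * (p t x \<bullet> n1 t x + p1 t x \<bullet> n t x) + (y1 t x \<bullet> p1 t x + y2 t x \<bullet> p t x) * (p t x \<bullet> n t x))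
     + \<alpha> * ((h t x * h t x) * time_rate m1 t x + (h t x * h1 t x + h1 t x * h t x) * m1 t x)"

lemma first_variation_time: "time_deriv a (frontier \<Omega>) first_variation second_variation"
  unfolding first_variation_def[abs_def] second_variation_def[abs_def]
  by (intro time_deriv_add time_deriv_diff time_deriv_linear[OF bounded_linear_mult_right] time_deriv_mult time_deriv_inner
      time_deriv_subset[OF bulk_time frontier_subset] time_deriv_subset[OF y1_time frontier_subset] p_frontier h_frontier
      time_C2_rate(1)[OF n_time] time_C2_rate(2)[OF m_time])

theorem second_derivative_robin_energy:
  "has_second_derivative (\<lambda>t. robin_energy (y t ` \<Omega>) \<alpha> G (U t)) (surface_integral \<Omega> (second_variation 0)) 0"
  unfolding has_second_derivative_def
proof (intro exI[of _ "\<lambda>t. surface_integral \<Omega> (first_variation t)"] conjI)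
  have "\<forall>\<^sub>F s in nhds 0. s \<in> {-a<..<a}" by (rule eventually_nhds_in_open) (use a in auto)
  then show "\<forall>\<^sub>F s in nhds 0. ((\<lambda>t. robin_energy (y t ` \<Omega>) \<alpha> G (U t)) has_real_derivative surface_integral \<Omega> (first_variation s)) (at s)"
    by eventually_elim (rule DERIV_robin_energy, simp add: abs_less_iff)
  show "((\<lambda>t. surface_integral \<Omega> (first_variation t)) has_real_derivative surface_integral \<Omega> (second_variation 0)) (at 0)"
    by (rule DERIV_surface_integral[OF _ time_slice(1)[OF first_variation_time] time_derivD(2)[OF first_variation_time] zero_time])
       (use time_derivD(3)[OF first_variation_time] in \<open>auto simp: has_real_derivative_iff_has_vector_derivative\<close>)
qed

end

section \<open>The second variation of the energy\<close>

text \<open>The left side sums \<open>\<nu> $ i\<close> times the \<open>j\<close>-th minus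
  \<open>\<nu> $ j\<close> times the \<open>i\<close>-th derivative of
  \<open>v $ i * p $ j * \<phi>\<close>, with \<open>p\<close> in the role of the gradient,
  \<open>H\<close> of the Hessian, \<open>d\<phi>\<close> of the gradient of \<open>\<phi>\<close>
  and \<open>dv j\<close> of the \<open>j\<close>-th derivative of \<open>v\<close>.\<close>

lemma tangential_identity:
  fixes v p \<nu> d\<phi> :: "real^'n" and dv :: "'n \<Rightarrow> real^'n" and H :: "real^'n^'n"
  shows "(\<Sum>i\<in>UNIV. \<Sum>j\<in>UNIV. \<nu> $ i * (v $ i * p $ j * d\<phi> $ j + (v $ i * H $ j $ j + dv j $ i * p $ j) * \<phi>)
      - \<nu> $ j * (v $ i * p $ j * d\<phi> $ i + (v $ i * H $ i $ j + dv i $ i * p $ j) * \<phi>)) =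
    (v \<bullet> \<nu>) * (p \<bullet> d\<phi>) - (p \<bullet> \<nu>) * (v \<bullet> d\<phi>) +
    \<phi> * (p \<bullet> (\<chi> j. dv j \<bullet> \<nu>) + (v \<bullet> \<nu>) * (\<Sum>j\<in>UNIV. H $ j $ j) - (\<Sum>i\<in>UNIV. dv i $ i) * (p \<bullet> \<nu>) - v \<bullet> (H *v \<nu>))"
proof -
  have "(v \<bullet> \<nu>) * (p \<bullet> d\<phi>) = (\<Sum>i\<in>UNIV. \<Sum>j\<in>UNIV. v $ i * \<nu> $ i * (p $ j * d\<phi> $ j))"
    unfolding inner_vec_def inner_real_def by (rule sum_product)
  moreover have "(p \<bullet> \<nu>) * (v \<bullet> d\<phi>) = (\<Sum>i\<in>UNIV. \<Sum>j\<in>UNIV. p $ j * \<nu> $ j * (v $ i * d\<phi> $ i))"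
    unfolding inner_vec_def inner_real_def sum_product by (rule sum.swap)
  moreover have "p \<bullet> (\<chi> j. dv j \<bullet> \<nu>) = (\<Sum>i\<in>UNIV. \<Sum>j\<in>UNIV. p $ j * (dv j $ i * \<nu> $ i))"
    unfolding inner_vec_def inner_real_def vec_lambda_beta sum_distrib_left by (rule sum.swap)
  moreover have "(v \<bullet> \<nu>) * (\<Sum>j\<in>UNIV. H $ j $ j) = (\<Sum>i\<in>UNIV. \<Sum>j\<in>UNIV. v $ i * \<nu> $ i * H $ j $ j)"
    unfolding inner_vec_def inner_real_def by (rule sum_product)
  moreover have "(\<Sum>i\<in>UNIV. dv i $ i) * (p \<bullet> \<nu>) = (\<Sum>i\<in>UNIV. \<Sum>j\<in>UNIV. dv i $ i * (p $ j * \<nu> $ j))"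
    unfolding inner_vec_def inner_real_def by (rule sum_product)
  moreover have "v \<bullet> (H *v \<nu>) = (\<Sum>i\<in>UNIV. \<Sum>j\<in>UNIV. v $ i * (H $ i $ j * \<nu> $ j))"
    by (simp add: inner_vec_def matrix_vector_mult_def sum_distrib_left)
  ultimately show ?thesis
    by (simp only: sum_distrib_left sum_subtractf[symmetric] sum.distrib[symmetric])
       (intro sum.cong refl, simp add: algebra_simps)
qed

text \<open>Algebra in the boundary values, with a letter for each inner product: \<open>un\<close>
  is the normal derivative of \<open>u\<close>, \<open>vn\<close> is
  \<open>v \<bullet> \<nu>\<close>, \<open>z\<close> is the derivative of \<open>u\<close> along
  \<open>v\<close>, the prefixes \<open>H\<close> and \<open>D\<close> mark terms with the Hessian
  and with \<open>dform\<close>, \<open>d\<close> is the divergence of \<open>v\<close>, and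
  \<open>b\<close> is the Robin expression of \<open>u'\<close>. The last two summands are the
  tangential expressions of \<open>u'\<close>, with weight 2, and of \<open>z\<close>, with weight
  4; both integrate to 0.\<close>

lemma variation_identity:
  fixes vn :: real
  assumes "un = - (\<alpha> * u)" and "b = - Hnv + Dun - un * Dnn - \<alpha> * z" and "du = b - \<alpha> * u'" and "m1 = d - Dnn"
    and "\<tau> = Dun - gu * vn - d * un - Hnv"
  shows "\<phi> * (d * vn - Dvn + wn) + (2 * (uu + Hvu) - 2 * (gu * (u' + z))) * vn
      - 2 * (z * (d * un - Dun + (du + Hnv)) + (vu + Hvv + wu) * un) + \<alpha> * (u * u * m2 + 2 * (u * (u' + z)) * m1) =
    ((vn * d - Dvn + wn) * \<phi> + 4 * (un * Dvu - vn * Duu) + 2 * (un * Hvv - vn * Hvu) + 2 * (gu * vn * z) - 4 * (z * b)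
      - 2 * \<alpha> * z\<^sup>2 - 2 * (wu * un) + \<alpha> * (u\<^sup>2 * m2) - 2 * (u' * b)) +
    2 * (vn * uu - un * vu + u' * \<tau>) + 4 * (vn * (Hvu + Duu) - un * (Hvv + Dvu) + z * \<tau>)"
  unfolding assms by (simp add: algebra_simps power2_eq_square)

lemma dform_eq: "dform \<Omega> v x a b = a \<bullet> (\<chi> i. partial \<Omega> i v x \<bullet> b)"
  by (simp add: dform_def inner_vec_def sum_distrib_left mult.assoc)

lemma (in regular_domain) surface_integral_sum:
  assumes "finite I" "\<And>i. i \<in> I \<Longrightarrow> continuous_on (frontier \<Omega>) (f i)"
  shows "surface_integral \<Omega> (\<lambda>x. \<Sum>i\<in>I. f i x) = (\<Sum>i\<in>I. surface_integral \<Omega> (f i))"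
  using assms
proof (induction I rule: finite_induct)
  case empty
  show ?case using surface_integral_cmult[of 0 "\<lambda>_. 0"] by simp
next
  case (insert i I)
  have "surface_integral \<Omega> (\<lambda>x. f i x + (\<Sum>i\<in>I. f i x)) = surface_integral \<Omega> (f i) + surface_integral \<Omega> (\<lambda>x. \<Sum>i\<in>I. f i x)"
    by (intro surface_integral_add continuous_on_sum) (use insert in auto)
  then show ?case using insert by simp
qed

text \<open>The shape derivative enters through \<open>h1_0\<close>, which splits the Lagrangian
  rate of the solution into \<open>u'\<close> and the convective term.\<close>

locale robin_variation = robin_flow \<Omega> a \<alpha> G g g' y y1 y2 U h h1 h2
  for \<Omega> :: "(real^'n) set" and a \<alpha> :: real and G g g' :: "real \<Rightarrow> real" and y y1 y2 :: "real \<Rightarrow> real^'n \<Rightarrow> real^'n"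
    and U h h1 h2 :: "real \<Rightarrow> real^'n \<Rightarrow> real" +
  fixes v w :: "real^'n \<Rightarrow> real^'n" and u u' :: "real^'n \<Rightarrow> real"
  assumes v_C2: "C2_closure \<Omega> v" and w_C2: "C2_closure \<Omega> w" and u: "robin_solution \<Omega> \<alpha> g u"
    and y1_0: "\<And>x. x \<in> closure \<Omega> \<Longrightarrow> y1 0 x = v x" and y2_0: "\<And>x. x \<in> closure \<Omega> \<Longrightarrow> y2 0 x = w x"
    and U_0: "\<And>x. x \<in> closure \<Omega> \<Longrightarrow> U 0 x = u x"
    and h1_0: "\<And>x. x \<in> closure \<Omega> \<Longrightarrow> h1 0 x = u' x + v x \<bullet> grad \<Omega> u x"
    and continuous_g': "continuous_on UNIV g'"
    and u'_eq: "weak_solution \<Omega> (\<lambda>x. g' (u x)) u'"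
    and u'_bc: "\<And>x. x \<in> frontier \<Omega> \<Longrightarrow> normal_deriv \<Omega> u' x + \<alpha> * u' x =
         - normal_deriv \<Omega> (\<lambda>z. v z \<bullet> grad \<Omega> u z) x
         + dform \<Omega> v x (tangential_grad \<Omega> u x) (outer_normal \<Omega> x) + dform \<Omega> v x (outer_normal \<Omega> x) (grad \<Omega> u x)
         - \<alpha> * (v x \<bullet> grad \<Omega> u x)"
begin

section \<open>Values at time 0\<close>

abbreviation \<nu> where "\<nu> \<equiv> outer_normal \<Omega>"

definition z where "z x = v x \<bullet> grad \<Omega> u x"

definition Z where "Z i x = v x \<bullet> (\<chi> k. partial \<Omega> i (partial \<Omega> k u) x) + partial \<Omega> i v x \<bullet> grad \<Omega> u x"

lemma u_C2: "C2_closure \<Omega> u"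
  using u unfolding robin_solution_def by blast

lemma grad_u_partials: "has_partials \<Omega> (grad \<Omega> u) (\<lambda>i x. \<chi> k. partial \<Omega> i (partial \<Omega> k u) x)"
  unfolding grad_def[abs_def] by (rule has_partials_vec[OF C2_closureD(6)[OF u_C2]])

lemma z_partials: "has_partials \<Omega> z Z"
  unfolding z_def[abs_def] Z_def[abs_def] by (rule has_partials_inner[OF C2_closureD(5)[OF v_C2] grad_u_partials])

text \<open>\<open>u'\<close> is the difference of the C^2 function \<open>h1 0\<close> and of
  \<open>z\<close>, which is C^1 because \<open>u\<close> is C^2.\<close>

lemma u'_partials: "has_partials \<Omega> u' (\<lambda>i x. partial \<Omega> i (h1 0) x - Z i x)"
  by (rule has_partials_cong[OF has_partials_diff[OF C2_closureD(5)[OF h1_C2[OF zero_time]] z_partials] open_domain])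
     (simp_all add: h1_0 z_def)

lemma u'_C1: "C1_closure \<Omega> u'"
  by (rule has_partials_C1_closure[OF u'_partials open_domain])

lemma hess_symmetric:
  assumes "x \<in> closure \<Omega>"
  shows "c \<bullet> (hess \<Omega> u x *v d) = d \<bullet> (hess \<Omega> u x *v c)"
proof -
  have "transpose (hess \<Omega> u x) = hess \<Omega> u x"
    using mixed_partials_eq[OF C2_closureD(5,6)[OF u_C2] open_domain assms]
    by (simp add: vec_eq_iff transpose_def hess_def)
  then show ?thesis using inner_transpose[of "hess \<Omega> u x" c d] by (simp add: inner_commute)
qed

lemma grad_z: "x \<in> closure \<Omega> \<Longrightarrow> grad \<Omega> z x = hess \<Omega> u x *v v x + (\<chi> i. partial \<Omega> i v x \<bullet> grad \<Omega> u x)"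
  unfolding grad_eq[OF z_partials open_domain]
  by (simp add: vec_eq_iff Z_def matrix_vector_mult_def hess_def inner_vec_def mult.commute)

lemma p_0: "x \<in> closure \<Omega> \<Longrightarrow> p 0 x = grad \<Omega> u x"
proof -
  have "y 0 ` \<Omega> = \<Omega>" using y_0 interior_closure by force
  moreover have "partial \<Omega> i (U 0) x = partial \<Omega> i u x" for i x
    by (rule partial_cong[OF open_domain]) (simp add: U_0 interior_closure)
  moreover assume "x \<in> closure \<Omega>"
  ultimately show ?thesis by (simp add: p_def y_0 grad_def)
qed

lemma n_0: "x \<in> frontier \<Omega> \<Longrightarrow> n 0 x = \<nu> x"
  using transpose_n[OF zero_time frontier_closure] by (simp add: A_0 frontier_closure transpose_mat del: transpose_matrix_vector)

lemma partial_y1_0: "partial \<Omega> i (y1 0) x = partial \<Omega> i v x"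
  by (rule partial_cong[OF open_domain]) (simp add: y1_0 interior_closure)

lemma h_0: "x \<in> closure \<Omega> \<Longrightarrow> h 0 x = u x"
  by (simp add: h_eq y_0 U_0)

lemma p1_0: "x \<in> closure \<Omega> \<Longrightarrow> p1 0 x = grad \<Omega> u' x + hess \<Omega> u x *v v x"
proof -
  assume x: "x \<in> closure \<Omega>"
  have "p1 0 x = grad \<Omega> (h1 0) x - (\<chi> i. partial \<Omega> i v x \<bullet> grad \<Omega> u x)"
    using transpose_p1[OF zero_time x] by (simp add: A_0[OF x] transpose_mat partial_y1_0 p_0[OF x] del: transpose_matrix_vector)
  moreover have "grad \<Omega> (h1 0) x = grad \<Omega> u' x + grad \<Omega> z x"
    unfolding grad_eq[OF u'_partials open_domain x] grad_eq[OF z_partials open_domain x] by (simp add: vec_eq_iff grad_def)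
  ultimately show ?thesis by (simp add: grad_z[OF x])
qed

lemma J1_0: "x \<in> closure \<Omega> \<Longrightarrow> J1 0 x = divergence \<Omega> v x"
  using J1_eq[OF zero_time, of x "\<chi> i j. partial \<Omega> j (y1 0) x $ i"] by (simp add: A_0 divergence_def partial_y1_0)

text \<open>Differentiates \<open>A\<^sup>T n = J \<nu>\<close> at time 0, where \<open>A\<close> is
  the identity and the rate of \<open>J\<close> is the divergence of \<open>v\<close>.\<close>

lemma n1_0:
  assumes x: "x \<in> frontier \<Omega>"
  shows "n1 0 x = divergence \<Omega> v x *\<^sub>R \<nu> x - (\<chi> i. partial \<Omega> i v x \<bullet> \<nu> x)"
proof -
  note xc = frontier_closure[OF x]
  have "partial \<Omega> i (y 0) x \<bullet> n1 0 x + partial \<Omega> i (y1 0) x \<bullet> n 0 x = J1 0 x * \<nu> x $ i" for i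
  proof -
    have "time_deriv a (frontier \<Omega>) (\<lambda>t x. partial \<Omega> i (y t) x \<bullet> n t x) (\<lambda>t x. partial \<Omega> i (y t) x \<bullet> n1 t x + partial \<Omega> i (y1 t) x \<bullet> n t x)"
      by (intro time_deriv_inner time_deriv_subset[OF Dy_time frontier_subset] time_C2_rate(1) n_time)
    then have *: "time_deriv a (frontier \<Omega>) (\<lambda>t x. det (A t x) * \<nu> x $ i) (\<lambda>t x. partial \<Omega> i (y t) x \<bullet> n1 t x + partial \<Omega> i (y1 t) x \<bullet> n t x)"
    proof (rule time_deriv_cong)
      fix t x assume t: "\<bar>t\<bar> < a" and x: "x \<in> frontier \<Omega>"
      have "(transpose (A t x) *v n t x) $ i = (det (A t x) *\<^sub>R \<nu> x) $ i" unfolding transpose_n[OF t frontier_closure[OF x]] ..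
      then show "partial \<Omega> i (y t) x \<bullet> n t x = det (A t x) * \<nu> x $ i"
        by (simp add: matrix_vector_mult_def transpose_def A_def inner_vec_def del: transpose_matrix_vector)
    qed simp
    have "((\<lambda>s. det (A s x) * \<nu> x $ i) has_vector_derivative J1 0 x * \<nu> x $ i) (at 0)"
      using time_derivD(3)[OF time_C2_rate(1)[OF det_A_time] zero_time xc]
      unfolding J1_def has_real_derivative_iff_has_vector_derivative[symmetric] by (rule DERIV_cmult_right)
    from time_deriv_unique[OF * zero_time x this] show ?thesis .
  qed
  moreover have "partial \<Omega> i (y 0) x \<bullet> b = b $ i" for i b
  proof -
    have "has_partials \<Omega> (y 0) (\<lambda>i x. axis i 1)"
      by (rule has_partials_cong[OF has_partials_id open_domain]) (simp_all add: y_0)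
    then show ?thesis by (simp add: partial_eq[OF _ open_domain xc] inner_axis')
  qed
  ultimately show ?thesis
    by (simp add: vec_eq_iff partial_y1_0 n_0[OF x] J1_0[OF xc]) (metis add_diff_cancel_right')
qed

lemma m_0: "x \<in> frontier \<Omega> \<Longrightarrow> m 0 x = 1"
  by (simp add: m_def n_0 norm_outer_normal)

text \<open>Differentiates the square of \<open>m\<close>, which is
  \<open>n t x \<bullet> n t x\<close>, at a point where \<open>m\<close> is 1.\<close>

lemma m1_0:
  assumes x: "x \<in> frontier \<Omega>"
  shows "m1 0 x = divergence \<Omega> v x - dform \<Omega> v x (\<nu> x) (\<nu> x)"
proof -
  have *: "time_deriv a (frontier \<Omega>) (\<lambda>t x. n t x \<bullet> n t x) (\<lambda>t x. m t x * m1 t x + m1 t x * m t x)"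
    by (rule time_deriv_cong[OF time_deriv_mult[OF time_C2_rate(1)[OF m_time] time_C2_rate(1)[OF m_time]]])
       (simp_all add: m_def dot_square_norm power2_eq_square)
  have **: "time_deriv a (frontier \<Omega>) (\<lambda>t x. n t x \<bullet> n t x) (\<lambda>t x. n t x \<bullet> n1 t x + n1 t x \<bullet> n t x)"
    by (intro time_deriv_inner time_C2_rate(1) n_time)
  have "m 0 x * m1 0 x + m1 0 x * m 0 x = n 0 x \<bullet> n1 0 x + n1 0 x \<bullet> n 0 x"
    by (rule time_deriv_unique[OF * zero_time x time_derivD(3)[OF ** zero_time x]])
  then have "m1 0 x = \<nu> x \<bullet> n1 0 x" by (simp add: m_0[OF x] n_0[OF x] inner_commute)
  then show ?thesis using norm_outer_normal[OF x] by (simp add: n1_0[OF x] inner_diff_right dform_eq dot_square_norm)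
qed

text \<open>The iterated \<open>deriv\<close> requires the first derivative on a whole neighbourhood
  of 0, where the tangential Jacobian equals \<open>m\<close>.\<close>

lemma m2_0:
  assumes x: "x \<in> frontier \<Omega>"
  shows "(deriv ^^ 2) (\<lambda>t. tangential_jacobian \<Omega> (y t) x) 0 = time_rate m1 0 x"
proof -
  have o: "open {-a<..<a}" and zero: "0 \<in> {-a<..<a}" using a by auto
  have d: "deriv (\<lambda>t. tangential_jacobian \<Omega> (y t) x) t = m1 t x" if "t \<in> {-a<..<a}" for t
  proof (rule DERIV_imp_deriv, rule has_field_derivative_transform_within_open[OF _ o that])
    show "((\<lambda>t. m t x) has_real_derivative m1 t x) (at t)"
      using time_derivD(3)[OF time_C2_rate(1)[OF m_time] _ x] that
      by (simp add: has_real_derivative_iff_has_vector_derivative abs_less_iff)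
  qed (use x in \<open>simp add: tangential_jacobian_eq abs_less_iff\<close>)
  have "deriv (deriv (\<lambda>t. tangential_jacobian \<Omega> (y t) x)) 0 = time_rate m1 0 x"
  proof (rule DERIV_imp_deriv, rule has_field_derivative_transform_within_open[OF _ o zero])
    show "((\<lambda>t. m1 t x) has_real_derivative time_rate m1 0 x) (at 0)"
      using time_derivD(3)[OF time_C2_rate(2)[OF m_time] zero_time x]
      by (simp add: has_real_derivative_iff_has_vector_derivative)
  qed (use d in simp)
  then show ?thesis by (simp add: numeral_2_eq_2)
qed

text \<open>The coefficient of \<open>\<phi>\<close> in \<open>tangential_identity\<close>, after
  the trace of the Hessian has been replaced by \<open>- g (u x)\<close>.\<close>

definition \<tau> where
  "\<tau> x = dform \<Omega> v x (grad \<Omega> u x) (\<nu> x) - g (u x) * (v x \<bullet> \<nu> x) - divergence \<Omega> v x * (grad \<Omega> u x \<bullet> \<nu> x)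
     - \<nu> x \<bullet> (hess \<Omega> u x *v v x)"

lemma laplace_closure: "x \<in> closure \<Omega> \<Longrightarrow> laplace \<Omega> u x = - g (u x)"
proof (rule closure_eqI[of \<Omega> "laplace \<Omega> u" "\<lambda>x. - g (u x)"])
  show "continuous_on (closure \<Omega>) (laplace \<Omega> u)"
    unfolding laplace_def[abs_def] by (intro continuous_on_sum has_partialsD(3)[OF C2_closureD(6)[OF u_C2]])
  show "continuous_on (closure \<Omega>) (\<lambda>x. - g (u x))"
    by (intro continuous_on_minus continuous_on_compose2[OF continuous_g C2_closureD(3)[OF u_C2] subset_UNIV])
  show "laplace \<Omega> u x = - g (u x)" if "x \<in> \<Omega>" for x
    using u that unfolding robin_solution_def by (force simp: eq_neg_iff_add_eq_0)
qed

lemma continuous_frontier: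
  "continuous_on (frontier \<Omega>) \<nu>" "continuous_on (frontier \<Omega>) v" "continuous_on (frontier \<Omega>) w"
  "continuous_on (frontier \<Omega>) u" "continuous_on (frontier \<Omega>) (grad \<Omega> u)"
  "continuous_on (frontier \<Omega>) u'" "continuous_on (frontier \<Omega>) (grad \<Omega> u')"
  "continuous_on (frontier \<Omega>) (partial \<Omega> i v)" "continuous_on (frontier \<Omega>) (\<lambda>x. hess \<Omega> u x $ i $ j)"
  "continuous_on (frontier \<Omega>) (\<lambda>x. g (u x))" "continuous_on (frontier \<Omega>) (\<lambda>x. G (u x))"
  by (rule continuous_on_outer_normal)
     (rule continuous_on_subset[OF _ frontier_subset],
      simp add: C2_closureD[OF v_C2] C2_closureD[OF w_C2] C2_closureD[OF u_C2] continuous_on_grad u'_C1 has_partialsD[OF u'_partials]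
        hess_def has_partialsD(3)[OF C2_closureD(6)[OF u_C2]]
        continuous_on_compose2[OF continuous_g C2_closureD(3)[OF u_C2] subset_UNIV]
        continuous_on_compose2[OF continuous_G C2_closureD(3)[OF u_C2] subset_UNIV])+

lemma continuous_dform:
  assumes "continuous_on (frontier \<Omega>) b" "continuous_on (frontier \<Omega>) c"
  shows "continuous_on (frontier \<Omega>) (\<lambda>x. dform \<Omega> v x (b x) (c x))"
  unfolding dform_eq by (intro continuous_on_inner continuous_on_vec_lambda continuous_frontier assms)

lemma continuous_hess:
  assumes "continuous_on (frontier \<Omega>) b"
  shows "continuous_on (frontier \<Omega>) (\<lambda>x. hess \<Omega> u x *v b x)"
  by (intro continuous_on_matrix_vector continuous_frontier assms)

lemma continuous_divergence: "continuous_on (frontier \<Omega>) (divergence \<Omega> v)"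
  unfolding divergence_def[abs_def] by (intro continuous_on_sum continuous_on_component continuous_frontier)

lemmas continuous_boundary = continuous_frontier continuous_dform continuous_hess continuous_divergence

text \<open>For each pair of indices the C^1 function
  \<open>v x $ i * partial \<Omega> j u x * \<phi> x\<close> yields a continuous field of weak
  divergence 0 by \<open>weak_partials_commute\<close>, whose flux vanishes. It is applied to
  \<open>u'\<close> and to \<open>z\<close>, where only first derivatives are available.\<close>

lemma surface_integral_tangential:
  assumes \<phi>: "has_partials \<Omega> \<phi> E"
  shows "surface_integral \<Omega> (\<lambda>x. (v x \<bullet> \<nu> x) * (grad \<Omega> u x \<bullet> (\<chi> i. E i x)) - (grad \<Omega> u x \<bullet> \<nu> x) * (v x \<bullet> (\<chi> i. E i x)) + \<phi> x * \<tau> x) = 0"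
proof -
  define D where "D i j k x = v x $ i * partial \<Omega> j u x * E k x +
    (v x $ i * partial \<Omega> k (partial \<Omega> j u) x + partial \<Omega> k v x $ i * partial \<Omega> j u x) * \<phi> x" for i j k x
  have D: "has_partials \<Omega> (\<lambda>x. v x $ i * partial \<Omega> j u x * \<phi> x) (D i j)" for i j
    unfolding D_def[abs_def]
    by (rule has_partials_mult[OF has_partials_mult[OF has_partials_component[OF C2_closureD(5)[OF v_C2]] C2_closureD(6)[OF u_C2]] \<phi>])
  have cD: "continuous_on (frontier \<Omega>) (D i j k)" for i j k
    by (rule continuous_on_subset[OF has_partialsD(3)[OF D] frontier_subset])
  have c\<nu>i: "continuous_on (frontier \<Omega>) (\<lambda>x. \<nu> x $ i)" for i by (intro continuous_on_component continuous_frontier)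
  have zero: "surface_integral \<Omega> (\<lambda>x. \<nu> x $ i * D i j j x - \<nu> x $ j * D i j i x) = 0" for i j
  proof -
    have "continuous_on (closure \<Omega>) (\<lambda>x. D i j j x *\<^sub>R axis i 1 - D i j i x *\<^sub>R (axis j 1 :: real^'n))"
      by (intro continuous_intros has_partialsD(3)[OF D])
    from divergence_theorem[OF this continuous_on_const weak_partials_commute[OF open_domain bounded_domain D]]
    show ?thesis by (simp add: inner_diff_left inner_axis' mult.commute)
  qed
  have "surface_integral \<Omega> (\<lambda>x. \<Sum>i\<in>UNIV. \<Sum>j\<in>UNIV. \<nu> x $ i * D i j j x - \<nu> x $ j * D i j i x) =
      (\<Sum>i\<in>UNIV. surface_integral \<Omega> (\<lambda>x. \<Sum>j\<in>UNIV. \<nu> x $ i * D i j j x - \<nu> x $ j * D i j i x))"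
    by (rule surface_integral_sum) (auto intro!: continuous_intros cD c\<nu>i)
  also have "\<dots> = (\<Sum>i\<in>UNIV. \<Sum>j\<in>UNIV. surface_integral \<Omega> (\<lambda>x. \<nu> x $ i * D i j j x - \<nu> x $ j * D i j i x))"
    by (intro sum.cong refl surface_integral_sum) (auto intro!: continuous_intros cD c\<nu>i)
  also have "\<dots> = 0" by (simp add: zero)
  finally have I: "surface_integral \<Omega> (\<lambda>x. \<Sum>i\<in>UNIV. \<Sum>j\<in>UNIV. \<nu> x $ i * D i j j x - \<nu> x $ j * D i j i x) = 0" .
  have "(\<Sum>i\<in>UNIV. \<Sum>j\<in>UNIV. \<nu> x $ i * D i j j x - \<nu> x $ j * D i j i x) =
      (v x \<bullet> \<nu> x) * (grad \<Omega> u x \<bullet> (\<chi> i. E i x)) - (grad \<Omega> u x \<bullet> \<nu> x) * (v x \<bullet> (\<chi> i. E i x)) + \<phi> x * \<tau> x" if x: "x \<in> frontier \<Omega>" for x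
  proof -
    note xc = frontier_closure[OF x]
    have lap: "(\<Sum>j\<in>UNIV. hess \<Omega> u x $ j $ j) = - g (u x)"
      using laplace_closure[OF xc] by (simp add: laplace_def hess_def)
    have d: "D i j k x = v x $ i * grad \<Omega> u x $ j * (\<chi> i. E i x) $ k +
        (v x $ i * hess \<Omega> u x $ k $ j + partial \<Omega> k v x $ i * grad \<Omega> u x $ j) * \<phi> x" for i j k
      by (simp add: D_def grad_def hess_def)
    show ?thesis
      unfolding d tangential_identity lap \<tau>_def dform_eq divergence_def hess_symmetric[OF xc, of "\<nu> x" "v x"]
      by (simp only: mult_minus_right mult.commute[of "v x \<bullet> \<nu> x" "g (u x)"] add_uminus_conv_diff)
  qed
  from trans[OF surface_integral_cong[OF this[symmetric]] I] show ?thesis .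
qed

text \<open>The weak equation says that the gradient of \<open>u'\<close> has weak divergence
  \<open>- (g' (u x) * u' x)\<close>. Multiplying by the C^1 function \<open>u'\<close> and applying
  the divergence theorem gives the Green identity.\<close>

lemma Q_form_eq: "Q_form \<Omega> \<alpha> (\<lambda>x. g' (u x)) u' = surface_integral \<Omega> (\<lambda>x. u' x * (normal_deriv \<Omega> u' x + \<alpha> * u' x))"
proof -
  let ?c = "\<lambda>x. g' (u x)"
  have cc: "continuous_on (closure \<Omega>) ?c"
    by (rule continuous_on_compose2[OF continuous_g' C2_closureD(3)[OF u_C2] subset_UNIV])
  note P = has_partials_partial[OF u'_C1]
  have cu: "continuous_on (closure \<Omega>) u'" and cg: "continuous_on (closure \<Omega>) (grad \<Omega> u')"
    using has_partialsD(2)[OF u'_partials] continuous_on_grad[OF u'_C1] by auto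
  have c1: "continuous_on (closure \<Omega>) (\<lambda>x. (norm (grad \<Omega> u' x))\<^sup>2)" and c2: "continuous_on (closure \<Omega>) (\<lambda>x. ?c x * (u' x)\<^sup>2)"
    by (intro continuous_intros cg cc cu)+
  have "has_weak_div \<Omega> (grad \<Omega> u') (\<lambda>x. - (?c x * u' x))"
    using u'_eq unfolding weak_solution_def has_weak_div_def test_function_def by simp
  from has_weak_div_scaleR[OF open_domain this has_partialsD(1)[OF P] continuous_on_subset[OF has_partialsD(3)[OF P] closure_subset]]
  have "has_weak_div \<Omega> (\<lambda>x. u' x *\<^sub>R grad \<Omega> u' x) (\<lambda>x. u' x * - (?c x * u' x) + grad \<Omega> u' x \<bullet> (\<chi> i. partial \<Omega> i u' x))" .
  then have "has_weak_div \<Omega> (\<lambda>x. u' x *\<^sub>R grad \<Omega> u' x) (\<lambda>x. (norm (grad \<Omega> u' x))\<^sup>2 - ?c x * (u' x)\<^sup>2)"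
    by (rule has_weak_div_cong[OF _ open_domain refl])
       (simp add: grad_def[symmetric] dot_square_norm power2_eq_square)
  from divergence_theorem[OF continuous_on_scaleR[OF cu cg] continuous_on_diff[OF c1 c2] this]
  have "(LINT x:\<Omega>|lborel. (norm (grad \<Omega> u' x))\<^sup>2 - ?c x * (u' x)\<^sup>2) = surface_integral \<Omega> (\<lambda>x. u' x *\<^sub>R grad \<Omega> u' x \<bullet> \<nu> x)" .
  moreover have "(LINT x:\<Omega>|lborel. (norm (grad \<Omega> u' x))\<^sup>2 - ?c x * (u' x)\<^sup>2) =
      (LINT x:\<Omega>|lborel. (norm (grad \<Omega> u' x))\<^sup>2) - (LINT x:\<Omega>|lborel. ?c x * (u' x)\<^sup>2)"
    by (intro set_integral_diff set_integrable_continuous bounded_domain open_domain c1 c2)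
  moreover have "surface_integral \<Omega> (\<lambda>x. u' x *\<^sub>R grad \<Omega> u' x \<bullet> \<nu> x) + \<alpha> * surface_integral \<Omega> (\<lambda>x. (u' x)\<^sup>2) =
      surface_integral \<Omega> (\<lambda>x. (u' x *\<^sub>R grad \<Omega> u' x \<bullet> \<nu> x) + \<alpha> * (u' x)\<^sup>2)"
    unfolding surface_integral_cmult[symmetric]
    by (intro surface_integral_add[symmetric] continuous_intros continuous_frontier)
  moreover have "(u' x *\<^sub>R grad \<Omega> u' x \<bullet> \<nu> x) + \<alpha> * (u' x)\<^sup>2 = u' x * (normal_deriv \<Omega> u' x + \<alpha> * u' x)" for x
    by (simp add: normal_deriv_def inner_commute power2_eq_square algebra_simps)
  ultimately show ?thesis unfolding Q_form_def by simp
qed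

text \<open>All time derivatives at 0 are inserted; \<open>variation_identity\<close> then separates
  the integrand of the claim from the tangential expressions of \<open>u'\<close> and
  \<open>z\<close>.\<close>

lemma second_variation_0:
  assumes x: "x \<in> frontier \<Omega>"
  defines "b \<equiv> normal_deriv \<Omega> u' x + \<alpha> * u' x"
  shows "second_variation 0 x =
    (((v x \<bullet> \<nu> x) * divergence \<Omega> v x - dform \<Omega> v x (v x) (\<nu> x) + w x \<bullet> \<nu> x) * ((norm (grad \<Omega> u x))\<^sup>2 - 2 * G (u x))
     + 4 * (normal_deriv \<Omega> u x * dform \<Omega> v x (v x) (grad \<Omega> u x) - (v x \<bullet> \<nu> x) * dform \<Omega> v x (grad \<Omega> u x) (grad \<Omega> u x))
     + 2 * (normal_deriv \<Omega> u x * (v x \<bullet> (hess \<Omega> u x *v v x)) - (v x \<bullet> \<nu> x) * (v x \<bullet> (hess \<Omega> u x *v grad \<Omega> u x)))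
     + 2 * (g (u x) * (v x \<bullet> \<nu> x) * (v x \<bullet> grad \<Omega> u x))
     - 4 * ((v x \<bullet> grad \<Omega> u x) * b) - 2 * \<alpha> * (v x \<bullet> grad \<Omega> u x)\<^sup>2 - 2 * ((w x \<bullet> grad \<Omega> u x) * normal_deriv \<Omega> u x)
     + \<alpha> * ((u x)\<^sup>2 * time_rate m1 0 x) - 2 * (u' x * b))
    + 2 * ((v x \<bullet> \<nu> x) * (grad \<Omega> u x \<bullet> grad \<Omega> u' x) - (grad \<Omega> u x \<bullet> \<nu> x) * (v x \<bullet> grad \<Omega> u' x) + u' x * \<tau> x)
    + 4 * ((v x \<bullet> \<nu> x) * (grad \<Omega> u x \<bullet> grad \<Omega> z x) - (grad \<Omega> u x \<bullet> \<nu> x) * (v x \<bullet> grad \<Omega> z x) + z x * \<tau> x)"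
proof -
  note xc = frontier_closure[OF x]
  let ?Hnv = "\<nu> x \<bullet> (hess \<Omega> u x *v v x)" and ?un = "normal_deriv \<Omega> u x"
  have un: "?un = grad \<Omega> u x \<bullet> \<nu> x" by (simp add: normal_deriv_def inner_commute)
  have 1: "?un = - (\<alpha> * u x)"
    using u x unfolding robin_solution_def by (force simp: eq_neg_iff_add_eq_0)
  \<comment> \<open>The normal derivative of \<open>z\<close> consists of the Hessian term and a
    term with \<open>dform\<close> that cancels against the one in the boundary condition; the
    tangential gradient splits off the term with the normal derivative of \<open>u\<close>.\<close>
  have 2: "b = - ?Hnv + dform \<Omega> v x (grad \<Omega> u x) (\<nu> x) - ?un * dform \<Omega> v x (\<nu> x) (\<nu> x) - \<alpha> * (v x \<bullet> grad \<Omega> u x)"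
    using u'_bc[OF x] grad_z[OF xc]
    by (simp add: b_def normal_deriv_def[of _ "\<lambda>z. _ z \<bullet> _ z"] z_def[abs_def] inner_add_right dform_eq tangential_grad_def
        inner_diff_left)
  have 3: "grad \<Omega> u' x \<bullet> \<nu> x = b - \<alpha> * u' x" by (simp add: b_def normal_deriv_def inner_commute)
  have 4: "m1 0 x = divergence \<Omega> v x - dform \<Omega> v x (\<nu> x) (\<nu> x)" by (rule m1_0[OF x])
  have 5: "\<tau> x = dform \<Omega> v x (grad \<Omega> u x) (\<nu> x) - g (u x) * (v x \<bullet> \<nu> x) - divergence \<Omega> v x * ?un - ?Hnv"
    by (simp add: \<tau>_def un)
  have gz: "c \<bullet> grad \<Omega> z x = c \<bullet> (hess \<Omega> u x *v v x) + dform \<Omega> v x c (grad \<Omega> u x)" for c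
    by (simp add: grad_z[OF xc] inner_add_right dform_eq)
  have pn1: "c \<bullet> n1 0 x = divergence \<Omega> v x * (c \<bullet> \<nu> x) - dform \<Omega> v x c (\<nu> x)" for c
    by (simp add: n1_0[OF x] inner_diff_right dform_eq)
  have p1: "c \<bullet> p1 0 x = c \<bullet> grad \<Omega> u' x + c \<bullet> (hess \<Omega> u x *v v x)" for c
    by (simp add: p1_0[OF xc] inner_add_right)
  have Hu: "grad \<Omega> u x \<bullet> (hess \<Omega> u x *v v x) = v x \<bullet> (hess \<Omega> u x *v grad \<Omega> u x)" by (rule hess_symmetric[OF xc])
  have "second_variation 0 x =
      ((norm (grad \<Omega> u x))\<^sup>2 - 2 * G (u x)) * (divergence \<Omega> v x * (v x \<bullet> \<nu> x) - dform \<Omega> v x (v x) (\<nu> x) + w x \<bullet> \<nu> x)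
      + (2 * (grad \<Omega> u x \<bullet> grad \<Omega> u' x + v x \<bullet> (hess \<Omega> u x *v grad \<Omega> u x)) - 2 * (g (u x) * (u' x + v x \<bullet> grad \<Omega> u x))) * (v x \<bullet> \<nu> x)
      - 2 * ((v x \<bullet> grad \<Omega> u x) * (divergence \<Omega> v x * ?un - dform \<Omega> v x (grad \<Omega> u x) (\<nu> x) + (grad \<Omega> u' x \<bullet> \<nu> x + ?Hnv))
        + (v x \<bullet> grad \<Omega> u' x + v x \<bullet> (hess \<Omega> u x *v v x) + w x \<bullet> grad \<Omega> u x) * ?un)
      + \<alpha> * (u x * u x * time_rate m1 0 x + 2 * (u x * (u' x + v x \<bullet> grad \<Omega> u x)) * m1 0 x)"
    unfolding second_variation_def bulk_def
    by (simp only: p_0[OF xc] n_0[OF x] y1_0[OF xc] y2_0[OF xc] h_0[OF xc] h1_0[OF xc] inner_commute[of "p1 0 x"] p1 pn1 Hu un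
        dot_square_norm inner_commute[of "\<nu> x" "grad \<Omega> u' x"]) (simp add: algebra_simps)
  also note variation_identity[OF 1 2 3 4 5]
  finally show ?thesis unfolding gz Hu un[symmetric] z_def by simp
qed

theorem surface_integral_second_variation:
  "surface_integral \<Omega> (second_variation 0) =
    surface_integral \<Omega> (\<lambda>x.
        ((v x \<bullet> \<nu> x) * divergence \<Omega> v x - dform \<Omega> v x (v x) (\<nu> x) + w x \<bullet> \<nu> x)
          * ((norm (grad \<Omega> u x))\<^sup>2 - 2 * G (u x)))
     + 4 * surface_integral \<Omega> (\<lambda>x.
        normal_deriv \<Omega> u x * dform \<Omega> v x (v x) (grad \<Omega> u x)
          - (v x \<bullet> \<nu> x) * dform \<Omega> v x (grad \<Omega> u x) (grad \<Omega> u x))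
     + 2 * surface_integral \<Omega> (\<lambda>x.
        normal_deriv \<Omega> u x * (v x \<bullet> (hess \<Omega> u x *v v x))
          - (v x \<bullet> \<nu> x) * (v x \<bullet> (hess \<Omega> u x *v grad \<Omega> u x)))
     + 2 * surface_integral \<Omega> (\<lambda>x. g (u x) * (v x \<bullet> \<nu> x) * (v x \<bullet> grad \<Omega> u x))
     - 4 * surface_integral \<Omega> (\<lambda>x.
        (v x \<bullet> grad \<Omega> u x) * (normal_deriv \<Omega> u' x + \<alpha> * u' x))
     - 2 * \<alpha> * surface_integral \<Omega> (\<lambda>x. (v x \<bullet> grad \<Omega> u x)\<^sup>2)
     - 2 * surface_integral \<Omega> (\<lambda>x. (w x \<bullet> grad \<Omega> u x) * normal_deriv \<Omega> u x)
     + \<alpha> * surface_integral \<Omega> (\<lambda>x.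
        (u x)\<^sup>2 * (deriv ^^ 2) (\<lambda>t. tangential_jacobian \<Omega> (y t) x) 0)
     - 2 * Q_form \<Omega> \<alpha> (\<lambda>x. g' (u x)) u'"
  (is "_ = surface_integral \<Omega> ?i1 + 4 * surface_integral \<Omega> ?i2 + 2 * surface_integral \<Omega> ?i3 + 2 * surface_integral \<Omega> ?i4
     - 4 * surface_integral \<Omega> ?i5 - 2 * \<alpha> * surface_integral \<Omega> ?i6 - 2 * surface_integral \<Omega> ?i7 + _ - _")
proof -
  define i1 where "i1 = ?i1"
  define i2 where "i2 = ?i2"
  define i3 where "i3 = ?i3"
  define i4 where "i4 = ?i4"
  define i5 where "i5 = ?i5"
  define i6 where "i6 = ?i6"
  define i7 where "i7 = ?i7"
  define i8 where "i8 = (\<lambda>x. (u x)\<^sup>2 * time_rate m1 0 x)"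
  define i9 where "i9 = (\<lambda>x. u' x * (normal_deriv \<Omega> u' x + \<alpha> * u' x))"
  define r1 where "r1 = (\<lambda>x. (v x \<bullet> \<nu> x) * (grad \<Omega> u x \<bullet> grad \<Omega> u' x) - (grad \<Omega> u x \<bullet> \<nu> x) * (v x \<bullet> grad \<Omega> u' x) + u' x * \<tau> x)"
  define r2 where "r2 = (\<lambda>x. (v x \<bullet> \<nu> x) * (grad \<Omega> u x \<bullet> grad \<Omega> z x) - (grad \<Omega> u x \<bullet> \<nu> x) * (v x \<bullet> grad \<Omega> z x) + z x * \<tau> x)"
  have cz: "continuous_on (frontier \<Omega>) z" "continuous_on (frontier \<Omega>) (grad \<Omega> z)"
    by (rule continuous_on_subset[OF _ frontier_subset],
        simp add: has_partialsD(2)[OF z_partials] continuous_on_grad has_partials_C1_closure[OF z_partials open_domain])+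
  have c\<tau>: "continuous_on (frontier \<Omega>) \<tau>"
    unfolding \<tau>_def[abs_def] by (intro continuous_intros continuous_boundary)
  have c: "continuous_on (frontier \<Omega>) i1" "continuous_on (frontier \<Omega>) i2" "continuous_on (frontier \<Omega>) i3"
    "continuous_on (frontier \<Omega>) i4" "continuous_on (frontier \<Omega>) i5" "continuous_on (frontier \<Omega>) i6"
    "continuous_on (frontier \<Omega>) i7" "continuous_on (frontier \<Omega>) i9" "continuous_on (frontier \<Omega>) r1" "continuous_on (frontier \<Omega>) r2"
    unfolding i1_def i2_def i3_def i4_def i5_def i6_def i7_def i9_def r1_def r2_def normal_deriv_def
    by (intro continuous_intros continuous_boundary cz c\<tau>)+
  have c8: "continuous_on (frontier \<Omega>) i8"
    unfolding i8_def by (intro continuous_intros continuous_boundary time_slice(2)[OF time_C2_rate(2)[OF m_time] zero_time])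
  have r1: "surface_integral \<Omega> r1 = 0"
    using surface_integral_tangential[OF has_partials_partial[OF u'_C1]] by (simp add: r1_def grad_def[symmetric])
  have r2: "surface_integral \<Omega> r2 = 0"
    using surface_integral_tangential[OF has_partials_partial[OF has_partials_C1_closure[OF z_partials open_domain]]]
    by (simp add: r2_def grad_def[symmetric])
  have "surface_integral \<Omega> (second_variation 0) = surface_integral \<Omega> (\<lambda>x. (i1 x + 4 * i2 x + 2 * i3 x + 2 * i4 x - 4 * i5 x
      - 2 * \<alpha> * i6 x - 2 * i7 x + \<alpha> * i8 x - 2 * i9 x) + 2 * r1 x + 4 * r2 x)"
    by (rule surface_integral_cong)
       (simp only: second_variation_0 i1_def i2_def i3_def i4_def i5_def i6_def i7_def i8_def i9_def r1_def r2_def)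
  also have "\<dots> = surface_integral \<Omega> i1 + 4 * surface_integral \<Omega> i2 + 2 * surface_integral \<Omega> i3 + 2 * surface_integral \<Omega> i4
      - 4 * surface_integral \<Omega> i5 - 2 * \<alpha> * surface_integral \<Omega> i6 - 2 * surface_integral \<Omega> i7 + \<alpha> * surface_integral \<Omega> i8
      - 2 * surface_integral \<Omega> i9 + 2 * surface_integral \<Omega> r1 + 4 * surface_integral \<Omega> r2"
    by (simp only: surface_integral_add surface_integral_diff surface_integral_cmult continuous_on_add continuous_on_diff
        continuous_on_mult_left c c8)
  also have "surface_integral \<Omega> i8 = surface_integral \<Omega> (\<lambda>x. (u x)\<^sup>2 * (deriv ^^ 2) (\<lambda>t. tangential_jacobian \<Omega> (y t) x) 0)"
    unfolding i8_def by (rule surface_integral_cong) (simp only: m2_0)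
  also have "surface_integral \<Omega> i9 = Q_form \<Omega> \<alpha> (\<lambda>x. g' (u x)) u'" unfolding i9_def Q_form_eq ..
  finally show ?thesis unfolding r1 r2 i1_def i2_def i3_def i4_def i5_def i6_def i7_def by simp
qed

end

theorem theorem3:
  fixes \<Omega> :: "(real^'n) set" and \<alpha> \<gamma> t0 :: real
    and G g g' :: "real \<Rightarrow> real"
    and y :: "real \<Rightarrow> real^'n \<Rightarrow> real^'n" and v w :: "real^'n \<Rightarrow> real^'n"
    and U :: "real \<Rightarrow> real^'n \<Rightarrow> real" and u u' :: "real^'n \<Rightarrow> real"
  defines "\<nu> \<equiv> outer_normal \<Omega>"
  assumes dim: "CARD('n) \<ge> 2"
    and gamma: "0 < \<gamma>" "\<gamma> \<le> 1"
    and domain: "C2_holder_domain \<gamma> \<Omega>"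
    and G: "\<And>r. (G has_real_derivative g r) (at r)"
    and g: "\<And>r. (g has_real_derivative g' r) (at r)"
    and g': "continuous_on UNIV g'"
    and u: "robin_solution \<Omega> \<alpha> g u"
    and perturbation: "admissible_perturbation \<gamma> \<Omega> t0 y v w"
    and solutions: "\<And>t. \<bar>t\<bar> < t0 \<Longrightarrow> robin_solution (y t ` \<Omega>) \<alpha> g (U t)"
    and unique: "\<And>t z x. \<bar>t\<bar> < t0 \<Longrightarrow> robin_solution (y t ` \<Omega>) \<alpha> g z \<Longrightarrow>
                   x \<in> closure (y t ` \<Omega>) \<Longrightarrow> z x = U t x"
    and U_0: "\<And>x. x \<in> closure \<Omega> \<Longrightarrow> U 0 x = u x"
    and U_curve: "C2_curve \<Omega> t0 (\<lambda>t x. U t (y t x))"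
    and u'_def: "u' = shape_derivative \<Omega> y v U u"
    and u'_eq: "weak_solution \<Omega> (\<lambda>x. g' (u x)) u'"
    and u'_bc: "\<And>x. x \<in> frontier \<Omega> \<Longrightarrow>
       normal_deriv \<Omega> u' x + \<alpha> * u' x =
         - normal_deriv \<Omega> (\<lambda>z. v z \<bullet> grad \<Omega> u z) x
         + dform \<Omega> v x (tangential_grad \<Omega> u x) (\<nu> x) + dform \<Omega> v x (\<nu> x) (grad \<Omega> u x)
         - \<alpha> * (v x \<bullet> grad \<Omega> u x)"
  shows "has_second_derivative (\<lambda>t. robin_energy (y t ` \<Omega>) \<alpha> G (U t))
    (surface_integral \<Omega> (\<lambda>x.
        ((v x \<bullet> \<nu> x) * divergence \<Omega> v x - dform \<Omega> v x (v x) (\<nu> x) + w x \<bullet> \<nu> x)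
          * ((norm (grad \<Omega> u x))\<^sup>2 - 2 * G (u x)))
     + 4 * surface_integral \<Omega> (\<lambda>x.
        normal_deriv \<Omega> u x * dform \<Omega> v x (v x) (grad \<Omega> u x)
          - (v x \<bullet> \<nu> x) * dform \<Omega> v x (grad \<Omega> u x) (grad \<Omega> u x))
     + 2 * surface_integral \<Omega> (\<lambda>x.
        normal_deriv \<Omega> u x * (v x \<bullet> (hess \<Omega> u x *v v x))
          - (v x \<bullet> \<nu> x) * (v x \<bullet> (hess \<Omega> u x *v grad \<Omega> u x)))
     + 2 * surface_integral \<Omega> (\<lambda>x. g (u x) * (v x \<bullet> \<nu> x) * (v x \<bullet> grad \<Omega> u x))
     - 4 * surface_integral \<Omega> (\<lambda>x.
        (v x \<bullet> grad \<Omega> u x) * (normal_deriv \<Omega> u' x + \<alpha> * u' x))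
     - 2 * \<alpha> * surface_integral \<Omega> (\<lambda>x. (v x \<bullet> grad \<Omega> u x)\<^sup>2)
     - 2 * surface_integral \<Omega> (\<lambda>x. (w x \<bullet> grad \<Omega> u x) * normal_deriv \<Omega> u x)
     + \<alpha> * surface_integral \<Omega> (\<lambda>x.
        (u x)\<^sup>2 * (deriv ^^ 2) (\<lambda>t. tangential_jacobian \<Omega> (y t) x) 0)
     - 2 * Q_form \<Omega> \<alpha> (\<lambda>x. g' (u x)) u')
    0"
proof -
  have \<Omega>: "open \<Omega>" "bounded \<Omega>" using domain unfolding C2_holder_domain_def by blast+
  have t0: "0 < t0" and vw: "C2_closure \<Omega> v" "C2_closure \<Omega> w" and curve: "C2_curve \<Omega> t0 y"
    and diffeo: "\<And>t. \<bar>t\<bar> < t0 \<Longrightarrow> C2_diffeo_closure \<Omega> (y t)" and y_0: "\<And>x. x \<in> closure \<Omega> \<Longrightarrow> y 0 x = x"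
    and expansion: "\<And>x. x \<in> closure \<Omega> \<Longrightarrow>
      ((\<lambda>t. (y t x - (x + t *\<^sub>R v x + (t\<^sup>2 / 2) *\<^sub>R w x)) /\<^sub>R t\<^sup>2) \<longlongrightarrow> 0) (at 0)"
    using perturbation unfolding admissible_perturbation_def C2_holder_closure_def by blast+
  \<comment> \<open>The predicate in \<open>boundary_atlas_exists\<close> keeps the second order
    regularity of the graph functions, which \<open>boundary_atlas\<close> itself does not
    record.\<close>
  have atlas: "\<exists>ps. boundary_atlas \<Omega> ps \<and> (\<forall>(U, k, s, h, \<zeta>)\<in>set ps. \<forall>i. C1_closure UNIV (partial UNIV i h))"
  proof (rule boundary_atlas_exists[OF \<Omega>(2)])
    fix p assume "p \<in> frontier \<Omega>"
    then obtain U k s h where "p \<in> U" "local_graph \<Omega> U k s h" "C2_holder_closure \<gamma> UNIV h"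
      using domain unfolding C2_holder_domain_def by blast
    then show "\<exists>U k s h. p \<in> U \<and> local_graph \<Omega> U k s h \<and> C1_closure UNIV h \<and> (\<forall>i. C1_closure UNIV (partial UNIV i h))"
      unfolding C2_holder_closure_def C2_closure_def by blast
  qed
  obtain y1 y2 where Y: "\<And>t. \<bar>t\<bar> < t0 \<Longrightarrow> C2_closure \<Omega> (y t)" "\<And>t. \<bar>t\<bar> < t0 \<Longrightarrow> C2_closure \<Omega> (y1 t)"
    "time_deriv t0 (closure \<Omega>) y y1" "time_deriv t0 (closure \<Omega>) y1 y2"
    "\<And>i. time_deriv t0 (closure \<Omega>) (\<lambda>t. partial \<Omega> i (y t)) (\<lambda>t. partial \<Omega> i (y1 t))"
    "\<And>i. time_deriv t0 (closure \<Omega>) (\<lambda>t. partial \<Omega> i (y1 t)) (\<lambda>t. partial \<Omega> i (y2 t))"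
    by (rule C2_curve_time_deriv[OF \<Omega>(2,1) curve]) blast
  define h where "h t x = U t (y t x)" for t x
  obtain h1 h2 where H: "\<And>t. \<bar>t\<bar> < t0 \<Longrightarrow> C2_closure \<Omega> (h1 t)"
    "time_deriv t0 (closure \<Omega>) h h1" "time_deriv t0 (closure \<Omega>) h1 h2"
    "\<And>i. time_deriv t0 (closure \<Omega>) (\<lambda>t. partial \<Omega> i (h t)) (\<lambda>t. partial \<Omega> i (h1 t))"
    "\<And>i. time_deriv t0 (closure \<Omega>) (\<lambda>t. partial \<Omega> i (h1 t)) (\<lambda>t. partial \<Omega> i (h2 t))"
    by (rule C2_curve_time_deriv[OF \<Omega>(2,1) U_curve[folded h_def]]) blast
  have Y0: "y1 0 x = v x" "y2 0 x = w x" if x: "x \<in> closure \<Omega>" for x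
  proof -
    have "((\<lambda>t. (y t x - (y 0 x + t *\<^sub>R v x + (t\<^sup>2 / 2) *\<^sub>R w x)) /\<^sub>R t\<^sup>2) \<longlongrightarrow> 0) (at 0)"
      using expansion[OF x] y_0[OF x] by simp
    note * = second_order_expansion[OF t0 time_derivD(3)[OF Y(3) _ x] time_derivD(3)[OF Y(4) _ x] this]
    show "y1 0 x = v x" "y2 0 x = w x" using * t0 by auto
  qed
  \<comment> \<open>The time derivative in \<open>shape_derivative\<close> exists along the curve,
    so \<open>deriv\<close> returns its actual value \<open>h1 0 x\<close>.\<close>
  have H0: "h1 0 x = u' x + v x \<bullet> grad \<Omega> u x" if x: "x \<in> closure \<Omega>" for x
  proof -
    have "((\<lambda>t. h t x) has_real_derivative h1 0 x) (at 0)"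
      using time_derivD(3)[OF H(2) _ x, of 0] t0 by (simp add: has_real_derivative_iff_has_vector_derivative)
    then show ?thesis by (simp add: u'_def shape_derivative_def h_def DERIV_imp_deriv)
  qed
  interpret robin_variation \<Omega> t0 \<alpha> G g g' y y1 y2 U h h1 h2 v w u u'
  proof
    show "\<exists>ps. boundary_atlas \<Omega> ps" using atlas by blast
  qed (use \<Omega> t0 G g g' atlas Y H h_def diffeo y_0 solutions vw u Y0 U_0 H0 u'_eq u'_bc in \<open>simp_all add: \<nu>_def\<close>)
  show ?thesis
    using second_derivative_robin_energy unfolding surface_integral_second_variation \<nu>_def .
qed

end
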